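(* Let $k\in\mathbb C$, let $\Phi: V^k(\mathfrak{sl}_3)\to \mathcal W_k\otimes\mathcal S\otimes\Pi(0)$ be the vertex algebra homomorphism described in the context, and let $\widetilde L_k(\mathfrak{sl}_3)=\operatorname{Im}(\Phi)$. Then $\widetilde L_k(\mathfrak{sl}_3)$ is a simple vertex algebra if and only if $k\notin\mathbb Z_{\ge 0}$. In particular, for $k\notin\mathbb Z_{\ge0}$ there exists an embedding of vertex algebras $L_k(\mathfrak{sl}_3)\hookrightarrow \mathcal W_k\otimes\mathcal S\otimes\Pi(0)$, where $L_k(\mathfrak{sl}_3)$ is the simple quotient of $V^k(\mathfrak{sl}_3)$.
   Context: $V^k(\mathfrak{sl}_3)$ is the universal affine vertex algebra of $\mathfrak{sl}_3$ at level $k$ (trace form), $L_k(\mathfrak{sl}_3)$ its simple (graded) quotient. Notation: $e_1=e_{1,2}$, $e_2=e_{2,3}$, $e_3=e_{1,3}$, $h_1=e_{1,1}-e_{2,2}$, $h_2=e_{2,2}-e_{3,3}$, $f_1=e_{2,1}$, $f_2=e_{3,2}$, $f_3=e_{3,1}=[f_2,f_1]$. Bershadsky-Polyakov algebra. For $k\neq-3$, $\mathcal W^k$ is the vertex algebra freely and strongly generated by $J,G^\pm,L^{\rm BP}$ with operator products: $L^{\rm BP}$ is a Virasoro field of central charge $-\frac{(2k+3)(3k+1)}{k+3}$; $J$ and $G^\pm$ are primary for $L^{\rm BP}$ of weights $1$ and $\frac32$; $J(z)J(w)\sim\frac{2k+3}{3(z-w)^2}$; $J(z)G^\pm(w)\sim\frac{\pm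 G^\pm(w)}{z-w}$; $G^\pm(z)G^\pm(w)\sim0$; and $$G^+(z)G^-(w)\sim\frac{(k+1)(2k+3)}{(z-w)^3}+\frac{3(k+1)J(w)}{(z-w)^2}+\frac{1}{z-w}\Big(3{:}J(w)^2{:}+\tfrac{3(k+1)}2\partial J(w)-(k+3)L^{\rm BP}(w)\Big).$$ For $k=-3$ the generator $L^{\rm BP}$ is replaced by a commutative (central) field $T^{\rm BP}$, of weight 2, obtained by formally replacing $(k+3)L^{\rm BP}$ by $T^{\rm BP}$ in these relations. $\mathcal W^k$ is $\mathbb Z_{\ge0}$-graded with $J,G^+,G^-$ of weights $1,1,2$ (for $k\ne-3$ this is the grading by the zero mode of $\widetilde L=L^{\rm BP}+\frac12\partial J$). $\mathcal W_k$ is the simple (graded) quotient of $\mathcal W^k$. $\mathcal S$ is the rank one $\beta\gamma$ vertex algebra with $\beta(z)\gamma(w)\sim\frac1{z-w}$. $\Pi(0)=M(1)\otimes\mathbb C[\mathbb Zc]$ is the half-lattice vertex algebra generated by Heisenberg fields $c,d$ with $c(z)d(w)\sim\frac{2}{(z-w)^2}$, $c(z)c(w)\sim0\sim d(z)d(w)$, and by $e^{\pm c}$. $\Phi$ is the composition of the following homomorphism $\Phi_0:V^k(\mathfrak{sl}_3)\to\mathcal W^k\otimes\mathcal S\otimes\Pi(0)$ with the quotient map $\mathcal W^k\to\mathcal W_k$: $e_1\mapsto-\gamma e^{c}$, $e_2\mapsto\beta$, $e_3\mapsto e^c$, $h_1\mapsto-2J+{:}\gamma\beta{:}-\frac{2k+9}6c+\frac12d$,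 $h_2\mapsto J-2{:}\gamma\beta{:}+\frac{4k+9}6c+\frac12d$, $f_1\mapsto G^+-{:}(2J+\frac{8k+9}6c-\frac12d)\beta e^{-c}{:}+(k+1)(\partial\beta)e^{-c}$, $f_2\mapsto G^-e^{-c}+(J+\frac{4k+9}6c+\frac12d)\gamma+k\,\partial\gamma-{:}\gamma^2\beta{:}$ (the image of $f_3$ is determined by $f_3=[f_2,f_1]$). *)

theory Defs
  imports
    "HOL-Analysis.Analysis"
    "HOL-Library.Poly_Mapping"
    "HOL-Library.Groups_Big_Fun"
begin

section \<open>Vertex algebras\<close>

text \<open>
  A vertex algebra is given by its n-th products: \<^term>\<open>nprod V a n b\<close> is the coefficient of
  \<open>z^(-n-1)\<close> in \<open>Y(a,z) b\<close>.  The underlying complex vector space is a subspace \<open>vspace V\<close> of an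
  ambient vector space with scalar multiplication \<open>smul V\<close>, so that images of homomorphisms are
  again of this form.  All vertex algebras here are purely even.
\<close>

record 'v vert_alg =
  vspace :: "'v set"
  smul :: "complex \<Rightarrow> 'v \<Rightarrow> 'v"
  vac :: 'v
  nprod :: "'v \<Rightarrow> int \<Rightarrow> 'v \<Rightarrow> 'v"

text \<open>The sums in the Borcherds identity have only finitely many non-zero terms by
  \<open>nprod_truncation\<close>; \<^const>\<open>Sum_any\<close> is the sum over the support.\<close>

locale vertex_algebra =
  fixes V :: "'v::ab_group_add vert_alg"
  assumes ambient: "vector_space (smul V)"
    and subspace_vspace: "module.subspace (smul V) (vspace V)"
    and vac_in: "vac V \<in> vspace V"
    and nprod_in: "\<lbrakk>a \<in> vspace V; b \<in> vspace V\<rbrakk> \<Longrightarrow> nprod V a n b \<in> vspace V"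
    and nprod_add_left: "\<lbrakk>a \<in> vspace V; a' \<in> vspace V; b \<in> vspace V\<rbrakk> \<Longrightarrow>
          nprod V (a + a') n b = nprod V a n b + nprod V a' n b"
    and nprod_add_right: "\<lbrakk>a \<in> vspace V; b \<in> vspace V; b' \<in> vspace V\<rbrakk> \<Longrightarrow>
          nprod V a n (b + b') = nprod V a n b + nprod V a n b'"
    and nprod_smul_left: "\<lbrakk>a \<in> vspace V; b \<in> vspace V\<rbrakk> \<Longrightarrow>
          nprod V (smul V r a) n b = smul V r (nprod V a n b)"
    and nprod_smul_right: "\<lbrakk>a \<in> vspace V; b \<in> vspace V\<rbrakk> \<Longrightarrow>
          nprod V a n (smul V r b) = smul V r (nprod V a n b)"
    and nprod_truncation: "\<lbrakk>a \<in> vspace V; b \<in> vspace V\<rbrakk> \<Longrightarrow> \<exists>N. \<forall>n\<ge>N. nprod V a n b = 0"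
    and vac_left: "a \<in> vspace V \<Longrightarrow> nprod V (vac V) n a = (if n = -1 then a else 0)"
    and vac_right: "a \<in> vspace V \<Longrightarrow> nprod V a (-1) (vac V) = a"
    and vac_right_nonneg: "\<lbrakk>a \<in> vspace V; n \<ge> 0\<rbrakk> \<Longrightarrow> nprod V a n (vac V) = 0"
    and borcherds: "\<lbrakk>a \<in> vspace V; b \<in> vspace V; c \<in> vspace V\<rbrakk> \<Longrightarrow>
          Sum_any (\<lambda>j::nat. smul V (of_int m gchoose j)
             (nprod V (nprod V a (q + int j) b) (m + n - int j) c)) =
          Sum_any (\<lambda>j::nat. smul V ((- 1) ^ j * (of_int q gchoose j))
             (nprod V a (m + q - int j) (nprod V b (n + int j) c) -
              smul V ((- 1) powi q) (nprod V b (n + q - int j) (nprod V a (m + int j) c))))"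

text \<open>The translation operator and the normally ordered product; nested normally ordered
  products are bracketed to the right.\<close>

definition transl :: "'v vert_alg \<Rightarrow> 'v \<Rightarrow> 'v" where
  "transl V a = nprod V a (-2) (vac V)"

definition nop :: "'v vert_alg \<Rightarrow> 'v \<Rightarrow> 'v \<Rightarrow> 'v" where
  "nop V a b = nprod V a (-1) b"

text \<open>\<open>ope V a b [c\<^sub>0, c\<^sub>1, \<dots>]\<close> states \<open>a(z) b(w) \<sim> c\<^sub>0(w)/(z-w) + c\<^sub>1(w)/(z-w)^2 + \<dots>\<close>, all further
  singular coefficients being zero.\<close>

definition ope :: "'v::zero vert_alg \<Rightarrow> 'v \<Rightarrow> 'v \<Rightarrow> 'v list \<Rightarrow> bool" where
  "ope V a b cs \<longleftrightarrow> (\<forall>n::nat. nprod V a (int n) b = (if n < length cs then cs ! n else 0))"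

definition va_hom :: "'v::plus vert_alg \<Rightarrow> 'w::plus vert_alg \<Rightarrow> ('v \<Rightarrow> 'w) \<Rightarrow> bool" where
  "va_hom V W \<phi> \<longleftrightarrow>
     (\<forall>a\<in>vspace V. \<phi> a \<in> vspace W) \<and>
     (\<forall>a\<in>vspace V. \<forall>b\<in>vspace V. \<phi> (a + b) = \<phi> a + \<phi> b) \<and>
     (\<forall>r. \<forall>a\<in>vspace V. \<phi> (smul V r a) = smul W r (\<phi> a)) \<and>
     \<phi> (vac V) = vac W \<and>
     (\<forall>a\<in>vspace V. \<forall>b\<in>vspace V. \<forall>n. \<phi> (nprod V a n b) = nprod W (\<phi> a) n (\<phi> b))"

definition va_image :: "'v vert_alg \<Rightarrow> 'w vert_alg \<Rightarrow> ('v \<Rightarrow> 'w) \<Rightarrow> 'w vert_alg" where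
  "va_image V W \<phi> = W\<lparr>vspace := \<phi> ` vspace V\<rparr>"

definition va_ideal :: "'v::ab_group_add vert_alg \<Rightarrow> 'v set \<Rightarrow> bool" where
  "va_ideal V I \<longleftrightarrow> module.subspace (smul V) I \<and> I \<subseteq> vspace V \<and>
     (\<forall>a\<in>vspace V. \<forall>v\<in>I. \<forall>n. nprod V a n v \<in> I \<and> nprod V v n a \<in> I)"

definition simple_vertex_algebra :: "'v::ab_group_add vert_alg \<Rightarrow> bool" where
  "simple_vertex_algebra V \<longleftrightarrow> vertex_algebra V \<and> vspace V \<noteq> {0} \<and>
     (\<forall>I. va_ideal V I \<longrightarrow> I = {0} \<or> I = vspace V)"

subsection \<open>Gradings and simple graded quotients\<close>

text \<open>Given a set of pairs (generator, conformal weight), the space of weight \<open>N\<close> is spanned by the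
  monomials \<open>a\<^sub>1(n\<^sub>1) \<dots> a\<^sub>r(n\<^sub>r) vac\<close> in the modes of the generators of total weight \<open>N\<close>, where
  the mode \<open>a(n)\<close> raises the weight by \<open>wt a - n - 1\<close>.\<close>

definition modes_on :: "'v vert_alg \<Rightarrow> ('v \<times> int) list \<Rightarrow> 'v \<Rightarrow> 'v" where
  "modes_on V ws v = foldr (\<lambda>(a, n) x. nprod V a n x) ws v"

definition weight_space :: "'v::ab_group_add vert_alg \<Rightarrow> ('v \<times> nat) set \<Rightarrow> nat \<Rightarrow> 'v set" where
  "weight_space V gens N = module.span (smul V)
     {modes_on V (map (\<lambda>((a, w), n). (a, n)) ws) (vac V) | ws.
        (\<forall>(g, n)\<in>set ws. g \<in> gens) \<and> (\<Sum>((a, w), n)\<leftarrow>ws. int w - n - 1) = int N}"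

definition graded_ideal :: "'v::ab_group_add vert_alg \<Rightarrow> (nat \<Rightarrow> 'v set) \<Rightarrow> 'v set \<Rightarrow> bool" where
  "graded_ideal V gr I \<longleftrightarrow> va_ideal V I \<and> I = module.span (smul V) (\<Union>N. I \<inter> gr N)"

definition va_kernel :: "'v vert_alg \<Rightarrow> ('v \<Rightarrow> 'w::zero) \<Rightarrow> 'v set" where
  "va_kernel V \<pi> = {a \<in> vspace V. \<pi> a = 0}"

definition simple_graded_quotient ::
  "'v::ab_group_add vert_alg \<Rightarrow> (nat \<Rightarrow> 'v set) \<Rightarrow> 'w::ab_group_add vert_alg \<Rightarrow> ('v \<Rightarrow> 'w) \<Rightarrow> bool" where
  "simple_graded_quotient V gr Q \<pi> \<longleftrightarrow>
     vertex_algebra Q \<and> va_hom V Q \<pi> \<and> \<pi> ` vspace V = vspace Q \<and>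
     graded_ideal V gr (va_kernel V \<pi>) \<and> va_kernel V \<pi> \<noteq> vspace V \<and>
     (\<forall>I. graded_ideal V gr I \<and> I \<noteq> vspace V \<longrightarrow> I \<subseteq> va_kernel V \<pi>)"

section \<open>Vector spaces given by generators and relations\<close>

text \<open>\<open>presented_by V X g R\<close>: the space of \<open>V\<close> is the free vector space on \<open>X\<close> modulo the span of
  the relations \<open>R\<close>, the class of a generator \<open>x\<close> being \<open>g x\<close>.  For \<open>R = {}\<close> this says
  that the family \<open>g\<close> on \<open>X\<close> is a basis.\<close>

definition free_smul :: "complex \<Rightarrow> ('x \<Rightarrow>\<^sub>0 complex) \<Rightarrow> 'x \<Rightarrow>\<^sub>0 complex" where
  "free_smul r f = Poly_Mapping.map (\<lambda>y. r * y) f"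

definition lin_ext :: "'v::ab_group_add vert_alg \<Rightarrow> ('x \<Rightarrow> 'v) \<Rightarrow> ('x \<Rightarrow>\<^sub>0 complex) \<Rightarrow> 'v" where
  "lin_ext V g f = (\<Sum>x\<in>Poly_Mapping.keys f. smul V (Poly_Mapping.lookup f x) (g x))"

definition presented_by ::
  "'v::ab_group_add vert_alg \<Rightarrow> 'x set \<Rightarrow> ('x \<Rightarrow> 'v) \<Rightarrow> ('x \<Rightarrow>\<^sub>0 complex) set \<Rightarrow> bool" where
  "presented_by V X g R \<longleftrightarrow>
     lin_ext V g ` {f. Poly_Mapping.keys f \<subseteq> X} = vspace V \<and>
     (\<forall>f. Poly_Mapping.keys f \<subseteq> X \<longrightarrow>
        (lin_ext V g f = 0 \<longleftrightarrow> f \<in> module.span free_smul R))"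

subsection \<open>Free strong generation\<close>

text \<open>A pair \<open>(i, n)\<close> encodes the mode \<open>a\<^sub>i(-n-1)\<close> of the \<open>i\<close>-th generator.  Ordered words
  correspond to multisets of such modes.\<close>

definition pbw_words :: "nat \<Rightarrow> (nat \<times> nat) list set" where
  "pbw_words r = {ws. (\<forall>(i, n)\<in>set ws. i < r) \<and>
     sorted_wrt (\<lambda>(i, m) (j, n). i < j \<or> (i = j \<and> n \<le> m)) ws}"

definition pbw_monomial :: "'v vert_alg \<Rightarrow> 'v list \<Rightarrow> (nat \<times> nat) list \<Rightarrow> 'v \<Rightarrow> 'v" where
  "pbw_monomial V gens ws v = modes_on V (map (\<lambda>(i, n). (gens ! i, - int n - 1)) ws) v"

definition freely_strongly_generated :: "'v::ab_group_add vert_alg \<Rightarrow> 'v list \<Rightarrow> bool" where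
  "freely_strongly_generated V gens \<longleftrightarrow> set gens \<subseteq> vspace V \<and>
     presented_by V (pbw_words (length gens)) (\<lambda>ws. pbw_monomial V gens ws (vac V)) {}"

subsection \<open>Tensor products\<close>

definition bilinear_relators ::
  "'a::ab_group_add vert_alg \<Rightarrow> 'b::ab_group_add vert_alg \<Rightarrow> ('a \<times> 'b \<Rightarrow>\<^sub>0 complex) set" where
  "bilinear_relators A B =
     {Poly_Mapping.single (a + a', b) 1 - Poly_Mapping.single (a, b) 1 - Poly_Mapping.single (a', b) 1
        | a a' b. a \<in> vspace A \<and> a' \<in> vspace A \<and> b \<in> vspace B} \<union>
     {Poly_Mapping.single (a, b + b') 1 - Poly_Mapping.single (a, b) 1 - Poly_Mapping.single (a, b') 1
        | a b b'. a \<in> vspace A \<and> b \<in> vspace B \<and> b' \<in> vspace B} \<union>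
     {Poly_Mapping.single (smul A r a, b) 1 - Poly_Mapping.single (a, b) r
        | r a b. a \<in> vspace A \<and> b \<in> vspace B} \<union>
     {Poly_Mapping.single (a, smul B r b) 1 - Poly_Mapping.single (a, b) r
        | r a b. a \<in> vspace A \<and> b \<in> vspace B}"

text \<open>\<open>t a b\<close> is the pure tensor \<open>a \<otimes> b\<close>; the product formula is
  \<open>Y(a \<otimes> b, z) = Y(a,z) \<otimes> Y(b,z)\<close>, written in modes (a finite sum).\<close>

definition va_tensor ::
  "'a::ab_group_add vert_alg \<Rightarrow> 'b::ab_group_add vert_alg \<Rightarrow> 't::ab_group_add vert_alg
     \<Rightarrow> ('a \<Rightarrow> 'b \<Rightarrow> 't) \<Rightarrow> bool" where
  "va_tensor A B T t \<longleftrightarrow> vertex_algebra T \<and>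
     presented_by T (vspace A \<times> vspace B) (\<lambda>(a, b). t a b) (bilinear_relators A B) \<and>
     vac T = t (vac A) (vac B) \<and>
     (\<forall>a\<in>vspace A. \<forall>a'\<in>vspace A. \<forall>b\<in>vspace B. \<forall>b'\<in>vspace B. \<forall>n.
        nprod T (t a b) n (t a' b') =
          Sum_any (\<lambda>j::int. t (nprod A a j a') (nprod B b (n - j - 1) b')))"

section \<open>The universal affine vertex algebra of \<open>sl\<^sub>3\<close>\<close>

definition sl3 :: "(complex^3^3) set" where
  "sl3 = {x. trace x = 0}"

definition emat :: "3 \<Rightarrow> 3 \<Rightarrow> complex^3^3" where
  "emat i j = (\<chi> r s. if r = i \<and> s = j then 1 else 0)"

definition lie_br :: "complex^3^3 \<Rightarrow> complex^3^3 \<Rightarrow> complex^3^3" where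
  "lie_br x y = x ** y - y ** x"

definition msmul :: "complex \<Rightarrow> complex^3^3 \<Rightarrow> complex^3^3" where
  "msmul r x = (\<chi> i j. r * x $ i $ j)"

definition affine_words :: "((complex^3^3) \<times> int) list set" where
  "affine_words = {ws. set ws \<subseteq> sl3 \<times> UNIV}"

text \<open>
  A word \<open>[(x\<^sub>1,n\<^sub>1), \<dots>, (x\<^sub>r,n\<^sub>r)]\<close> stands for \<open>x\<^sub>1 t^n\<^sub>1 \<dots> x\<^sub>r t^n\<^sub>r \<otimes> 1\<close> in the vacuum module
  \<open>U(\<gg>) \<otimes> C\<^sub>k\<close> induced from \<open>sl\<^sub>3[t] \<oplus> C K\<close>, where \<open>\<gg>\<close> is the affine Lie algebra of \<open>sl\<^sub>3\<close>, \<open>K\<close> acts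
  on \<open>C\<^sub>k\<close> as \<open>k\<close> and \<open>sl\<^sub>3[t]\<close> acts on it as zero.  The relators are linearity in each letter, the
  commutation relations
  \<open>[x t^m, y t^n] = [x,y] t^(m+n) + m \<delta>\<^sub>m\<^sub>+\<^sub>n\<^sub>,\<^sub>0 tr(xy) k\<close>, and \<open>x t^n \<otimes> 1 = 0\<close> for \<open>n \<ge> 0\<close>.
\<close>

definition affine_relators :: "complex \<Rightarrow> (((complex^3^3) \<times> int) list \<Rightarrow>\<^sub>0 complex) set" where
  "affine_relators k =
     {Poly_Mapping.single (u @ [(x + y, n)] @ w) 1
        - Poly_Mapping.single (u @ [(x, n)] @ w) 1 - Poly_Mapping.single (u @ [(y, n)] @ w) 1
        | u w x y n. u \<in> affine_words \<and> w \<in> affine_words \<and> x \<in> sl3 \<and> y \<in> sl3} \<union>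
     {Poly_Mapping.single (u @ [(msmul r x, n)] @ w) 1 - Poly_Mapping.single (u @ [(x, n)] @ w) r
        | u w r x n. u \<in> affine_words \<and> w \<in> affine_words \<and> x \<in> sl3} \<union>
     {Poly_Mapping.single (u @ [(x, m), (y, n)] @ w) 1 - Poly_Mapping.single (u @ [(y, n), (x, m)] @ w) 1
        - Poly_Mapping.single (u @ [(lie_br x y, m + n)] @ w) 1
        - Poly_Mapping.single (u @ w) (if m + n = 0 then of_int m * trace (x ** y) * k else 0)
        | u w x y m n. u \<in> affine_words \<and> w \<in> affine_words \<and> x \<in> sl3 \<and> y \<in> sl3} \<union>
     {Poly_Mapping.single (u @ [(x, n)]) 1
        | u x n. u \<in> affine_words \<and> x \<in> sl3 \<and> n \<ge> 0}"

text \<open>\<open>V\<close> is \<open>V^k(sl\<^sub>3)\<close>: the vacuum module, with \<open>x t^n\<close> acting as the mode \<open>(\<iota> x)(n)\<close> of the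
  current \<open>\<iota> x = x t^(-1) vac\<close>.\<close>

definition universal_affine_sl3 ::
  "complex \<Rightarrow> 'v::ab_group_add vert_alg \<Rightarrow> (complex^3^3 \<Rightarrow> 'v) \<Rightarrow> bool" where
  "universal_affine_sl3 k V \<iota> \<longleftrightarrow> vertex_algebra V \<and> \<iota> ` sl3 \<subseteq> vspace V \<and>
     presented_by V affine_words (\<lambda>ws. modes_on V (map (\<lambda>(x, n). (\<iota> x, n)) ws) (vac V))
       (affine_relators k)"

definition affine_grading :: "'v::ab_group_add vert_alg \<Rightarrow> (complex^3^3 \<Rightarrow> 'v) \<Rightarrow> nat \<Rightarrow> 'v set" where
  "affine_grading V \<iota> = weight_space V {(\<iota> x, 1) | x. x \<in> sl3}"

section \<open>The Bershadsky-Polyakov algebra\<close>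

text \<open>For \<open>k = -3\<close> the last generator \<open>L\<close> is the central field usually denoted \<open>T\<close>, which takes the
  place of \<open>(k + 3) L\<close> in the product of \<open>G^+\<close> and \<open>G^-\<close>.\<close>

definition bershadsky_polyakov ::
  "complex \<Rightarrow> 'v::ab_group_add vert_alg \<Rightarrow> 'v \<Rightarrow> 'v \<Rightarrow> 'v \<Rightarrow> 'v \<Rightarrow> bool" where
  "bershadsky_polyakov k W J Gp Gm L \<longleftrightarrow>
     vertex_algebra W \<and> freely_strongly_generated W [J, Gp, Gm, L] \<and>
     (k \<noteq> -3 \<longrightarrow>
        ope W L L [transl W L, smul W 2 L, 0,
                   smul W (- ((2 * k + 3) * (3 * k + 1) / (k + 3)) / 2) (vac W)] \<and>
        ope W L J [transl W J, J] \<and>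
        ope W L Gp [transl W Gp, smul W (3 / 2) Gp] \<and>
        ope W L Gm [transl W Gm, smul W (3 / 2) Gm]) \<and>
     (k = -3 \<longrightarrow> (\<forall>a\<in>vspace W. ope W L a [])) \<and>
     ope W J J [0, smul W ((2 * k + 3) / 3) (vac W)] \<and>
     ope W J Gp [Gp] \<and>
     ope W J Gm [- Gm] \<and>
     ope W Gp Gp [] \<and>
     ope W Gm Gm [] \<and>
     ope W Gp Gm
       [smul W 3 (nop W J J) + smul W (3 * (k + 1) / 2) (transl W J)
          - (if k = -3 then L else smul W (k + 3) L),
        smul W (3 * (k + 1)) J,
        smul W ((k + 1) * (2 * k + 3)) (vac W)]"

definition bp_grading ::
  "'v::ab_group_add vert_alg \<Rightarrow> 'v \<Rightarrow> 'v \<Rightarrow> 'v \<Rightarrow> 'v \<Rightarrow> nat \<Rightarrow> 'v set" where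
  "bp_grading W J Gp Gm L = weight_space W {(J, 1), (Gp, 1), (Gm, 2), (L, 2)}"

section \<open>The \<open>\<beta>\<gamma>\<close> and half-lattice vertex algebras\<close>

definition beta_gamma_va :: "'v::ab_group_add vert_alg \<Rightarrow> 'v \<Rightarrow> 'v \<Rightarrow> bool" where
  "beta_gamma_va S \<beta> \<gamma> \<longleftrightarrow> vertex_algebra S \<and> freely_strongly_generated S [\<beta>, \<gamma>] \<and>
     ope S \<beta> \<gamma> [vac S] \<and> ope S \<beta> \<beta> [] \<and> ope S \<gamma> \<gamma> []"

text \<open>\<open>e m\<close> is the lattice vector \<open>1 \<otimes> e^(m c)\<close>, whose field is
  \<open>e^(m c) exp(m \<Sum>\<^sub>j\<^sub>>\<^sub>0 c(-j) z^j / j) exp(-m \<Sum>\<^sub>j\<^sub>>\<^sub>0 c(j) z^(-j) / j)\<close>; since \<open>\<langle>c,c\<rangle> = 0\<close> there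
  is neither a power of \<open>z\<close> nor a cocycle.  The basis condition is
  \<open>\<Pi>(0) = M(1) \<otimes> C[Z c]\<close>.\<close>

definition half_lattice_va :: "'v::ab_group_add vert_alg \<Rightarrow> 'v \<Rightarrow> 'v \<Rightarrow> (int \<Rightarrow> 'v) \<Rightarrow> bool" where
  "half_lattice_va P c d e \<longleftrightarrow> vertex_algebra P \<and>
     c \<in> vspace P \<and> d \<in> vspace P \<and> range e \<subseteq> vspace P \<and>
     presented_by P (pbw_words 2 \<times> UNIV) (\<lambda>(ws, m). pbw_monomial P [c, d] ws (e m)) {} \<and>
     ope P c d [0, smul P 2 (vac P)] \<and> ope P c c [] \<and> ope P d d [] \<and>
     e 0 = vac P \<and>
     (\<forall>m. ope P c (e m) [] \<and> ope P d (e m) [smul P (2 * of_int m) (e m)] \<and>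
          transl P (e m) = smul P (of_int m) (nop P c (e m))) \<and>
     (\<forall>m n. ope P (e m) (e n) [] \<and> nop P (e m) (e n) = e (m + n))"

section \<open>The homomorphism\<close>

text \<open>Values on \<open>e\<^sub>1, e\<^sub>2, e\<^sub>3, h\<^sub>1, h\<^sub>2, f\<^sub>1, f\<^sub>2\<close>; the value on \<open>f\<^sub>3 = [f\<^sub>2,f\<^sub>1]\<close> is then forced.
  Here \<open>J, Gp, Gm, \<beta>, \<gamma>, c, d, e m\<close> are the respective elements of the target \<open>T\<close>, and \<open>\<iota> x\<close> is
  the element of the source attached to \<open>x\<close> in \<open>sl\<^sub>3\<close>.\<close>

definition realization_values ::
  "complex \<Rightarrow> (complex^3^3 \<Rightarrow> 'v) \<Rightarrow> 't::ab_group_add vert_alg \<Rightarrow> 't \<Rightarrow> 't \<Rightarrow> 't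
     \<Rightarrow> 't \<Rightarrow> 't \<Rightarrow> 't \<Rightarrow> 't \<Rightarrow> (int \<Rightarrow> 't) \<Rightarrow> ('v \<Rightarrow> 't) \<Rightarrow> bool" where
  "realization_values k \<iota> T J Gp Gm \<beta> \<gamma> c d e \<Phi> \<longleftrightarrow>
     \<Phi> (\<iota> (emat 1 2)) = - nop T \<gamma> (e 1) \<and>
     \<Phi> (\<iota> (emat 2 3)) = \<beta> \<and>
     \<Phi> (\<iota> (emat 1 3)) = e 1 \<and>
     \<Phi> (\<iota> (emat 1 1 - emat 2 2)) =
       - smul T 2 J + nop T \<gamma> \<beta> - smul T ((2 * k + 9) / 6) c + smul T (1 / 2) d \<and>
     \<Phi> (\<iota> (emat 2 2 - emat 3 3)) =
       J - smul T 2 (nop T \<gamma> \<beta>) + smul T ((4 * k + 9) / 6) c + smul T (1 / 2) d \<and>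
     \<Phi> (\<iota> (emat 2 1)) =
       Gp - nop T (smul T 2 J + smul T ((8 * k + 9) / 6) c - smul T (1 / 2) d) (nop T \<beta> (e (-1)))
          + smul T (k + 1) (nop T (transl T \<beta>) (e (-1))) \<and>
     \<Phi> (\<iota> (emat 3 2)) =
       nop T Gm (e (-1)) + nop T (J + smul T ((4 * k + 9) / 6) c + smul T (1 / 2) d) \<gamma>
          + smul T k (transl T \<gamma>) - nop T \<gamma> (nop T \<gamma> \<beta>)"

end

theory Submission
  imports Defs
begin

text \<open>
  Let \<open>A\<close> be the image of \<open>\<Phi>\<close>. A nonzero ideal of \<open>A\<close> contains a nonzero vector \<open>v\<close> that is lowest in
  the weight filtration and killed by the zero modes of \<open>e\<^sub>1, e\<^sub>2, e\<^sub>3\<close>. Since \<open>e\<^sub>3 = e\<^sup>c\<close> is invertible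
  with \<open>\<partial>e\<^sup>c = c e\<^sup>c\<close>, the equations \<open>e\<^sub>i(n) v = 0\<close> for \<open>n \<ge> 0\<close> force \<open>v\<close> to be a vacuum for \<open>\<beta>, \<gamma>\<close> and
  the positive modes of \<open>c\<close>; the equations for \<open>h\<^sub>1, h\<^sub>2\<close> do the same for \<open>d\<close> and \<open>J\<close>, so that
  \<open>v = \<Sum> w\<^sub>m \<otimes> e\<^sup>m\<^sup>c\<close>, and those for \<open>f\<^sub>1, f\<^sub>2\<close> make the \<open>w\<^sub>m\<close> singular in the simple quotient \<open>W\<close>,
  hence multiples of the vacuum. So the ideal contains some \<open>e\<^sup>m\<^sup>c\<close>, and \<open>m \<ge> 0\<close> because \<open>A\<close> has no
  negative weights. From \<open>f\<^sub>3(1) e\<^sup>m\<^sup>c = m (k + 1 - m) e\<^bsup>(m-1)c\<^esup>\<close> one descends to the vacuum if \<open>k\<close> is not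
  a natural number, while for \<open>k \<in> \<nat>\<close> the vector \<open>e\<^bsup>(k+1)c\<^esup>\<close> of \<open>A\<close> is singular and generates a proper
  ideal. Semisimplicity of a grading operator on the tensor product (needed because there is no
  conformal vector at the critical level \<open>k = -3\<close>) shows that the kernel of \<open>\<Phi>\<close> is graded.
\<close>

section \<open>Vertex algebras: consequences of the Borcherds identity\<close>

text \<open>Simplicity concerns all ideals, graded or not, whereas \<open>Lk\<close> and
  \<open>W\<close> are quotients by graded ideals only. Ideals of the image are therefore studied
  through the increasing weight filtration, and a single \<open>e^(mc)\<close> is split off at the
  end by the zero mode of \<open>h1\<close>, which preserves the ideal. Weight spaces are mere spans
  of words, so their independence has to be proved. It comes from an operator with the weights as
  eigenvalues: read off the PBW basis for \<open>U\<close>, a mode of an explicit vector for the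
  \<beta>\<gamma> and half-lattice factors, then passed to quotients and tensor products. Asking
  every current to have weight 1 forces the weights 1, 0 for \<beta>, \<gamma>, 1 for
  \<open>c\<close> and \<open>d\<close>, \<open>m\<close> for \<open>e^(mc)\<close>, and 1, 1, 2 for
  \<open>J\<close>, \<open>G+\<close>, \<open>G-\<close>. The tensor product has negative weights
  because of \<open>e^(-c)\<close>. Positivity holds in the image, where words in the currents can
  be reordered. A common kernel vector of the zero modes of the \<open>e_i\<close> is found from
  their local nilpotency, which rests on the square of an off-diagonal matrix unit being
  zero.\<close>

lemma Sum_any_lessThan:
  fixes f :: "nat \<Rightarrow> 'a::comm_monoid_add"
  assumes "\<And>j. j \<ge> N \<Longrightarrow> f j = 0"
  shows "Sum_any f = (\<Sum>j<N. f j)"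
  by (rule Sum_any.expand_superset) (auto simp: not_le[symmetric] intro: assms)

lemma Sum_any_single:
  fixes f :: "'i \<Rightarrow> 'a::comm_monoid_add"
  assumes "\<And>j. j \<noteq> i \<Longrightarrow> f j = 0"
  shows "Sum_any f = f i"
proof -
  have "Sum_any f = sum f {i}"
    by (rule Sum_any.expand_superset) (use assms in auto)
  then show ?thesis by simp
qed

lemma Sum_any_zero: "(\<And>j. f j = 0) \<Longrightarrow> Sum_any f = (0::'a::comm_monoid_add)"
  by simp

lemma Sum_any_closed:
  assumes "0 \<in> K" "\<And>x y. x \<in> K \<Longrightarrow> y \<in> K \<Longrightarrow> x + y \<in> K" "\<And>j. f j \<in> K"
  shows "Sum_any f \<in> (K::'a::comm_monoid_add set)"
proof -
  have "sum f F \<in> K" for F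
    by (induction F rule: infinite_finite_induct) (use assms in auto)
  then show ?thesis unfolding Sum_any.expand_set .
qed

lemma gbinomial_minus_one: "(-1 :: complex) gchoose j = (-1) ^ j"
  using gbinomial_minus[of "1::complex" j] by (simp add: binomial_gbinomial[symmetric])

lemma gbinomial_minus_two: "(-2 :: complex) gchoose j = (-1) ^ j * (of_nat j + 1)"
proof -
  have "(-2 :: complex) gchoose j = (-1) ^ j * ((of_nat (Suc j)) gchoose j)"
    using gbinomial_minus[of "2::complex" j] by (simp add: add.commute)
  also have "(of_nat (Suc j) :: complex) gchoose j = of_nat (Suc j choose j)"
    by (simp only: binomial_gbinomial)
  finally show ?thesis by (simp add: add.commute)
qed

lemma gbinomial_zero_if: "(0 :: complex) gchoose j = (if j = 0 then 1 else 0)"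
  by (cases j) auto

context vertex_algebra
begin

sublocale vs: vector_space "smul V" by (rule ambient)

lemma zero_in [simp]: "0 \<in> vspace V"
  using subspace_vspace vs.subspace_0 by blast
lemma add_in [simp]: "a \<in> vspace V \<Longrightarrow> b \<in> vspace V \<Longrightarrow> a + b \<in> vspace V"
  using subspace_vspace vs.subspace_add by blast
lemma smul_in [simp]: "a \<in> vspace V \<Longrightarrow> smul V r a \<in> vspace V"
  using subspace_vspace vs.subspace_scale by blast
lemma neg_in [simp]: "a \<in> vspace V \<Longrightarrow> - a \<in> vspace V"
  using subspace_vspace vs.subspace_neg by blast
lemma diff_in [simp]: "a \<in> vspace V \<Longrightarrow> b \<in> vspace V \<Longrightarrow> a - b \<in> vspace V"
  using subspace_vspace vs.subspace_diff by blast
lemma sum_in_vspace: "(\<And>i. i \<in> F \<Longrightarrow> f i \<in> vspace V) \<Longrightarrow> sum f F \<in> vspace V"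
  using subspace_vspace vs.subspace_sum by blast

declare vac_in [simp] nprod_in [simp]

lemma transl_in [simp]: "a \<in> vspace V \<Longrightarrow> transl V a \<in> vspace V"
  by (simp add: transl_def)
lemma nop_in [simp]: "a \<in> vspace V \<Longrightarrow> b \<in> vspace V \<Longrightarrow> nop V a b \<in> vspace V"
  by (simp add: nop_def)

lemma smul_zero_scalar [simp]: "smul V 0 x = 0" by (rule vs.scale_zero_left)
lemma smul_zero [simp]: "smul V r 0 = 0" by (rule vs.scale_zero_right)
lemma smul_one [simp]: "smul V 1 x = x" by (rule vs.scale_one)

lemma nprod_zero_left [simp]: "b \<in> vspace V \<Longrightarrow> nprod V 0 n b = 0"
  using nprod_smul_left[of 0 b 0 n] by simp
lemma nprod_zero_right [simp]: "a \<in> vspace V \<Longrightarrow> nprod V a n 0 = 0"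
  using nprod_smul_right[of a 0 n 0] by simp
lemma nprod_neg_left: "a \<in> vspace V \<Longrightarrow> b \<in> vspace V \<Longrightarrow> nprod V (- a) n b = - nprod V a n b"
  using nprod_add_left[of a "- a" b n] by (simp add: eq_neg_iff_add_eq_0 add.commute)
lemma nprod_neg_right: "a \<in> vspace V \<Longrightarrow> b \<in> vspace V \<Longrightarrow> nprod V a n (- b) = - nprod V a n b"
  using nprod_add_right[of a b "- b" n] by (simp add: eq_neg_iff_add_eq_0 add.commute)
lemma nprod_diff_left: "\<lbrakk>a \<in> vspace V; a' \<in> vspace V; b \<in> vspace V\<rbrakk> \<Longrightarrow>
    nprod V (a - a') n b = nprod V a n b - nprod V a' n b"
  using nprod_add_left[of a "- a'" b n] by (simp add: nprod_neg_left)
lemma nprod_diff_right: "\<lbrakk>a \<in> vspace V; b \<in> vspace V; b' \<in> vspace V\<rbrakk> \<Longrightarrow>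
    nprod V a n (b - b') = nprod V a n b - nprod V a n b'"
  using nprod_add_right[of a b "- b'" n] by (simp add: nprod_neg_right)
lemma nprod_sum_right: "\<lbrakk>\<And>i. i \<in> F \<Longrightarrow> f i \<in> vspace V; a \<in> vspace V\<rbrakk> \<Longrightarrow>
    nprod V a n (sum f F) = (\<Sum>i\<in>F. nprod V a n (f i))"
  by (induction F rule: infinite_finite_induct) (auto simp: nprod_add_right sum_in_vspace)

lemmas nprod_linear = nprod_add_left nprod_add_right nprod_diff_left nprod_diff_right
  nprod_neg_left nprod_neg_right nprod_smul_left nprod_smul_right

lemma Sum_any_in_subspace:
  "vs.subspace K \<Longrightarrow> (\<And>j. f j \<in> K) \<Longrightarrow> Sum_any f \<in> K"
  by (rule Sum_any_closed) (auto intro: vs.subspace_0 vs.subspace_add)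

lemma span_subset_vspace: "X \<subseteq> vspace V \<Longrightarrow> vs.span X \<subseteq> vspace V"
  by (rule vs.span_minimal[OF _ subspace_vspace])

lemma subspace_preimage_right:
  assumes "vs.subspace K" "a \<in> vspace V"
  shows "vs.subspace {v \<in> vspace V. nprod V a n v \<in> K}"
  unfolding vs.subspace_def
  using assms by (auto simp: nprod_linear vs.subspace_0 intro: vs.subspace_add vs.subspace_scale)

lemma subspace_preimage_left:
  assumes "vs.subspace K" "b \<in> vspace V"
  shows "vs.subspace {v \<in> vspace V. nprod V v n b \<in> K}"
  unfolding vs.subspace_def
  using assms by (auto simp: nprod_linear vs.subspace_0 intro: vs.subspace_add vs.subspace_scale)

text \<open>The Borcherds identity at \<open>q = 0\<close>, where \<open>0 gchoose j\<close> leaves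
  only the term \<open>j = 0\<close> on the right.\<close>

lemma commutator:
  assumes "a \<in> vspace V" "b \<in> vspace V" "c \<in> vspace V"
  shows "nprod V a m (nprod V b n c) - nprod V b n (nprod V a m c) =
    Sum_any (\<lambda>j::nat. smul V (of_int m gchoose j) (nprod V (nprod V a (int j) b) (m + n - int j) c))"
proof -
  have "Sum_any (\<lambda>j::nat. smul V ((- 1) ^ j * (of_int 0 gchoose j))
             (nprod V a (m + 0 - int j) (nprod V b (n + int j) c) -
              smul V ((- 1) powi 0) (nprod V b (n + 0 - int j) (nprod V a (m + int j) c))))
     = nprod V a m (nprod V b n c) - nprod V b n (nprod V a m c)"
    by (subst Sum_any_single[where i = 0]) (auto simp: gbinomial_zero_if)
  with borcherds[OF assms, where m = m and n = n and q = 0] show ?thesis by simp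
qed

text \<open>The Borcherds identity at \<open>m = 0\<close>, where the left-hand side collapses to
  one term instead.\<close>

lemma iterate:
  assumes "a \<in> vspace V" "b \<in> vspace V" "c \<in> vspace V"
  shows "nprod V (nprod V a q b) n c =
    Sum_any (\<lambda>j::nat. smul V ((- 1) ^ j * (of_int q gchoose j))
             (nprod V a (q - int j) (nprod V b (n + int j) c) -
              smul V ((- 1) powi q) (nprod V b (n + q - int j) (nprod V a (int j) c))))"
proof -
  have "Sum_any (\<lambda>j::nat. smul V (of_int 0 gchoose j)
             (nprod V (nprod V a (q + int j) b) (0 + n - int j) c))
     = nprod V (nprod V a q b) n c"
    by (subst Sum_any_single[where i = 0]) (auto simp: gbinomial_zero_if)
  with borcherds[OF assms, where m = 0 and n = n and q = q] show ?thesis by simp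
qed

lemma nop_modes:
  assumes "a \<in> vspace V" "b \<in> vspace V" "c \<in> vspace V"
  shows "nprod V (nprod V a (-1) b) n c =
    Sum_any (\<lambda>j::nat. nprod V a (- 1 - int j) (nprod V b (n + int j) c) +
                      nprod V b (n - 1 - int j) (nprod V a (int j) c))"
proof -
  have *: "(- 1 :: complex) ^ j * ((- 1) gchoose j) = 1" for j
    by (simp add: gbinomial_minus_one flip: power_mult_distrib)
  show ?thesis
    unfolding iterate[OF assms] by (simp add: * add.commute)
qed

text \<open>This is \<open>iterate\<close> at \<open>q = -2\<close> with the vacuum in second place.
  The vacuum has only its mode -1, so at most one summand survives: one from the first product if
  \<open>n \<le> -1\<close>, none if \<open>n = 0\<close>, one from the second product if
  \<open>n \<ge> 1\<close>.\<close>

lemma transl_modes: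
  assumes "a \<in> vspace V" "c \<in> vspace V"
  shows "nprod V (transl V a) n c = smul V (- of_int n) (nprod V a (n - 1) c)"
proof -
  have *: "(- 1 :: complex) ^ j * ((- 2) gchoose j) = of_nat j + 1" for j
    by (simp add: gbinomial_minus_two flip: power_mult_distrib mult.assoc)
  have eq: "nprod V (transl V a) n c = Sum_any (\<lambda>j::nat. smul V (of_nat j + 1)
      (nprod V a (- 2 - int j) (nprod V (vac V) (n + int j) c) -
       nprod V (vac V) (n - 2 - int j) (nprod V a (int j) c)))"
    unfolding transl_def iterate[OF assms(1) vac_in assms(2)] by (simp add: * algebra_simps)
  consider "n \<le> -1" | "n = 0" | "n \<ge> 1" by linarith
  then show ?thesis
  proof cases
    case 1
    have "nprod V (transl V a) n c = smul V (of_nat (nat (- 1 - n)) + 1)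
      (nprod V a (- 2 - int (nat (- 1 - n))) (nprod V (vac V) (n + int (nat (- 1 - n))) c) -
       nprod V (vac V) (n - 2 - int (nat (- 1 - n))) (nprod V a (int (nat (- 1 - n))) c))"
      unfolding eq
      by (rule Sum_any_single) (use 1 assms in \<open>auto simp: vac_left\<close>)
    then show ?thesis using 1 assms by (simp add: vac_left algebra_simps)
  next
    case 2
    have "nprod V (transl V a) n c = 0"
      unfolding eq by (rule Sum_any_zero) (use 2 assms in \<open>auto simp: vac_left\<close>)
    then show ?thesis using 2 by simp
  next
    case 3
    have "nprod V (transl V a) n c = smul V (of_nat (nat (n - 1)) + 1)
      (nprod V a (- 2 - int (nat (n - 1))) (nprod V (vac V) (n + int (nat (n - 1))) c) -
       nprod V (vac V) (n - 2 - int (nat (n - 1))) (nprod V a (int (nat (n - 1))) c))"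
      unfolding eq
      by (rule Sum_any_single) (use 3 assms in \<open>auto simp: vac_left\<close>)
    then show ?thesis using 3 assms by (simp add: vac_left algebra_simps)
  qed
qed

lemma transl_nprod:
  assumes "a \<in> vspace V" "b \<in> vspace V"
  shows "transl V (nprod V a n b) = nprod V (transl V a) n b + nprod V a n (transl V b)"
proof -
  have "transl V (nprod V a n b) = (\<Sum>j<2. smul V ((- 1) ^ j * (of_int n gchoose j))
             (nprod V a (n - int j) (nprod V b (-2 + int j) (vac V)) -
              smul V ((- 1) powi n) (nprod V b (-2 + n - int j) (nprod V a (int j) (vac V)))))"
    unfolding transl_def iterate[OF assms vac_in]
    by (rule Sum_any_lessThan) (use assms in \<open>auto simp: vac_right_nonneg\<close>)
  also have "\<dots> = nprod V (transl V a) n b + nprod V a n (transl V b)"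
    using assms
    by (simp add: numeral_2_eq_2 vac_right_nonneg vac_right transl_modes)
       (simp add: transl_def)
  finally show ?thesis .
qed

lemma transl_vac [simp]: "transl V (vac V) = 0"
  by (simp add: transl_def vac_left)

lemma transl_linear:
  "a \<in> vspace V \<Longrightarrow> b \<in> vspace V \<Longrightarrow> transl V (a + b) = transl V a + transl V b"
  "a \<in> vspace V \<Longrightarrow> transl V (smul V r a) = smul V r (transl V a)"
  by (simp_all add: transl_def nprod_linear)

text \<open>Borcherds at \<open>m = -1\<close>, \<open>n = 0\<close> on the vacuum:
  \<open>b(j) vac\<close> vanishes, and \<open>a(-1 + j) vac\<close> vanishes unless
  \<open>j = 0\<close>, so one side is the single product \<open>b(q) a\<close> up to sign.\<close>

lemma skew_symmetry:
  assumes "a \<in> vspace V" "b \<in> vspace V"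
  shows "nprod V b q a = smul V (- ((- 1) powi q))
    (Sum_any (\<lambda>j::nat. smul V ((- 1) ^ j) (nprod V (nprod V a (q + int j) b) (- 1 - int j) (vac V))))"
    (is "_ = smul V _ ?S")
proof -
  have "Sum_any (\<lambda>j::nat. smul V ((- 1) ^ j * (of_int q gchoose j))
             (nprod V a (- 1 + q - int j) (nprod V b (0 + int j) (vac V)) -
              smul V ((- 1) powi q) (nprod V b (0 + q - int j) (nprod V a (- 1 + int j) (vac V)))))
     = - smul V ((- 1) powi q) (nprod V b q a)"
    by (subst Sum_any_single[where i = 0]) (use assms in \<open>auto simp: vac_right_nonneg vac_right\<close>)
  with borcherds[OF assms vac_in, where m = "-1" and n = 0 and q = q]
  have "?S = - smul V ((- 1) powi q) (nprod V b q a)"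
    by (simp add: gbinomial_minus_one)
  moreover have "(- 1 :: complex) powi q * (- 1) powi q = 1"
    by (simp flip: power_int_mult_distrib)
  ultimately show ?thesis by simp
qed

lemma commute_modes:
  assumes "a \<in> vspace V" "b \<in> vspace V" "c \<in> vspace V" "\<And>n::nat. nprod V a (int n) b = 0"
  shows "nprod V a m (nprod V b n c) = nprod V b n (nprod V a m c)"
proof -
  have "nprod V a m (nprod V b n c) - nprod V b n (nprod V a m c) = 0"
    unfolding commutator[OF assms(1-3)] by (rule Sum_any_zero) (use assms in simp)
  then show ?thesis by simp
qed

lemma nprod_zero_mode:
  assumes "a \<in> vspace V" "b \<in> vspace V" "c \<in> vspace V"
  shows "nprod V a 0 (nprod V b n c) = nprod V (nprod V a 0 b) n c + nprod V b n (nprod V a 0 c)"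
proof -
  have "nprod V a 0 (nprod V b n c) - nprod V b n (nprod V a 0 c) =  nprod V (nprod V a 0 b) n c"
    unfolding commutator[OF assms(1-3)]
    by (subst Sum_any_single[where i = 0]) (auto simp: gbinomial_zero_if)
  then show ?thesis by (simp add: algebra_simps)
qed

lemma nprod_one_mode:
  assumes "a \<in> vspace V" "b \<in> vspace V" "c \<in> vspace V"
  shows "nprod V a 1 (nprod V b n c) = nprod V (nprod V a 0 b) (n + 1) c
    + nprod V (nprod V a 1 b) n c + nprod V b n (nprod V a 1 c)"
proof -
  have "nprod V a 1 (nprod V b n c) - nprod V b n (nprod V a 1 c)
      = (\<Sum>j<2. smul V (of_int 1 gchoose j) (nprod V (nprod V a (int j) b) (1 + n - int j) c))"
    unfolding commutator[OF assms(1-3)]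
  proof (rule Sum_any_lessThan)
    fix j :: nat assume "j \<ge> 2"
    then have "(of_int 1 :: complex) gchoose j = 0"
      using binomial_gbinomial[of 1 j, where 'a = complex, symmetric] by simp
    then show "smul V (of_int 1 gchoose j) (nprod V (nprod V a (int j) b) (1 + n - int j) c) = 0" by simp
  qed
  also have "\<dots> = nprod V (nprod V a 0 b) (n + 1) c + nprod V (nprod V a 1 b) n c"
    by (simp add: numeral_2_eq_2 add.commute)
  finally show ?thesis by (simp add: algebra_simps)
qed

end

section \<open>Words in the modes of weighted generators\<close>

context vertex_algebra
begin

definition act :: "(('v \<times> nat) \<times> int) list \<Rightarrow> 'v \<Rightarrow> 'v" where
  "act ws v = modes_on V (map (\<lambda>((a, w), n). (a, n)) ws) v"

lemma act_simps [simp]: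
  "act [] v = v"
  "act (((a, p), n) # ws) v = nprod V a n (act ws v)"
  by (simp_all add: act_def modes_on_def)

lemma act_append [simp]: "act (us @ ws) v = act us (act ws v)"
  by (simp add: act_def modes_on_def)

definition wdeg :: "(('v \<times> nat) \<times> int) list \<Rightarrow> int" where
  "wdeg ws = (\<Sum>((a, w), n)\<leftarrow>ws. int w - n - 1)"

text \<open>The filtration degree. A mode counts with the weight of its generator, whatever its
  index. Under the hypotheses of \<open>reorderable\<close> a commutator of two letters lowers this
  number and keeps \<open>wdeg\<close>.\<close>

definition gwt :: "(('v \<times> nat) \<times> int) list \<Rightarrow> nat" where
  "gwt ws = (\<Sum>((a, w), n)\<leftarrow>ws. w)"

lemma wdeg_simps [simp]: "wdeg [] = 0" "wdeg (((a, p), n) # ws) = int p - n - 1 + wdeg ws"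
    "wdeg (us @ ws) = wdeg us + wdeg ws"
  by (simp_all add: wdeg_def)
lemma gwt_simps [simp]: "gwt [] = 0" "gwt (((a, p), n) # ws) = p + gwt ws"
    "gwt (us @ ws) = gwt us + gwt ws"
  by (simp_all add: gwt_def)

lemma wdeg_cong_mset: "mset ws = mset ws' \<Longrightarrow> wdeg ws = wdeg ws'"
  unfolding wdeg_def sum_mset_sum_list[symmetric] mset_map by simp
lemma gwt_cong_mset: "mset ws = mset ws' \<Longrightarrow> gwt ws = gwt ws'"
  unfolding gwt_def sum_mset_sum_list[symmetric] mset_map by simp

definition letters :: "('v \<times> nat) set \<Rightarrow> (('v \<times> nat) \<times> int) list \<Rightarrow> bool" where
  "letters G ws \<longleftrightarrow> (\<forall>(g, n)\<in>set ws. g \<in> G)"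

lemma letters_simps [simp]: "letters G []" "letters G ((g, n) # ws) \<longleftrightarrow> g \<in> G \<and> letters G ws"
    "letters G (us @ ws) \<longleftrightarrow> letters G us \<and> letters G ws"
  by (auto simp: letters_def)

lemma letters_cong_mset: "mset ws = mset ws' \<Longrightarrow> letters G ws = letters G ws'"
  unfolding letters_def by (drule mset_eq_setD) simp

definition wspan :: "('v \<times> nat) set \<Rightarrow> nat \<Rightarrow> int \<Rightarrow> 'v set" where
  "wspan G s N = vs.span {act ws (vac V) | ws. letters G ws \<and> gwt ws \<le> s \<and> wdeg ws = N}"

text \<open>The weight spaces with integer weights; the natural ones are those of \<^const>\<open>weight_space\<close>.\<close>

definition wspace :: "('v \<times> nat) set \<Rightarrow> int \<Rightarrow> 'v set" where
  "wspace G N = vs.span {act ws (vac V) | ws. letters G ws \<and> wdeg ws = N}"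

lemma weight_space_eq: "weight_space V G N = wspace G (int N)"
  by (simp add: weight_space_def wspace_def act_def letters_def wdeg_def)

lemma subspace_wspan [simp, intro]: "vs.subspace (wspan G s N)"
  by (simp add: wspan_def)
lemma subspace_wspace [simp, intro]: "vs.subspace (wspace G N)"
  by (simp add: wspace_def)

lemma wspan_mono: "s \<le> t \<Longrightarrow> wspan G s N \<subseteq> wspan G t N"
  unfolding wspan_def by (rule vs.span_mono) auto
lemma wspan_subset_wspace: "wspan G s N \<subseteq> wspace G N"
  unfolding wspan_def wspace_def by (rule vs.span_mono) auto
lemma act_in_wspan: "letters G ws \<Longrightarrow> gwt ws \<le> s \<Longrightarrow> wdeg ws = N \<Longrightarrow> act ws (vac V) \<in> wspan G s N"
  unfolding wspan_def by (rule vs.span_base) auto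
lemma act_in_wspace: "letters G ws \<Longrightarrow> wdeg ws = N \<Longrightarrow> act ws (vac V) \<in> wspace G N"
  unfolding wspace_def by (rule vs.span_base) auto
lemma vac_in_wspan: "vac V \<in> wspan G s 0"
  using act_in_wspan[of G "[]" s 0] by simp
lemma vac_in_wspace: "vac V \<in> wspace G 0"
  using act_in_wspace[of G "[]" 0] by simp

lemma act_in:
  assumes "letters G ws" "fst ` G \<subseteq> vspace V" "v \<in> vspace V"
  shows "act ws v \<in> vspace V"
  using assms by (induction ws) (force simp: image_subset_iff)+

lemma wspan_in: "fst ` G \<subseteq> vspace V \<Longrightarrow> v \<in> wspan G s N \<Longrightarrow> v \<in> vspace V"
  unfolding wspan_def by (rule subsetD[OF span_subset_vspace]) (auto intro: act_in)
lemma wspace_in: "fst ` G \<subseteq> vspace V \<Longrightarrow> v \<in> wspace G N \<Longrightarrow> v \<in> vspace V"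
  unfolding wspace_def by (rule subsetD[OF span_subset_vspace]) (auto intro: act_in)

lemma wspan_letter:
  assumes G: "fst ` G \<subseteq> vspace V" "(a, p) \<in> G" and v: "v \<in> wspan G s N"
  shows "nprod V a n v \<in> wspan G (s + p) (N + int p - n - 1)"
proof -
  have a: "a \<in> vspace V" using G by (auto simp: image_subset_iff)
  have "v \<in> {v \<in> vspace V. nprod V a n v \<in> wspan G (s + p) (N + int p - n - 1)}"
  proof (rule subsetD[OF vs.span_minimal v[unfolded wspan_def]])
    show "{act ws (vac V) |ws. letters G ws \<and> gwt ws \<le> s \<and> wdeg ws = N}
       \<subseteq> {v \<in> vspace V. nprod V a n v \<in> wspan G (s + p) (N + int p - n - 1)}"
    proof clarify
      fix ws assume ws: "letters G ws" "gwt ws \<le> s" "N = wdeg ws"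
      have "act (((a, p), n) # ws) (vac V) \<in> wspan G (s + p) (wdeg ws + int p - n - 1)"
        by (rule act_in_wspan) (use ws G in auto)
      then show "act ws (vac V) \<in> vspace V \<and>
          nprod V a n (act ws (vac V)) \<in> wspan G (s + p) (wdeg ws + int p - n - 1)"
        using act_in[OF ws(1) G(1) vac_in] by simp
    qed
    show "vs.subspace {v \<in> vspace V. nprod V a n v \<in> wspan G (s + p) (N + int p - n - 1)}"
      by (rule subspace_preimage_right[OF subspace_wspan a])
  qed
  then show ?thesis by simp
qed

text \<open>The iterate formula turns a mode of a composite vector into compositions of modes of its
  two constituents, so induction over the word of \<open>x\<close> reduces the claim to single
  letters. Letters are also applied to \<open>v\<close> first, which is why \<open>v\<close> and its
  degrees vary in the induction.\<close>

lemma wspan_nprod: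
  assumes G: "fst ` G \<subseteq> vspace V" and x: "x \<in> wspan G t M" and v: "v \<in> wspan G s N"
  shows "nprod V x n v \<in> wspan G (t + s) (M + N - n - 1)"
proof -
  have word: "nprod V (act ws (vac V)) n v \<in> wspan G (gwt ws + s) (wdeg ws + N - n - 1)"
    if "letters G ws" "v \<in> wspan G s N" for ws n v s N
    using that
  proof (induction ws arbitrary: n v s N)
    case Nil
    then have v: "v \<in> vspace V" using wspan_in[OF G] by blast
    show ?case using Nil v by (auto simp: vac_left vs.subspace_0)
  next
    case (Cons l ws)
    obtain a p q where l: "l = ((a, p), q)" by (metis surj_pair)
    have ap: "(a, p) \<in> G" and ws: "letters G ws" using Cons.prems l by auto
    have a: "a \<in> vspace V" using ap G by (auto simp: image_subset_iff)
    have b: "act ws (vac V) \<in> vspace V" using act_in[OF ws G] by simp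
    have v: "v \<in> vspace V" using wspan_in[OF G] Cons.prems by blast
    let ?K = "wspan G (gwt (l # ws) + s) (wdeg (l # ws) + N - n - 1)"
    have "nprod V a (q - int j) (nprod V (act ws (vac V)) (n + int j) v) \<in> ?K" for j
      using wspan_letter[OF G ap Cons.IH[OF ws Cons.prems(2), of "n + int j"], of "q - int j"]
      by (simp add: l algebra_simps)
    moreover have "nprod V (act ws (vac V)) (n + q - int j) (nprod V a (int j) v) \<in> ?K" for j
      using Cons.IH[OF ws wspan_letter[OF G ap Cons.prems(2), of "int j"], of "n + q - int j"]
      by (simp add: l algebra_simps)
    ultimately show ?case
      using a b v unfolding l act_simps iterate[OF a b v]
      by (intro Sum_any_in_subspace vs.subspace_scale vs.subspace_diff subspace_wspan) auto
  qed
  have v': "v \<in> vspace V" using wspan_in[OF G v] .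
  have "x \<in> {x \<in> vspace V. nprod V x n v \<in> wspan G (t + s) (M + N - n - 1)}"
  proof (rule subsetD[OF vs.span_minimal x[unfolded wspan_def]])
    show "{act ws (vac V) |ws. letters G ws \<and> gwt ws \<le> t \<and> wdeg ws = M}
      \<subseteq> {x \<in> vspace V. nprod V x n v \<in> wspan G (t + s) (M + N - n - 1)}"
    proof clarify
      fix ws assume ws: "letters G ws" "gwt ws \<le> t" "M = wdeg ws"
      show "act ws (vac V) \<in> vspace V \<and>
          nprod V (act ws (vac V)) n v \<in> wspan G (t + s) (wdeg ws + N - n - 1)"
        using act_in[OF ws(1) G vac_in] word[OF ws(1) v, of n] ws(2)
          wspan_mono[of "gwt ws + s" "t + s" G "wdeg ws + N - n - 1"] by auto
    qed
    show "vs.subspace {x \<in> vspace V. nprod V x n v \<in> wspan G (t + s) (M + N - n - 1)}"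
      by (rule subspace_preimage_left[OF subspace_wspan v'])
  qed
  then show ?thesis by simp
qed

lemma wspace_span_wspan: "wspace G N \<subseteq> (\<Union>s. wspan G s N)"
proof
  fix v assume "v \<in> wspace G N"
  then have "\<exists>s. v \<in> wspan G s N"
    unfolding wspace_def
  proof (induction rule: vs.span_induct_alt)
    case base
    show ?case using vs.subspace_0[OF subspace_wspan] by blast
  next
    case (step c x y)
    from step(1) obtain ws where ws: "x = act ws (vac V)" "letters G ws" "wdeg ws = N" by auto
    from step(2) obtain s where s: "y \<in> wspan G s N" by auto
    have "x \<in> wspan G (max s (gwt ws)) N" "y \<in> wspan G (max s (gwt ws)) N"
      using ws s act_in_wspan[of G ws "max s (gwt ws)" N] wspan_mono[of s "max s (gwt ws)" G N] by auto
    then show ?case using vs.subspace_add vs.subspace_scale subspace_wspan by blast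
  qed
  then show "v \<in> (\<Union>s. wspan G s N)" by blast
qed

lemma wspace_nprod:
  assumes G: "fst ` G \<subseteq> vspace V" and x: "x \<in> wspace G M" and v: "v \<in> wspace G N"
  shows "nprod V x n v \<in> wspace G (M + N - n - 1)"
proof -
  obtain s t where "x \<in> wspan G t M" "v \<in> wspan G s N"
    using wspace_span_wspan x v by blast
  from wspan_nprod[OF G this, of n] show ?thesis using wspan_subset_wspace by blast
qed

lemma act_wspan:
  assumes G: "fst ` G \<subseteq> vspace V" and "letters G us" "v \<in> wspan G s N"
  shows "act us v \<in> wspan G (gwt us + s) (wdeg us + N)"
  using assms(2)
proof (induction us)
  case (Cons l us)
  obtain a p q where l: "l = ((a, p), q)" by (metis surj_pair)
  show ?case using wspan_letter[OF G, of a p "act us v" "gwt us + s" "wdeg us + N" q] Cons l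
    by (simp add: algebra_simps)
qed (use assms in simp)

lemma act_diff:
  assumes G: "fst ` G \<subseteq> vspace V" and "letters G us" "x \<in> vspace V" "y \<in> vspace V"
  shows "act us (x - y) = act us x - act us y"
  using assms(2)
proof (induction us)
  case (Cons l us)
  obtain a p q where l: "l = ((a, p), q)" by (metis surj_pair)
  show ?case using Cons l assms act_in[OF _ G] by (auto simp: nprod_diff_right image_subset_iff)
qed simp

lemma act_zero:
  assumes G: "fst ` G \<subseteq> vspace V" and "letters G us"
  shows "act us 0 = 0"
  using act_diff[OF assms, of 0 0] by simp

end

section \<open>Reordering modes modulo smaller generator weight\<close>

locale reorderable = vertex_algebra V for V :: "'v::ab_group_add vert_alg" +
  fixes G :: "('v \<times> nat) set"
  assumes G_in: "fst ` G \<subseteq> vspace V"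
    and G_gen: "vspace V \<subseteq> module.span (smul V) {act ws (vac V) | ws. letters G ws}"
    and G_pos: "(a, p) \<in> G \<Longrightarrow> p \<ge> 1"
    and G_ope: "(a, p) \<in> G \<Longrightarrow> (b, q) \<in> G \<Longrightarrow>
      (\<forall>n::nat. nprod V a (int n) b \<in> wspan G (p + q - 1) (int p + int q - int n - 1)) \<or>
      (\<forall>n::nat. nprod V b (int n) a \<in> wspan G (p + q - 1) (int p + int q - int n - 1))"
begin

lemma G_fst_in: "(a, p) \<in> G \<Longrightarrow> a \<in> vspace V"
  using G_in by (auto simp: image_subset_iff)

text \<open>The commutator formula involves only products \<open>a(j) b\<close> with
  \<open>j \<ge> 0\<close>, which lose one unit of generator weight. The locale grants this for one
  of the two orders of \<open>a\<close> and \<open>b\<close>; the other order follows since the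
  commutator is antisymmetric.\<close>

lemma commutator_lower:
  assumes ap: "(a, p) \<in> G" and bq: "(b, q) \<in> G" and v: "v \<in> wspan G s N"
  shows "nprod V a m (nprod V b n v) - nprod V b n (nprod V a m v)
     \<in> wspan G (p + q + s - 1) (N + int p - m - 1 + int q - n - 1)"
proof -
  have *: "nprod V a m (nprod V b n v) - nprod V b n (nprod V a m v)
     \<in> wspan G (p + q + s - 1) (N + int p - m - 1 + int q - n - 1)"
    if ap: "(a, p) \<in> G" and bq: "(b, q) \<in> G"
      and ope: "\<forall>n::nat. nprod V a (int n) b \<in> wspan G (p + q - 1) (int p + int q - int n - 1)"
    for a b p q m n
  proof -
    have "nprod V (nprod V a (int j) b) (m + n - int j) v
        \<in> wspan G (p + q + s - 1) (N + int p - m - 1 + int q - n - 1)" for j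
      using wspan_nprod[OF G_in ope[rule_format, of j] v, of "m + n - int j"] G_pos[OF ap]
      by (simp add: algebra_simps)
    then show ?thesis
      unfolding commutator[OF G_fst_in[OF ap] G_fst_in[OF bq] wspan_in[OF G_in v]]
      by (intro Sum_any_in_subspace vs.subspace_scale subspace_wspan)
  qed
  from G_ope[OF ap bq] show ?thesis
  proof
    assume "\<forall>n::nat. nprod V b (int n) a \<in> wspan G (p + q - 1) (int p + int q - int n - 1)"
    then have "nprod V b n (nprod V a m v) - nprod V a m (nprod V b n v)
      \<in> wspan G (p + q + s - 1) (N + int p - m - 1 + int q - n - 1)"
      using *[OF bq ap, of n m] by (simp add: algebra_simps)
    from vs.subspace_neg[OF subspace_wspan this] show ?thesis by simp
  qed (rule *[OF ap bq])
qed

lemma swap_lower: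
  assumes "letters G (us @ l # l' # ws)"
  shows "act (us @ l # l' # ws) (vac V) - act (us @ l' # l # ws) (vac V)
     \<in> wspan G (gwt (us @ l # l' # ws) - 1) (wdeg (us @ l # l' # ws))"
proof -
  obtain a p m b q n where l: "l = ((a, p), m)" "l' = ((b, q), n)" by (metis surj_pair)
  have ap: "(a, p) \<in> G" "(b, q) \<in> G" and us: "letters G us" and ws: "letters G ws"
    using assms l by auto
  have v: "act ws (vac V) \<in> wspan G (gwt ws) (wdeg ws)" using act_in_wspan ws by simp
  have vV: "act ws (vac V) \<in> vspace V" using act_in[OF ws G_in] by simp
  note c = commutator_lower[OF ap v, of m n]
  have pos: "p \<ge> 1" using G_pos ap by blast
  show ?thesis
    using act_wspan[OF G_in us c] pos
    by (simp add: l act_diff[OF G_in us] vV G_fst_in[OF ap(1)] G_fst_in[OF ap(2)] algebra_simps)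
qed

lemma move_lower:
  assumes "letters G (us @ xs @ l # ws)"
  shows "act (us @ xs @ l # ws) (vac V) - act (us @ l # xs @ ws) (vac V)
     \<in> wspan G (gwt (us @ xs @ l # ws) - 1) (wdeg (us @ xs @ l # ws))"
  using assms
proof (induction xs arbitrary: ws rule: rev_induct)
  case Nil
  then show ?case by (simp add: vs.subspace_0)
next
  case (snoc x xs)
  have m: "mset ((us @ xs) @ l # x # ws) = mset (us @ xs @ l # x # ws)"
    "mset (us @ (xs @ [x]) @ l # ws) = mset (us @ xs @ l # x # ws)" by simp_all
  have L: "letters G (us @ xs @ l # x # ws)" using snoc.prems letters_cong_mset[OF m(2)] by blast
  have "act ((us @ xs) @ x # l # ws) (vac V) - act ((us @ xs) @ l # x # ws) (vac V)
     \<in> wspan G (gwt (us @ xs @ l # x # ws) - 1) (wdeg (us @ xs @ l # x # ws))"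
    using swap_lower[of "us @ xs" x l ws] snoc.prems gwt_cong_mset[OF m(2)] wdeg_cong_mset[OF m(2)]
    by simp
  from vs.subspace_add[OF subspace_wspan this snoc.IH[OF L]]
  show ?case using gwt_cong_mset[OF m(2)] wdeg_cong_mset[OF m(2)] by simp
qed

text \<open>The first letter of \<open>ws\<close> is located in \<open>ws'\<close> and pulled to its
  front by \<open>move_lower\<close>; it then joins the fixed prefix \<open>us\<close> and the
  induction continues with the tails.\<close>

lemma perm_lower:
  assumes "letters G (us @ ws)" "mset ws = mset ws'"
  shows "act (us @ ws) (vac V) - act (us @ ws') (vac V)
     \<in> wspan G (gwt (us @ ws) - 1) (wdeg (us @ ws))"
  using assms
proof (induction ws arbitrary: us ws')
  case Nil
  then show ?case by (simp add: vs.subspace_0)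
next
  case (Cons x ws)
  have "x \<in> set ws'" using Cons.prems(2) by (metis list.set_intros(1) mset_eq_setD)
  then obtain ys zs where ws': "ws' = ys @ x # zs" by (meson split_list)
  have m: "mset ws = mset (ys @ zs)" using Cons.prems(2) ws' by simp
  have "act ((us @ [x]) @ ws) (vac V) - act ((us @ [x]) @ ys @ zs) (vac V)
     \<in> wspan G (gwt ((us @ [x]) @ ws) - 1) (wdeg ((us @ [x]) @ ws))"
    by (rule Cons.IH[OF _ m]) (use Cons.prems in simp)
  then have a1: "act (us @ x # ws) (vac V) - act (us @ x # ys @ zs) (vac V)
     \<in> wspan G (gwt (us @ x # ws) - 1) (wdeg (us @ x # ws))" by simp
  have m2: "mset (us @ ys @ x # zs) = mset (us @ x # ws)" using m by simp
  have L: "letters G (us @ ys @ x # zs)"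
    using letters_cong_mset[OF m2] Cons.prems(1) by blast
  have a2: "act (us @ ys @ x # zs) (vac V) - act (us @ x # ys @ zs) (vac V)
     \<in> wspan G (gwt (us @ x # ws) - 1) (wdeg (us @ x # ws))"
    using move_lower[OF L] unfolding gwt_cong_mset[OF m2] wdeg_cong_mset[OF m2] .
  show ?case
    using vs.subspace_diff[OF subspace_wspan a1 a2] unfolding ws' by simp
qed

text \<open>Modulo words of smaller total generator weight the modes commute, so a word can be brought
  into any normal form \<open>P\<close>; a non-negative mode can be moved to the vacuum, which it kills.\<close>

lemma normal_form:
  assumes P: "\<And>ws. letters G ws \<Longrightarrow> \<forall>(g, n)\<in>set ws. n < 0 \<Longrightarrow> \<exists>ws'. mset ws' = mset ws \<and> P ws'"
    and ws: "letters G ws"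
  shows "act ws (vac V) \<in> vs.span {act ws' (vac V) | ws'. letters G ws' \<and>
    (\<forall>(g, n)\<in>set ws'. n < 0) \<and> P ws' \<and> wdeg ws' = wdeg ws}"
  using ws
proof (induction "gwt ws" arbitrary: ws rule: less_induct)
  case less
  let ?NF = "\<lambda>N. vs.span {act ws' (vac V) | ws'. letters G ws' \<and>
    (\<forall>(g, n)\<in>set ws'. n < 0) \<and> P ws' \<and> wdeg ws' = N}"
  show ?case
  proof (cases "ws = []")
    case True
    obtain ws' where "mset ws' = mset ([] :: (('v \<times> nat) \<times> int) list)" "P ws'" using P[of "[]"] by auto
    then have "P []" by simp
    then have "act [] (vac V) \<in> ?NF 0"
      by (intro vs.span_base CollectI exI[of _ "[]"]) auto
    then show ?thesis using True by simp
  next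
    case False
    obtain l us where us: "ws = l # us" using False by (cases ws) auto
    obtain a p q where l: "l = ((a, p), q)" by (metis surj_pair)
    have pos: "gwt ws \<ge> 1" using us l G_pos less.prems by fastforce
    \<comment> \<open>The subtraction is genuine: generators have positive weight and the word is
      nonempty, so the words spanning the left-hand side fall under the induction
      hypothesis.\<close>
    have lower: "wspan G (gwt ws - 1) (wdeg ws) \<subseteq> ?NF (wdeg ws)"
      unfolding wspan_def
    proof (rule vs.span_minimal)
      show "{act ws' (vac V) |ws'. letters G ws' \<and> gwt ws' \<le> gwt ws - 1 \<and> wdeg ws' = wdeg ws}
         \<subseteq> ?NF (wdeg ws)"
      proof clarify
        fix ws' assume "letters G ws'" "gwt ws' \<le> gwt ws - 1" "wdeg ws' = wdeg ws"
        then show "act ws' (vac V) \<in> ?NF (wdeg ws)"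
          using less.hyps[of ws'] pos by auto
      qed
    qed simp
    show ?thesis
    proof (cases "\<forall>(g, n)\<in>set ws. n < 0")
      case True
      obtain ws' where ws': "mset ws' = mset ws" "P ws'" using P[OF less.prems True] by auto
      have "act ws (vac V) - act ws' (vac V) \<in> ?NF (wdeg ws)"
        using perm_lower[of "[]" ws ws'] less.prems ws' lower by auto
      moreover have "act ws' (vac V) \<in> ?NF (wdeg ws)"
        using ws' wdeg_cong_mset[OF ws'(1)] letters_cong_mset[OF ws'(1)] less.prems True
          mset_eq_setD[OF ws'(1)]
        by (intro vs.span_base CollectI exI[of _ ws']) auto
      ultimately show ?thesis using vs.span_add by fastforce
    next
      case False
      then obtain g n where gn: "(g, n) \<in> set ws" "n \<ge> 0" by force
      obtain ys zs where ws': "ws = ys @ (g, n) # zs" using gn(1) by (meson split_list)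
      obtain b r where g: "g = (b, r)" by fastforce
      have b: "b \<in> vspace V" using less.prems ws' g G_fst_in by auto
      have z: "act ((ys @ zs) @ [(g, n)]) (vac V) = 0"
        using b gn g less.prems ws' by (simp add: vac_right_nonneg act_zero[OF G_in])
      have "act ([] @ ws) (vac V) - act ([] @ ((ys @ zs) @ [(g, n)])) (vac V)
          \<in> wspan G (gwt ([] @ ws) - 1) (wdeg ([] @ ws))"
        by (rule perm_lower) (use less.prems ws' in auto)
      then show ?thesis using lower z by auto
    qed
  qed
qed

lemma negative_words:
  assumes "letters G ws"
  shows "act ws (vac V) \<in> vs.span {act ws' (vac V) | ws'. letters G ws' \<and>
    (\<forall>(g, n)\<in>set ws'. n < 0) \<and> wdeg ws' = wdeg ws}"
  using normal_form[of "\<lambda>_. True", OF _ assms] by auto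

lemma wdeg_nonneg:
  assumes "letters G ws" "\<forall>(g, n)\<in>set ws. n < 0"
  shows "wdeg ws \<ge> int (length ws)"
  using assms
proof (induction ws)
  case (Cons l us)
  obtain a p q where l: "l = ((a, p), q)" by (metis surj_pair)
  have "p \<ge> 1" using Cons.prems l G_pos by auto
  then show ?case using Cons l by auto
qed simp

text \<open>In a word of negative modes every letter contributes \<open>p - n - 1 \<ge> 1\<close>,
  so no such word has negative weight and the spanning set provided by \<open>negative_words\<close>
  is empty.\<close>

lemma wspace_neg:
  assumes "N < 0" shows "wspace G N = {0}"
proof -
  have "act ws (vac V) = 0" if "letters G ws" "wdeg ws = N" for ws
  proof -
    have "{act ws' (vac V) |ws'. letters G ws' \<and> (\<forall>(g, n)\<in>set ws'. n < 0) \<and> wdeg ws' = wdeg ws} = {}"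
      using wdeg_nonneg that assms by fastforce
    with negative_words[OF that(1)] show ?thesis by (simp only: vs.span_empty singleton_iff)
  qed
  then have "{act ws (vac V) |ws. letters G ws \<and> wdeg ws = N} \<subseteq> {0}" by blast
  then have "wspace G N \<subseteq> {0}"
    unfolding wspace_def by (rule vs.span_minimal) (rule vs.subspace_single_0)
  then show ?thesis using vs.subspace_0[OF subspace_wspace] by blast
qed

text \<open>By the same count the empty word is the only word of negative modes that has weight
  0.\<close>

lemma wspace_0: "wspace G 0 = vs.span {vac V}"
proof
  have "act ws (vac V) \<in> vs.span {vac V}" if "letters G ws" "wdeg ws = 0" for ws
  proof -
    have "{act ws' (vac V) |ws'. letters G ws' \<and> (\<forall>(g, n)\<in>set ws'. n < 0) \<and> wdeg ws' = wdeg ws}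
        \<subseteq> {vac V}"
      using wdeg_nonneg that by fastforce
    from vs.span_mono[OF this] negative_words[OF that(1)] show ?thesis by auto
  qed
  then show "wspace G 0 \<subseteq> vs.span {vac V}"
    unfolding wspace_def by (intro vs.span_minimal) auto
  show "vs.span {vac V} \<subseteq> wspace G 0"
    by (rule vs.span_minimal) (auto simp: vac_in_wspace)
qed

lemma wspace_neg_words:
  "wspace G N \<subseteq> vs.span {act ws (vac V) | ws. letters G ws \<and> (\<forall>(g, n)\<in>set ws. n < 0) \<and> wdeg ws = N}"
  unfolding wspace_def
proof (rule vs.span_minimal)
  show "{act ws (vac V) |ws. letters G ws \<and> wdeg ws = N} \<subseteq>
    vs.span {act ws (vac V) | ws. letters G ws \<and> (\<forall>(g, n)\<in>set ws. n < 0) \<and> wdeg ws = N}"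
    using negative_words by auto
qed simp

end

section \<open>Spaces given by generators and relations; grading operators\<close>

text \<open>\<open>lin_ext\<close> for an arbitrary scalar multiplication, so that one formula
  serves both the presented space and the target of a map out of it.\<close>

definition lext :: "(complex \<Rightarrow> 'w \<Rightarrow> 'w) \<Rightarrow> ('x \<Rightarrow> 'w) \<Rightarrow> ('x \<Rightarrow>\<^sub>0 complex) \<Rightarrow> 'w::ab_group_add" where
  "lext sc h f = (\<Sum>x\<in>Poly_Mapping.keys f. sc (Poly_Mapping.lookup f x) (h x))"

lemma lin_ext_eq: "lin_ext V g = lext (smul V) g"
  by (rule ext) (simp add: lin_ext_def lext_def)

lemma lookup_free_smul [simp]: "Poly_Mapping.lookup (free_smul r f) x = r * Poly_Mapping.lookup f x"
  by (simp add: free_smul_def Poly_Mapping.map.rep_eq when_def)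

lemma keys_free_smul: "Poly_Mapping.keys (free_smul r f) \<subseteq> Poly_Mapping.keys f"
  by (auto simp: in_keys_iff)

lemma vector_space_free_smul: "vector_space free_smul"
  by unfold_locales (auto intro!: poly_mapping_eqI simp: lookup_add algebra_simps)

lemma vector_space_times: "vector_space ((*) :: complex \<Rightarrow> complex \<Rightarrow> complex)"
  by unfold_locales (auto simp: algebra_simps)

context
  fixes sc :: "complex \<Rightarrow> 'w \<Rightarrow> 'w::ab_group_add"
  assumes sc: "vector_space sc"
begin

interpretation vector_space sc by (rule sc)

lemma lext_superset:
  assumes "finite S" "Poly_Mapping.keys f \<subseteq> S"
  shows "lext sc h f = (\<Sum>x\<in>S. sc (Poly_Mapping.lookup f x) (h x))"
  unfolding lext_def
  by (rule sum.mono_neutral_left) (use assms in \<open>auto simp: in_keys_iff\<close>)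

lemma lext_zero [simp]: "lext sc h 0 = 0"
  by (simp add: lext_def)

lemma lext_single [simp]: "lext sc h (Poly_Mapping.single x r) = sc r (h x)"
  by (cases "r = 0") (simp_all add: lext_def)

lemma lext_add: "lext sc h (f + g) = lext sc h f + lext sc h g"
proof -
  let ?S = "Poly_Mapping.keys f \<union> Poly_Mapping.keys g"
  have "lext sc h (f + g) = (\<Sum>x\<in>?S. sc (Poly_Mapping.lookup (f + g) x) (h x))"
    by (rule lext_superset) (use Poly_Mapping.keys_add[of f g] in auto)
  also have "\<dots> = lext sc h f + lext sc h g"
    by (simp add: lookup_add scale_left_distrib sum.distrib lext_superset[of ?S])
  finally show ?thesis .
qed

lemma lext_free_smul: "lext sc h (free_smul r f) = sc r (lext sc h f)"
  by (simp add: lext_superset[OF _ keys_free_smul] lext_def[of sc h f] scale_sum_right)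

lemma lext_diff: "lext sc h (f - g) = lext sc h f - lext sc h g"
  using lext_add[of h "f - g" g] by (simp add: algebra_simps)

lemma lext_span_zero:
  assumes "\<And>r. r \<in> R \<Longrightarrow> lext sc h r = 0" "f \<in> module.span free_smul R"
  shows "lext sc h f = 0"
proof -
  interpret free: vector_space free_smul by (rule vector_space_free_smul)
  from assms(2) show ?thesis
    by (induction rule: free.span_induct_alt) (auto simp: lext_add lext_free_smul assms(1))
qed

end

definition lin_on :: "'v::ab_group_add vert_alg \<Rightarrow> (complex \<Rightarrow> 'w \<Rightarrow> 'w) \<Rightarrow> ('v \<Rightarrow> 'w::ab_group_add) \<Rightarrow> bool" where
  "lin_on V sc F \<longleftrightarrow> (\<forall>a\<in>vspace V. \<forall>b\<in>vspace V. F (a + b) = F a + F b) \<and>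
     (\<forall>r. \<forall>a\<in>vspace V. F (smul V r a) = sc r (F a))"

text \<open>The universal property of a presentation. \<open>F\<close> evaluates \<open>h\<close> on
  a chosen representative; two representatives differ by a combination of relators, which
  \<open>h\<close> annihilates.\<close>

lemma presented_lift:
  fixes V :: "'v::ab_group_add vert_alg" and sc :: "complex \<Rightarrow> 'w \<Rightarrow> 'w::ab_group_add"
  assumes P: "presented_by V X g R" and V: "vector_space (smul V)" and sc: "vector_space sc"
    and R: "\<And>r. r \<in> R \<Longrightarrow> lext sc h r = 0"
  obtains F where "lin_on V sc F" "\<And>x. x \<in> X \<Longrightarrow> F (g x) = h x"
proof -
  interpret V: vector_space "smul V" by (rule V)
  interpret S: vector_space sc by (rule sc)
  define F where "F v = lext sc h (SOME f. Poly_Mapping.keys f \<subseteq> X \<and> lin_ext V g f = v)" for v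
  have F: "F (lin_ext V g f) = lext sc h f" if f: "Poly_Mapping.keys f \<subseteq> X" for f
  proof -
    define f' where "f' = (SOME f'. Poly_Mapping.keys f' \<subseteq> X \<and> lin_ext V g f' = lin_ext V g f)"
    have f': "Poly_Mapping.keys f' \<subseteq> X \<and> lin_ext V g f' = lin_ext V g f"
      unfolding f'_def by (rule someI[of _ f]) (use f in simp)
    have "Poly_Mapping.keys (f' - f) \<subseteq> X"
      using f f' keys_diff[of f' f] by blast
    moreover have "lin_ext V g (f' - f) = 0"
      using f' by (simp add: lin_ext_eq lext_diff[OF V])
    ultimately have "f' - f \<in> module.span free_smul R"
      using P by (auto simp: presented_by_def)
    from lext_span_zero[OF sc R this] have "lext sc h f' = lext sc h f"
      by (simp add: lext_diff[OF sc])
    then show ?thesis by (simp add: F_def f'_def)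
  qed
  have rep: "\<exists>f. Poly_Mapping.keys f \<subseteq> X \<and> v = lin_ext V g f" if "v \<in> vspace V" for v
  proof -
    from that have "v \<in> lin_ext V g ` {f. Poly_Mapping.keys f \<subseteq> X}"
      using P by (simp add: presented_by_def)
    then show ?thesis by auto
  qed
  show ?thesis
  proof
    show "lin_on V sc F"
      unfolding lin_on_def
    proof (intro conjI ballI allI)
      fix a b assume "a \<in> vspace V" "b \<in> vspace V"
      then obtain f f' where f: "Poly_Mapping.keys f \<subseteq> X" "a = lin_ext V g f"
        "Poly_Mapping.keys f' \<subseteq> X" "b = lin_ext V g f'" using rep by meson
      have "Poly_Mapping.keys (f + f') \<subseteq> X"
        using f(1,3) Poly_Mapping.keys_add[of f f'] by blast
      from F[OF this] have "F (a + b) = lext sc h (f + f')"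
        unfolding f lin_ext_eq lext_add[OF V] .
      moreover have "F a = lext sc h f" "F b = lext sc h f'"
        unfolding f using F f by blast+
      ultimately show "F (a + b) = F a + F b" by (simp add: lext_add[OF sc])
    next
      fix r a assume "a \<in> vspace V"
      then obtain f where f: "Poly_Mapping.keys f \<subseteq> X" "a = lin_ext V g f" using rep by meson
      have "Poly_Mapping.keys (free_smul r f) \<subseteq> X"
        using f(1) keys_free_smul[of r f] by (rule order_trans[rotated])
      from F[OF this] have "F (smul V r a) = lext sc h (free_smul r f)"
        unfolding f lin_ext_eq lext_free_smul[OF V] .
      moreover have "F a = lext sc h f"
        unfolding f using F f by blast
      ultimately show "F (smul V r a) = sc r (F a)" by (simp add: lext_free_smul[OF sc])
    qed
  next
    fix x assume "x \<in> X"
    then have "F (lin_ext V g (Poly_Mapping.single x 1)) = lext sc h (Poly_Mapping.single x 1)"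
      by (intro F) simp
    then show "F (g x) = h x"
      unfolding lin_ext_eq lext_single[OF V] lext_single[OF sc] by simp
  qed
qed

lemma presented_generator_in:
  assumes P: "presented_by V X g R" and V: "vector_space (smul V)" and x: "x \<in> X"
  shows "g x \<in> vspace V"
proof -
  interpret V: vector_space "smul V" by (rule V)
  have "lin_ext V g (Poly_Mapping.single x 1) \<in> vspace V"
    using P x by (auto simp: presented_by_def)
  then show ?thesis by (simp add: lin_ext_eq lext_single[OF V])
qed

lemma presented_span:
  assumes P: "presented_by V X g R" and V: "vector_space (smul V)"
  shows "vspace V \<subseteq> module.span (smul V) (g ` X)"
proof -
  interpret V: vector_space "smul V" by (rule V)
  have "lin_ext V g f \<in> V.span (g ` X)" if "Poly_Mapping.keys f \<subseteq> X" for f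
    unfolding lin_ext_def using that
    by (intro V.span_sum V.span_scale V.span_base) auto
  moreover have "vspace V = lin_ext V g ` {f. Poly_Mapping.keys f \<subseteq> X}"
    using P by (simp add: presented_by_def)
  ultimately show ?thesis by auto
qed

lemma presented_relator:
  assumes P: "presented_by V X g R" and r: "r \<in> R" "Poly_Mapping.keys r \<subseteq> X"
  shows "lext (smul V) g r = 0"
proof -
  interpret free: vector_space free_smul by (rule vector_space_free_smul)
  show ?thesis using P r free.span_base by (auto simp: presented_by_def lin_ext_eq)
qed

context vertex_algebra
begin

lemma lin_onD:
  assumes "lin_on V sc F" "vector_space sc" "a \<in> vspace V" "b \<in> vspace V"
  shows "F (a + b) = F a + F b" "F (smul V r a) = sc r (F a)" "F 0 = 0" "F (- a) = - F a"
    "F (a - b) = F a - F b"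
proof -
  interpret S: vector_space sc by (rule assms)
  show *: "F (a + b) = F a + F b" "F (smul V r a) = sc r (F a)"
    using assms by (auto simp: lin_on_def)
  have s: "F (smul V r a) = sc r (F a)" if "a \<in> vspace V" for r a
    using assms that by (auto simp: lin_on_def)
  show z: "F 0 = 0" using s[of 0 0] by simp
  show n: "F (- a) = - F a" using s[of a "-1"] assms by (simp add: S.scale_minus_left vs.scale_minus_left)
  have "F (a - b + b) = F (a - b) + F b" using assms unfolding lin_on_def by (metis diff_in)
  then show "F (a - b) = F a - F b" by (simp add: algebra_simps)
qed

lemma lin_on_zero: "lin_on V sc F \<Longrightarrow> vector_space sc \<Longrightarrow> F 0 = 0"
  by (rule lin_onD(3)[OF _ _ zero_in zero_in])

lemma lin_on_sum:
  assumes "lin_on V sc F" "vector_space sc" "\<And>i. i \<in> I \<Longrightarrow> f i \<in> vspace V"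
  shows "F (sum f I) = (\<Sum>i\<in>I. F (f i))"
  using assms(3)
  by (induction I rule: infinite_finite_induct)
    (auto simp: lin_onD(1)[OF assms(1,2)] sum_in_vspace lin_on_zero[OF assms(1,2)])

text \<open>Applying \<open>H - c x\<close> to the sum removes the component \<open>v x\<close> and
  multiplies each other one by \<open>c i - c x\<close>, which is nonzero by injectivity. Induction
  gives these components, and subtraction gives \<open>v x\<close>.\<close>

lemma eigencomponents:
  assumes H: "lin_on V (smul V) H" and K: "vs.subspace K" "K \<subseteq> vspace V" "\<And>x. x \<in> K \<Longrightarrow> H x \<in> K"
    and F: "finite F" "inj_on c F" "\<And>i. i \<in> F \<Longrightarrow> v i \<in> vspace V \<and> H (v i) = smul V (c i) (v i)"
    and sum: "sum v F \<in> K" and "i \<in> F"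
  shows "v i \<in> K"
  using F sum \<open>i \<in> F\<close>
proof (induction F arbitrary: v i rule: finite_induct)
  case (insert x F)
  have vV: "\<And>i. i \<in> insert x F \<Longrightarrow> v i \<in> vspace V" using insert.prems by blast
  have "H (sum v (insert x F)) - smul V (c x) (sum v (insert x F))
     = (\<Sum>i\<in>insert x F. H (v i)) - (\<Sum>i\<in>insert x F. smul V (c x) (v i))"
    using lin_on_sum[OF H ambient vV, of "insert x F" "\<lambda>i. i"] by (simp add: vs.scale_sum_right del: sum.insert)
  also have "\<dots> = (\<Sum>i\<in>insert x F. smul V (c i - c x) (v i))"
    unfolding sum_subtractf[symmetric]
    by (rule sum.cong) (use insert.prems in \<open>auto simp: vs.scale_left_diff_distrib\<close>)
  also have "\<dots> = (\<Sum>i\<in>F. smul V (c i - c x) (v i))" using insert.hyps by simp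
  finally have "(\<Sum>i\<in>F. smul V (c i - c x) (v i)) \<in> K"
    using vs.subspace_diff[OF K(1) K(3)[OF insert.prems(3)] vs.subspace_scale[OF K(1) insert.prems(3), of "c x"]]
    by simp
  then have *: "smul V (c i - c x) (v i) \<in> K" if "i \<in> F" for i
  proof (intro insert.IH[where v = "\<lambda>i. smul V (c i - c x) (v i)", OF _ _ _ that])
    show "inj_on c F" using insert.prems(1) by simp
    show "smul V (c j - c x) (v j) \<in> vspace V \<and>
        H (smul V (c j - c x) (v j)) = smul V (c j) (smul V (c j - c x) (v j))" if "j \<in> F" for j
    proof -
      have "v j \<in> vspace V" "H (v j) = smul V (c j) (v j)" using insert.prems(2)[of j] that by auto
      then show ?thesis by (simp add: lin_onD(2)[OF H ambient _ zero_in] mult.commute)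
    qed
  qed
  have F: "v i \<in> K" if "i \<in> F" for i
  proof -
    have "c i \<noteq> c x" using insert.prems(1) insert.hyps that by (auto simp: inj_on_def)
    then show ?thesis using vs.subspace_scale[OF K(1) *[OF that], of "1 / (c i - c x)"]
      by (simp add: vs.scale_scale)
  qed
  have "v x = sum v (insert x F) - sum v F" using insert.hyps by simp
  then have "v x \<in> K" using vs.subspace_diff[OF K(1) insert.prems(3) vs.subspace_sum[OF K(1)], of F v] F by simp
  then show ?case using F insert.prems by auto
qed simp

text \<open>The commutation rule of \<open>L(0)\<close> with modes, imposed on a bare operator so
  that it makes sense without a conformal vector, as at \<open>k = -3\<close>.\<close>

definition grading_op :: "('v \<Rightarrow> 'v) \<Rightarrow> bool" where
  "grading_op D \<longleftrightarrow> lin_on V (smul V) D \<and> (\<forall>a\<in>vspace V. D a \<in> vspace V) \<and>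
     (\<forall>a\<in>vspace V. \<forall>b\<in>vspace V. \<forall>n.
        D (nprod V a n b) = nprod V (D a) n b + nprod V a n (D b) - smul V (of_int (n + 1)) (nprod V a n b))"

text \<open>The commutator of \<open>w(1)\<close> with \<open>a(n)\<close> is
  \<open>(w(0) a)(n + 1) + (w(1) a)(n)\<close>; when \<open>w(0)\<close> is translation, the first
  term is \<open>-(n + 1) a(n)\<close>, the shift required of a grading operator.\<close>

lemma grading_op_inner:
  assumes w: "w \<in> vspace V" and T: "\<And>a. a \<in> vspace V \<Longrightarrow> nprod V w 0 a = transl V a"
  shows "grading_op (nprod V w 1)"
  unfolding grading_op_def lin_on_def
  using w by (auto simp: nprod_linear nprod_one_mode T transl_modes vs.scale_left_distrib
      vs.scale_left_diff_distrib)

text \<open>The zero mode of \<open>w\<close> and the translation operator are both derivations of all products.\<close>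

lemma zero_mode_eq_transl_nprod:
  assumes "w \<in> vspace V" "a \<in> vspace V" "b \<in> vspace V"
    and "nprod V w 0 a = transl V a" "nprod V w 0 b = transl V b"
  shows "nprod V w 0 (nprod V a n b) = transl V (nprod V a n b)"
  using assms by (simp add: nprod_zero_mode transl_nprod)

lemma subspace_zero_mode_eq_transl:
  assumes "w \<in> vspace V"
  shows "vs.subspace {a \<in> vspace V. nprod V w 0 a = transl V a}"
  using assms unfolding vs.subspace_def
  by (auto simp: nprod_linear transl_linear) (simp add: transl_def vac_left)

lemma grading_opD:
  assumes "grading_op D" "a \<in> vspace V" "b \<in> vspace V"
  shows "D (nprod V a n b) = nprod V (D a) n b + nprod V a n (D b) - smul V (of_int (n + 1)) (nprod V a n b)"
  using assms unfolding grading_op_def by blast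

lemma grading_op_vac: "grading_op D \<Longrightarrow> D (vac V) = 0"
proof -
  assume D: "grading_op D"
  have v: "D (vac V) \<in> vspace V" using D by (auto simp: grading_op_def)
  show ?thesis using v grading_opD[OF D vac_in vac_in, of "-1"] by (simp add: vac_left vac_right)
qed

lemma grading_op_nprod:
  assumes "grading_op D" "a \<in> vspace V" "b \<in> vspace V"
    "D a = smul V (of_int p) a" "D b = smul V (of_int q) b"
  shows "D (nprod V a n b) = smul V (of_int (p + q - n - 1)) (nprod V a n b)"
  using assms by (simp add: grading_opD nprod_linear vs.scale_left_distrib vs.scale_left_diff_distrib)

lemma grading_op_act:
  assumes D: "grading_op D" and G: "fst ` G \<subseteq> vspace V"
    and DG: "\<And>a p. (a, p) \<in> G \<Longrightarrow> D a = smul V (of_int (int p)) a" and ws: "letters G ws"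
  shows "D (act ws (vac V)) = smul V (of_int (wdeg ws)) (act ws (vac V))"
  using ws
proof (induction ws)
  case Nil
  then show ?case using grading_op_vac[OF D] by simp
next
  case (Cons l ws)
  obtain a p n where l: "l = ((a, p), n)" by (metis surj_pair)
  then have ap: "(a, p) \<in> G" "a \<in> vspace V" and ws: "letters G ws"
    using Cons.prems G by (auto simp: image_subset_iff)
  have "act ws (vac V) \<in> vspace V" using act_in[OF ws G] by simp
  from grading_op_nprod[OF D ap(2) this DG[OF ap(1)] Cons.IH[OF ws], of n]
  show ?case by (simp add: l algebra_simps)
qed

lemma grading_op_wspace:
  assumes D: "grading_op D" and G: "fst ` G \<subseteq> vspace V"
    and DG: "\<And>a p. (a, p) \<in> G \<Longrightarrow> D a = smul V (of_int (int p)) a" and v: "v \<in> wspace G N"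
  shows "D v = smul V (of_int N) v"
proof -
  have lin: "lin_on V (smul V) D" using D by (simp add: grading_op_def)
  have "v \<in> {v \<in> vspace V. D v = smul V (of_int N) v}"
  proof (rule subsetD[OF vs.span_minimal v[unfolded wspace_def]])
    show "{act ws (vac V) |ws. letters G ws \<and> wdeg ws = N} \<subseteq> {v \<in> vspace V. D v = smul V (of_int N) v}"
      using act_in[OF _ G] grading_op_act[OF D G DG] by auto
    show "vs.subspace {v \<in> vspace V. D v = smul V (of_int N) v}"
      unfolding vs.subspace_def
      by (auto simp: lin_onD(1,2)[OF lin ambient] lin_on_zero[OF lin ambient] vs.scale_right_distrib vs.scale_scale mult.commute)
  qed
  then show ?thesis by simp
qed

end

section \<open>Tensor products\<close>

locale tensor_product = A: vertex_algebra A + B: vertex_algebra B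
  for A :: "'a::ab_group_add vert_alg" and B :: "'b::ab_group_add vert_alg" +
  fixes T :: "'t::ab_group_add vert_alg" and t :: "'a \<Rightarrow> 'b \<Rightarrow> 't"
  assumes tensor: "va_tensor A B T t"
begin

sublocale T: vertex_algebra T
  using tensor by (simp add: va_tensor_def)

lemma presented: "presented_by T (vspace A \<times> vspace B) (\<lambda>(a, b). t a b) (bilinear_relators A B)"
  using tensor by (simp add: va_tensor_def)

lemma vac_T: "vac T = t (vac A) (vac B)"
  using tensor by (simp add: va_tensor_def)

lemma t_in [simp]: "a \<in> vspace A \<Longrightarrow> b \<in> vspace B \<Longrightarrow> t a b \<in> vspace T"
  using presented_generator_in[OF presented T.ambient, of "(a, b)"] by simp

lemma t_relator:
  assumes "r \<in> bilinear_relators A B" "Poly_Mapping.keys r \<subseteq> vspace A \<times> vspace B"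
  shows "lext (smul T) (\<lambda>(a, b). t a b) r = 0"
  using presented_relator[OF presented assms] .

lemma keys_single_diff: "Poly_Mapping.keys (Poly_Mapping.single x r - Poly_Mapping.single y s) \<subseteq> {x, y}"
  by (rule order_trans[OF keys_diff]) auto
lemma keys_single_diff2:
  "Poly_Mapping.keys (Poly_Mapping.single x r - Poly_Mapping.single y s - Poly_Mapping.single z u) \<subseteq> {x, y, z}"
  using keys_single_diff[of x r y s] by (intro order_trans[OF keys_diff]) auto

lemma t_add_left: assumes "a \<in> vspace A" "a' \<in> vspace A" "b \<in> vspace B"
  shows "t (a + a') b = t a b + t a' b"
proof -
  have "lext (smul T) (\<lambda>(a, b). t a b) (Poly_Mapping.single (a + a', b) 1
      - Poly_Mapping.single (a, b) 1 - Poly_Mapping.single (a', b) 1) = 0"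
  proof (rule t_relator[OF _ order_trans[OF keys_single_diff2]])
  qed (unfold bilinear_relators_def, use assms in blast, use assms in auto)
  then show ?thesis by (simp add: lext_diff[OF T.ambient] lext_add[OF T.ambient] lext_single[OF T.ambient] algebra_simps)
qed

lemma t_add_right: assumes "a \<in> vspace A" "b' \<in> vspace B" "b \<in> vspace B"
  shows "t a (b + b') = t a b + t a b'"
proof -
  have "lext (smul T) (\<lambda>(a, b). t a b) (Poly_Mapping.single (a, b + b') 1
      - Poly_Mapping.single (a, b) 1 - Poly_Mapping.single (a, b') 1) = 0"
  proof (rule t_relator[OF _ order_trans[OF keys_single_diff2]])
  qed (unfold bilinear_relators_def, use assms in blast, use assms in auto)
  then show ?thesis by (simp add: lext_diff[OF T.ambient] lext_add[OF T.ambient] lext_single[OF T.ambient] algebra_simps)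
qed

lemma t_smul_left: assumes "a \<in> vspace A" "b \<in> vspace B"
  shows "t (smul A r a) b = smul T r (t a b)"
proof -
  have "lext (smul T) (\<lambda>(a, b). t a b) (Poly_Mapping.single (smul A r a, b) 1
      - Poly_Mapping.single (a, b) r) = 0"
  proof (rule t_relator[OF _ order_trans[OF keys_single_diff]])
  qed (unfold bilinear_relators_def, use assms in blast, use assms in auto)
  then show ?thesis by (simp add: lext_diff[OF T.ambient] lext_add[OF T.ambient] lext_single[OF T.ambient] algebra_simps)
qed

lemma t_smul_right: assumes "a \<in> vspace A" "b \<in> vspace B"
  shows "t a (smul B r b) = smul T r (t a b)"
proof -
  have "lext (smul T) (\<lambda>(a, b). t a b) (Poly_Mapping.single (a, smul B r b) 1
      - Poly_Mapping.single (a, b) r) = 0"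
  proof (rule t_relator[OF _ order_trans[OF keys_single_diff]])
  qed (unfold bilinear_relators_def, use assms in blast, use assms in auto)
  then show ?thesis by (simp add: lext_diff[OF T.ambient] lext_add[OF T.ambient] lext_single[OF T.ambient] algebra_simps)
qed

lemma t_zero [simp]: "b \<in> vspace B \<Longrightarrow> t 0 b = 0" "a \<in> vspace A \<Longrightarrow> t a 0 = 0"
  using t_smul_left[of 0 b 0] t_smul_right[of a 0 0] by simp_all

lemma t_diff_left: assumes "a \<in> vspace A" "a' \<in> vspace A" "b \<in> vspace B"
  shows "t (a - a') b = t a b - t a' b"
  using t_add_left[of "a - a'" a' b] assms by (simp add: algebra_simps)
lemma t_diff_right: assumes "a \<in> vspace A" "b' \<in> vspace B" "b \<in> vspace B"
  shows "t a (b - b') = t a b - t a b'"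
  using t_add_right[of a b' "b - b'"] assms by (simp add: algebra_simps)

lemma bilinear_lift:
  fixes sc :: "complex \<Rightarrow> 'w \<Rightarrow> 'w::ab_group_add"
  assumes sc: "vector_space sc"
    and l: "\<And>b. b \<in> vspace B \<Longrightarrow> lin_on A sc (\<lambda>a. f a b)"
    and r: "\<And>a. a \<in> vspace A \<Longrightarrow> lin_on B sc (\<lambda>b. f a b)"
  obtains F where "lin_on T sc F" "\<And>a b. a \<in> vspace A \<Longrightarrow> b \<in> vspace B \<Longrightarrow> F (t a b) = f a b"
proof -
  interpret S: vector_space sc by (rule sc)
  have "lext sc (\<lambda>(a, b). f a b) r = 0" if "r \<in> bilinear_relators A B" for r
    using that l r unfolding bilinear_relators_def lin_on_def
    by (auto simp: lext_diff[OF sc] lext_single[OF sc])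
  from presented_lift[OF presented T.ambient sc this]
  obtain F where F: "lin_on T sc F"
    "\<And>x. x \<in> vspace A \<times> vspace B \<Longrightarrow> F (case x of (a, b) \<Rightarrow> t a b) = (case x of (a, b) \<Rightarrow> f a b)" by blast
  show ?thesis by (rule that[OF F(1)]) (use F(2) in auto)
qed

lemma tensor_induct [consumes 1, case_names zero pure add]:
  assumes "x \<in> vspace T" "P 0" "\<And>a b. a \<in> vspace A \<Longrightarrow> b \<in> vspace B \<Longrightarrow> P (t a b)"
    "\<And>x y. x \<in> vspace T \<Longrightarrow> y \<in> vspace T \<Longrightarrow> P x \<Longrightarrow> P y \<Longrightarrow> P (x + y)"
  shows "P x"
proof -
  have "x \<in> T.vs.span ((\<lambda>(a, b). t a b) ` (vspace A \<times> vspace B))"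
    using assms(1) presented_span[OF presented T.ambient] by blast
  then have "x \<in> vspace T \<and> P x"
  proof (induction rule: T.vs.span_induct_alt)
    case (step c x y)
    then obtain a b where ab: "a \<in> vspace A" "b \<in> vspace B" "x = t a b" by auto
    then have "smul T c x = t (smul A c a) b" by (simp add: t_smul_left)
    then show ?case using assms(3,4) step ab by simp
  qed (use assms in simp)
  then show ?thesis by simp
qed

text \<open>If neither factor is zero, there are functionals with value 1 on \<open>a\<close> and on
  \<open>b\<close>; their product is bilinear, hence descends to the tensor product, where it takes
  the value 1 on \<open>t a b\<close>.\<close>

lemma pure_nonzero:
  assumes "a \<in> vspace A" "b \<in> vspace B" "t a b = 0" shows "a = 0 \<or> b = 0"
proof (rule ccontr)
  assume nz: "\<not> (a = 0 \<or> b = 0)"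
  interpret VA: vector_space_pair "smul A" "(*) :: complex \<Rightarrow> complex \<Rightarrow> complex"
    by (intro vector_space_pair.intro A.ambient vector_space_times)
  interpret VB: vector_space_pair "smul B" "(*) :: complex \<Rightarrow> complex \<Rightarrow> complex"
    by (intro vector_space_pair.intro B.ambient vector_space_times)
  obtain \<phi> where \<phi>: "Vector_Spaces.linear (smul A) (*) \<phi>" "\<phi> a = (1::complex)"
    using VA.linear_independent_extend[of "{a}" "\<lambda>_. 1"] nz by auto
  obtain \<psi> where \<psi>: "Vector_Spaces.linear (smul B) (*) \<psi>" "\<psi> b = (1::complex)"
    using VB.linear_independent_extend[of "{b}" "\<lambda>_. 1"] nz by auto
  obtain F where F: "lin_on T (*) F" "\<And>a b. a \<in> vspace A \<Longrightarrow> b \<in> vspace B \<Longrightarrow> F (t a b) = \<phi> a * \<psi> b"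
  proof (rule bilinear_lift[OF vector_space_times, of "\<lambda>a b. \<phi> a * \<psi> b"])
    show "lin_on A (*) (\<lambda>a. \<phi> a * \<psi> b)" for b
      unfolding lin_on_def using VA.linear_add[OF \<phi>(1)] VA.linear_scale[OF \<phi>(1)]
      by (simp add: algebra_simps)
    show "lin_on B (*) (\<lambda>b. \<phi> a * \<psi> b)" for a
      unfolding lin_on_def using VB.linear_add[OF \<psi>(1)] VB.linear_scale[OF \<psi>(1)]
      by (simp add: algebra_simps)
  qed blast
  have "F (t a b) = 0" using assms T.lin_on_zero[OF F(1) vector_space_times] by simp
  then show False using F(2)[OF assms(1,2)] \<phi> \<psi> by simp
qed

lemma nprod_pure: "\<lbrakk>a \<in> vspace A; a' \<in> vspace A; b \<in> vspace B; b' \<in> vspace B\<rbrakk> \<Longrightarrow>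
    nprod T (t a b) n (t a' b') = Sum_any (\<lambda>j::int. t (nprod A a j a') (nprod B b (n - j - 1) b'))"
  using tensor by (simp add: va_tensor_def)

lemma nprod_pure_sum:
  assumes "a \<in> vspace A" "a' \<in> vspace A" "b \<in> vspace B" "b' \<in> vspace B" "finite S"
    "\<And>j. j \<notin> S \<Longrightarrow> nprod A a j a' = 0 \<or> nprod B b (n - j - 1) b' = 0"
  shows "nprod T (t a b) n (t a' b') = (\<Sum>j\<in>S. t (nprod A a j a') (nprod B b (n - j - 1) b'))"
  unfolding nprod_pure[OF assms(1-4)]
proof (rule Sum_any.expand_superset[OF assms(5)])
  show "{aa. t (nprod A a aa a') (nprod B b (n - aa - 1) b') \<noteq> 0} \<subseteq> S"
    using assms by fastforce
qed

lemma nprod_left: 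
  assumes "a \<in> vspace A" "a' \<in> vspace A" "b' \<in> vspace B"
  shows "nprod T (t a (vac B)) n (t a' b') = t (nprod A a n a') b'"
proof -
  have "nprod T (t a (vac B)) n (t a' b') = (\<Sum>j\<in>{n}. t (nprod A a j a') (nprod B (vac B) (n - j - 1) b'))"
    by (rule nprod_pure_sum) (use assms in \<open>auto simp: B.vac_left\<close>)
  then show ?thesis using assms by (simp add: B.vac_left)
qed

lemma nprod_right: 
  assumes "b \<in> vspace B" "a' \<in> vspace A" "b' \<in> vspace B"
  shows "nprod T (t (vac A) b) n (t a' b') = t a' (nprod B b n b')"
proof -
  have "nprod T (t (vac A) b) n (t a' b') = (\<Sum>j\<in>{-1}. t (nprod A (vac A) j a') (nprod B b (n - j - 1) b'))"
    by (rule nprod_pure_sum) (use assms in \<open>auto simp: A.vac_left\<close>)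
  then show ?thesis using assms by (simp add: A.vac_left)
qed

text \<open>The operator is \<open>DA \<otimes> 1 + 1 \<otimes> DB\<close>. In the summand with
  modes \<open>j\<close> and \<open>n - j - 1\<close> the two shifts \<open>-(j + 1)\<close> and
  \<open>-(n - j)\<close> add up to \<open>-(n + 1)\<close>, independently of
  \<open>j\<close>.\<close>

lemma grading_op_tensor:
  assumes DA: "A.grading_op DA" and DB: "B.grading_op DB"
  obtains D where "T.grading_op D"
    "\<And>a b. a \<in> vspace A \<Longrightarrow> b \<in> vspace B \<Longrightarrow> D (t a b) = t (DA a) b + t a (DB b)"
proof -
  have DA': "lin_on A (smul A) DA" "\<And>a. a \<in> vspace A \<Longrightarrow> DA a \<in> vspace A"
    and DB': "lin_on B (smul B) DB" "\<And>a. a \<in> vspace B \<Longrightarrow> DB a \<in> vspace B"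
    using DA DB by (auto simp: A.grading_op_def B.grading_op_def)
  have lA: "DA (x + y) = DA x + DA y" "DA (smul A r x) = smul A r (DA x)"
    if "x \<in> vspace A" "y \<in> vspace A" for x y r
    using that DA'(1) by (auto simp: lin_on_def)
  have lB: "DB (x + y) = DB x + DB y" "DB (smul B r x) = smul B r (DB x)"
    if "x \<in> vspace B" "y \<in> vspace B" for x y r
    using that DB'(1) by (auto simp: lin_on_def)
  obtain D where D: "lin_on T (smul T) D"
    "\<And>a b. a \<in> vspace A \<Longrightarrow> b \<in> vspace B \<Longrightarrow> D (t a b) = t (DA a) b + t a (DB b)"
  proof (rule bilinear_lift[OF T.ambient, of "\<lambda>a b. t (DA a) b + t a (DB b)"])
    show "lin_on A (smul T) (\<lambda>a. t (DA a) b + t a (DB b))" if "b \<in> vspace B" for b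
      unfolding lin_on_def using that DA'(2) DB'(2)
      by (auto simp: lA t_add_left t_smul_left T.vs.scale_right_distrib)
    show "lin_on B (smul T) (\<lambda>b. t (DA a) b + t a (DB b))" if "a \<in> vspace A" for a
      unfolding lin_on_def using that DA'(2) DB'(2)
      by (auto simp: lB t_add_right t_smul_right T.vs.scale_right_distrib)
  qed blast
  note DT = T.lin_onD(1,2)[OF D(1) T.ambient] T.lin_on_zero[OF D(1) T.ambient]
  have D_in: "D x \<in> vspace T" if "x \<in> vspace T" for x
    using that by (induction rule: tensor_induct) (auto simp: DT D DA'(2) DB'(2))
  let ?P = "\<lambda>x n y. D (nprod T x n y) = nprod T (D x) n y + nprod T x n (D y) - smul T (of_int (n + 1)) (nprod T x n y)"
  have pure: "?P (t a b) n (t a' b')"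
    if ab: "a \<in> vspace A" "a' \<in> vspace A" "b \<in> vspace B" "b' \<in> vspace B" for a a' b b' n
  proof -
    obtain N1 N2 N3 where N: "\<forall>n\<ge>N1. nprod A a n a' = 0" "\<forall>n\<ge>N2. nprod A (DA a) n a' = 0"
        "\<forall>n\<ge>N3. nprod A a n (DA a') = 0"
      using ab DA' A.nprod_truncation by meson
    obtain M1 M2 M3 where M: "\<forall>n\<ge>M1. nprod B b n b' = 0" "\<forall>n\<ge>M2. nprod B (DB b) n b' = 0"
        "\<forall>n\<ge>M3. nprod B b n (DB b') = 0"
      using ab DB' B.nprod_truncation by meson
    \<comment> \<open>One finite window for all five products, so that their sums over
      \<open>j\<close> can be compared term by term.\<close>
    define S where "S = {n - 1 - max M1 (max M2 M3) .. max N1 (max N2 N3)}"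
    have S: "finite S" by (simp add: S_def)
    have out: "j > max N1 (max N2 N3) \<or> n - j - 1 > max M1 (max M2 M3)" if "j \<notin> S" for j
      using that by (auto simp: S_def)
    have zero: "nprod A a j a' = 0 \<and> nprod A (DA a) j a' = 0 \<and> nprod A a j (DA a') = 0 \<or>
        nprod B b (n - j - 1) b' = 0 \<and> nprod B (DB b) (n - j - 1) b' = 0 \<and> nprod B b (n - j - 1) (DB b') = 0"
      if "j \<notin> S" for j
      using out[OF that] N M by (elim disjE) simp_all
    note sums = nprod_pure_sum[OF _ _ _ _ S]
    have s1: "nprod T (t a b) n (t a' b') = (\<Sum>j\<in>S. t (nprod A a j a') (nprod B b (n - j - 1) b'))"
      by (rule sums) (use ab zero in blast)+
    have s2: "nprod T (t (DA a) b) n (t a' b') = (\<Sum>j\<in>S. t (nprod A (DA a) j a') (nprod B b (n - j - 1) b'))"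
      by (rule sums) (use ab zero DA' in blast)+
    have s3: "nprod T (t a b) n (t (DA a') b') = (\<Sum>j\<in>S. t (nprod A a j (DA a')) (nprod B b (n - j - 1) b'))"
      by (rule sums) (use ab zero DA' in blast)+
    have s4: "nprod T (t a (DB b)) n (t a' b') = (\<Sum>j\<in>S. t (nprod A a j a') (nprod B (DB b) (n - j - 1) b'))"
      by (rule sums) (use ab zero DB' in blast)+
    have s5: "nprod T (t a b) n (t a' (DB b')) = (\<Sum>j\<in>S. t (nprod A a j a') (nprod B b (n - j - 1) (DB b')))"
      by (rule sums) (use ab zero DB' in blast)+
    have summand: "D (t (nprod A a j a') (nprod B b (n - j - 1) b')) =
        t (nprod A (DA a) j a') (nprod B b (n - j - 1) b') + t (nprod A a j (DA a')) (nprod B b (n - j - 1) b')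
        + t (nprod A a j a') (nprod B (DB b) (n - j - 1) b') + t (nprod A a j a') (nprod B b (n - j - 1) (DB b'))
        - smul T (of_int (n + 1)) (t (nprod A a j a') (nprod B b (n - j - 1) b'))" for j
      using ab DA'(2) DB'(2)
      by (simp add: D(2) A.grading_opD[OF DA] B.grading_opD[OF DB] t_add_left t_add_right t_diff_left
          t_diff_right t_smul_left t_smul_right T.vs.scale_left_distrib T.vs.scale_left_diff_distrib algebra_simps)
    have "D (nprod T (t a b) n (t a' b')) = (\<Sum>j\<in>S. D (t (nprod A a j a') (nprod B b (n - j - 1) b')))"
      unfolding s1 by (rule T.lin_on_sum[OF D(1) T.ambient]) (use ab in auto)
    also have "\<dots> = nprod T (t (DA a) b) n (t a' b') + nprod T (t a b) n (t (DA a') b')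
        + nprod T (t a (DB b)) n (t a' b') + nprod T (t a b) n (t a' (DB b'))
        - smul T (of_int (n + 1)) (nprod T (t a b) n (t a' b'))"
      unfolding summand sum.distrib sum_subtractf T.vs.scale_sum_right[symmetric] s1 s2 s3 s4 s5 ..
    also have "\<dots> = nprod T (D (t a b)) n (t a' b') + nprod T (t a b) n (D (t a' b'))
        - smul T (of_int (n + 1)) (nprod T (t a b) n (t a' b'))"
      using ab DA'(2) DB'(2) by (simp add: D(2) T.nprod_linear algebra_simps)
    finally show ?thesis .
  qed
  have right: "?P (t a b) n y" if "a \<in> vspace A" "b \<in> vspace B" "y \<in> vspace T" for a b n y
    using that(3)
  proof (induction rule: tensor_induct)
    case (add x y)
    show ?case using that add.hyps D_in by (simp add: add.IH DT T.nprod_linear T.vs.scale_right_distrib algebra_simps)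
  qed (use that pure D_in in \<open>auto simp: DT\<close>)
  have "?P x n y" if "x \<in> vspace T" "y \<in> vspace T" for x n y
    using that(1)
  proof (induction rule: tensor_induct)
    case (add x x')
    show ?case using that(2) add.hyps D_in by (simp add: add.IH DT T.nprod_linear T.vs.scale_right_distrib algebra_simps)
  qed (use that right D_in in \<open>auto simp: DT\<close>)
  then have "T.grading_op D" unfolding T.grading_op_def using D(1) D_in by blast
  then show ?thesis using that D(2) by blast
qed

end

section \<open>Ideals of graded vertex algebras\<close>

context vertex_algebra
begin

text \<open>The vector \<open>x(-1-j) vac\<close> is the \<open>j\<close>-th translate of
  \<open>x\<close> divided by \<open>j!\<close>.\<close>

lemma nprod_vac_closed:
  assumes I: "vs.subspace I" "I \<subseteq> vspace V" "\<And>x. x \<in> I \<Longrightarrow> transl V x \<in> I" and x: "x \<in> I"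
  shows "nprod V x (- 1 - int j) (vac V) \<in> I"
  using x
proof (induction j arbitrary: x)
  case 0
  then show ?case using I by (simp add: vac_right subset_iff)
next
  case (Suc j)
  have "x \<in> vspace V" using Suc I by blast
  then have "nprod V (transl V x) (- 1 - int j) (vac V)
      = smul V (of_nat (Suc j)) (nprod V x (- 1 - int (Suc j)) (vac V))"
    by (simp add: transl_modes add.commute)
  with vs.subspace_scale[OF I(1) Suc.IH[OF I(3)[OF Suc.prems]], of "1 / of_nat (Suc j)"]
  show ?case by (simp del: of_nat_Suc)
qed

text \<open>Skew symmetry expresses \<open>v(n) a\<close> through translates of products
  \<open>a(m) v\<close>, so a left ideal stable under translation is two-sided.\<close>

lemma va_idealI:
  assumes I: "vs.subspace I" "I \<subseteq> vspace V" "\<And>x. x \<in> I \<Longrightarrow> transl V x \<in> I"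
    and left: "\<And>a n x. a \<in> vspace V \<Longrightarrow> x \<in> I \<Longrightarrow> nprod V a n x \<in> I"
  shows "va_ideal V I"
proof -
  have "nprod V v n a \<in> I" if "a \<in> vspace V" "v \<in> I" for a v n
    unfolding skew_symmetry[OF that(1) subsetD[OF I(2) that(2)]]
    by (intro vs.subspace_scale Sum_any_in_subspace I nprod_vac_closed left that) 
  then show ?thesis unfolding va_ideal_def using I left by blast
qed

lemma va_ideal_vac:
  assumes "va_ideal V I" "vac V \<in> I" shows "I = vspace V"
proof
  show "vspace V \<subseteq> I"
  proof
    fix a assume a: "a \<in> vspace V"
    then have "nprod V a (-1) (vac V) \<in> I" using assms unfolding va_ideal_def by blast
    then show "a \<in> I" using a by (simp add: vac_right)
  qed
qed (use assms in \<open>simp add: va_ideal_def\<close>)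

text \<open>Downward induction on \<open>n\<close>, using the Borcherds identity with \<open>m\<close> so large that all \<open>a(m + j) c\<close>
  vanish.\<close>

lemma nprod_nprod_in_span:
  assumes a: "a \<in> vspace V" and b: "b \<in> vspace V" and c: "c \<in> vspace V"
  shows "nprod V a p (nprod V b n c) \<in> vs.span {nprod V x m c | x m. x \<in> vspace V}"
    (is "_ \<in> ?K")
proof -
  obtain N where N: "\<And>n. n \<ge> N \<Longrightarrow> nprod V b n c = 0" using nprod_truncation[OF b c] by blast
  obtain M where M: "\<And>n. n \<ge> M \<Longrightarrow> nprod V a n c = 0" using nprod_truncation[OF a c] by blast
  have "\<forall>p. nprod V a p (nprod V b n c) \<in> ?K" if "n \<ge> N - int r" for r n
    using that
  proof (induction r arbitrary: n)
    case 0
    then show ?case using N a by (simp add: vs.span_zero)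
  next
    case (Suc r)
    show ?case
    proof
      fix p
      \<comment> \<open>With this \<open>q\<close> and \<open>m = M\<close> the term
        \<open>j = 0\<close> on the right is exactly \<open>a(p) b(n) c\<close>; the other surviving
        terms contain \<open>b(n + j)\<close> with \<open>j \<ge> 1\<close> and are covered by the
        induction.\<close>
      let ?q = "p - M"
      let ?f = "\<lambda>j::nat. smul V ((- 1) ^ j * (of_int ?q gchoose j)) (nprod V a (p - int j) (nprod V b (n + int j) c))"
      have zero: "nprod V a (M + int j) c = 0" for j using M by simp
      have "Sum_any (\<lambda>j::nat. smul V (of_int M gchoose j)
             (nprod V (nprod V a (?q + int j) b) (M + n - int j) c)) = Sum_any ?f"
        using borcherds[OF a b c, of M ?q n] b by (simp add: zero)
      moreover have "Sum_any (\<lambda>j::nat. smul V (of_int M gchoose j)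
             (nprod V (nprod V a (?q + int j) b) (M + n - int j) c)) \<in> ?K"
      proof (rule Sum_any_in_subspace[OF vs.subspace_span])
        fix j
        have "nprod V (nprod V a (?q + int j) b) (M + n - int j) c \<in> ?K"
          by (rule vs.span_base) (use a b in \<open>blast intro: nprod_in\<close>)
        then show "smul V (of_int M gchoose j) (nprod V (nprod V a (?q + int j) b) (M + n - int j) c) \<in> ?K"
          by (rule vs.span_scale)
      qed
      moreover have "Sum_any ?f = (\<Sum>j<Suc (nat (N - n)). ?f j)"
        by (rule Sum_any_lessThan) (use N a in auto)
      moreover have "(\<Sum>j<Suc (nat (N - n)). ?f j) = ?f 0 + (\<Sum>j<nat (N - n). ?f (Suc j))"
        by (rule sum.lessThan_Suc_shift)
      ultimately have "?f 0 + (\<Sum>j<nat (N - n). ?f (Suc j)) \<in> ?K" by simp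
      moreover have "(\<Sum>j<nat (N - n). ?f (Suc j)) \<in> ?K"
        by (intro vs.span_sum vs.span_scale Suc.IH[rule_format]) (use Suc.prems in auto)
      ultimately have "?f 0 \<in> ?K" using vs.span_add_eq2 by blast
      then show "nprod V a p (nprod V b n c) \<in> ?K" by simp
    qed
  qed
  from this[of "nat (N - n)" n] show ?thesis by simp
qed

lemma span_UN_decomp:
  assumes "\<And>N. vs.subspace (A N)" "v \<in> vs.span (\<Union>N\<in>S. A N)"
  shows "\<exists>F f. finite F \<and> F \<subseteq> S \<and> (\<forall>N\<in>F. f N \<in> A N) \<and> v = (\<Sum>N\<in>F. f N)"
  using assms(2)
proof (induction rule: vs.span_induct_alt)
  case base
  show ?case by (intro exI[of _ "{}"]) auto
next
  case (step c x y)
  from step(1) obtain N0 where N0: "N0 \<in> S" "x \<in> A N0" by blast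
  from step(2) obtain F f where F: "finite F" "F \<subseteq> S" "\<And>N. N \<in> F \<Longrightarrow> f N \<in> A N" "y = (\<Sum>N\<in>F. f N)"
    by blast
  define f0 where "f0 N = (if N \<in> F then f N else 0)" for N
  define f' where "f' = f0(N0 := smul V c x + f0 N0)"
  have f0: "f0 N \<in> A N" for N using F(3) by (auto simp: f0_def vs.subspace_0[OF assms(1)])
  have "f' N \<in> A N" for N
    using N0 f0 by (auto simp: f'_def intro: vs.subspace_add[OF assms(1)] vs.subspace_scale[OF assms(1)])
  moreover have "smul V c x + y = (\<Sum>N\<in>insert N0 F. f' N)"
  proof -
    have "y = (\<Sum>N\<in>insert N0 F. f0 N)"
      unfolding F(4) by (rule sum.mono_neutral_cong_left) (use F(1) in \<open>auto simp: f0_def\<close>)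
    also have "\<dots> = f0 N0 + (\<Sum>N\<in>F - {N0}. f0 N)" using F(1) by (simp add: sum.insert_remove)
    also have "smul V c x + \<dots> = (\<Sum>N\<in>insert N0 F. f' N)"
      using F(1) by (simp add: sum.insert_remove f'_def add.assoc)
    finally show ?thesis .
  qed
  ultimately show ?case using F N0 by (intro exI[of _ "insert N0 F"] exI[of _ f']) auto
qed

lemmas wspace_decomp = span_UN_decomp[OF subspace_wspace]

end

section \<open>The weight filtration and the largest ideal inside the positive part\<close>

context reorderable
begin

definition positive_part :: "'v set" where
  "positive_part = vs.span (\<Union>N\<in>{1..}. wspace G N)"

text \<open>An increasing filtration: a nonzero subspace that is not graded still meets a smallest
  member of it nontrivially.\<close>

definition lower_part :: "int \<Rightarrow> 'v set" where
  "lower_part B = vs.span (\<Union>N\<in>{..B}. wspace G N)"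

lemma generator_in_wspace: "(a, p) \<in> G \<Longrightarrow> a \<in> wspace G (int p)"
  using act_in_wspace[of G "[((a, p), -1)]" "int p"] G_fst_in by (simp add: vac_right)

lemma vspace_decomp: "vspace V = vs.span (\<Union>N. wspace G N)"
proof
  have "{act ws (vac V) | ws. letters G ws} \<subseteq> (\<Union>N. wspace G N)"
    using act_in_wspace by blast
  then show "vspace V \<subseteq> vs.span (\<Union>N. wspace G N)"
    using G_gen vs.span_mono by blast
  show "vs.span (\<Union>N. wspace G N) \<subseteq> vspace V"
    by (rule span_subset_vspace) (use wspace_in[OF G_in] in blast)
qed

lemma vspace_induct [consumes 1, case_names wspace add]:
  assumes "v \<in> vspace V" "\<And>N v. v \<in> wspace G N \<Longrightarrow> P v"
    "\<And>u v. u \<in> vspace V \<Longrightarrow> v \<in> vspace V \<Longrightarrow> P u \<Longrightarrow> P v \<Longrightarrow> P (u + v)"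
  shows "P v"
proof -
  from assms(1) have "v \<in> vspace V \<and> P v"
    unfolding vspace_decomp
  proof (induction rule: vs.span_induct_alt)
    case base
    show ?case using assms(2)[of 0 0] vs.subspace_0[OF subspace_wspace] by (simp add: vs.span_zero)
  next
    case (step c x y)
    then obtain N where "smul V c x \<in> wspace G N" using vs.subspace_scale[OF subspace_wspace] by blast
    then show ?case using assms(2,3)[of "smul V c x"] step(2) wspace_in[OF G_in]
      unfolding vspace_decomp by (meson vs.span_add)
  qed
  then show ?thesis by simp
qed

lemma wspace_positive: "N \<noteq> 0 \<Longrightarrow> wspace G N \<subseteq> positive_part"
proof -
  assume N: "N \<noteq> 0"
  show ?thesis
  proof (cases "N < 0")
    case True
    then show ?thesis using wspace_neg by (auto simp: positive_part_def vs.span_zero)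
  next
    case False
    then have "wspace G N \<subseteq> (\<Union>N\<in>{1..}. wspace G N)" using N by force
    then show ?thesis unfolding positive_part_def using vs.span_superset by blast
  qed
qed

lemma wspace_lower: "N \<le> B \<Longrightarrow> wspace G N \<subseteq> lower_part B"
  unfolding lower_part_def using vs.span_superset[of "\<Union>N\<in>{..B}. wspace G N"] by blast

lemma lower_part_neg: "B < 0 \<Longrightarrow> lower_part B = {0}"
proof -
  assume "B < 0"
  then have "(\<Union>N\<in>{..B}. wspace G N) \<subseteq> {0}" using wspace_neg by auto
  then have "lower_part B \<subseteq> {0}" unfolding lower_part_def by (rule vs.span_minimal) (rule vs.subspace_single_0)
  then show ?thesis using vs.span_zero by (auto simp: lower_part_def)
qed

lemma nprod_lower_part:
  assumes "x \<in> wspace G M" "v \<in> lower_part B"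
  shows "nprod V x n v \<in> lower_part (M + B - n - 1)"
proof -
  have x: "x \<in> vspace V" using wspace_in[OF G_in assms(1)] .
  have "v \<in> {v \<in> vspace V. nprod V x n v \<in> lower_part (M + B - n - 1)}"
  proof (rule subsetD[OF vs.span_minimal assms(2)[unfolded lower_part_def]])
    show "(\<Union>N\<in>{..B}. wspace G N) \<subseteq> {v \<in> vspace V. nprod V x n v \<in> lower_part (M + B - n - 1)}"
    proof clarify
      fix N v assume "N \<le> B" "v \<in> wspace G N"
      then show "v \<in> vspace V \<and> nprod V x n v \<in> lower_part (M + B - n - 1)"
        using wspace_nprod[OF G_in assms(1), of v N n] wspace_lower[of "M + N - n - 1" "M + B - n - 1"]
          wspace_in[OF G_in] by auto
    qed
    show "vs.subspace {v \<in> vspace V. nprod V x n v \<in> lower_part (M + B - n - 1)}"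
      by (rule subspace_preimage_right) (auto simp: x lower_part_def)
  qed
  then show ?thesis by simp
qed

text \<open>The mode \<open>j\<close> of a generator of weight \<open>p\<close> shifts weights by
  \<open>p - j - 1\<close>, so the modes listed are precisely those that strictly lower the weight.
  The mode \<open>p - 1\<close>, for a current its zero mode, is left free.\<close>

definition lowered :: "'v \<Rightarrow> bool" where
  "lowered u \<longleftrightarrow> (\<forall>(x, p)\<in>G. \<forall>j\<ge>int p. nprod V x j u = 0)"

text \<open>Take the vectors of the subspace that are lowest in the weight filtration.\<close>

lemma lowered_exists:
  assumes I: "I \<subseteq> vspace V" "I \<noteq> {}" "I \<noteq> {0}"
    and closed: "\<And>x p j v. (x, p) \<in> G \<Longrightarrow> v \<in> I \<Longrightarrow> nprod V x j v \<in> I"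
  obtains B v where "v \<in> I \<inter> lower_part B" "v \<noteq> 0" "\<And>v. v \<in> I \<inter> lower_part B \<Longrightarrow> lowered v"
proof -
  obtain v0 where v0: "v0 \<in> I" "v0 \<noteq> 0" using I by auto
  have "v0 \<in> vs.span (\<Union>N\<in>UNIV. wspace G N)" using v0(1) I(1) vspace_decomp by auto
  from wspace_decomp[OF this] obtain F f where
    F: "finite F" "\<And>N. N \<in> F \<Longrightarrow> f N \<in> wspace G N" "v0 = (\<Sum>N\<in>F. f N)" by blast
  define C where "C = Max (insert 0 F)"
  have "v0 \<in> lower_part C"
    unfolding F(3)
  proof (rule vs.subspace_sum)
    show "vs.subspace (lower_part C)" by (simp add: lower_part_def)
    show "f N \<in> lower_part C" if "N \<in> F" for N
      using F(2)[OF that] wspace_lower[of N C] F(1) that by (auto simp: C_def)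
  qed
  moreover have "C \<ge> 0" using F(1) by (simp add: C_def)
  ultimately have ex: "\<exists>v\<in>I \<inter> lower_part (int (nat C)). v \<noteq> 0" using v0 by auto
  \<comment> \<open>A minimum over natural numbers suffices because \<open>lower_part\<close> is
    zero at negative bounds.\<close>
  define b where "b = (LEAST b. \<exists>v\<in>I \<inter> lower_part (int b). v \<noteq> 0)"
  have b: "\<exists>v\<in>I \<inter> lower_part (int b). v \<noteq> 0" unfolding b_def by (rule LeastI[of _ "nat C"]) (rule ex)
  have min: "v = 0" if "v \<in> I \<inter> lower_part B" "B < int b" for v B
  proof (cases "B < 0")
    case True
    then show ?thesis using that lower_part_neg by auto
  next
    case False
    then have "v \<in> I \<inter> lower_part (int (nat B))" "nat B < b" using that by auto
    then show ?thesis unfolding b_def using not_less_Least by blast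
  qed
  obtain v where v: "v \<in> I \<inter> lower_part (int b)" "v \<noteq> 0" using b by blast
  show ?thesis
  proof (rule that[OF v])
    fix u assume u: "u \<in> I \<inter> lower_part (int b)"
    show "lowered u" unfolding lowered_def
    proof (clarify)
      fix x p j assume x: "(x, p) \<in> G" and j: "int p \<le> j"
      have "nprod V x j u \<in> I \<inter> lower_part (int p + int b - j - 1)"
        using nprod_lower_part[OF generator_in_wspace[OF x]] closed[OF x] u by blast
      then show "nprod V x j u = 0" by (rule min) (use j in simp)
    qed
  qed
qed

text \<open>Extends \<open>lowered\<close> from generators to all homogeneous \<open>y\<close>, by
  induction on the weight. For \<open>y = x(q) b\<close> the iterate formula produces
  \<open>b(m + j) u\<close>, zero by induction, and \<open>b(m + q - j) x(j) u\<close>. If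
  \<open>j \<ge> p\<close> the inner factor is zero. Otherwise \<open>b\<close> is commuted past
  \<open>x(j)\<close>; the commutator consists of modes of \<open>b(i) x\<close>, whose weight is
  below that of \<open>y\<close> because \<open>q < 0\<close>.\<close>

lemma lowered_nprod:
  assumes u: "u \<in> vspace V" "lowered u" and y: "y \<in> wspace G N" and m: "m \<ge> N"
  shows "nprod V y m u = 0"
  using y m
proof (induction "nat N" arbitrary: N y m rule: less_induct)
  case less
  have word: "nprod V (act ws (vac V)) m u = 0"
    if ws: "letters G ws" "\<forall>(g, n)\<in>set ws. n < 0" "wdeg ws = N" for ws
  proof (cases ws)
    case Nil
    then show ?thesis using that less.prems u by (simp add: vac_left)
  next
    case (Cons l us)
    obtain x p q where l: "l = ((x, p), q)" by (metis surj_pair)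
    define b where "b = act us (vac V)"
    have xp: "(x, p) \<in> G" "x \<in> vspace V" and us: "letters G us" "\<forall>(g, n)\<in>set us. n < 0" and q: "q < 0"
      using ws Cons l G_fst_in by auto
    have p: "p \<ge> 1" using G_pos xp by blast
    have b: "b \<in> wspace G (wdeg us)" "b \<in> vspace V"
      using act_in_wspace[OF us(1)] wspace_in[OF G_in] by (auto simp: b_def)
    have us0: "wdeg us \<ge> 0" using wdeg_nonneg[OF us] by simp
    have N: "N = int p - q - 1 + wdeg us" using ws Cons l by simp
    have IHb: "nprod V b r u = 0" if "r \<ge> wdeg us" for r
      by (rule less.hyps[OF _ b(1) that]) (use N p q us0 in linarith)
    have second: "nprod V b (m + q - int j) (nprod V x (int j) u) = 0" for j
    proof (cases "j \<ge> p")
      case True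
      then show ?thesis using u xp b by (force simp: lowered_def)
    next
      case False
      have "nprod V b (m + q - int j) (nprod V x (int j) u) - nprod V x (int j) (nprod V b (m + q - int j) u) = 0"
        unfolding commutator[OF b(2) xp(2) u(1)]
      proof (rule Sum_any_zero)
        fix i :: nat
        have "nprod V (nprod V b (int i) x) (m + q - int i) u = 0"
        proof (rule less.hyps[OF _ wspace_nprod[OF G_in b(1) generator_in_wspace[OF xp(1)]]])
          show "nat (wdeg us + int p - int i - 1) < nat N" using N p q us0 by linarith
          show "wdeg us + int p - int i - 1 \<le> m + q - int i" using N less.prems(2) by linarith
        qed
        then show "smul V (of_int (m + q - int j) gchoose i)
            (nprod V (nprod V b (int i) x) (m + q - int j + int j - int i) u) = 0" by simp
      qed
      moreover have "nprod V b (m + q - int j) u = 0"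
        by (rule IHb) (use N False less.prems(2) in linarith)
      ultimately show ?thesis using xp by simp
    qed
    have first: "nprod V b (m + int j) u = 0" for j
      by (rule IHb) (use N p q less.prems(2) in linarith)
    show ?thesis
      unfolding Cons l act_simps b_def[symmetric] iterate[OF xp(2) b(2) u(1)]
      by (rule Sum_any_zero) (simp add: first second xp)
  qed
  have "y \<in> {y \<in> vspace V. nprod V y m u \<in> {0}}"
  proof (rule subsetD[OF vs.span_minimal subsetD[OF wspace_neg_words less.prems(1)]])
    show "{act ws (vac V) |ws. letters G ws \<and> (\<forall>(g, n)\<in>set ws. n < 0) \<and> wdeg ws = N}
        \<subseteq> {y \<in> vspace V. nprod V y m u \<in> {0}}"
      using word act_in[OF _ G_in] by auto
    show "vs.subspace {y \<in> vspace V. nprod V y m u \<in> {0}}"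
      by (rule subspace_preimage_left[OF vs.subspace_single_0 u(1)])
  qed
  then show ?case by simp
qed

text \<open>The largest ideal contained in \<open>positive_part\<close>. Testing with one mode at a
  time is enough, since by \<open>nprod_nprod_in_span\<close> iterated modes are combinations of
  single ones.\<close>

definition maximal_ideal :: "'v set" where
  "maximal_ideal = {v \<in> vspace V. \<forall>a\<in>vspace V. \<forall>m. nprod V a m v \<in> positive_part}"

lemma transl_positive: "v \<in> positive_part \<Longrightarrow> transl V v \<in> positive_part"
proof -
  assume v: "v \<in> positive_part"
  have "v \<in> {v \<in> vspace V. nprod V v (-2) (vac V) \<in> positive_part}"
  proof (rule subsetD[OF vs.span_minimal v[unfolded positive_part_def]])
    show "(\<Union>N\<in>{1..}. wspace G N) \<subseteq> {v \<in> vspace V. nprod V v (-2) (vac V) \<in> positive_part}"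
    proof clarify
      fix N v assume "N \<ge> (1::int)" "v \<in> wspace G N"
      then show "v \<in> vspace V \<and> nprod V v (-2) (vac V) \<in> positive_part"
        using wspace_nprod[OF G_in _ vac_in_wspace, of v N "-2"] wspace_positive[of "1 + N"]
          wspace_in[OF G_in] by (auto simp: add.commute)
    qed
    show "vs.subspace {v \<in> vspace V. nprod V v (-2) (vac V) \<in> positive_part}"
      by (rule subspace_preimage_left) (auto simp: positive_part_def)
  qed
  then show ?thesis by (simp add: transl_def)
qed

lemma subspace_positive_part [simp, intro]: "vs.subspace positive_part"
  by (simp add: positive_part_def)

lemma subspace_maximal_ideal: "vs.subspace maximal_ideal"
  unfolding vs.subspace_def maximal_ideal_def
  by (auto simp: nprod_linear vs.subspace_0 intro: vs.subspace_add vs.subspace_scale)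

lemma va_ideal_maximal: "va_ideal V maximal_ideal"
proof (rule va_idealI[OF subspace_maximal_ideal])
  show "maximal_ideal \<subseteq> vspace V" by (auto simp: maximal_ideal_def)
  show "transl V x \<in> maximal_ideal" if x: "x \<in> maximal_ideal" for x
    unfolding maximal_ideal_def
  proof (intro CollectI conjI ballI allI)
    have xV: "x \<in> vspace V" using x by (simp add: maximal_ideal_def)
    then show "transl V x \<in> vspace V" by simp
    fix a m assume a: "a \<in> vspace V"
    have "nprod V a m (transl V x) = transl V (nprod V a m x) - nprod V (transl V a) m x"
      using transl_nprod[OF a xV, of m] by simp
    also have "\<dots> \<in> positive_part"
      using x a transl_positive by (intro vs.subspace_diff) (auto simp: maximal_ideal_def)
    finally show "nprod V a m (transl V x) \<in> positive_part" .
  qed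
  show "nprod V a n x \<in> maximal_ideal" if a: "a \<in> vspace V" and x: "x \<in> maximal_ideal" for a n x
    unfolding maximal_ideal_def
  proof (intro CollectI conjI ballI allI)
    have xV: "x \<in> vspace V" using x by (simp add: maximal_ideal_def)
    then show "nprod V a n x \<in> vspace V" using a by simp
    fix b m assume b: "b \<in> vspace V"
    have "vs.span {nprod V y m x |y m. y \<in> vspace V} \<subseteq> positive_part"
      by (rule vs.span_minimal) (use x in \<open>auto simp: maximal_ideal_def\<close>)
    then show "nprod V b m (nprod V a n x) \<in> positive_part"
      using nprod_nprod_in_span[OF b a xV] by blast
  qed
qed

text \<open>A mode \<open>a(m)\<close> of a vector of weight \<open>M\<close> kills \<open>u\<close>
  if \<open>m \<ge> M\<close>; otherwise it does not lower the weight, which therefore stays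
  positive.\<close>

lemma lowered_in_maximal_ideal:
  assumes "u \<in> wspace G n" "n \<ge> 1" "lowered u"
  shows "u \<in> maximal_ideal"
  unfolding maximal_ideal_def
proof (intro CollectI conjI ballI allI)
  show u: "u \<in> vspace V" using wspace_in[OF G_in assms(1)] .
  fix a m assume "a \<in> vspace V"
  then show "nprod V a m u \<in> positive_part"
  proof (induction rule: vspace_induct)
    case (wspace M a)
    show ?case
    proof (cases "m \<ge> M")
      case True
      then show ?thesis using lowered_nprod[OF u assms(3) wspace] by (simp add: vs.subspace_0)
    next
      case False
      then show ?thesis
        using wspace_nprod[OF G_in wspace assms(1), of m] wspace_positive[of "M + n - m - 1"] assms(2) by auto
    qed
  next
    case (add a b)
    then show ?case using u by (simp add: nprod_linear vs.subspace_add)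
  qed
qed

text \<open>A given mode of a homogeneous vector can send at most one of the components to weight 0.
  All others land in \<open>positive_part\<close> anyway, so the condition on the sum becomes a
  condition on that component. Spanning by weight spaces is enough for this argument.\<close>

lemma maximal_ideal_component:
  assumes v: "(\<Sum>N\<in>F. f N) \<in> maximal_ideal" and F: "finite F" "\<And>N. N \<in> F \<Longrightarrow> f N \<in> wspace G N"
    and N: "N \<in> F"
  shows "f N \<in> maximal_ideal"
  unfolding maximal_ideal_def
proof (intro CollectI conjI ballI allI)
  have fV: "f N \<in> vspace V" if "N \<in> F" for N using F(2)[OF that] wspace_in[OF G_in] by blast
  then show fN: "f N \<in> vspace V" using N by blast
  fix a m assume "a \<in> vspace V"
  then show "nprod V a m (f N) \<in> positive_part"
  proof (induction rule: vspace_induct)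
    case (wspace M a)
    have a: "a \<in> vspace V" using wspace_in[OF G_in wspace] .
    show ?case
    proof (cases "M + N - m - 1 = 0")
      case True
      have "nprod V a m (\<Sum>N\<in>F. f N) - (\<Sum>N'\<in>F - {N}. nprod V a m (f N')) \<in> positive_part"
      proof (intro vs.subspace_diff vs.subspace_sum subspace_positive_part)
        show "nprod V a m (\<Sum>N\<in>F. f N) \<in> positive_part" using v a by (simp add: maximal_ideal_def)
        fix N' assume N': "N' \<in> F - {N}"
        show "nprod V a m (f N') \<in> positive_part"
          using wspace_nprod[OF G_in wspace F(2), of N' m] wspace_positive[of "M + N' - m - 1"] N' True by auto
      qed
      moreover have "nprod V a m (\<Sum>N\<in>F. f N) = nprod V a m (f N) + (\<Sum>N'\<in>F - {N}. nprod V a m (f N'))"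
        using nprod_sum_right[of F f a m] fV a F(1) N by (simp add: sum.remove)
      ultimately show ?thesis by simp
    next
      case False
      then show ?thesis using wspace_nprod[OF G_in wspace F(2)[OF N], of m] wspace_positive by blast
    qed
  next
    case (add a b)
    then show ?case using fN by (simp add: nprod_linear vs.subspace_add)
  qed
qed

text \<open>Weight spaces are spans of words and might overlap; an operator acting on each by its
  weight certifies that they do not.\<close>

definition graded_by :: "('v \<Rightarrow> 'v) \<Rightarrow> bool" where
  "graded_by D \<longleftrightarrow> lin_on V (smul V) D \<and> (\<forall>N. \<forall>v\<in>wspace G N. D v = smul V (of_int N) v)"

lemma graded_by_independent:
  assumes D: "graded_by D" and F: "finite F" "\<And>N. N \<in> F \<Longrightarrow> f N \<in> wspace G N" "(\<Sum>N\<in>F. f N) = 0"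
    and N: "N \<in> F"
  shows "f N = 0"
proof -
  have D': "lin_on V (smul V) D" using D by (simp add: graded_by_def)
  have "f N \<in> {0}"
  proof (rule eigencomponents[OF D' _ _ _ F(1) _ _ _ N, where c = of_int])
    show "D x \<in> {0}" if "x \<in> {0}" for x using that lin_on_zero[OF D' ambient] by simp
    show "f i \<in> vspace V \<and> D (f i) = smul V (of_int i) (f i)" if "i \<in> F" for i
      using D F(2)[OF that] wspace_in[OF G_in] by (auto simp: graded_by_def)
  qed (use F(3) in \<open>auto simp: inj_on_def\<close>)
  then show ?thesis by simp
qed

text \<open>An expression of the vacuum by vectors of positive weight, completed by
  \<open>- vac V\<close> in degree 0, would be a linear relation between independent weight
  spaces.\<close>

lemma vac_not_positive:
  assumes D: "graded_by D" and vac: "vac V \<noteq> 0"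
  shows "vac V \<notin> positive_part"
proof
  assume "vac V \<in> positive_part"
  from wspace_decomp[OF this[unfolded positive_part_def]] obtain F f where
    F: "finite F" "F \<subseteq> {1..}" "\<And>N. N \<in> F \<Longrightarrow> f N \<in> wspace G N" "vac V = (\<Sum>N\<in>F. f N)" by blast
  have 0: "0 \<notin> F" using F(2) by auto
  have "- vac V \<in> wspace G 0" by (rule vs.subspace_neg) (auto simp: vac_in_wspace)
  moreover have "(\<Sum>N\<in>F. (f(0 := - vac V)) N) = (\<Sum>N\<in>F. f N)"
    by (rule sum.cong) (use 0 in auto)
  ultimately have "(f(0 := - vac V)) 0 = 0"
    by (intro graded_by_independent[OF D, of "insert 0 F" "f(0 := - vac V)" 0])
      (use F 0 in \<open>auto simp del: fun_upd_apply simp: fun_upd_same fun_upd_other\<close>)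
  then show False using vac by simp
qed

end

section \<open>Images and simple graded quotients\<close>

locale va_epi = V: vertex_algebra V + Q: vertex_algebra Q
  for V :: "'v::ab_group_add vert_alg" and Q :: "'q::ab_group_add vert_alg" +
  fixes \<pi> :: "'v \<Rightarrow> 'q"
  assumes hom: "va_hom V Q \<pi>" and onto: "\<pi> ` vspace V = vspace Q"
begin

lemma hom_in [simp]: "a \<in> vspace V \<Longrightarrow> \<pi> a \<in> vspace Q"
  and hom_add: "a \<in> vspace V \<Longrightarrow> b \<in> vspace V \<Longrightarrow> \<pi> (a + b) = \<pi> a + \<pi> b"
  and hom_smul: "a \<in> vspace V \<Longrightarrow> \<pi> (smul V r a) = smul Q r (\<pi> a)"
  and hom_vac: "\<pi> (vac V) = vac Q"
  and hom_nprod: "a \<in> vspace V \<Longrightarrow> b \<in> vspace V \<Longrightarrow> \<pi> (nprod V a n b) = nprod Q (\<pi> a) n (\<pi> b)"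
  using hom by (simp_all add: va_hom_def)

lemma lin_on_hom: "lin_on V (smul Q) \<pi>"
  by (simp add: lin_on_def hom_add hom_smul)

lemma hom_zero [simp]: "\<pi> 0 = 0"
  using V.lin_on_zero[OF lin_on_hom Q.ambient] .
lemma hom_diff: "a \<in> vspace V \<Longrightarrow> b \<in> vspace V \<Longrightarrow> \<pi> (a - b) = \<pi> a - \<pi> b"
  using V.lin_onD(5)[OF lin_on_hom Q.ambient] .
lemma hom_sum: "(\<And>i. i \<in> I \<Longrightarrow> f i \<in> vspace V) \<Longrightarrow> \<pi> (sum f I) = (\<Sum>i\<in>I. \<pi> (f i))"
  using V.lin_on_sum[OF lin_on_hom Q.ambient] .
lemma hom_transl: "a \<in> vspace V \<Longrightarrow> \<pi> (transl V a) = transl Q (\<pi> a)"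
  by (simp add: transl_def hom_nprod hom_vac)

lemma obtain_preimage:
  assumes "y \<in> vspace Q" obtains x where "x \<in> vspace V" "y = \<pi> x"
  using assms onto by blast

lemma hom_span:
  assumes "X \<subseteq> vspace V" shows "\<pi> ` V.vs.span X = Q.vs.span (\<pi> ` X)"
proof
  have sub: "V.vs.span X \<subseteq> vspace V" by (rule V.span_subset_vspace[OF assms])
  show "\<pi> ` V.vs.span X \<subseteq> Q.vs.span (\<pi> ` X)"
  proof clarify
    fix v assume "v \<in> V.vs.span X"
    then have "v \<in> vspace V \<and> \<pi> v \<in> Q.vs.span (\<pi> ` X)"
    proof (induction rule: V.vs.span_induct_alt)
      case base
      show ?case by (simp add: Q.vs.span_zero)
    next
      case (step c x y)
      then have "x \<in> vspace V" using assms by blast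
      then show ?case using step Q.vs.span_base[of "\<pi> x" "\<pi> ` X"]
        by (simp add: hom_add hom_smul Q.vs.span_add Q.vs.span_scale)
    qed
    then show "\<pi> v \<in> Q.vs.span (\<pi> ` X)" by simp
  qed
  show "Q.vs.span (\<pi> ` X) \<subseteq> \<pi> ` V.vs.span X"
  proof
    fix y assume "y \<in> Q.vs.span (\<pi> ` X)"
    then show "y \<in> \<pi> ` V.vs.span X"
    proof (induction rule: Q.vs.span_induct_alt)
      case base
      show ?case by (intro image_eqI[of _ _ 0]) (auto simp: V.vs.span_zero)
    next
      case (step c x y)
      then obtain x' y' where "x' \<in> X" "x = \<pi> x'" "y' \<in> V.vs.span X" "y = \<pi> y'" by blast
      then show ?case using sub assms
        by (intro image_eqI[of _ _ "smul V c x' + y'"])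
          (auto simp: hom_add hom_smul subset_iff V.vs.span_base V.vs.span_add V.vs.span_scale)
    qed
  qed
qed

definition hom_gens :: "('v \<times> nat) set \<Rightarrow> ('q \<times> nat) set" where
  "hom_gens G = (\<lambda>(a, p). (\<pi> a, p)) ` G"

lemma hom_act:
  assumes G: "fst ` G \<subseteq> vspace V" and ws: "V.letters G ws"
  shows "\<exists>ws'. Q.letters (hom_gens G) ws' \<and> Q.gwt ws' = V.gwt ws \<and> Q.wdeg ws' = V.wdeg ws \<and>
     \<pi> (V.act ws (vac V)) = Q.act ws' (vac Q)"
  using ws
proof (induction ws)
  case Nil
  show ?case by (intro exI[of _ "[]"]) (simp add: hom_vac)
next
  case (Cons l ws)
  obtain a p n where l: "l = ((a, p), n)" by (metis surj_pair)
  have a: "(a, p) \<in> G" "a \<in> vspace V" and ws: "V.letters G ws"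
    using Cons.prems l G by (auto simp: image_subset_iff)
  obtain ws' where ws': "Q.letters (hom_gens G) ws'" "Q.gwt ws' = V.gwt ws" "Q.wdeg ws' = V.wdeg ws"
     "\<pi> (V.act ws (vac V)) = Q.act ws' (vac Q)" using Cons.IH[OF ws] by blast
  have "(\<pi> a, p) \<in> hom_gens G" using a by (force simp: hom_gens_def)
  then show ?case
    using ws' V.act_in[OF ws G] a
    by (intro exI[of _ "((\<pi> a, p), n) # ws'"]) (simp add: l hom_nprod)
qed

lemma hom_act_lift:
  assumes G: "fst ` G \<subseteq> vspace V" and ws: "Q.letters (hom_gens G) ws'"
  shows "\<exists>ws. V.letters G ws \<and> V.gwt ws = Q.gwt ws' \<and> V.wdeg ws = Q.wdeg ws' \<and>
     \<pi> (V.act ws (vac V)) = Q.act ws' (vac Q)"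
  using ws
proof (induction ws')
  case Nil
  show ?case by (intro exI[of _ "[]"]) (simp add: hom_vac)
next
  case (Cons l ws')
  obtain b p n where l: "l = ((b, p), n)" by (metis surj_pair)
  obtain a where a: "(a, p) \<in> G" "b = \<pi> a" "a \<in> vspace V" and ws': "Q.letters (hom_gens G) ws'"
    using Cons.prems l G by (auto simp: image_subset_iff hom_gens_def)
  obtain ws where ws: "V.letters G ws" "V.gwt ws = Q.gwt ws'" "V.wdeg ws = Q.wdeg ws'"
     "\<pi> (V.act ws (vac V)) = Q.act ws' (vac Q)" using Cons.IH[OF ws'] by blast
  then show ?case
    using V.act_in[OF ws(1) G] a
    by (intro exI[of _ "((a, p), n) # ws"]) (simp add: l hom_nprod)
qed

lemma hom_wspan:
  assumes G: "fst ` G \<subseteq> vspace V" shows "\<pi> ` V.wspan G s N = Q.wspan (hom_gens G) s N"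
proof -
  have "\<pi> ` {V.act ws (vac V) |ws. V.letters G ws \<and> V.gwt ws \<le> s \<and> V.wdeg ws = N}
    = {Q.act ws (vac Q) |ws. Q.letters (hom_gens G) ws \<and> Q.gwt ws \<le> s \<and> Q.wdeg ws = N}"
    (is "\<pi> ` ?X = ?Y")
  proof
    show "\<pi> ` ?X \<subseteq> ?Y" using hom_act[OF G] by force
    show "?Y \<subseteq> \<pi> ` ?X"
    proof clarify
      fix ws' assume ws': "Q.letters (hom_gens G) ws'" "Q.gwt ws' \<le> s" "N = Q.wdeg ws'"
      obtain ws where "V.letters G ws" "V.gwt ws = Q.gwt ws'" "V.wdeg ws = Q.wdeg ws'"
        "\<pi> (V.act ws (vac V)) = Q.act ws' (vac Q)" using hom_act_lift[OF G ws'(1)] by blast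
      then show "Q.act ws' (vac Q) \<in> \<pi> ` {V.act ws (vac V) |ws. V.letters G ws \<and> V.gwt ws \<le> s \<and> V.wdeg ws = Q.wdeg ws'}"
        using ws' by (intro image_eqI[of _ _ "V.act ws (vac V)"]) auto
    qed
  qed
  moreover have "?X \<subseteq> vspace V" using V.act_in[OF _ G V.vac_in] by blast
  ultimately show ?thesis unfolding V.wspan_def Q.wspan_def using hom_span by simp
qed

lemma hom_wspace:
  assumes G: "fst ` G \<subseteq> vspace V" shows "\<pi> ` V.wspace G N = Q.wspace (hom_gens G) N"
proof
  show "\<pi> ` V.wspace G N \<subseteq> Q.wspace (hom_gens G) N"
    using V.wspace_span_wspan hom_wspan[OF G] Q.wspan_subset_wspace by blast
  show "Q.wspace (hom_gens G) N \<subseteq> \<pi> ` V.wspace G N"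
    using Q.wspace_span_wspan hom_wspan[OF G] V.wspan_subset_wspace by blast
qed

lemma hom_gens_in: "fst ` G \<subseteq> vspace V \<Longrightarrow> fst ` hom_gens G \<subseteq> vspace Q"
  by (force simp: hom_gens_def)

text \<open>Generation and the products of generators are conditions of membership in spans of
  words, and these spans are mapped onto the corresponding spans in the image.\<close>

lemma reorderable_hom:
  assumes "reorderable V G" shows "reorderable Q (hom_gens G)"
proof -
  interpret VG: reorderable V G by (rule assms)
  have G: "fst ` G \<subseteq> vspace V" by (rule VG.G_in)
  show ?thesis
  proof
    show "fst ` hom_gens G \<subseteq> vspace Q" by (rule hom_gens_in[OF G])
    show "p \<ge> 1" if "(a, p) \<in> hom_gens G" for a p
      using that VG.G_pos by (auto simp: hom_gens_def)
    show "vspace Q \<subseteq> Q.vs.span {Q.act ws (vac Q) |ws. Q.letters (hom_gens G) ws}"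
    proof -
      have sub: "{V.act ws (vac V) |ws. V.letters G ws} \<subseteq> vspace V" using V.act_in[OF _ G V.vac_in] by blast
      have "vspace Q \<subseteq> \<pi> ` V.vs.span {V.act ws (vac V) |ws. V.letters G ws}"
        using onto VG.G_gen by blast
      also have "\<dots> = Q.vs.span (\<pi> ` {V.act ws (vac V) |ws. V.letters G ws})" by (rule hom_span[OF sub])
      also have "\<dots> \<subseteq> Q.vs.span {Q.act ws (vac Q) |ws. Q.letters (hom_gens G) ws}"
      proof (rule Q.vs.span_mono)
        show "\<pi> ` {V.act ws (vac V) |ws. V.letters G ws} \<subseteq> {Q.act ws (vac Q) |ws. Q.letters (hom_gens G) ws}"
          using hom_act[OF G] by blast
      qed
      finally show ?thesis .
    qed
    fix a' p b' q assume "(a', p) \<in> hom_gens G" "(b', q) \<in> hom_gens G"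
    then obtain a b where ab: "(a, p) \<in> G" "a' = \<pi> a" "(b, q) \<in> G" "b' = \<pi> b"
      by (auto simp: hom_gens_def)
    have *: "nprod Q (\<pi> a) (int n) (\<pi> b) \<in> Q.wspan (hom_gens G) s N"
      if "nprod V a (int n) b \<in> V.wspan G s N" "(a, p) \<in> G" "(b, q) \<in> G" for a b p q n s N
      using that hom_wspan[OF G, of s N] hom_nprod[OF VG.G_fst_in VG.G_fst_in, of a p b q "int n"]
      by (metis imageI)
    show "(\<forall>n::nat. nprod Q a' (int n) b' \<in> Q.wspan (hom_gens G) (p + q - 1) (int p + int q - int n - 1)) \<or>
      (\<forall>n::nat. nprod Q b' (int n) a' \<in> Q.wspan (hom_gens G) (p + q - 1) (int p + int q - int n - 1))"
      using VG.G_ope[OF ab(1,3)] *[OF _ ab(1,3)] *[OF _ ab(3,1)] unfolding ab(2,4) by blast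
  qed
qed

lemma ideal_vimage:
  assumes I: "va_ideal Q I" shows "va_ideal V {v \<in> vspace V. \<pi> v \<in> I}"
proof -
  have s: "Q.vs.subspace I" using I by (simp add: va_ideal_def)
  have "V.vs.subspace {v \<in> vspace V. \<pi> v \<in> I}"
    unfolding V.vs.subspace_def
    using s by (auto simp: hom_add hom_smul Q.vs.subspace_0 Q.vs.subspace_add Q.vs.subspace_scale)
  then show ?thesis using I unfolding va_ideal_def by (auto simp: hom_nprod)
qed

lemma ideal_image:
  assumes I: "va_ideal V I" shows "va_ideal Q (\<pi> ` I)"
proof -
  have sub: "I \<subseteq> vspace V" and s: "V.vs.subspace I" using I by (auto simp: va_ideal_def)
  have "\<pi> ` V.vs.span I = Q.vs.span (\<pi> ` I)" by (rule hom_span[OF sub])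
  then have "Q.vs.subspace (\<pi> ` I)" using s V.vs.span_eq_iff Q.vs.subspace_span by metis
  moreover have "nprod Q a n v \<in> \<pi> ` I \<and> nprod Q v n a \<in> \<pi> ` I" if a: "a \<in> vspace Q" and v: "v \<in> \<pi> ` I" for a v n
  proof -
    obtain v' where v': "v' \<in> I" "v = \<pi> v'" using v by blast
    obtain a' where "a' \<in> vspace V" "a = \<pi> a'" by (rule obtain_preimage[OF a])
    with v' show ?thesis using I sub hom_nprod[of a' v' n] hom_nprod[of v' a' n]
      unfolding va_ideal_def by (metis imageI subsetD)
  qed
  ultimately show ?thesis using sub unfolding va_ideal_def by auto
qed

lemma kernel_ideal: "va_ideal V (va_kernel V \<pi>)"
proof -
  have "va_ideal Q {0}" unfolding va_ideal_def by (auto simp: Q.vs.subspace_single_0)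
  from ideal_vimage[OF this] show ?thesis by (simp add: va_kernel_def)
qed

end

lemma vertex_algebra_va_image:
  assumes "vertex_algebra V" "vertex_algebra T" "va_hom V T \<Phi>"
  shows "vertex_algebra (va_image V T \<Phi>)"
proof -
  interpret V: vertex_algebra V by (rule assms)
  interpret T: vertex_algebra T by (rule assms)
  have h: "\<And>a. a \<in> vspace V \<Longrightarrow> \<Phi> a \<in> vspace T" "\<Phi> (vac V) = vac T"
    "\<And>a b. a \<in> vspace V \<Longrightarrow> b \<in> vspace V \<Longrightarrow> \<Phi> a + \<Phi> b = \<Phi> (a + b)"
    "\<And>a r. a \<in> vspace V \<Longrightarrow> smul T r (\<Phi> a) = \<Phi> (smul V r a)"
    "\<And>a b n. a \<in> vspace V \<Longrightarrow> b \<in> vspace V \<Longrightarrow> nprod T (\<Phi> a) n (\<Phi> b) = \<Phi> (nprod V a n b)"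
    using assms(3) by (auto simp: va_hom_def)
  have sub: "\<Phi> ` vspace V \<subseteq> vspace T" using h(1) by blast
  have z: "\<Phi> 0 = 0" using h(4)[of 0 0] by simp
  show ?thesis
  proof (unfold_locales, goal_cases)
    case 1
    then show ?case by (simp add: va_image_def T.ambient T.vs.scale_right_distrib)
  next
    case 2
    then show ?case by (simp add: va_image_def T.vs.scale_left_distrib)
  next
    case 3
    then show ?case by (simp add: va_image_def)
  next
    case 4
    then show ?case by (simp add: va_image_def)
  next
    case 5
    have "T.vs.subspace (\<Phi> ` vspace V)"
      unfolding T.vs.subspace_def
    proof (intro conjI ballI allI)
      show "0 \<in> \<Phi> ` vspace V" using z V.zero_in by (metis imageI)
    qed (auto simp: h)
    then show ?case by (simp add: va_image_def)
  next
    case 6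
    then show ?case using imageI[OF V.vac_in, of \<Phi>] h(2) by (simp add: va_image_def)
  next
    case (7 a b n)
    then show ?case by (auto simp: va_image_def h)
  next
    case (8 a a' b n)
    then show ?case using sub by (simp add: va_image_def T.nprod_add_left subset_iff)
  next
    case (9 a b b' n)
    then show ?case using sub by (simp add: va_image_def T.nprod_add_right subset_iff)
  next
    case (10 a b r n)
    then show ?case using sub by (simp add: va_image_def T.nprod_smul_left subset_iff)
  next
    case (11 a b n r)
    then show ?case using sub by (simp add: va_image_def T.nprod_smul_right subset_iff)
  next
    case (12 a b)
    then show ?case using sub T.nprod_truncation by (simp add: va_image_def subset_iff)
  next
    case (13 a n)
    then show ?case using sub by (simp add: va_image_def T.vac_left subset_iff)
  next
    case (14 a)
    then show ?case using sub by (simp add: va_image_def T.vac_right subset_iff)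
  next
    case (15 a n)
    then show ?case using sub by (simp add: va_image_def T.vac_right_nonneg subset_iff)
  next
    case (16 a b c m q n)
    then have "a \<in> vspace T" "b \<in> vspace T" "c \<in> vspace T" using sub by (auto simp: va_image_def)
    from T.borcherds[OF this, of m q n] show ?case by (simp add: va_image_def)
  qed
qed

lemma va_epi_va_image:
  assumes "vertex_algebra V" "vertex_algebra T" "va_hom V T \<Phi>"
  shows "va_epi V (va_image V T \<Phi>) \<Phi>"
proof -
  have "va_hom V (va_image V T \<Phi>) \<Phi>" using assms(3) by (simp add: va_hom_def va_image_def)
  moreover have "\<Phi> ` vspace V = vspace (va_image V T \<Phi>)" by (simp add: va_image_def)
  ultimately show ?thesis
    using vertex_algebra_va_image[OF assms] assms(1) by (simp add: va_epi_def va_epi_axioms_def)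
qed

section \<open>Simple graded quotients and their lowered vectors\<close>

locale simple_quotient = reorderable V G
  for V :: "'v::ab_group_add vert_alg" and G :: "('v \<times> nat) set" +
  fixes Q :: "'q::ab_group_add vert_alg" and \<pi> :: "'v \<Rightarrow> 'q"
  assumes quotient: "simple_graded_quotient V (weight_space V G) Q \<pi>"
begin

sublocale epi: va_epi V Q \<pi>
  using quotient vertex_algebra_axioms
  by (simp add: simple_graded_quotient_def va_epi_def va_epi_axioms_def)

sublocale Q: reorderable Q "epi.hom_gens G"
  by (rule epi.reorderable_hom) (rule reorderable_axioms)

abbreviation "ker \<equiv> va_kernel V \<pi>"

lemma ker_proper: "ker \<noteq> vspace V"
  and ker_graded: "ker = vs.span (\<Union>N. ker \<inter> wspace G (int N))"
  and ker_largest: "\<lbrakk>va_ideal V I; I = vs.span (\<Union>N. I \<inter> wspace G (int N)); I \<noteq> vspace V\<rbrakk> \<Longrightarrow> I \<subseteq> ker"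
  using quotient by (auto simp: simple_graded_quotient_def graded_ideal_def weight_space_eq)

lemma vac_Q: "vac Q \<noteq> 0"
proof
  assume "vac Q = 0"
  then have "vac V \<in> ker" by (simp add: va_kernel_def epi.hom_vac)
  then show False using va_ideal_vac[OF epi.kernel_ideal] ker_proper by blast
qed

text \<open>Weight 0 is the line of the vacuum, and the vacuum is not killed because the kernel is
  proper; being graded, the kernel is spanned by its other components.\<close>

lemma ker_positive: "ker \<subseteq> positive_part"
proof -
  have "ker \<inter> wspace G (int N) \<subseteq> positive_part" for N
  proof (cases "N = 0")
    case True
    have "v = 0" if v: "v \<in> ker" "v \<in> wspace G 0" for v
    proof -
      obtain c where c: "v = smul V c (vac V)" using v(2) wspace_0 vs.span_singleton by auto
      have "\<pi> v = 0" using v by (simp add: va_kernel_def)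
      then have "smul Q c (vac Q) = 0" using c by (simp add: epi.hom_smul epi.hom_vac)
      then show ?thesis using vac_Q c by simp
    qed
    then have "ker \<inter> wspace G 0 \<subseteq> {0}" by blast
    then show ?thesis using True vs.subspace_0[OF subspace_positive_part] by auto
  next
    case False
    then show ?thesis using wspace_positive[of "int N"] by auto
  qed
  then have "vs.span (\<Union>N. ker \<inter> wspace G (int N)) \<subseteq> positive_part"
    by (intro vs.span_minimal) auto
  then show ?thesis using ker_graded by blast
qed

text \<open>The kernel is spanned by homogeneous vectors, on which \<open>D\<close> acts by scalars;
  hence \<open>D\<close> preserves it and descends.\<close>

lemma quotient_grading_op:
  assumes D: "grading_op D" and DG: "\<And>a p. (a, p) \<in> G \<Longrightarrow> D a = smul V (of_int (int p)) a"
  obtains DQ where "epi.Q.grading_op DQ" "\<And>v. v \<in> vspace V \<Longrightarrow> DQ (\<pi> v) = \<pi> (D v)"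
proof -
  have lin: "lin_on V (smul V) D" and D_in: "\<And>v. v \<in> vspace V \<Longrightarrow> D v \<in> vspace V"
    using D by (auto simp: grading_op_def)
  have ker_sub: "vs.subspace ker" using epi.kernel_ideal by (simp add: va_ideal_def)
  have Dker: "D v \<in> ker" if "v \<in> ker" for v
  proof -
    have "v \<in> vs.span (\<Union>N. ker \<inter> wspace G (int N))" using that ker_graded by blast
    then have "v \<in> vspace V \<and> D v \<in> ker"
    proof (induction rule: vs.span_induct_alt)
      case base
      show ?case using lin_on_zero[OF lin ambient] by (simp add: vs.subspace_0[OF ker_sub])
    next
      case (step c x y)
      then obtain N where x: "x \<in> ker" "x \<in> wspace G (int N)" by blast
      then have xV: "x \<in> vspace V" by (simp add: va_kernel_def)
      have "D x \<in> ker"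
        using grading_op_wspace[OF D G_in DG x(2)] vs.subspace_scale[OF ker_sub x(1)] by simp
      moreover have "D (smul V c x + y) = smul V c (D x) + D y"
        using step xV by (simp add: lin_onD(1)[OF lin ambient] lin_onD(2)[OF lin ambient _ zero_in])
      ultimately show ?case
        using step xV vs.subspace_add[OF ker_sub] vs.subspace_scale[OF ker_sub] by simp
    qed
    then show ?thesis by simp
  qed
  define DQ where "DQ y = \<pi> (D (SOME v. v \<in> vspace V \<and> \<pi> v = y))" for y
  have DQ: "DQ (\<pi> v) = \<pi> (D v)" if v: "v \<in> vspace V" for v
  proof -
    define u where "u = (SOME u. u \<in> vspace V \<and> \<pi> u = \<pi> v)"
    have u: "u \<in> vspace V \<and> \<pi> u = \<pi> v" unfolding u_def by (rule someI[of _ v]) (use v in simp)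
    have "u - v \<in> ker" using u v by (simp add: va_kernel_def epi.hom_diff)
    then have "\<pi> (D (u - v)) = 0" using Dker by (simp add: va_kernel_def)
    then have "\<pi> (D u) = \<pi> (D v)"
      using u v D_in by (simp add: lin_onD(5)[OF lin ambient] epi.hom_diff)
    then show ?thesis by (simp add: DQ_def u_def)
  qed
  have "epi.Q.grading_op DQ"
    unfolding epi.Q.grading_op_def lin_on_def
  proof (intro conjI ballI allI)
    fix x y assume x: "x \<in> vspace Q" and y: "y \<in> vspace Q"
    obtain a where a: "a \<in> vspace V" "x = \<pi> a" by (rule epi.obtain_preimage[OF x])
    obtain b where b: "b \<in> vspace V" "y = \<pi> b" by (rule epi.obtain_preimage[OF y])
    note ab = a b
    have "DQ (\<pi> (a + b)) = \<pi> (D a) + \<pi> (D b)"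
      using ab D_in by (subst DQ) (simp_all add: lin_onD(1)[OF lin ambient] epi.hom_add)
    then show "DQ (x + y) = DQ x + DQ y" using ab by (simp add: epi.hom_add DQ)
    show "DQ x \<in> vspace Q" using ab D_in by (simp add: DQ)
    fix n
    have "DQ (\<pi> (nprod V a n b)) = nprod Q (\<pi> (D a)) n (\<pi> b) + nprod Q (\<pi> a) n (\<pi> (D b))
        - smul Q (of_int (n + 1)) (nprod Q (\<pi> a) n (\<pi> b))"
      using ab D_in by (subst DQ) (simp_all add: grading_opD[OF D] epi.hom_add epi.hom_diff epi.hom_nprod epi.hom_smul)
    then show "DQ (nprod Q x n y) = nprod Q (DQ x) n y + nprod Q x n (DQ y) - smul Q (of_int (n + 1)) (nprod Q x n y)"
      using ab by (simp add: epi.hom_nprod DQ)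
  next
    fix r x assume "x \<in> vspace Q"
    then obtain a where a: "a \<in> vspace V" "x = \<pi> a" by (rule epi.obtain_preimage)
    have "DQ (\<pi> (smul V r a)) = smul Q r (\<pi> (D a))"
      using a D_in by (subst DQ) (simp_all add: lin_onD(2)[OF lin ambient _ zero_in] epi.hom_smul)
    then show "DQ (smul Q r x) = smul Q r (DQ x)" using a by (simp add: epi.hom_smul DQ)
  qed
  then show ?thesis using that DQ by blast
qed

text \<open>The preimage of the ideal in \<open>V\<close> is graded by
  \<open>maximal_ideal_component\<close> and misses the vacuum, so maximality of the kernel among
  proper graded ideals puts it inside the kernel.\<close>

lemma Q_maximal_ideal:
  assumes "vac Q \<notin> Q.positive_part" shows "Q.maximal_ideal = {0}"
proof -
  define I where "I = {v \<in> vspace V. \<pi> v \<in> Q.maximal_ideal}"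
  have I: "va_ideal V I" unfolding I_def by (rule epi.ideal_vimage[OF Q.va_ideal_maximal])
  have vacQ: "vac Q \<notin> Q.maximal_ideal"
  proof
    assume "vac Q \<in> Q.maximal_ideal"
    then have "nprod Q (vac Q) (-1) (vac Q) \<in> Q.positive_part" by (simp add: Q.maximal_ideal_def)
    then show False using assms by (simp add: epi.Q.vac_left)
  qed
  have Is: "vs.subspace I" using I by (simp add: va_ideal_def)
  have "I \<subseteq> ker"
  proof (rule ker_largest[OF I])
    have "vac V \<notin> I" using vacQ epi.hom_vac by (simp add: I_def)
    then show "I \<noteq> vspace V" using vac_in by blast
    show "I = vs.span (\<Union>N. I \<inter> wspace G (int N))"
    proof
      show "vs.span (\<Union>N. I \<inter> wspace G (int N)) \<subseteq> I" by (rule vs.span_minimal[OF _ Is]) blast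
      show "I \<subseteq> vs.span (\<Union>N. I \<inter> wspace G (int N))"
      proof
        fix v assume v: "v \<in> I"
        then have "v \<in> vs.span (\<Union>N\<in>UNIV. wspace G N)" using vspace_decomp by (auto simp: I_def)
        from wspace_decomp[OF this] obtain F f where
          F: "finite F" "\<And>N. N \<in> F \<Longrightarrow> f N \<in> wspace G N" "v = (\<Sum>N\<in>F. f N)" by blast
        have fV: "f N \<in> vspace V" if "N \<in> F" for N using F(2)[OF that] wspace_in[OF G_in] by blast
        have s: "(\<Sum>N\<in>F. \<pi> (f N)) \<in> Q.maximal_ideal"
          using v F(3) epi.hom_sum[of F f] fV by (simp add: I_def)
        have w: "\<pi> (f N) \<in> epi.Q.wspace (epi.hom_gens G) N" if "N \<in> F" for N
          using F(2)[OF that] epi.hom_wspace[OF G_in] by blast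
        have "f N \<in> vs.span (\<Union>N. I \<inter> wspace G (int N))" if N: "N \<in> F" for N
        proof (cases "N < 0")
          case True
          then show ?thesis using F(2)[OF N] wspace_neg by (simp add: vs.span_zero)
        next
          case False
          have "f N \<in> I" using Q.maximal_ideal_component[OF s F(1) w N] fV[OF N] by (simp add: I_def)
          then show ?thesis using F(2)[OF N] False by (intro vs.span_base UN_I[of "nat N"]) auto
        qed
        then show "v \<in> vs.span (\<Union>N. I \<inter> wspace G (int N))"
          unfolding F(3) by (rule vs.span_sum)
      qed
    qed
  qed
  have "y = 0" if "y \<in> Q.maximal_ideal" for y
  proof -
    have "y \<in> vspace Q" using that by (simp add: Q.maximal_ideal_def)
    then obtain x where "x \<in> vspace V" "y = \<pi> x" by (rule epi.obtain_preimage)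
    then show ?thesis using that \<open>I \<subseteq> ker\<close> by (auto simp: I_def va_kernel_def)
  qed
  then show ?thesis using epi.Q.vs.subspace_0[OF Q.subspace_maximal_ideal] by blast
qed

text \<open>The homogeneous components of \<open>w\<close> are again lowered. Those of positive
  weight lie in the zero ideal \<open>Q.maximal_ideal\<close>, those of negative weight vanish, and
  weight 0 is the vacuum line.\<close>

lemma lowered_in_vac:
  assumes DQ: "Q.graded_by DQ" and w: "w \<in> vspace Q" "Q.lowered w"
  shows "w \<in> epi.Q.vs.span {vac Q}"
proof -
  have lin: "lin_on Q (smul Q) DQ" using DQ by (simp add: Q.graded_by_def)
  have max: "Q.maximal_ideal = {0}" by (rule Q_maximal_ideal[OF Q.vac_not_positive[OF DQ vac_Q]])
  have "w \<in> epi.Q.vs.span (\<Union>N\<in>UNIV. epi.Q.wspace (epi.hom_gens G) N)" using w(1) Q.vspace_decomp by auto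
  from epi.Q.wspace_decomp[OF this] obtain F f where
    F: "finite F" "\<And>N. N \<in> F \<Longrightarrow> f N \<in> epi.Q.wspace (epi.hom_gens G) N" "w = (\<Sum>N\<in>F. f N)" by blast
  have fV: "f N \<in> vspace Q" if "N \<in> F" for N using F(2)[OF that] epi.Q.wspace_in[OF Q.G_in] by blast
  have low: "Q.lowered (f N)" if N: "N \<in> F" for N
    unfolding Q.lowered_def
  proof clarify
    fix x p j assume x: "(x, p) \<in> epi.hom_gens G" and j: "int p \<le> j"
    have xV: "x \<in> vspace Q" using Q.G_fst_in[OF x] .
    have "(\<Sum>N\<in>F. nprod Q x j (f N)) = nprod Q x j w"
      unfolding F(3) by (rule epi.Q.nprod_sum_right[symmetric]) (use fV xV in auto)
    then have z: "(\<Sum>N\<in>F. nprod Q x j (f N)) = 0" using w(2) x j by (auto simp: Q.lowered_def)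
    \<comment> \<open>The mode shifts all weights by the same amount, so the images of distinct
      components have distinct eigenvalues under \<open>DQ\<close>.\<close>
    have "nprod Q x j (f N) \<in> {0}"
    proof (rule epi.Q.eigencomponents[OF lin _ _ _ F(1) _ _ _ N, where c = "\<lambda>N. of_int (int p + N - j - 1)"])
      show "DQ y \<in> {0}" if "y \<in> {0}" for y using that epi.Q.lin_on_zero[OF lin epi.Q.ambient] by simp
      show "nprod Q x j (f M) \<in> vspace Q \<and>
          DQ (nprod Q x j (f M)) = smul Q (of_int (int p + M - j - 1)) (nprod Q x j (f M))" if M: "M \<in> F" for M
        using DQ[unfolded Q.graded_by_def, THEN conjunct2, rule_format,
            OF epi.Q.wspace_nprod[OF Q.G_in Q.generator_in_wspace[OF x] F(2)[OF M], of j]] xV fV[OF M]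
        by simp
    qed (use z in \<open>auto simp: inj_on_def\<close>)
    then show "nprod Q x j (f N) = 0" by simp
  qed
  have "f N \<in> epi.Q.vs.span {vac Q}" if N: "N \<in> F" for N
  proof -
    consider "N < 0" | "N = 0" | "N \<ge> 1" by linarith
    then show ?thesis
    proof cases
      case 1
      then show ?thesis using F(2)[OF N] Q.wspace_neg by (simp add: epi.Q.vs.span_zero)
    next
      case 2
      then show ?thesis using F(2)[OF N] Q.wspace_0 by simp
    next
      case 3
      then show ?thesis using Q.lowered_in_maximal_ideal[OF F(2)[OF N] 3 low[OF N]] max
        by (simp add: epi.Q.vs.span_zero)
    qed
  qed
  then show ?thesis unfolding F(3) by (rule epi.Q.vs.span_sum)
qed

end

section \<open>The gradings of the factors\<close>

text \<open>Insertion sort for a total transitive relation; needed for the PBW order, which compares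
  the modes of equal generators in reverse.\<close>

lemma exists_sorted_wrt:
  assumes "\<And>x y. R x y \<or> R y x" "\<And>x y z. R x y \<Longrightarrow> R y z \<Longrightarrow> R x z"
  shows "\<exists>ys. mset ys = mset xs \<and> sorted_wrt R ys"
proof (induction xs)
  case (Cons x xs)
  then obtain ys where ys: "mset ys = mset xs" "sorted_wrt R ys" by blast
  have "\<exists>zs. mset zs = mset (x # ys) \<and> sorted_wrt R zs" using ys(2)
  proof (induction ys)
    case (Cons y ys)
    then obtain zs where zs: "mset zs = mset (x # ys)" "sorted_wrt R zs" by auto
    show ?case
    proof (cases "R x y")
      case True
      then have "sorted_wrt R (x # y # ys)" using Cons.prems assms(2) by auto
      then show ?thesis by (intro exI[of _ "x # y # ys"]) simp
    next
      case False
      then have "R y x" using assms(1) by blast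
      moreover have "set zs = insert x (set ys)" using mset_eq_setD[OF zs(1)] by simp
      ultimately have "sorted_wrt R (y # zs)" using zs Cons.prems by auto
      then show ?thesis using zs(1) by (intro exI[of _ "y # zs"]) simp
    qed
  qed simp
  then show ?case using ys(1) by simp
qed simp

context vertex_algebra
begin

lemma opeD: "ope V a b cs \<Longrightarrow> nprod V a (int n) b = (if n < length cs then cs ! n else 0)"
  by (simp add: ope_def)

text \<open>In skew symmetry all terms except \<open>j = 0\<close> contain derivatives of the vacuum
  and vanish, which leaves only a sign.\<close>

lemma ope_scalar_swap:
  assumes a: "a \<in> vspace V" and b: "b \<in> vspace V"
    and ope: "\<And>n::nat. nprod V a (int n) b = (if n = N then smul V r (vac V) else 0)"
  shows "nprod V b (int n) a = (if n = N then smul V (- ((- 1) ^ N) * r) (vac V) else 0)"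
proof -
  have "Sum_any (\<lambda>j::nat. smul V ((- 1) ^ j) (nprod V (nprod V a (int n + int j) b) (- 1 - int j) (vac V)))
    = smul V ((- 1) ^ 0) (nprod V (nprod V a (int n + int 0) b) (- 1 - int 0) (vac V))"
  proof (rule Sum_any_single)
    fix j :: nat assume "j \<noteq> 0"
    then show "smul V ((- 1) ^ j) (nprod V (nprod V a (int n + int j) b) (- 1 - int j) (vac V)) = 0"
      using ope[of "n + j"] by (simp add: nprod_smul_left vac_left)
  qed
  then show ?thesis
    unfolding skew_symmetry[OF a b] using ope[of n] by (simp add: nprod_smul_left vac_left)
qed

lemma gen_wspan:
  assumes "(a, p) \<in> G" "fst ` G \<subseteq> vspace V" "p \<le> s"
  shows "a \<in> wspan G s (int p)"
  using act_in_wspan[of G "[((a, p), -1)]" s "int p"] assms by (force simp: vac_right image_subset_iff)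

lemma transl_wspan:
  assumes "(a, p) \<in> G" "p \<le> s"
  shows "transl V a \<in> wspan G s (int p + 1)"
  using act_in_wspan[of G "[((a, p), -2)]" s "int p + 1"] assms by (simp add: transl_def)

end

context reorderable
begin

lemma graded_by_grading_op:
  assumes D: "graded_by D" shows "grading_op D"
proof -
  have lin: "lin_on V (smul V) D" and DN: "\<And>N v. v \<in> wspace G N \<Longrightarrow> D v = smul V (of_int N) v"
    using D by (auto simp: graded_by_def)
  have D_in: "D v \<in> vspace V" if "v \<in> vspace V" for v
    using that
  proof (induction rule: vspace_induct)
    case (wspace N v)
    then show ?case using DN[OF wspace] wspace_in[OF G_in] by simp
  qed (simp add: lin_onD(1)[OF lin ambient])
  let ?P = "\<lambda>x n y. D (nprod V x n y) = nprod V (D x) n y + nprod V x n (D y) - smul V (of_int (n + 1)) (nprod V x n y)"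
  have "?P x n y" if "x \<in> vspace V" "y \<in> vspace V" for x n y
    using that(1)
  proof (induction rule: vspace_induct)
    case (wspace M x)
    have x: "x \<in> vspace V" using wspace_in[OF G_in wspace] .
    from that(2) show ?case
    proof (induction rule: vspace_induct)
      case (wspace N y)
      have "y \<in> vspace V" using wspace_in[OF G_in wspace] .
      then show ?case
        using x DN[OF \<open>x \<in> wspace G M\<close>] DN[OF wspace] DN[OF wspace_nprod[OF G_in \<open>x \<in> wspace G M\<close> wspace, of n]]
        by (simp add: nprod_linear vs.scale_left_distrib vs.scale_left_diff_distrib algebra_simps)
    next
      case (add u v)
      show ?case using x add.hyps D_in
        by (simp add: add.IH lin_onD(1)[OF lin ambient] nprod_linear vs.scale_right_distrib algebra_simps)
    qed
  next
    case (add u v)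
    show ?case using that(2) add.hyps D_in
      by (simp add: add.IH lin_onD(1)[OF lin ambient] nprod_linear vs.scale_right_distrib algebra_simps)
  qed
  then show ?thesis unfolding grading_op_def using lin D_in by blast
qed

end

section \<open>Gradings from PBW bases and the Bershadsky-Polyakov algebra\<close>

locale weighted_generators = vertex_algebra V for V :: "'v::ab_group_add vert_alg" +
  fixes gens :: "'v list" and wts :: "nat list"
  assumes free: "freely_strongly_generated V gens" and len: "length wts = length gens"
begin

definition G :: "('v \<times> nat) set" where "G = set (zip gens wts)"

definition pbw_letters :: "(nat \<times> nat) list \<Rightarrow> (('v \<times> nat) \<times> int) list" where
  "pbw_letters is = map (\<lambda>(i, n). ((gens ! i, wts ! i), - int n - 1)) is"

lemma pbw_monomial_eq: "pbw_monomial V gens is v = act (pbw_letters is) v"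
  by (simp add: pbw_monomial_def pbw_letters_def act_def comp_def case_prod_unfold)

lemma letters_pbw: "\<forall>(i, n)\<in>set is. i < length gens \<Longrightarrow> letters G (pbw_letters is)"
  using len by (fastforce simp: letters_def pbw_letters_def G_def in_set_zip)

lemma gens_in: "fst ` G \<subseteq> vspace V"
  using free by (auto simp: G_def freely_strongly_generated_def dest: set_zip_leftD)

lemma pbw_span: "vspace V \<subseteq> vs.span {act ws (vac V) |ws. letters G ws}"
proof -
  have p: "presented_by V (pbw_words (length gens)) (\<lambda>ws. pbw_monomial V gens ws (vac V)) {}"
    using free by (simp add: freely_strongly_generated_def)
  have "(\<lambda>ws. pbw_monomial V gens ws (vac V)) ` pbw_words (length gens) \<subseteq> {act ws (vac V) |ws. letters G ws}"
    using letters_pbw by (auto simp: pbw_monomial_eq pbw_words_def)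
  then show ?thesis using presented_span[OF p ambient] vs.span_mono by blast
qed

lemma pbw_normal_form:
  assumes ws: "letters G ws" "\<forall>(g, n)\<in>set ws. n < 0"
  shows "\<exists>ws'. mset ws' = mset ws \<and> (\<exists>is\<in>pbw_words (length gens). ws' = pbw_letters is)"
proof -
  have "\<exists>is. (\<forall>(i, n)\<in>set is. i < length gens) \<and> ws = pbw_letters is"
    using ws
  proof (induction ws)
    case Nil
    show ?case by (intro exI[of _ "[]"]) (simp add: pbw_letters_def)
  next
    case (Cons l ws)
    obtain a p n where l: "l = ((a, p), n)" by (metis surj_pair)
    have "(a, p) \<in> set (zip gens wts)" using Cons.prems l by (simp add: G_def)
    then obtain i where i: "i < length gens" "a = gens ! i" "p = wts ! i"
      using len by (auto simp: in_set_zip)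
    obtain "is" where "is": "\<forall>(i, n)\<in>set is. i < length gens" "ws = pbw_letters is" using Cons by auto
    have "n < 0" using Cons.prems l by auto
    then show ?case using i "is" l
      by (intro exI[of _ "(i, nat (- n - 1)) # is"]) (simp add: pbw_letters_def)
  qed
  then obtain "is" where "is": "\<forall>(i, n)\<in>set is. i < length gens" "ws = pbw_letters is" by blast
  have "\<exists>js. mset js = mset is \<and> sorted_wrt (\<lambda>(i, m) (j, n). i < j \<or> (i = j \<and> n \<le> m)) js"
    by (rule exists_sorted_wrt) auto
  then obtain js where js: "mset js = mset is" "sorted_wrt (\<lambda>(i, m) (j, n). i < j \<or> (i = j \<and> n \<le> m)) js"
    by blast
  have "js \<in> pbw_words (length gens)"
    using "is"(1) js mset_eq_setD[OF js(1)] by (simp add: pbw_words_def)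
  moreover have "mset (pbw_letters js) = mset ws" using js(1) "is"(2) by (simp add: pbw_letters_def)
  ultimately show ?thesis by blast
qed

text \<open>Freeness allows \<open>D\<close> to be prescribed on the PBW basis. That it also has the
  right eigenvalue on arbitrary words follows from \<open>normal_form\<close>, which rewrites a word
  by PBW monomials of the same weight.\<close>

lemma pbw_grading:
  assumes "reorderable V G"
  obtains D where "reorderable.graded_by V G D"
proof -
  interpret reorderable V G by (rule assms)
  have p: "presented_by V (pbw_words (length gens)) (\<lambda>ws. pbw_monomial V gens ws (vac V)) {}"
    using free by (simp add: freely_strongly_generated_def)
  obtain D where D: "lin_on V (smul V) D" "\<And>is. is \<in> pbw_words (length gens) \<Longrightarrow>
      D (pbw_monomial V gens is (vac V)) = smul V (of_int (wdeg (pbw_letters is))) (pbw_monomial V gens is (vac V))"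
    using presented_lift[OF p ambient ambient, of "\<lambda>is. smul V (of_int (wdeg (pbw_letters is))) (pbw_monomial V gens is (vac V))"]
    by auto
  have "D v = smul V (of_int N) v" if v: "v \<in> wspace G N" for v N
  proof -
    let ?X = "{act ws (vac V) | ws. letters G ws \<and> (\<forall>(g, n)\<in>set ws. n < 0) \<and>
      (\<exists>is\<in>pbw_words (length gens). ws = pbw_letters is) \<and> wdeg ws = N}"
    have "v \<in> vs.span ?X"
    proof (rule subsetD[OF vs.span_minimal v[unfolded wspace_def]])
      show "{act ws (vac V) |ws. letters G ws \<and> wdeg ws = N} \<subseteq> vs.span ?X"
        using normal_form[of "\<lambda>ws. \<exists>is\<in>pbw_words (length gens). ws = pbw_letters is", OF pbw_normal_form] by blast
    qed simp
    then have "v \<in> vspace V \<and> D v = smul V (of_int N) v"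
    proof (induction rule: vs.span_induct_alt)
      case base
      show ?case using lin_on_zero[OF D(1) ambient] by simp
    next
      case (step c x y)
      then have "x \<in> vspace V" "D x = smul V (of_int N) x"
        using D(2) act_in[OF _ G_in vac_in] by (auto simp: pbw_monomial_eq)
      then show ?case using step
        by (simp add: lin_onD(1)[OF D(1) ambient] lin_onD(2)[OF D(1) ambient _ zero_in]
            vs.scale_right_distrib mult.commute)
    qed
    then show ?thesis by simp
  qed
  then have "graded_by D" using D(1) by (simp add: graded_by_def)
  then show ?thesis by (rule that)
qed

end

text \<open>The operator products are homogeneous for the shifted weights 1, 1, 2, 2 as well,
  although \<open>L\<close> itself gives \<open>Gp\<close> and \<open>Gm\<close> weight 3/2. Each
  right-hand side also has generator weight below the sum for its two factors, at the critical level
  too, where \<open>L\<close> is central.\<close>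

lemma bershadsky_polyakov_graded:
  assumes U: "bershadsky_polyakov k U J Gp Gm L"
  defines "G \<equiv> {(J, 1), (Gp, 1), (Gm, 2), (L, 2)}"
  shows "reorderable U G" "\<exists>D. reorderable.graded_by U G D"
proof -
  interpret vertex_algebra U using U by (simp add: bershadsky_polyakov_def)
  interpret W: weighted_generators U "[J, Gp, Gm, L]" "[1, 1, 2, 2]"
    using U by unfold_locales (auto simp: bershadsky_polyakov_def)
  have G: "W.G = G" unfolding W.G_def G_def by simp
  have in_G: "(J, 1) \<in> G" "(Gp, 1) \<in> G" "(Gm, 2) \<in> G" "(L, 2) \<in> G" by (auto simp: G_def)
  have Gin: "fst ` G \<subseteq> vspace U" using W.gens_in G by simp
  have inV: "J \<in> vspace U" "Gp \<in> vspace U" "Gm \<in> vspace U" "L \<in> vspace U"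
    using Gin by (auto simp: G_def)
  have sp: "v \<in> wspan G s N \<Longrightarrow> smul U r v \<in> wspan G s N" "v \<in> wspan G s N \<Longrightarrow> - v \<in> wspan G s N"
    "v \<in> wspan G s N \<Longrightarrow> w \<in> wspan G s N \<Longrightarrow> v + w \<in> wspan G s N"
    "v \<in> wspan G s N \<Longrightarrow> w \<in> wspan G s N \<Longrightarrow> v - w \<in> wspan G s N"
    "0 \<in> wspan G s N" for r v w s N
    by (simp_all add: vs.subspace_scale vs.subspace_neg vs.subspace_add vs.subspace_diff vs.subspace_0)
  define good where "good a p b q \<longleftrightarrow>
    (\<forall>n::nat. nprod U a (int n) b \<in> wspan G (p + q - 1) (int p + int q - int n - 1))" for a p b q
  have goodI: "good a p b q" if "ope U a b cs"
    "\<And>n. n < length cs \<Longrightarrow> cs ! n \<in> wspan G (p + q - 1) (int p + int q - int n - 1)" for a p b q cs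
    unfolding good_def using that by (auto simp: opeD sp)
  note g = gen_wspan[OF in_G(1) Gin] gen_wspan[OF in_G(2) Gin] gen_wspan[OF in_G(3) Gin] gen_wspan[OF in_G(4) Gin]
  note t = transl_wspan[OF in_G(1)] transl_wspan[OF in_G(2)] transl_wspan[OF in_G(3)] transl_wspan[OF in_G(4)]
  have JJ: "nop U J J \<in> wspan G 2 2"
    using act_in_wspan[of G "[((J, 1), -1), ((J, 1), -1)]" 2 2] in_G inV by (simp add: nop_def vac_right)
  have g1: "good J 1 J 1" "good J 1 Gp 1" "good J 1 Gm 2" "good Gp 1 Gp 1" "good Gm 2 Gm 2"
  proof -
    show "good J 1 J 1"
      by (rule goodI[of _ _ "[0, smul U ((2 * k + 3) / 3) (vac U)]"])
        (use U in \<open>auto simp: bershadsky_polyakov_def less_Suc_eq sp vac_in_wspan\<close>)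
    show "good J 1 Gp 1"
      by (rule goodI[of _ _ "[Gp]"]) (use U g in \<open>auto simp: bershadsky_polyakov_def\<close>)
    show "good J 1 Gm 2"
      by (rule goodI[of _ _ "[- Gm]"]) (use U g in \<open>auto simp: bershadsky_polyakov_def sp\<close>)
    show "good Gp 1 Gp 1" "good Gm 2 Gm 2"
      by (rule goodI[of _ _ "[]"]; use U in \<open>simp add: bershadsky_polyakov_def\<close>)+
  qed
  \<comment> \<open>The tight case: the bound \<open>1 + 2 - 1 = 2\<close> is attained by the
    normally ordered square of \<open>J\<close> and by \<open>L\<close>.\<close>
  have g2: "good Gp 1 Gm 2"
  proof (rule goodI)
    show "ope U Gp Gm
       [smul U 3 (nop U J J) + smul U (3 * (k + 1) / 2) (transl U J)
          - (if k = -3 then L else smul U (k + 3) L),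
        smul U (3 * (k + 1)) J, smul U ((k + 1) * (2 * k + 3)) (vac U)]"
      (is "ope U Gp Gm ?cs") using U by (simp add: bershadsky_polyakov_def)
    fix n assume "n < length ?cs"
    then consider "n = 0" | "n = 1" | "n = 2" by fastforce
    then show "?cs ! n \<in> wspan G (1 + 2 - 1) (int 1 + int 2 - int n - 1)"
      by cases (use JJ t(1)[of 2] g(1)[of 2] g(4)[of 2] vac_in_wspan[of G 2] in
        \<open>auto simp: numeral_2_eq_2[symmetric] intro!: sp\<close>)
  qed
  have g3: "good L 2 L 2 \<and> good L 2 J 1 \<and> good L 2 Gp 1 \<and> good L 2 Gm 2"
  proof (cases "k = -3")
    case True
    have "good L 2 a p" if "a \<in> vspace U" for a p
      by (rule goodI[of _ _ "[]"]) (use U True that in \<open>auto simp: bershadsky_polyakov_def\<close>)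
    then show ?thesis using inV by blast
  next
    case False
    have "good L 2 L 2"
      by (rule goodI[of _ _ "[transl U L, smul U 2 L, 0, smul U (- ((2 * k + 3) * (3 * k + 1) / (k + 3)) / 2) (vac U)]"])
        (use U False t(4)[of 3] g(4)[of 3] vac_in_wspan[of G 3] in \<open>auto simp: bershadsky_polyakov_def less_Suc_eq intro!: sp\<close>)
    moreover have "good L 2 J 1"
    proof (rule goodI)
      show "ope U L J [transl U J, J]" using U False by (simp add: bershadsky_polyakov_def)
      fix n assume "n < length [transl U J, J]"
      then consider "n = 0" | "n = 1" by fastforce
      then show "[transl U J, J] ! n \<in> wspan G (2 + 1 - 1) (int 2 + int 1 - int n - 1)"
        by cases (use t(1)[of 2] g(1)[of 2] in \<open>auto intro!: sp\<close>)
    qed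
    moreover have "good L 2 Gp 1"
    proof (rule goodI)
      show "ope U L Gp [transl U Gp, smul U (3 / 2) Gp]" using U False by (simp add: bershadsky_polyakov_def)
      fix n assume "n < length [transl U Gp, smul U (3 / 2) Gp]"
      then consider "n = 0" | "n = 1" by fastforce
      then show "[transl U Gp, smul U (3 / 2) Gp] ! n \<in> wspan G (2 + 1 - 1) (int 2 + int 1 - int n - 1)"
        by cases (use t(2)[of 2] g(2)[of 2] in \<open>auto intro!: sp\<close>)
    qed
    moreover have "good L 2 Gm 2"
      by (rule goodI[of _ _ "[transl U Gm, smul U (3 / 2) Gm]"])
        (use U False t(3)[of 3] g(3)[of 3] in \<open>auto simp: bershadsky_polyakov_def less_Suc_eq intro!: sp\<close>)
    ultimately show ?thesis by blast
  qed
  show R: "reorderable U G"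
  proof
    show "vspace U \<subseteq> vs.span {act ws (vac U) |ws. letters G ws}" using W.pbw_span G by simp
    fix a p b q assume "(a, p) \<in> G" "(b, q) \<in> G"
    then have "good a p b q \<or> good b q a p" using g1 g2 g3 unfolding G_def by auto
    then show "(\<forall>n::nat. nprod U a (int n) b \<in> wspan G (p + q - 1) (int p + int q - int n - 1)) \<or>
      (\<forall>n::nat. nprod U b (int n) a \<in> wspan G (p + q - 1) (int p + int q - int n - 1))"
      unfolding good_def by (auto simp: add.commute)
  qed (use Gin in \<open>auto simp: G_def\<close>)
  show "\<exists>D. reorderable.graded_by U G D"
    using W.pbw_grading R unfolding G by blast
qed

section \<open>Grading operators on the free field factors\<close>

lemma (in vertex_algebra) modes_on_in:
  assumes "set (map fst ws) \<subseteq> vspace V" "v \<in> vspace V"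
  shows "modes_on V ws v \<in> vspace V"
  using assms by (induction ws) (auto simp: modes_on_def)

lemma pbw_monomial_closed:
  assumes K: "v \<in> K" "\<And>g n y. g \<in> set gens \<Longrightarrow> y \<in> K \<Longrightarrow> nprod V g (- int n - 1) y \<in> K"
    and ws: "ws \<in> pbw_words (length gens)"
  shows "pbw_monomial V gens ws v \<in> K"
proof -
  have "\<forall>(i, n)\<in>set ws. i < length gens" using ws by (simp add: pbw_words_def)
  then show ?thesis
  proof (induction ws)
    case (Cons l ws)
    obtain i n where "l = (i, n)" by fastforce
    then show ?case using Cons K(2)[of "gens ! i" "pbw_monomial V gens ws v" n]
      by (auto simp: pbw_monomial_def modes_on_def)
  qed (simp add: K(1) pbw_monomial_def modes_on_def)
qed

lemma freely_generated_subset: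
  assumes "freely_strongly_generated V gens" "vector_space (smul V)" "module.subspace (smul V) K"
    "vac V \<in> K" "\<And>g n y. g \<in> set gens \<Longrightarrow> y \<in> K \<Longrightarrow> nprod V g (- int n - 1) y \<in> K"
  shows "vspace V \<subseteq> K"
proof -
  interpret vector_space "smul V" by (rule assms(2))
  have p: "presented_by V (pbw_words (length gens)) (\<lambda>ws. pbw_monomial V gens ws (vac V)) {}"
    using assms(1) by (simp add: freely_strongly_generated_def)
  show ?thesis
    by (rule order_trans[OF presented_span[OF p assms(2)] span_minimal[OF _ assms(3)]])
      (use pbw_monomial_closed[OF assms(4,5)] in blast)
qed

lemma half_lattice_subset:
  assumes P: "half_lattice_va P c d e" and K: "module.subspace (smul P) K"
    "\<And>m. e m \<in> K" "\<And>g n y. g \<in> {c, d} \<Longrightarrow> y \<in> K \<Longrightarrow> nprod P g (- int n - 1) y \<in> K"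
  shows "vspace P \<subseteq> K"
proof -
  interpret vertex_algebra P using P by (simp add: half_lattice_va_def)
  have p: "presented_by P (pbw_words 2 \<times> UNIV) (\<lambda>(ws, m). pbw_monomial P [c, d] ws (e m)) {}"
    using P by (simp add: half_lattice_va_def)
  have "pbw_monomial P [c, d] ws (e m) \<in> K" if "ws \<in> pbw_words 2" for ws m
    by (rule pbw_monomial_closed) (use K that in \<open>auto simp: numeral_2_eq_2\<close>)
  then show ?thesis
    by (intro order_trans[OF presented_span[OF p ambient] vs.span_minimal[OF _ K(1)]]) auto
qed

lemma beta_gamma_grading_op:
  assumes S: "beta_gamma_va S \<beta> \<gamma>"
  obtains D where "vertex_algebra.grading_op S D" "D \<beta> = \<beta>" "D \<gamma> = 0"
proof -
  interpret vertex_algebra S using S by (simp add: beta_gamma_va_def)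
  have free: "freely_strongly_generated S [\<beta>, \<gamma>]" using S by (simp add: beta_gamma_va_def)
  have in_S [simp]: "\<beta> \<in> vspace S" "\<gamma> \<in> vspace S" using free by (auto simp: freely_strongly_generated_def)
  have bg: "nprod S \<beta> (int n) \<gamma> = (if n = 0 then smul S 1 (vac S) else 0)" for n
    using S by (simp add: beta_gamma_va_def ope_def)
  have gb: "nprod S \<gamma> (int n) \<beta> = (if n = 0 then - vac S else 0)" for n
    using ope_scalar_swap[OF in_S bg, of n] by simp
  have bb: "nprod S \<beta> (int n) \<beta> = 0" and gg: "nprod S \<gamma> (int n) \<gamma> = 0" for n
    using S by (simp_all add: beta_gamma_va_def ope_def)
  \<comment> \<open>The conformal vector for which \<beta> has weight 1 and \<gamma> weight 0: its
    zero mode is translation and its mode 1 is the desired operator.\<close>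
  define w where "w = nprod S \<beta> (-1) (transl S \<gamma>)"
  have w: "w \<in> vspace S" by (simp add: w_def)
  have modes: "nprod S w n x = Sum_any (\<lambda>j::nat.
      smul S (- of_int (n + int j)) (nprod S \<beta> (- 1 - int j) (nprod S \<gamma> (n + int j - 1) x)) +
      smul S (- of_int (n - 1 - int j)) (nprod S \<gamma> (n - 2 - int j) (nprod S \<beta> (int j) x)))"
    if "x \<in> vspace S" for n x
    using that by (simp add: w_def nop_modes transl_modes nprod_linear algebra_simps)
  have gb': "nprod S \<gamma> (int j - 1) \<beta> = (if j = 1 then - vac S else 0)" if "j \<ge> 1" for j :: nat
    using gb[of "j - 1"] that by (simp add: of_nat_diff)
  have w0b: "nprod S w 0 \<beta> = transl S \<beta>"
  proof -
    have "nprod S w 0 \<beta> = (smul S (- of_int (0 + int 1)) (nprod S \<beta> (- 1 - int 1) (nprod S \<gamma> (0 + int 1 - 1) \<beta>)) +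
      smul S (- of_int (0 - 1 - int 1)) (nprod S \<gamma> (0 - 2 - int 1) (nprod S \<beta> (int 1) \<beta>)))"
      unfolding modes[OF in_S(1)]
    proof (rule Sum_any_single)
      fix j :: nat assume "j \<noteq> 1"
      then show "smul S (- of_int (0 + int j)) (nprod S \<beta> (- 1 - int j) (nprod S \<gamma> (0 + int j - 1) \<beta>)) +
         smul S (- of_int (0 - 1 - int j)) (nprod S \<gamma> (0 - 2 - int j) (nprod S \<beta> (int j) \<beta>)) = 0"
        using gb'[of j] bb[of j] by (cases "j = 0") auto
    qed
    then show ?thesis using gb[of 0] bb[of 1] by (simp add: transl_def nprod_linear)
  qed
  have w0g: "nprod S w 0 \<gamma> = transl S \<gamma>"
  proof -
    have "nprod S w 0 \<gamma> = (smul S (- of_int (0 + int 0)) (nprod S \<beta> (- 1 - int 0) (nprod S \<gamma> (0 + int 0 - 1) \<gamma>)) +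
      smul S (- of_int (0 - 1 - int 0)) (nprod S \<gamma> (0 - 2 - int 0) (nprod S \<beta> (int 0) \<gamma>)))"
      unfolding modes[OF in_S(2)]
    proof (rule Sum_any_single)
      fix j :: nat assume "j \<noteq> 0"
      then show "smul S (- of_int (0 + int j)) (nprod S \<beta> (- 1 - int j) (nprod S \<gamma> (0 + int j - 1) \<gamma>)) +
         smul S (- of_int (0 - 1 - int j)) (nprod S \<gamma> (0 - 2 - int j) (nprod S \<beta> (int j) \<gamma>)) = 0"
        using gg[of "j - 1"] bg[of j] by (simp add: of_nat_diff)
    qed
    then show ?thesis using bg[of 0] by (simp add: transl_def)
  qed
  have w1b: "nprod S w 1 \<beta> = \<beta>"
  proof -
    have "nprod S w 1 \<beta> = (smul S (- of_int (1 + int 0)) (nprod S \<beta> (- 1 - int 0) (nprod S \<gamma> (1 + int 0 - 1) \<beta>)) +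
      smul S (- of_int (1 - 1 - int 0)) (nprod S \<gamma> (1 - 2 - int 0) (nprod S \<beta> (int 0) \<beta>)))"
      unfolding modes[OF in_S(1)]
      by (rule Sum_any_single) (use gb bb in auto)
    then show ?thesis using gb[of 0] by (simp add: nprod_linear vac_right)
  qed
  have w1g: "nprod S w 1 \<gamma> = 0"
    unfolding modes[OF in_S(2)]
  proof (rule Sum_any_zero)
    fix j :: nat
    show "smul S (- of_int (1 + int j)) (nprod S \<beta> (- 1 - int j) (nprod S \<gamma> (1 + int j - 1) \<gamma>)) +
         smul S (- of_int (1 - 1 - int j)) (nprod S \<gamma> (1 - 2 - int j) (nprod S \<beta> (int j) \<gamma>)) = 0"
      using gg[of j] bg[of j] by auto
  qed
  have "vspace S \<subseteq> {a \<in> vspace S. nprod S w 0 a = transl S a}"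
  proof (rule freely_generated_subset[OF free ambient subspace_zero_mode_eq_transl[OF w]])
    show "vac S \<in> {a \<in> vspace S. nprod S w 0 a = transl S a}" using w by (simp add: vac_right_nonneg)
    fix g n y assume "g \<in> set [\<beta>, \<gamma>]" "y \<in> {a \<in> vspace S. nprod S w 0 a = transl S a}"
    then show "nprod S g (- int n - 1) y \<in> {a \<in> vspace S. nprod S w 0 a = transl S a}"
      using zero_mode_eq_transl_nprod[OF w] w0b w0g by auto
  qed
  then have "nprod S w 0 a = transl S a" if "a \<in> vspace S" for a using that by blast
  from that[OF grading_op_inner[OF w this] w1b w1g] show ?thesis .
qed

lemma half_lattice_grading_op:
  assumes P: "half_lattice_va P c d e"
  obtains D where "vertex_algebra.grading_op P D" "D c = c" "D d = d"
    "\<And>m. D (e m) = smul P (of_int m) (e m)"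
proof -
  interpret vertex_algebra P using P by (simp add: half_lattice_va_def)
  have c [simp]: "c \<in> vspace P" and d [simp]: "d \<in> vspace P" and e [simp]: "e m \<in> vspace P" for m
    using P by (auto simp: half_lattice_va_def)
  have cd: "nprod P c (int n) d = (if n = 1 then smul P 2 (vac P) else 0)" for n
    using P by (auto simp: half_lattice_va_def ope_def nth_Cons split: nat.split)
  have dc: "nprod P d (int n) c = (if n = 1 then smul P 2 (vac P) else 0)" for n
    using ope_scalar_swap[OF c d cd, of n] by simp
  have cc: "nprod P c (int n) c = 0" and dd: "nprod P d (int n) d = 0"
    and ce: "nprod P c (int n) (e m) = 0"
    and de: "nprod P d (int n) (e m) = (if n = 0 then smul P (2 * of_int m) (e m) else 0)" for n m
    using P by (simp_all add: half_lattice_va_def ope_def)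
  have te: "transl P (e m) = smul P (of_int m) (nprod P c (-1) (e m))" for m
    using P by (simp add: half_lattice_va_def nop_def)
  define u where "u = nprod P c (-1) d"
  \<comment> \<open>The vector \<open>u / 2\<close> alone gives every \<open>e m\<close> weight 0.
    The derivative term leaves the zero mode on the generators as it has to be and adds
    \<open>d(0) / 2\<close> to mode 1, which is \<open>m\<close> on \<open>e m\<close>.\<close>
  define w where "w = smul P (1 / 2) u - smul P (1 / 2) (transl P d)"
  have u: "u \<in> vspace P" by (simp add: u_def)
  have w: "w \<in> vspace P" by (simp add: w_def u)
  have modes: "nprod P u n x = Sum_any (\<lambda>j::nat. nprod P c (- 1 - int j) (nprod P d (n + int j) x) +
                      nprod P d (n - 1 - int j) (nprod P c (int j) x))" if "x \<in> vspace P" for n x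
    using that by (simp add: u_def nop_modes)
  have wm: "nprod P w n x = smul P (1 / 2) (nprod P u n x) + smul P (of_int n / 2) (nprod P d (n - 1) x)"
    if "x \<in> vspace P" for n x
    using that u by (simp add: w_def nprod_linear transl_modes)
  have u0c: "nprod P u 0 c = smul P 2 (transl P c)"
    unfolding modes[OF c]
    by (subst Sum_any_single[where i = 1]) (use dc dc[of 1] cc cc[of 1] in \<open>auto simp: nprod_linear transl_def\<close>)
  have u0d: "nprod P u 0 d = smul P 2 (transl P d)"
    unfolding modes[OF d]
    by (subst Sum_any_single[where i = 1]) (use cd cd[of 1] dd dd[of 1] in \<open>auto simp: nprod_linear transl_def\<close>)
  have u0e: "nprod P u 0 (e m) = smul P 2 (transl P (e m))" for m
    unfolding modes[OF e]
    by (subst Sum_any_single[where i = 0]) (use de de[of 0 m] ce ce[of 0 m] in \<open>auto simp: nprod_linear te\<close>)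
  have u1c: "nprod P u 1 c = smul P 2 c"
    unfolding modes[OF c]
  proof (subst Sum_any_single[where i = 0])
    fix j :: nat assume "j \<noteq> 0"
    then show "nprod P c (- 1 - int j) (nprod P d (1 + int j) c) + nprod P d (1 - 1 - int j) (nprod P c (int j) c) = 0"
      using dc[of "1 + j"] cc by simp
  qed (use dc[of 1] cc[of 0] in \<open>simp add: nprod_linear vac_right\<close>)
  have u1d: "nprod P u 1 d = smul P 2 d"
    unfolding modes[OF d]
  proof (subst Sum_any_single[where i = 1])
    fix j :: nat assume "j \<noteq> 1"
    then show "nprod P c (- 1 - int j) (nprod P d (1 + int j) d) + nprod P d (1 - 1 - int j) (nprod P c (int j) d) = 0"
      using cd[of j] dd[of "1 + j"] by simp
  qed (use cd[of 1] dd[of 2] in \<open>simp add: nprod_linear vac_right\<close>)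
  have u1e: "nprod P u 1 (e m) = 0" for m
    unfolding modes[OF e]
  proof (rule Sum_any_zero)
    fix j :: nat
    show "nprod P c (- 1 - int j) (nprod P d (1 + int j) (e m)) + nprod P d (1 - 1 - int j) (nprod P c (int j) (e m)) = 0"
      using ce de[of "1 + j"] by simp
  qed
  have w0: "nprod P w 0 x = transl P x" if "x \<in> {c, d} \<union> range e" for x
    using that u0c u0d u0e by (auto simp: wm)
  have w1: "nprod P w 1 c = c" "nprod P w 1 d = d" "nprod P w 1 (e m) = smul P (of_int m) (e m)" for m
    using dc[of 0] dd[of 0] de[of 0 m] by (simp_all add: wm u1c u1d u1e)
  have "vspace P \<subseteq> {a \<in> vspace P. nprod P w 0 a = transl P a}"
  proof (rule half_lattice_subset[OF P subspace_zero_mode_eq_transl[OF w]])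
    show "e m \<in> {a \<in> vspace P. nprod P w 0 a = transl P a}" for m using w0 by simp
    fix g n y assume "g \<in> {c, d}" "y \<in> {a \<in> vspace P. nprod P w 0 a = transl P a}"
    then show "nprod P g (- int n - 1) y \<in> {a \<in> vspace P. nprod P w 0 a = transl P a}"
      using zero_mode_eq_transl_nprod[OF w] w0 by auto
  qed
  then have "nprod P w 0 a = transl P a" if "a \<in> vspace P" for a using that by blast
  from that[OF grading_op_inner[OF w this] w1] show ?thesis .
qed

section \<open>The affine currents\<close>

lemma lie_br_sl3: "x \<in> sl3 \<Longrightarrow> y \<in> sl3 \<Longrightarrow> lie_br x y \<in> sl3"
  unfolding sl3_def lie_br_def mem_Collect_eq trace_sub by (simp only: trace_mul_sym[of x y] diff_self)

text \<open>The relators with empty prefix and suffix, read in \<open>V\<close>: the letter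
  \<open>(y, -1)\<close> applied to the vacuum is \<open>\<iota> y\<close>, and letters with
  non-negative mode kill the vacuum, so the commutation relator becomes the operator
  product.\<close>

lemma affine_relations:
  assumes V: "universal_affine_sl3 k V \<iota>" and x: "x \<in> sl3" and y: "y \<in> sl3"
  shows "\<iota> x \<in> vspace V" "\<iota> (x + y) = \<iota> x + \<iota> y" "\<iota> (msmul r x) = smul V r (\<iota> x)"
    "nprod V (\<iota> x) (int n) (\<iota> y) =
      (if n = 0 then \<iota> (lie_br x y) else if n = 1 then smul V (trace (x ** y) * k) (vac V) else 0)"
proof -
  interpret vertex_algebra V using V by (simp add: universal_affine_sl3_def)
  have in_V: "\<iota> x \<in> vspace V" if "x \<in> sl3" for x using V that by (auto simp: universal_affine_sl3_def)
  show "\<iota> x \<in> vspace V" by (rule in_V[OF x])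
  have p: "presented_by V affine_words (\<lambda>ws. modes_on V (map (\<lambda>(x, n). (\<iota> x, n)) ws) (vac V)) (affine_relators k)"
    using V by (simp add: universal_affine_sl3_def)
  note rel = presented_relator[OF p]
  note ls = lext_diff[OF ambient] lext_add[OF ambient] lext_single[OF ambient]
  have k3: "Poly_Mapping.keys (a - b - c) \<subseteq> X"
    if "Poly_Mapping.keys a \<subseteq> X" "Poly_Mapping.keys b \<subseteq> X" "Poly_Mapping.keys c \<subseteq> X"
    for a b c :: "('x \<Rightarrow>\<^sub>0 complex)" and X
    using keys_diff[of "a - b" c] keys_diff[of a b] that by blast
  have k4: "Poly_Mapping.keys (a - b - c - f) \<subseteq> X"
    if "Poly_Mapping.keys a \<subseteq> X" "Poly_Mapping.keys b \<subseteq> X" "Poly_Mapping.keys c \<subseteq> X" "Poly_Mapping.keys f \<subseteq> X"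
    for a b c f :: "('x \<Rightarrow>\<^sub>0 complex)" and X
    using keys_diff[of "a - b - c" f] k3[OF that(1-3)] that(4) by blast
  have add_sl3: "x + y \<in> sl3" using x y by (simp add: sl3_def trace_add)
  have smul_sl3: "msmul r x \<in> sl3"
    using x by (simp add: sl3_def msmul_def trace_def flip: sum_distrib_left)
  have nil: "[] \<in> affine_words" by (simp add: affine_words_def)
  have w1: "[(x, n)] \<in> affine_words" if "x \<in> sl3" for x n using that by (simp add: affine_words_def)
  have "lext (smul V) (\<lambda>ws. modes_on V (map (\<lambda>(x, n). (\<iota> x, n)) ws) (vac V))
    (Poly_Mapping.single ([] @ [(x + y, -1)] @ []) 1
        - Poly_Mapping.single ([] @ [(x, -1)] @ []) 1 - Poly_Mapping.single ([] @ [(y, -1)] @ []) 1) = 0"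
  proof (rule rel)
    show "Poly_Mapping.single ([] @ [(x + y, -1)] @ []) 1 - Poly_Mapping.single ([] @ [(x, -1)] @ []) 1
      - Poly_Mapping.single ([] @ [(y, -1)] @ []) 1 \<in> affine_relators k"
      unfolding affine_relators_def using x y nil by blast
  qed (rule k3; use w1[OF x] w1[OF y] w1[OF add_sl3] in simp)
  then have "\<iota> (x + y) - \<iota> x - \<iota> y = 0"
    using in_V x y add_sl3 by (simp add: ls modes_on_def vac_right)
  then show "\<iota> (x + y) = \<iota> x + \<iota> y" by (simp add: algebra_simps)
  have "lext (smul V) (\<lambda>ws. modes_on V (map (\<lambda>(x, n). (\<iota> x, n)) ws) (vac V))
    (Poly_Mapping.single ([] @ [(msmul r x, -1)] @ []) 1
        - Poly_Mapping.single ([] @ [(x, -1)] @ []) r) = 0"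
  proof (rule rel)
    show "Poly_Mapping.single ([] @ [(msmul r x, -1)] @ []) 1 - Poly_Mapping.single ([] @ [(x, -1)] @ []) r
       \<in> affine_relators k"
      unfolding affine_relators_def using x nil by blast
    show "Poly_Mapping.keys (Poly_Mapping.single ([] @ [(msmul r x, -1)] @ []) 1
        - Poly_Mapping.single ([] @ [(x, -1)] @ []) r) \<subseteq> affine_words"
      by (rule order_trans[OF keys_diff]) (use w1[OF x] w1[OF smul_sl3] in auto)
  qed
  then have "\<iota> (msmul r x) - smul V r (\<iota> x) = 0"
    using in_V x smul_sl3 by (simp add: ls modes_on_def vac_right)
  then show "\<iota> (msmul r x) = smul V r (\<iota> x)" by simp
  let ?c = "if int n + (-1) = 0 then of_int (int n) * trace (x ** y) * k else 0"
  have "lext (smul V) (\<lambda>ws. modes_on V (map (\<lambda>(x, n). (\<iota> x, n)) ws) (vac V))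
    (Poly_Mapping.single ([] @ [(x, int n), (y, -1)] @ []) 1 - Poly_Mapping.single ([] @ [(y, -1), (x, int n)] @ []) 1
        - Poly_Mapping.single ([] @ [(lie_br x y, int n + (-1))] @ []) 1
        - Poly_Mapping.single ([] @ []) ?c) = 0"
  proof (rule rel)
    show "Poly_Mapping.single ([] @ [(x, int n), (y, -1)] @ []) 1 - Poly_Mapping.single ([] @ [(y, -1), (x, int n)] @ []) 1
        - Poly_Mapping.single ([] @ [(lie_br x y, int n + (-1))] @ []) 1
        - Poly_Mapping.single ([] @ []) ?c \<in> affine_relators k"
      unfolding affine_relators_def using x y nil by blast
  qed (rule k4; use x y lie_br_sl3[OF x y] nil in \<open>simp add: affine_words_def\<close>)
  then have "nprod V (\<iota> x) (int n) (\<iota> y) = nprod V (\<iota> (lie_br x y)) (int n - 1) (vac V) + smul V ?c (vac V)"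
    using in_V x y lie_br_sl3[OF x y]
    by (simp add: ls modes_on_def vac_right vac_right_nonneg algebra_simps split del: if_split)
  then show "nprod V (\<iota> x) (int n) (\<iota> y) =
      (if n = 0 then \<iota> (lie_br x y) else if n = 1 then smul V (trace (x ** y) * k) (vac V) else 0)"
    using in_V[OF lie_br_sl3[OF x y]] by (auto simp: vac_right vac_right_nonneg)
qed

text \<open>The product of two currents is a current or a multiple of the vacuum, of generator
  weight at most \<open>1 = 1 + 1 - 1\<close>.\<close>

lemma affine_reorderable:
  assumes V: "universal_affine_sl3 k V \<iota>"
  shows "reorderable V {(\<iota> x, 1) | x. x \<in> sl3}" (is "reorderable V ?G")
proof -
  interpret vertex_algebra V using V by (simp add: universal_affine_sl3_def)
  note in_V = affine_relations(1)[OF V]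
  have G: "fst ` ?G \<subseteq> vspace V" using in_V by auto
  show ?thesis
  proof
    show "fst ` ?G \<subseteq> vspace V" by (rule G)
    have p: "presented_by V affine_words (\<lambda>ws. modes_on V (map (\<lambda>(x, n). (\<iota> x, n)) ws) (vac V)) (affine_relators k)"
      using V by (simp add: universal_affine_sl3_def)
    have "(\<lambda>ws. modes_on V (map (\<lambda>(x, n). (\<iota> x, n)) ws) (vac V)) ` affine_words
        \<subseteq> {act ws (vac V) |ws. letters ?G ws}"
    proof clarify
      fix ws assume "ws \<in> affine_words"
      then have "letters ?G (map (\<lambda>(x, n). ((\<iota> x, 1), n)) ws)"
        by (fastforce simp: letters_def affine_words_def)
      moreover have "modes_on V (map (\<lambda>(x, n). (\<iota> x, n)) ws) (vac V) = act (map (\<lambda>(x, n). ((\<iota> x, 1), n)) ws) (vac V)"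
        by (simp add: act_def comp_def case_prod_unfold)
      ultimately show "\<exists>ws'. modes_on V (map (\<lambda>(x, n). (\<iota> x, n)) ws) (vac V) = act ws' (vac V) \<and> letters ?G ws'"
        by blast
    qed
    then show "vspace V \<subseteq> vs.span {act ws (vac V) |ws. letters ?G ws}"
      using presented_span[OF p ambient] vs.span_mono by blast
    fix a p b q assume "(a, p) \<in> ?G" "(b, q) \<in> ?G"
    then obtain x y where xy: "x \<in> sl3" "y \<in> sl3" "a = \<iota> x" "b = \<iota> y" "p = 1" "q = 1" by auto
    have "nprod V a (int n) b \<in> wspan ?G 1 (1 - int n)" for n
    proof -
      have "(\<iota> (lie_br x y), 1) \<in> ?G" using lie_br_sl3[OF xy(1,2)] by blast
      from gen_wspan[OF this G, of 1] vac_in_wspan[of ?G 1] show ?thesis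
        by (auto simp: xy affine_relations(4)[OF V xy(1,2)] vs.subspace_scale vs.subspace_0)
    qed
    then show "(\<forall>n::nat. nprod V a (int n) b \<in> wspan ?G (p + q - 1) (int p + int q - int n - 1)) \<or>
      (\<forall>n::nat. nprod V b (int n) a \<in> wspan ?G (p + q - 1) (int p + int q - int n - 1))"
      by (simp add: xy)
  qed auto
qed

section \<open>Free fields and singular vectors\<close>

text \<open>The elements of \<open>Om m\<close> are the vectors \<open>w \<otimes> e\<^sup>m\<^sup>c\<close> with \<open>w\<close> in a factor commuting with all the
  fields \<open>\<beta>, \<gamma>, c, d, e\<close>.\<close>

locale free_fields = vertex_algebra T for T :: "'t::ab_group_add vert_alg" +
  fixes \<beta> \<gamma> c d :: 't and e :: "int \<Rightarrow> 't" and Om :: "int \<Rightarrow> 't set"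
  assumes fields_in [simp]: "\<beta> \<in> vspace T" "\<gamma> \<in> vspace T" "c \<in> vspace T" "d \<in> vspace T" "e m \<in> vspace T"
    and beta_gamma: "nprod T \<beta> (int n) \<gamma> = (if n = 0 then vac T else 0)"
    and beta_beta: "nprod T \<beta> (int n) \<beta> = 0" and gamma_gamma: "nprod T \<gamma> (int n) \<gamma> = 0"
    and c_d: "nprod T c (int n) d = (if n = 1 then smul T 2 (vac T) else 0)"
    and c_c: "nprod T c (int n) c = 0" and d_d: "nprod T d (int n) d = 0"
    and c_e: "nprod T c (int n) (e m) = 0"
    and d_e: "nprod T d (int n) (e m) = (if n = 0 then smul T (2 * of_int m) (e m) else 0)"
    and transl_e: "transl T (e m) = smul T (of_int m) (nprod T c (-1) (e m))"
    and e_e: "nprod T (e m) (int n) (e l) = 0" "nprod T (e m) (-1) (e l) = e (m + l)" and e_0: "e 0 = vac T"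
    and cross: "a \<in> {\<beta>, \<gamma>} \<Longrightarrow> b \<in> {c, d} \<union> range e \<Longrightarrow> nprod T a (int n) b = 0"
    and Om_subspace: "vs.subspace (Om m)"
    and Om_in: "x \<in> Om m \<Longrightarrow> x \<in> vspace T"
    and Om_beta: "x \<in> Om m \<Longrightarrow> nprod T \<beta> (int n) x = 0"
    and Om_gamma: "x \<in> Om m \<Longrightarrow> nprod T \<gamma> (int n) x = 0"
    and Om_c: "x \<in> Om m \<Longrightarrow> nprod T c (int n) x = 0"
    and Om_d: "x \<in> Om m \<Longrightarrow> nprod T d (int n) x = (if n = 0 then smul T (2 * of_int m) x else 0)"
    and Om_e: "x \<in> Om m \<Longrightarrow> nprod T (e l) (int n) x = 0"
      "x \<in> Om m \<Longrightarrow> nprod T (e l) (-1) x \<in> Om (m + l)"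
      "x \<in> Om m \<Longrightarrow> nprod T (e 1) (-1) (nprod T (e (-1)) (-1) x) = x"
    and generated: "vspace T \<subseteq> vs.span {modes_on T ws x | ws x m.
        (\<forall>(a, q)\<in>set ws. a \<in> {\<beta>, \<gamma>, c, d} \<and> q < 0) \<and> x \<in> Om m}"
begin

lemma d_c: "nprod T d (int n) c = (if n = 1 then smul T 2 (vac T) else 0)"
  using ope_scalar_swap[of c d 1 2 n] c_d by simp

lemma comm_simple:
  assumes "a \<in> vspace T" "b \<in> vspace T" "x \<in> vspace T"
    and ope: "\<And>n::nat. nprod T a (int n) b = (if n = N then smul T r (vac T) else 0)"
  shows "nprod T a m (nprod T b q x) = nprod T b q (nprod T a m x) +
      (if m + q = int N - 1 then smul T ((of_int m gchoose N) * r) x else 0)"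
proof -
  have "nprod T a m (nprod T b q x) - nprod T b q (nprod T a m x) =
     smul T (of_int m gchoose N) (nprod T (nprod T a (int N) b) (m + q - int N) x)"
    unfolding commutator[OF assms(1-3)]
    by (rule Sum_any_single) (use ope assms(3) in auto)
  also have "\<dots> = (if m + q = int N - 1 then smul T ((of_int m gchoose N) * r) x else 0)"
    using ope[of N] assms(3) by (auto simp: nprod_smul_left vac_left)
  finally show ?thesis by (simp add: algebra_simps)
qed

context
  fixes x assumes x [simp]: "x \<in> vspace T"
begin

lemma comm_beta_gamma: "nprod T \<beta> m (nprod T \<gamma> q x) = nprod T \<gamma> q (nprod T \<beta> m x) + (if m + q = -1 then x else 0)"
  using comm_simple[of \<beta> \<gamma> x 0 1 m q] beta_gamma by simp

lemma comm_gamma_beta: "nprod T \<gamma> m (nprod T \<beta> q x) = nprod T \<beta> q (nprod T \<gamma> m x) - (if m + q = -1 then x else 0)"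
  using comm_beta_gamma[of q m] by (simp add: add.commute)

lemma comm_c_d: "nprod T c m (nprod T d q x) = nprod T d q (nprod T c m x) + (if m + q = 0 then smul T (2 * of_int m) x else 0)"
  using comm_simple[of c d x 1 2 m q] c_d by (simp add: mult.commute)

lemma comm_d_c: "nprod T d m (nprod T c q x) = nprod T c q (nprod T d m x) + (if m + q = 0 then smul T (2 * of_int m) x else 0)"
  using comm_simple[of d c x 1 2 m q] d_c by (simp add: mult.commute)

lemma comm_same: "nprod T \<beta> m (nprod T \<beta> q x) = nprod T \<beta> q (nprod T \<beta> m x)"
  "nprod T \<gamma> m (nprod T \<gamma> q x) = nprod T \<gamma> q (nprod T \<gamma> m x)"
  "nprod T c m (nprod T c q x) = nprod T c q (nprod T c m x)"
  "nprod T d m (nprod T d q x) = nprod T d q (nprod T d m x)"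
  "nprod T (e l) m (nprod T (e l') q x) = nprod T (e l') q (nprod T (e l) m x)"
  by (rule commute_modes; simp add: beta_beta gamma_gamma c_c d_d e_e)+

lemma comm_c_e: "nprod T c m (nprod T (e l) q x) = nprod T (e l) q (nprod T c m x)"
  by (rule commute_modes) (simp_all add: c_e)

lemma comm_cross:
  assumes "a \<in> {\<beta>, \<gamma>}" "b \<in> {c, d} \<union> range e"
  shows "nprod T a m (nprod T b q x) = nprod T b q (nprod T a m x)"
  using assms by (intro commute_modes) (auto simp: cross)

end

lemmas comm_fields = comm_cross[of _ \<beta> c] comm_cross[of _ \<beta> d] comm_cross[of _ \<gamma> c] comm_cross[of _ \<gamma> d]
  comm_cross[of _ \<beta> "e l" for l] comm_cross[of _ \<gamma> "e l" for l]

text \<open>Filtration by the number \<open>r\<close> of creation letters. The bound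
  \<open>R\<close> on their modes is there so that the operator counting them can be a finite
  sum.\<close>

definition words :: "nat \<Rightarrow> nat \<Rightarrow> 't set" where
  "words r R = vs.span {modes_on T ws x | ws x m.
     (\<forall>(a, q)\<in>set ws. a \<in> {\<beta>, \<gamma>, c, d} \<and> q < 0 \<and> q \<ge> - int R) \<and> length ws \<le> r \<and> x \<in> Om m}"

definition top :: "'t set" where "top = vs.span (\<Union>m. Om m)"

lemma words_0: "words 0 R = top"
proof -
  have "{modes_on T ws x | ws x m. (\<forall>(a, q)\<in>set ws. a \<in> {\<beta>, \<gamma>, c, d} \<and> q < 0 \<and> q \<ge> - int R)
      \<and> length ws \<le> 0 \<and> x \<in> Om m} = (\<Union>m. Om m)"
    by (force simp: modes_on_def)
  then show ?thesis by (simp add: words_def top_def)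
qed

lemma subspace_words [simp, intro]: "vs.subspace (words r R)"
  by (simp add: words_def)

lemma words_mono: "r \<le> r' \<Longrightarrow> R \<le> R' \<Longrightarrow> words r R \<subseteq> words r' R'"
  unfolding words_def by (rule vs.span_mono) force

lemma word_in_vspace:
  assumes "\<forall>(a, q)\<in>set ws. a \<in> {\<beta>, \<gamma>, c, d} \<and> q < 0 \<and> q \<ge> - int R" "x \<in> Om m"
  shows "modes_on T ws x \<in> vspace T"
  by (rule modes_on_in) (use assms Om_in in fastforce)+

lemma words_in: "words r R \<subseteq> vspace T"
  unfolding words_def by (rule span_subset_vspace) (use word_in_vspace in blast)

text \<open>The property is indexed by the number of letters, since the facts proved with it, such
  as \<open>euler_words\<close>, depend on the exact length; \<open>mono\<close> is what finally
  combines words of different lengths.\<close>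

lemma words_induct [consumes 1, case_names top letter add smul mono]:
  assumes v: "v \<in> words r R"
    and top: "\<And>x m. x \<in> Om m \<Longrightarrow> Q 0 x"
    and letter: "\<And>n a q y. \<lbrakk>n < r; a \<in> {\<beta>, \<gamma>, c, d}; q < 0; q \<ge> - int R; y \<in> words n R; Q n y\<rbrakk>
        \<Longrightarrow> Q (Suc n) (nprod T a q y)"
    and sum: "\<And>n x y. x \<in> words n R \<Longrightarrow> y \<in> words n R \<Longrightarrow> Q n x \<Longrightarrow> Q n y \<Longrightarrow> Q n (x + y)"
    and smul: "\<And>n x s. x \<in> words n R \<Longrightarrow> Q n x \<Longrightarrow> Q n (smul T s x)"
    and mono: "\<And>n x. n \<le> r \<Longrightarrow> x \<in> words n R \<Longrightarrow> Q n x \<Longrightarrow> Q r x"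
  shows "Q r v"
proof -
  have word: "modes_on T ws x \<in> words (length ws) R \<and> Q (length ws) (modes_on T ws x)"
    if "\<forall>(a, q)\<in>set ws. a \<in> {\<beta>, \<gamma>, c, d} \<and> q < 0 \<and> q \<ge> - int R" "x \<in> Om m" "length ws \<le> r" for ws x m
    using that
  proof (induction ws)
    case Nil
    then show ?case using top words_0 by (auto simp: modes_on_def top_def intro: vs.span_base)
  next
    case (Cons l ws)
    obtain a q where l: "l = (a, q)" by fastforce
    have eq: "modes_on T (l # ws) x = nprod T a q (modes_on T ws x)" by (simp add: modes_on_def l)
    have "modes_on T (l # ws) x \<in> words (length (l # ws)) R"
      unfolding words_def
      by (rule vs.span_base, intro CollectI exI[of _ "l # ws"] exI[of _ x] exI[of _ m]) (use Cons.prems in auto)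
    moreover have "Q (length (l # ws)) (modes_on T (l # ws) x)"
      unfolding eq using letter[of "length ws" a q "modes_on T ws x"] Cons l by auto
    ultimately show ?case by blast
  qed
  have "v \<in> words r R \<and> Q r v"
    using v unfolding words_def
  proof (induction rule: vs.span_induct_alt)
    case base
    have "Q 0 0" using top[of 0 0] vs.subspace_0[OF Om_subspace] by blast
    then show ?case using mono[of 0 0] vs.subspace_0[OF subspace_words] by (simp add: vs.span_zero)
  next
    case (step s x y)
    then obtain ws z m where z: "x = modes_on T ws z" "z \<in> Om m" "length ws \<le> r"
      "\<forall>(a, q)\<in>set ws. a \<in> {\<beta>, \<gamma>, c, d} \<and> q < 0 \<and> q \<ge> - int R" by blast
    have x: "x \<in> words r R" "Q r x"
      using word[OF z(4,2,3)] z(1,3) words_mono[of "length ws" r R R] mono[of "length ws"] by auto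
    have y: "y \<in> words r R" "Q r y" using step(2) by (auto simp: words_def)
    have sx: "smul T s x \<in> words r R" using x(1) vs.subspace_scale subspace_words by blast
    have "smul T s x + y \<in> words r R" using sx y vs.subspace_add subspace_words by blast
    then show ?case using sum[OF sx y(1) smul[OF x] y(2)] by (simp add: words_def)
  qed
  then show ?thesis by blast
qed

lemma letter_in_words:
  assumes "a \<in> {\<beta>, \<gamma>, c, d}" "q < 0" "q \<ge> - int R" "y \<in> words n R"
  shows "nprod T a q y \<in> words (Suc n) R"
proof -
  have a: "a \<in> vspace T" using assms(1) by auto
  have "y \<in> {y \<in> vspace T. nprod T a q y \<in> words (Suc n) R}"
  proof (rule subsetD[OF vs.span_minimal assms(4)[unfolded words_def]])
    show "vs.subspace {y \<in> vspace T. nprod T a q y \<in> words (Suc n) R}"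
      by (rule subspace_preimage_right[OF subspace_words a])
    show "{modes_on T ws x | ws x m. (\<forall>(a, q)\<in>set ws. a \<in> {\<beta>, \<gamma>, c, d} \<and> q < 0 \<and> q \<ge> - int R)
        \<and> length ws \<le> n \<and> x \<in> Om m} \<subseteq> {y \<in> vspace T. nprod T a q y \<in> words (Suc n) R}"
    proof clarify
      fix ws x m
      assume ws: "\<forall>(a, q)\<in>set ws. a \<in> {\<beta>, \<gamma>, c, d} \<and> q < 0 \<and> q \<ge> - int R" "length ws \<le> n" "x \<in> Om m"
      have "modes_on T ((a, q) # ws) x \<in> words (Suc n) R"
        unfolding words_def
        by (rule vs.span_base, intro CollectI exI[of _ "(a, q) # ws"] exI[of _ x] exI[of _ m])
          (use ws assms in simp)
      then show "modes_on T ws x \<in> vspace T \<and> nprod T a q (modes_on T ws x) \<in> words (Suc n) R"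
        using word_in_vspace[OF ws(1,3)] by (simp add: modes_on_def)
    qed
  qed
  then show ?thesis by simp
qed

lemma vspace_words: assumes "v \<in> vspace T" shows "\<exists>r R. v \<in> words r R"
proof -
  have "v \<in> vs.span {modes_on T ws x | ws x m. (\<forall>(a, q)\<in>set ws. a \<in> {\<beta>, \<gamma>, c, d} \<and> q < 0) \<and> x \<in> Om m}"
    using assms generated by blast
  then show ?thesis
  proof (induction rule: vs.span_induct_alt)
    case base
    show ?case using vs.subspace_0[OF subspace_words] by blast
  next
    case (step s x y)
    then obtain ws z m where z: "x = modes_on T ws z" "z \<in> Om m"
      "\<forall>(a, q)\<in>set ws. a \<in> {\<beta>, \<gamma>, c, d} \<and> q < 0" by blast
    obtain r R where y: "y \<in> words r R" using step by blast
    have "\<exists>R. \<forall>(a, q)\<in>set ws. q \<ge> - int R"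
    proof -
      have "\<forall>(a, q)\<in>set ws. q \<ge> - int (nat (Max ((\<lambda>(a, q). - q) ` set ws)))"
      proof clarify
        fix a q assume aq: "(a, q) \<in> set ws"
        then have "- q \<le> Max ((\<lambda>(a, q). - q) ` set ws)" by (intro Max_ge) force+
        moreover have "q < 0" using z(3) aq by auto
        ultimately show "- int (nat (Max ((\<lambda>(a, q). - q) ` set ws))) \<le> q" by linarith
      qed
      then show ?thesis by blast
    qed
    then obtain R' where R': "\<forall>(a, q)\<in>set ws. q \<ge> - int R'" by blast
    have "x \<in> words (length ws) R'"
      unfolding words_def z(1)
      by (rule vs.span_base, intro CollectI exI[of _ ws] exI[of _ z] exI[of _ m]) (use z R' in auto)
    then have "x \<in> words (max r (length ws)) (max R R')" "y \<in> words (max r (length ws)) (max R R')"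
      using y words_mono[of "length ws" "max r (length ws)" R' "max R R'"]
        words_mono[of r "max r (length ws)" R "max R R'"] by auto
    then show ?case using vs.subspace_add[OF subspace_words] vs.subspace_scale[OF subspace_words] by blast
  qed
qed

lemma top_in: "x \<in> top \<Longrightarrow> x \<in> vspace T"
  using words_in[of 0 0] by (auto simp: words_0)

lemma subspace_top [simp, intro]: "vs.subspace top"
  by (simp add: top_def)

lemma top_kill:
  assumes "x \<in> top"
  shows "nprod T \<beta> (int n) x = 0" "nprod T \<gamma> (int n) x = 0" "nprod T c (int n) x = 0"
    "nprod T (e l) (int n) x = 0" "n \<ge> 1 \<Longrightarrow> nprod T d (int n) x = 0" "nprod T d 0 x \<in> top"
proof -
  have "x \<in> {x \<in> vspace T. nprod T \<beta> (int n) x \<in> {0}}" "x \<in> {x \<in> vspace T. nprod T \<gamma> (int n) x \<in> {0}}"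
    "x \<in> {x \<in> vspace T. nprod T c (int n) x \<in> {0}}" "x \<in> {x \<in> vspace T. nprod T (e l) (int n) x \<in> {0}}"
    by (rule subsetD[OF vs.span_minimal assms[unfolded top_def]],
        use Om_in Om_beta Om_gamma Om_c Om_e in blast,
        rule subspace_preimage_right[OF vs.subspace_single_0], simp)+
  then show "nprod T \<beta> (int n) x = 0" "nprod T \<gamma> (int n) x = 0" "nprod T c (int n) x = 0"
    "nprod T (e l) (int n) x = 0" by auto
  have "x \<in> {x \<in> vspace T. nprod T d (int n) x \<in> {0}}" if "n \<ge> 1"
  proof (rule subsetD[OF vs.span_minimal assms[unfolded top_def]])
    show "(\<Union>m. Om m) \<subseteq> {x \<in> vspace T. nprod T d (int n) x \<in> {0}}"
      using that Om_in Om_d by auto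
  qed (rule subspace_preimage_right[OF vs.subspace_single_0], simp)
  then show "n \<ge> 1 \<Longrightarrow> nprod T d (int n) x = 0" by auto
  have "x \<in> {x \<in> vspace T. nprod T d 0 x \<in> top}"
  proof (rule subsetD[OF vs.span_minimal assms[unfolded top_def]])
    show "(\<Union>m. Om m) \<subseteq> {x \<in> vspace T. nprod T d 0 x \<in> top}"
    proof clarify
      fix x m assume x: "x \<in> Om m"
      have "smul T (2 * of_int m) x \<in> top"
        unfolding top_def by (rule vs.span_scale, rule vs.span_base) (use x in blast)
      then show "x \<in> vspace T \<and> nprod T d 0 x \<in> top" using Om_in[OF x] Om_d[OF x, of 0] by simp
    qed
    show "vs.subspace {x \<in> vspace T. nprod T d 0 x \<in> top}"
      by (rule subspace_preimage_right[OF subspace_top]) simp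
  qed
  then show "nprod T d 0 x \<in> top" by simp
qed

text \<open>The Euler operator counts the letters of a word with modes at least \<open>-R\<close>.\<close>

definition euler :: "nat \<Rightarrow> 't \<Rightarrow> 't" where
  "euler R y = (\<Sum>n<R. nprod T \<gamma> (- int n - 1) (nprod T \<beta> (int n) y) - nprod T \<beta> (- int n - 1) (nprod T \<gamma> (int n) y)
     + smul T (1 / (2 * (of_nat n + 1)))
        (nprod T c (- int n - 1) (nprod T d (int n + 1) y) + nprod T d (- int n - 1) (nprod T c (int n + 1) y)))"

lemma euler_in: "y \<in> vspace T \<Longrightarrow> euler R y \<in> vspace T"
  unfolding euler_def by (rule sum_in_vspace) simp

lemma euler_add: "x \<in> vspace T \<Longrightarrow> y \<in> vspace T \<Longrightarrow> euler R (x + y) = euler R x + euler R y"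
  unfolding euler_def sum.distrib[symmetric]
  by (rule sum.cong) (simp_all add: nprod_linear vs.scale_right_distrib algebra_simps)

lemma euler_smul: "y \<in> vspace T \<Longrightarrow> euler R (smul T s y) = smul T s (euler R y)"
  unfolding euler_def vs.scale_sum_right
  by (rule sum.cong) (simp_all add: nprod_linear vs.scale_right_distrib vs.scale_right_diff_distrib mult.commute)

text \<open>The only summand that fails to commute with the letter of mode
  \<open>q = - p - 1\<close> is the one with index \<open>p\<close>. Its commutators are 1 for
  \<beta>(p) with \<gamma>, -1 for \<gamma>(p) with \<beta>, and \<open>2 (p + 1)\<close> for the
  pair \<open>c\<close>, \<open>d\<close>, which explains the sign and the denominator in
  \<open>euler\<close>.\<close>

lemma euler_letter:
  assumes a: "a \<in> {\<beta>, \<gamma>, c, d}" and q: "q < 0" "q \<ge> - int R" and y: "y \<in> vspace T"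
  shows "euler R (nprod T a q y) = nprod T a q (euler R y) + nprod T a q y"
proof -
  define p where "p = nat (- q - 1)"
  have p: "p < R" "q = - int p - 1" using q by (auto simp: p_def)
  have aT: "a \<in> vspace T" using a by auto
  let ?t = "\<lambda>n y. nprod T \<gamma> (- int n - 1) (nprod T \<beta> (int n) y) - nprod T \<beta> (- int n - 1) (nprod T \<gamma> (int n) y)
     + smul T (1 / (2 * (of_nat n + 1)))
        (nprod T c (- int n - 1) (nprod T d (int n + 1) y) + nprod T d (- int n - 1) (nprod T c (int n + 1) y))"
  have t: "?t n (nprod T a q y) = nprod T a q (?t n y) + (if n = p then nprod T a q y else 0)" for n
  proof -
    have i: "int n + q = -1 \<longleftrightarrow> n = p" "int n + 1 + q = 0 \<longleftrightarrow> n = p" using p(2) by auto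
    have "(2 * (of_nat n + 1) :: complex) = of_nat (2 * Suc n)" by simp
    then have nz: "(2 * (of_nat n + 1) :: complex) \<noteq> 0" by (simp only: of_nat_eq_0_iff) simp
    have m: "2 * (of_int (int n + 1) :: complex) = 2 * (of_nat n + 1)" by simp
    have neg: "\<not> (- int n - 1 + q = -1)" "\<not> (- int n - 1 + q = 0)" using q(1) by auto
    note left = comm_cross[where m = q and b = c, symmetric] comm_cross[where m = q and b = d, symmetric]
    note right = comm_cross[where q = q and a = \<beta>] comm_cross[where q = q and a = \<gamma>]
    have delta: "?t n (nprod T a q y) = nprod T a q (?t n y)" if "n \<noteq> p"
    proof -
      from a consider "a = \<beta>" | "a = \<gamma>" | "a = c" | "a = d" by auto
      then show ?thesis
      proof cases
        case 1
        show ?thesis using y that unfolding 1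
          by (simp add: comm_gamma_beta[where q = q] comm_same(1)[where q = q] left[where a = \<beta>] i neg nprod_linear)
      next
        case 2
        show ?thesis using y that unfolding 2
          by (simp add: comm_beta_gamma[where q = q] comm_same(2)[where q = q] left[where a = \<gamma>] i neg nprod_linear)
      next
        case 3
        show ?thesis using y that unfolding 3
          by (simp add: comm_d_c[where q = q] comm_same(3)[where q = q] right[where b = c] i neg nprod_linear)
      next
        case 4
        show ?thesis using y that unfolding 4
          by (simp add: comm_c_d[where q = q] comm_same(4)[where q = q] right[where b = d] i neg nprod_linear)
      qed
    qed
    have "?t n (nprod T a q y) = nprod T a q (?t n y) + nprod T a q y" if np: "n = p"
    proof -
      have qn: "- int n - 1 = q" using p(2) np by simp
      have iq: "int n + q = -1" "int n + 1 + q = 0" "2 * q \<noteq> -1" "q + q \<noteq> 0" using p(2) np by presburger+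
      from a consider "a = \<beta>" | "a = \<gamma>" | "a = c" | "a = d" by auto
      then show ?thesis
      proof cases
        case 1
        show ?thesis using y unfolding 1 qn
          by (simp add: comm_gamma_beta[where q = q and m = "int n"] comm_gamma_beta[where q = q and m = q]
              comm_same(1)[where q = q and m = "int n"] left[where a = \<beta>] iq nprod_linear)
      next
        case 2
        show ?thesis using y unfolding 2 qn
          by (simp add: comm_beta_gamma[where q = q and m = "int n"] comm_beta_gamma[where q = q and m = q]
              comm_same(2)[where q = q and m = "int n"] left[where a = \<gamma>] iq nprod_linear)
      next
        case 3
        show ?thesis using y nz unfolding 3 qn
          by (simp add: comm_d_c[where q = q and m = "int n + 1"] comm_d_c[where q = q and m = q]
              comm_same(3)[where q = q and m = "int n + 1"] right[where b = c] iq m nprod_linear vs.scale_right_distrib)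
      next
        case 4
        show ?thesis using y nz unfolding 4 qn
          by (simp add: comm_c_d[where q = q and m = "int n + 1"] comm_c_d[where q = q and m = q]
              comm_same(4)[where q = q and m = "int n + 1"] right[where b = d] iq m nprod_linear vs.scale_right_distrib)
      qed
    qed
    then show ?thesis using delta by simp
  qed
  have "euler R (nprod T a q y) = (\<Sum>n<R. nprod T a q (?t n y)) + (\<Sum>n<R. if n = p then nprod T a q y else 0)"
    unfolding euler_def t sum.distrib ..
  also have "(\<Sum>n<R. nprod T a q (?t n y)) = nprod T a q (euler R y)"
    unfolding euler_def by (rule nprod_sum_right[symmetric]) (use y aT in auto)
  also have "(\<Sum>n<R. if n = p then nprod T a q y else 0) = nprod T a q y" using p(1) by simp
  finally show ?thesis .
qed

lemma euler_Om: "x \<in> Om m \<Longrightarrow> euler R x = 0"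
  unfolding euler_def
proof (rule sum.neutral, rule ballI)
  fix n assume x: "x \<in> Om m"
  have "nprod T d (int n + 1) x = 0" "nprod T c (int n + 1) x = 0"
    using Om_d[OF x, of "Suc n"] Om_c[OF x, of "Suc n"] by (simp_all add: add.commute)
  then show "nprod T \<gamma> (- int n - 1) (nprod T \<beta> (int n) x) - nprod T \<beta> (- int n - 1) (nprod T \<gamma> (int n) x)
     + smul T (1 / (2 * (of_nat n + 1)))
        (nprod T c (- int n - 1) (nprod T d (int n + 1) x) + nprod T d (- int n - 1) (nprod T c (int n + 1) x)) = 0"
    using Om_beta[OF x] Om_gamma[OF x] by simp
qed

text \<open>On a word with \<open>s \<le> r\<close> letters the operator \<open>euler R - r\<close>
  is multiplication by \<open>s - r\<close>, which is zero on words of full length. The clause for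
  \<open>r = 0\<close> is separate because \<open>r - 1\<close> is then 0 again.\<close>

lemma euler_words:
  assumes "v \<in> words r R"
  shows "(r = 0 \<longrightarrow> euler R v = 0) \<and> euler R v - smul T (of_nat r) v \<in> words (r - 1) R"
  using assms
proof (induction r v rule: words_induct)
  case (top x m)
  then show ?case using euler_Om vs.subspace_0[OF subspace_words] by simp
next
  case (letter n a q y)
  have y: "y \<in> vspace T" "a \<in> vspace T" using letter words_in by auto
  have "euler R (nprod T a q y) - smul T (of_nat (Suc n)) (nprod T a q y) = nprod T a q (euler R y - smul T (of_nat n) y)"
    using y euler_in by (simp add: euler_letter[OF letter(2-4)] nprod_linear vs.scale_left_distrib)
  also have "\<dots> \<in> words n R"
  proof (cases "n = 0")
    case True
    then have "euler R y - smul T (of_nat n) y = 0" using letter by simp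
    then show ?thesis using y vs.subspace_0[OF subspace_words] by simp
  next
    case False
    then show ?thesis using letter(6) letter_in_words[OF letter(2-4), of "euler R y - smul T (of_nat n) y" "n - 1"] by simp
  qed
  finally show ?case by simp
next
  case (add n x y)
  then have xy: "x \<in> vspace T" "y \<in> vspace T" using words_in by auto
  have "euler R (x + y) - smul T (of_nat n) (x + y)
    = (euler R x - smul T (of_nat n) x) + (euler R y - smul T (of_nat n) y)"
    using xy by (simp add: euler_add vs.scale_right_distrib)
  also have "\<dots> \<in> words (n - 1) R" using add vs.subspace_add[OF subspace_words] by blast
  finally show ?case using add xy by (simp add: euler_add)
next
  case (smul n x s)
  then have x: "x \<in> vspace T" using words_in by auto
  have "euler R (smul T s x) - smul T (of_nat n) (smul T s x) = smul T s (euler R x - smul T (of_nat n) x)"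
    using x by (simp add: euler_smul vs.scale_right_diff_distrib mult.commute)
  also have "\<dots> \<in> words (n - 1) R" using smul vs.subspace_scale[OF subspace_words] by blast
  finally show ?case using smul x by (simp add: euler_smul)
next
  case (mono n x)
  show ?case
  proof (cases "n = r")
    case False
    then have n: "n \<le> r - 1" "r \<noteq> 0" using mono by auto
    have "euler R x = (euler R x - smul T (of_nat n) x) + smul T (of_nat n) x" by simp
    also have "\<dots> \<in> words n R"
      using mono words_mono[of "n - 1" n R R]
      by (intro vs.subspace_add[OF subspace_words] vs.subspace_scale[OF subspace_words]) auto
    finally have "euler R x \<in> words (r - 1) R" "x \<in> words (r - 1) R"
      using words_mono[OF n(1), of R R] mono by auto
    then show ?thesis
      using n(2) by (simp add: vs.subspace_diff[OF subspace_words] vs.subspace_scale[OF subspace_words])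
  qed (use mono in simp)
qed

text \<open>Every term of \<open>euler R\<close> ends in one of the annihilating modes, so
  \<open>euler R v = 0\<close>. If \<open>v\<close> has at most \<open>r + 1\<close> letters, then
  \<open>-(r + 1) v\<close> has at most \<open>r\<close>, and the length descends to 0.\<close>

lemma fock_vacuum:
  assumes v: "v \<in> vspace T" and kill: "\<And>n::nat. nprod T \<beta> (int n) v = 0" "\<And>n::nat. nprod T \<gamma> (int n) v = 0"
    "\<And>n::nat. n \<ge> 1 \<Longrightarrow> nprod T c (int n) v = 0" "\<And>n::nat. n \<ge> 1 \<Longrightarrow> nprod T d (int n) v = 0"
  shows "v \<in> top"
proof -
  have z: "euler R v = 0" for R
    unfolding euler_def using kill(3)[of "Suc _"] kill(4)[of "Suc _"] kill(1,2)
    by (intro sum.neutral) (simp add: add.commute)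
  obtain r R where "v \<in> words r R" using vspace_words[OF v] by blast
  then have "v \<in> words 0 R"
  proof (induction r)
    case (Suc r)
    have "- smul T (of_nat (Suc r)) v \<in> words r R" using euler_words[OF Suc.prems] z by simp
    from vs.subspace_scale[OF subspace_words this, of "- 1 / of_nat (Suc r)"]
    have "v \<in> words r R" by (simp del: of_nat_Suc)
    then show ?case by (rule Suc.IH)
  qed
  then show ?thesis by (simp add: words_0)
qed

text \<open>A positive mode of \<open>c\<close> commutes with all letters except those of
  \<open>d\<close>, where the commutator is a scalar: it deletes a letter.\<close>

lemma c_lowers_words:
  assumes "v \<in> words r R" "j \<ge> 1"
  shows "(r = 0 \<longrightarrow> nprod T c (int j) v = 0) \<and> nprod T c (int j) v \<in> words (r - 1) R"
  using assms(1)
proof (induction r v rule: words_induct)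
  case (top x m)
  then show ?case using Om_c vs.subspace_0[OF subspace_words] by simp
next
  case (letter n a q y)
  have y: "y \<in> vspace T" "a \<in> vspace T" using letter words_in by auto
  have "\<exists>s. nprod T c (int j) (nprod T a q y) = nprod T a q (nprod T c (int j) y) + smul T s y"
  proof -
    from letter(2) consider "a = \<beta>" | "a = \<gamma>" | "a = c" | "a = d" by auto
    then show ?thesis
    proof cases
      case 4
      then show ?thesis using y(1) comm_c_d[of y "int j" q]
        by (intro exI[of _ "if int j + q = 0 then 2 * of_int (int j) else 0"]) simp
    qed (use y(1) in \<open>auto intro!: exI[of _ 0] simp: comm_fields comm_same(3)\<close>)
  qed
  then obtain s where s: "nprod T c (int j) (nprod T a q y) = nprod T a q (nprod T c (int j) y) + smul T s y" by blast
  have "nprod T a q (nprod T c (int j) y) \<in> words n R"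
  proof (cases "n = 0")
    case True
    then show ?thesis using letter y vs.subspace_0[OF subspace_words] by simp
  next
    case False
    then show ?thesis using letter(6) letter_in_words[OF letter(2-4), of "nprod T c (int j) y" "n - 1"] by simp
  qed
  then show ?case
    using s letter(5) vs.subspace_add[OF subspace_words] vs.subspace_scale[OF subspace_words] by simp
next
  case (add n x y)
  then have xy: "x \<in> vspace T" "y \<in> vspace T" using words_in by auto
  then show ?case using add vs.subspace_add[OF subspace_words] by (simp add: nprod_linear)
next
  case (smul n x s)
  then have x: "x \<in> vspace T" using words_in by auto
  then show ?case using smul vs.subspace_scale[OF subspace_words] by (simp add: nprod_linear)
next
  case (mono n x)
  then show ?case using words_mono[of "n - 1" "r - 1" R R] diff_le_mono[of n r 1]
    by (cases "n = 0") (auto simp: vs.subspace_0[OF subspace_words])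
qed

text \<open>\<open>c\<close> and \<open>d\<close> have only a double pole, so \<open>c(0)\<close>
  commutes with all letters, and it kills every \<open>Om m\<close>.\<close>

lemma c_zero_mode: assumes "v \<in> vspace T" shows "nprod T c 0 v = 0"
proof -
  obtain r R where "v \<in> words r R" using vspace_words[OF assms] by blast
  then show ?thesis
  proof (induction r v rule: words_induct)
    case (top x m)
    then show ?case using Om_c[of x m 0] by simp
  next
    case (letter n a q y)
    have y: "y \<in> vspace T" "a \<in> vspace T" using letter words_in by auto
    from letter(2) consider "a = \<beta>" | "a = \<gamma>" | "a = c" | "a = d" by auto
    then have "nprod T c 0 (nprod T a q y) = nprod T a q (nprod T c 0 y)"
      by cases (use y(1) in \<open>simp_all add: comm_fields comm_same(3) comm_c_d\<close>)
    then show ?case using letter(6) y by simp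
  next
    case (add n x y)
    then show ?case using words_in by (simp add: nprod_linear subset_iff)
  next
    case (smul n x s)
    then show ?case using words_in by (simp add: nprod_linear subset_iff)
  qed
qed

text \<open>Modes of both sides of the identity that the derivative of \<open>e^(lc)\<close> is
  \<open>l\<close> times the normally ordered product of \<open>c\<close> and
  \<open>e^(lc)\<close>.\<close>

lemma e_mode_relation:
  assumes "v \<in> vspace T"
  shows "smul T (- of_int i) (nprod T (e l) (i - 1) v) = smul T (of_int l)
    (Sum_any (\<lambda>j::nat. nprod T c (- 1 - int j) (nprod T (e l) (i + int j) v) +
                      nprod T (e l) (i - 1 - int j) (nprod T c (int j) v)))"
  using assms transl_modes[of "e l" v i] unfolding transl_e
  by (simp add: nprod_linear nop_modes)

text \<open>When the non-negative modes of \<open>c\<close> kill \<open>u\<close>,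
  \<open>e_mode_relation\<close> expresses \<open>e(i - 1) u\<close> by the vectors
  \<open>e(i + j) u\<close>, so the vanishing spreads to all modes of \<open>e l\<close>. Since
  \<open>e (- l)\<close> is inverse to \<open>e l\<close>, nothing but \<open>u = 0\<close> is
  possible.\<close>

lemma e_kernel:
  assumes u: "u \<in> vspace T" and c0: "\<And>j::nat. j \<ge> 1 \<Longrightarrow> nprod T c (int j) u = 0"
    and e0: "\<And>q. q \<ge> -1 \<Longrightarrow> nprod T (e l) q u = 0"
  shows "u = 0"
proof -
  have c: "nprod T c (int j) u = 0" for j using c0[of j] c_zero_mode[OF u] by (cases "j = 0") auto
  have below: "nprod T (e l) q u = 0" if "q \<ge> - 1 - int a" for a q
    using that
  proof (induction a arbitrary: q)
    case (Suc a)
    show ?case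
    proof (cases "q = - 2 - int a")
      case True
      \<comment> \<open>The relation carries the factor \<open>-i\<close>, nonzero for these
        indices. At \<open>i = 0\<close> it would give no information about mode -1, which is why
        that mode belongs to the assumptions.\<close>
      let ?i = "- 1 - int a"
      have "smul T (- of_int ?i) (nprod T (e l) (?i - 1) u) = 0"
        unfolding e_mode_relation[OF u] by (subst Sum_any_zero) (use Suc.IH c in auto)
      moreover have "?i - 1 = q" using True by simp
      moreover have "(- of_int ?i :: complex) \<noteq> 0" by (simp only: neg_equal_0_iff_equal of_int_eq_0_iff)
      ultimately show ?thesis by (simp add: vs.scale_eq_0_iff)
    next
      case False
      then show ?thesis using Suc by auto
    qed
  qed (use e0 in auto)
  have e: "nprod T (e l) q u = 0" for q using below[where a = "nat (- 1 - q)" and q = q] by simp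
  \<comment> \<open>The bracket is the vacuum \<open>e 0\<close>, written as a normally ordered
    product whose modes all involve a mode of \<open>e l\<close> on \<open>u\<close>.\<close>
  have "u = nprod T (nprod T (e (- l)) (-1) (e l)) (-1) u" using u by (simp add: e_e e_0 vac_left)
  also have "\<dots> = 0"
    unfolding nop_modes[OF fields_in(5) fields_in(5) u]
    by (rule Sum_any_zero) (simp add: e comm_same(5)[OF u, of l _ "- l"])
  finally show ?thesis .
qed

lemma last_nonzero_mode:
  assumes a: "a \<in> vspace T" "v \<in> vspace T" and nz: "nprod T a (int j) v \<noteq> 0"
  obtains M :: nat where "M \<ge> j" "nprod T a (int M) v \<noteq> 0" "\<And>i::nat. i > M \<Longrightarrow> nprod T a (int i) v = 0"
proof -
  obtain N where N: "\<forall>n\<ge>N. nprod T a n v = 0" using nprod_truncation[OF a] by blast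
  have bound: "i \<le> nat N" if "nprod T a (int i) v \<noteq> 0" for i 
  proof (rule ccontr)
    assume "\<not> i \<le> nat N"
    then have "int i \<ge> N" by linarith
    then show False using N that by blast
  qed
  define M where "M = (GREATEST i. nprod T a (int i) v \<noteq> 0)"
  have "nprod T a (int M) v \<noteq> 0" unfolding M_def by (rule GreatestI_nat[of _ j "nat N"]) (use nz bound in auto)
  moreover have "i \<le> M" if "nprod T a (int i) v \<noteq> 0" for i
    unfolding M_def by (rule Greatest_le_nat[of _ i "nat N"]) (use that bound in auto)
  ultimately show ?thesis using that[of M] nz not_less by blast
qed

text \<open>Let \<open>c(M)\<close> be the last nonzero mode on \<open>v\<close>, and
  \<open>u = c(M) v\<close>. In the relation for \<open>e 1\<close> at index \<open>M\<close> every
  term vanishes except \<open>e(-1) u\<close>, so \<open>e(-1) u = 0\<close>; non-negative modes of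
  \<open>e 1\<close> commute with \<open>c(M)\<close> and kill \<open>u\<close> too. As
  \<open>u\<close> has fewer letters, the induction kills its positive \<open>c\<close>-modes, and
  \<open>e_kernel\<close> yields \<open>u = 0\<close>.\<close>

lemma e_vacuum_c:
  assumes v: "v \<in> vspace T" and e0: "\<And>n::nat. nprod T (e 1) (int n) v = 0" and j: "j \<ge> 1"
  shows "nprod T c (int j) v = 0"
proof -
  obtain r R where "v \<in> words r R" using vspace_words[OF v] by blast
  then show ?thesis using v e0 j
  proof (induction r arbitrary: v j)
    case 0
    then show ?case using c_lowers_words by blast
  next
    case (Suc r)
    show ?case
    proof (rule ccontr)
      assume "nprod T c (int j) v \<noteq> 0"
      then obtain M where M: "M \<ge> j" "nprod T c (int M) v \<noteq> 0" "\<And>i::nat. i > M \<Longrightarrow> nprod T c (int i) v = 0"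
        by (rule last_nonzero_mode[OF fields_in(3) Suc.prems(2)]) blast
      have M1: "M \<ge> 1" using M(1) Suc.prems(4) by simp
      let ?u = "nprod T c (int M) v"
      have ev: "nprod T (e 1) q v = 0" if "q \<ge> 0" for q using Suc.prems(3)[of "nat q"] that by simp
      have eu: "nprod T (e 1) q ?u = 0" if "q \<ge> 0" for q
        using ev[OF that] comm_c_e[OF Suc.prems(2), of "int M" 1 q, symmetric] by simp
      have "nprod T (e 1) (-1) ?u = Sum_any (\<lambda>i::nat. nprod T c (- 1 - int i) (nprod T (e 1) (int M + int i) v) +
                      nprod T (e 1) (int M - 1 - int i) (nprod T c (int i) v))"
      proof (subst Sum_any_single[where i = M])
        fix i assume "i \<noteq> M"
        then consider "i < M" | "i > M" by linarith
        then have "nprod T (e 1) (int M - 1 - int i) (nprod T c (int i) v) = 0"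
        proof cases
          case 1
          then show ?thesis using ev[of "int M - 1 - int i"] comm_c_e[OF Suc.prems(2), of "int i" 1, symmetric] by simp
        qed (use M(3) in simp)
        then show "nprod T c (- 1 - int i) (nprod T (e 1) (int M + int i) v) +
            nprod T (e 1) (int M - 1 - int i) (nprod T c (int i) v) = 0" using ev by simp
      qed (use ev in simp)
      also have "\<dots> = smul T (- of_int (int M)) (nprod T (e 1) (int M - 1) v)"
        using e_mode_relation[OF Suc.prems(2), of "int M" 1] by simp
      also have "\<dots> = 0" using ev M1 by simp
      finally have e1: "nprod T (e 1) (-1) ?u = 0" .
      have "?u \<in> words r R" using c_lowers_words[OF Suc.prems(1) M1] by simp
      then have cu: "nprod T c (int i) ?u = 0" if "i \<ge> 1" for i
        using Suc.IH[of ?u i] Suc.prems(2) eu that by simp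
      have "?u = 0"
      proof (rule e_kernel[of _ 1])
        show "nprod T (e 1) q ?u = 0" if "q \<ge> -1" for q
          using that e1 eu by (cases "q = -1") auto
      qed (use cu Suc.prems(2) in auto)
      then show False using M(2) by simp
    qed
  qed
qed

text \<open>The same device of the last nonzero mode: for that index \<open>M\<close>, the mode
  \<open>M\<close> of the normally ordered product of \<gamma> and \<open>e 1\<close> is
  \<open>e(-1)\<close> applied to \<gamma>(M) \<open>v\<close>, and \<open>e_kernel\<close>
  applies.\<close>

lemma e_vacuum_gamma:
  assumes v: "v \<in> vspace T" and e0: "\<And>n::nat. nprod T (e 1) (int n) v = 0"
    and ge: "\<And>n::nat. nprod T (nprod T \<gamma> (-1) (e 1)) (int n) v = 0"
  shows "nprod T \<gamma> (int j) v = 0"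
proof (rule ccontr)
  assume "nprod T \<gamma> (int j) v \<noteq> 0"
  then obtain M where M: "nprod T \<gamma> (int M) v \<noteq> 0" "\<And>i::nat. i > M \<Longrightarrow> nprod T \<gamma> (int i) v = 0"
    by (rule last_nonzero_mode[OF fields_in(2) v]) blast
  let ?u = "nprod T \<gamma> (int M) v"
  have ev: "nprod T (e 1) q v = 0" if "q \<ge> 0" for q using e0[of "nat q"] that by simp
  have comm: "nprod T (e 1) q (nprod T \<gamma> i v) = nprod T \<gamma> i (nprod T (e 1) q v)" for q i
    using comm_cross[OF v, of \<gamma> "e 1" i q] by simp
  have "nprod T (e 1) (-1) ?u = nprod T (nprod T \<gamma> (-1) (e 1)) (int M) v"
    unfolding nop_modes[OF fields_in(2) fields_in(5) v]
  proof (subst Sum_any_single[where i = M])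
    fix i assume "i \<noteq> M"
    then consider "i < M" | "i > M" by linarith
    then have "nprod T (e 1) (int M - 1 - int i) (nprod T \<gamma> (int i) v) = 0"
      by cases (use M(2) ev comm in auto)
    then show "nprod T \<gamma> (- 1 - int i) (nprod T (e 1) (int M + int i) v) +
        nprod T (e 1) (int M - 1 - int i) (nprod T \<gamma> (int i) v) = 0" using ev by simp
  qed (use ev in simp)
  then have e1: "nprod T (e 1) (-1) ?u = 0" using ge by simp
  have "?u = 0"
  proof (rule e_kernel[of _ 1])
    show "nprod T (e 1) q ?u = 0" if "q \<ge> -1" for q
      using that e1 ev comm by (cases "q = -1") auto
    show "nprod T c (int i) ?u = 0" if "i \<ge> 1" for i
      using e_vacuum_c[OF v e0 that] comm_cross[OF v, of \<gamma> c "int M" "int i"] by simp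
  qed (use v in auto)
  then show False using M(1) by simp
qed

end

section \<open>Singular vectors in the realization\<close>

lemma (in vertex_algebra) nop_mode_shift:
  assumes ab: "a \<in> vspace V" "b \<in> vspace V" "x \<in> vspace V"
    and b: "\<And>j::nat. nprod V b (n + int j) x = 0" and a: "\<And>j::nat. j \<ge> 1 \<Longrightarrow> nprod V a (int j) x = 0"
  shows "nprod V (nop V a b) n x = nprod V b (n - 1) (nprod V a 0 x)"
  unfolding nop_def nop_modes[OF ab]
  by (subst Sum_any_single[where i = 0]) (use ab a b b[of 0] in auto)

lemma (in vertex_algebra) nop_mode_zero:
  assumes ab: "a \<in> vspace V" "b \<in> vspace V" "x \<in> vspace V"
    and b: "\<And>j::nat. nprod V b (n + int j) x = 0" and a: "\<And>j::nat. nprod V a (int j) x = 0"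
  shows "nprod V (nop V a b) n x = 0"
  using nop_mode_shift[OF ab b a] a[of 0] ab by simp

locale bp_fields = free_fields T \<beta> \<gamma> c d e Om
  for T :: "'t::ab_group_add vert_alg" and \<beta> \<gamma> c d :: 't and e :: "int \<Rightarrow> 't" and Om :: "int \<Rightarrow> 't set" +
  fixes J Gp Gm :: 't and k :: complex
  assumes bp_in [simp]: "J \<in> vspace T" "Gp \<in> vspace T" "Gm \<in> vspace T"
    and bp_cross: "a \<in> {J, Gp, Gm} \<Longrightarrow> b \<in> {\<beta>, \<gamma>, c, d} \<union> range e \<Longrightarrow> nprod T a (int n) b = 0"
    and bp_Om: "a \<in> {J, Gp, Gm} \<Longrightarrow> x \<in> Om m \<Longrightarrow> nprod T a q x \<in> Om m"
    and e_Om: "e m \<in> Om m"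
begin

definition "E1 = - nop T \<gamma> (e 1)"
definition "H1 = - smul T 2 J + nop T \<gamma> \<beta> - smul T ((2 * k + 9) / 6) c + smul T (1 / 2) d"
definition "H2 = J - smul T 2 (nop T \<gamma> \<beta>) + smul T ((4 * k + 9) / 6) c + smul T (1 / 2) d"
text \<open>\<open>X\<close> and \<open>Y\<close> are the Heisenberg factors inside the images of
  \<open>f1\<close> and \<open>f2\<close>. Their zero modes act on \<open>e m\<close> by
  \<open>-m\<close> and \<open>m\<close>.\<close>

definition "X = smul T 2 J + smul T ((8 * k + 9) / 6) c - smul T (1 / 2) d"
definition "Y = J + smul T ((4 * k + 9) / 6) c + smul T (1 / 2) d"
definition "F1 = Gp - nop T X (nop T \<beta> (e (-1))) + smul T (k + 1) (nop T (transl T \<beta>) (e (-1)))"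
definition "F2 = nop T Gm (e (-1)) + nop T Y \<gamma> + smul T k (transl T \<gamma>) - nop T \<gamma> (nop T \<gamma> \<beta>)"

lemma XY_in [simp]: "X \<in> vspace T" "Y \<in> vspace T" by (simp_all add: X_def Y_def)

lemma bp_comm:
  assumes "a \<in> {J, Gp, Gm}" "b \<in> {\<beta>, \<gamma>, c, d} \<union> range e" "x \<in> vspace T"
  shows "nprod T a m (nprod T b q x) = nprod T b q (nprod T a m x)"
  using assms bp_cross by (intro commute_modes) auto

lemma bp_top:
  assumes "a \<in> {J, Gp, Gm}" "x \<in> top" shows "nprod T a q x \<in> top"
proof -
  have "x \<in> {x \<in> vspace T. nprod T a q x \<in> top}"
  proof (rule subsetD[OF vs.span_minimal assms(2)[unfolded top_def]])
    show "(\<Union>m. Om m) \<subseteq> {x \<in> vspace T. nprod T a q x \<in> top}"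
      using Om_in bp_Om[OF assms(1)] vs.span_base[of _ "\<Union>m. Om m"] unfolding top_def by blast
    show "vs.subspace {x \<in> vspace T. nprod T a q x \<in> top}"
      by (rule subspace_preimage_right[OF subspace_top]) (use assms in auto)
  qed
  then show ?thesis by simp
qed

lemma Om_top: "x \<in> Om m \<Longrightarrow> x \<in> top"
  unfolding top_def by (rule vs.span_base) blast

lemma X_mode: "x \<in> vspace T \<Longrightarrow> nprod T X n x =
    smul T 2 (nprod T J n x) + smul T ((8 * k + 9) / 6) (nprod T c n x) - smul T (1 / 2) (nprod T d n x)"
  by (simp add: X_def nprod_linear)
lemma Y_mode: "x \<in> vspace T \<Longrightarrow> nprod T Y n x =
    nprod T J n x + smul T ((4 * k + 9) / 6) (nprod T c n x) + smul T (1 / 2) (nprod T d n x)"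
  by (simp add: Y_def nprod_linear)

lemma F1_mode: "x \<in> vspace T \<Longrightarrow> nprod T F1 n x = nprod T Gp n x
    - nprod T (nop T X (nop T \<beta> (e (-1)))) n x + smul T (k + 1) (nprod T (nop T (transl T \<beta>) (e (-1))) n x)"
  by (simp add: F1_def nprod_linear)
lemma F2_mode: "x \<in> vspace T \<Longrightarrow> nprod T F2 n x = nprod T (nop T Gm (e (-1))) n x
    + nprod T (nop T Y \<gamma>) n x + smul T k (nprod T (transl T \<gamma>) n x) - nprod T (nop T \<gamma> (nop T \<gamma> \<beta>)) n x"
  by (simp add: F2_def nprod_linear)

lemma transl_mode_nonneg:
  assumes "a \<in> vspace T" "x \<in> vspace T" "\<And>n::nat. nprod T a (int n) x = 0"
  shows "nprod T (transl T a) (int n) x = 0"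
proof (cases n)
  case (Suc m)
  then show ?thesis using assms(3)[of m] by (simp add: transl_modes[OF assms(1,2)])
qed (simp add: transl_modes[OF assms(1,2)])

lemma top_gamma_beta:
  assumes x: "x \<in> top" shows "nprod T (nop T \<gamma> \<beta>) (int n) x = 0"
proof -
  have "nprod T \<beta> (int n + int j) x = 0" for j using top_kill(1)[OF x, of "n + j"] by simp
  then show ?thesis by (intro nop_mode_zero) (simp_all add: top_in[OF x] top_kill(2)[OF x])
qed

lemma top_F2_part:
  assumes x: "x \<in> top"
  shows "nprod T F2 (int n) x = nprod T (nop T Gm (e (-1))) (int n) x + nprod T (nop T Y \<gamma>) (int n) x"
proof -
  have xT: "x \<in> vspace T" using top_in[OF x] .
  have "nprod T (transl T \<gamma>) (int n) x = 0" by (rule transl_mode_nonneg) (simp_all add: xT top_kill(2)[OF x])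
  moreover have "nprod T (nop T \<gamma> (nop T \<gamma> \<beta>)) (int n) x = 0"
  proof (rule nop_mode_zero)
    show "nprod T (nop T \<gamma> \<beta>) (int n + int j) x = 0" for j using top_gamma_beta[OF x, of "n + j"] by simp
  qed (simp_all add: xT top_kill(2)[OF x])
  ultimately show ?thesis using F2_mode[OF xT] by simp
qed

lemma top_Y_gamma:
  assumes x: "x \<in> top" and J: "\<And>n::nat. n \<ge> 1 \<Longrightarrow> nprod T J (int n) x = 0"
  shows "nprod T (nop T Y \<gamma>) (int n) x = nprod T \<gamma> (int n - 1) (nprod T Y 0 x)"
proof (rule nop_mode_shift)
  have xT: "x \<in> vspace T" using top_in[OF x] .
  show "nprod T \<gamma> (int n + int j) x = 0" for j using top_kill(2)[OF x, of "n + j"] by simp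
  show "nprod T Y (int j) x = 0" if "j \<ge> 1" for j
    using that by (simp add: Y_mode xT J top_kill[OF x])
qed (simp_all add: top_in[OF x])

lemma top_Y_zero: "x \<in> top \<Longrightarrow> nprod T Y 0 x \<in> top"
  using bp_top[of J x 0] top_kill(3)[of x 0] top_kill(6)[of x]
  by (simp add: Y_mode top_in vs.subspace_add[OF subspace_top] vs.subspace_scale[OF subspace_top])

lemma top_X_zero: "x \<in> top \<Longrightarrow> nprod T X 0 x \<in> top"
  using bp_top[of J x 0] top_kill(3)[of x 0] top_kill(6)[of x]
  by (simp add: X_mode top_in vs.subspace_diff[OF subspace_top] vs.subspace_scale[OF subspace_top])

lemma top_beta_e:
  assumes x: "x \<in> top" shows "nprod T (nop T \<beta> (e (-1))) (int n) x = 0"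
proof -
  have "nprod T (e (-1)) (int n + int j) x = 0" for j using top_kill(4)[OF x, of "-1" "n + j"] by simp
  then show ?thesis by (intro nop_mode_zero) (simp_all add: top_in[OF x] top_kill(1)[OF x])
qed

text \<open>For \<open>n \<ge> 1\<close> the term with \<open>X\<close> reduces to the mode
  \<open>n - 1 \<ge> 0\<close> of the normally ordered product of \<beta> and \<open>e (-1)\<close>,
  and the term with the derivative of \<beta> to non-negative modes; both vanish on
  \<open>top\<close>.\<close>

lemma top_F1:
  assumes x: "x \<in> top" and J: "\<And>n::nat. n \<ge> 1 \<Longrightarrow> nprod T J (int n) x = 0" and n: "n \<ge> 1"
  shows "nprod T F1 (int n) x = nprod T Gp (int n) x"
proof -
  have xT: "x \<in> vspace T" using top_in[OF x] .
  have "nprod T (nop T X (nop T \<beta> (e (-1)))) (int n) x = nprod T (nop T \<beta> (e (-1))) (int n - 1) (nprod T X 0 x)"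
  proof (rule nop_mode_shift)
    show "nprod T (nop T \<beta> (e (-1))) (int n + int j) x = 0" for j using top_beta_e[OF x, of "n + j"] by simp
    show "nprod T X (int j) x = 0" if "j \<ge> 1" for j
      using that by (simp add: X_mode xT J top_kill[OF x])
  qed (simp_all add: xT)
  also have "\<dots> = 0" using top_beta_e[OF top_X_zero[OF x], of "n - 1"] n by (simp add: of_nat_diff)
  finally have 1: "nprod T (nop T X (nop T \<beta> (e (-1)))) (int n) x = 0" .
  have "nprod T (nop T (transl T \<beta>) (e (-1))) (int n) x = 0"
  proof (rule nop_mode_zero)
    show "nprod T (e (-1)) (int n + int j) x = 0" for j using top_kill(4)[OF x, of "-1" "n + j"] by simp
    show "nprod T (transl T \<beta>) (int j) x = 0" for j
      by (rule transl_mode_nonneg) (simp_all add: xT top_kill(1)[OF x])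
  qed (simp_all add: xT)
  then show ?thesis using 1 F1_mode[OF xT] by simp
qed

lemma e_inverse_top:
  assumes "x \<in> top" shows "nprod T (e 1) (-1) (nprod T (e (-1)) (-1) x) = x"
proof -
  have "x \<in> vspace T \<and> nprod T (e 1) (-1) (nprod T (e (-1)) (-1) x) = x"
    using assms unfolding top_def
  proof (induction rule: vs.span_induct_alt)
    case (step s x y)
    then show ?case using Om_in Om_e(3) by (auto simp: nprod_linear)
  qed simp
  then show ?thesis by simp
qed

text \<open>The order matters: \<open>e3\<close> gives \<open>c\<close>, then \<open>e1\<close>
  gives \<gamma>, and then the Cartan currents can be solved for \<open>J\<close> and
  \<open>d\<close>. This places \<open>v\<close> in \<open>top\<close>, where the long expressions
  for \<open>f1\<close> and \<open>f2\<close> reduce to \<open>Gp\<close> and to the normally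
  ordered product of \<open>Gm\<close> and \<open>e (-1)\<close>.\<close>

lemma singular_vectors:
  assumes v: "v \<in> vspace T"
    and "\<And>n::nat. nprod T (e 1) (int n) v = 0" "\<And>n::nat. nprod T \<beta> (int n) v = 0"
      "\<And>n::nat. nprod T E1 (int n) v = 0"
    and H: "\<And>n::nat. n \<ge> 1 \<Longrightarrow> nprod T H1 (int n) v = 0" "\<And>n::nat. n \<ge> 1 \<Longrightarrow> nprod T H2 (int n) v = 0"
    and F: "\<And>n::nat. n \<ge> 1 \<Longrightarrow> nprod T F1 (int n) v = 0" "\<And>n::nat. n \<ge> 1 \<Longrightarrow> nprod T F2 (int n) v = 0"
  shows "v \<in> top" "\<And>a n::nat. a \<in> {J, Gp, Gm} \<Longrightarrow> n \<ge> 1 \<Longrightarrow> nprod T a (int n) v = 0"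
proof -
  have c: "nprod T c (int n) v = 0" if "n \<ge> 1" for n by (rule e_vacuum_c[OF v assms(2) that])
  have "nprod T (nprod T \<gamma> (-1) (e 1)) (int n) v = 0" for n
    using assms(4)[of n] v by (simp add: E1_def nprod_linear nop_def)
  from e_vacuum_gamma[OF v assms(2) this] have g: "nprod T \<gamma> (int n) v = 0" for n .
  have gb: "nprod T (nop T \<gamma> \<beta>) (int n) v = 0" for n
  proof -
    have "nprod T \<beta> (int n + int j) v = 0" for j using assms(3)[of "n + j"] by simp
    then show ?thesis by (intro nop_mode_zero) (simp_all add: v g)
  qed
  \<comment> \<open>Once \<open>c\<close> and the \<gamma>\<beta> term drop out, \<open>H1\<close>
    is \<open>-2 J + d / 2\<close> and \<open>H2\<close> is \<open>J + d / 2\<close>; eliminating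
    \<open>d\<close> leaves \<open>3 J\<close>.\<close>
  have Jd: "nprod T J (int n) v = 0 \<and> nprod T d (int n) v = 0" if n: "n \<ge> 1" for n
  proof -
    have 1: "smul T (1 / 2) (nprod T d (int n) v) = smul T 2 (nprod T J (int n) v)"
      using H(1)[OF n] v by (simp add: H1_def nprod_linear gb c[OF n] algebra_simps)
    have 2: "nprod T J (int n) v + smul T (1 / 2) (nprod T d (int n) v) = 0"
      using H(2)[OF n] v by (simp add: H2_def nprod_linear gb c[OF n])
    have "smul T 1 (nprod T J (int n) v) + smul T 2 (nprod T J (int n) v) = 0" using 1 2 by simp
    then have "smul T 3 (nprod T J (int n) v) = 0" unfolding vs.scale_left_distrib[symmetric] by simp
    then have "nprod T J (int n) v = 0" by (simp add: vs.scale_eq_0_iff)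
    then show ?thesis using 2 by (simp add: vs.scale_eq_0_iff)
  qed
  show top: "v \<in> top" by (rule fock_vacuum[OF v assms(3) g c]) (use Jd in auto)
  have J: "nprod T J (int n) v = 0" if "n \<ge> 1" for n using Jd that by blast
  have Gp: "nprod T Gp (int n) v = 0" if "n \<ge> 1" for n
    using top_F1[OF top J that] F(1)[OF that] by simp
  have Ge: "nprod T (nop T Gm (e (-1))) (int n) v = 0" if n: "n \<ge> 1" for n
  proof -
    have "nprod T (nop T Y \<gamma>) (int n) v = nprod T \<gamma> (int (n - 1)) (nprod T Y 0 v)"
      using top_Y_gamma[OF top J, of n] n by (simp add: of_nat_diff)
    also have "\<dots> = 0" by (rule top_kill(2)[OF top_Y_zero[OF top]])
    finally show ?thesis using top_F2_part[OF top, of n] F(2)[OF n] by simp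
  qed
  \<comment> \<open>\<open>F2\<close> controls \<open>Gm\<close> only together with
    \<open>e (-1)\<close>. At the last nonzero mode \<open>M\<close> of \<open>Gm\<close> the
    product reduces to \<open>e(-1)(-1)\<close> applied to \<open>Gm(M) v\<close>, and
    \<open>e 1\<close> undoes this factor.\<close>
  have Gm: "nprod T Gm (int n) v = 0" if n: "n \<ge> 1" for n
  proof (rule ccontr)
    assume "nprod T Gm (int n) v \<noteq> 0"
    then obtain M where M: "M \<ge> n" "nprod T Gm (int M) v \<noteq> 0" "\<And>i::nat. i > M \<Longrightarrow> nprod T Gm (int i) v = 0"
      by (rule last_nonzero_mode[OF bp_in(3) v]) blast
    let ?u = "nprod T Gm (int M) v"
    have Gtop: "nprod T Gm q v \<in> top" for q using bp_top[of Gm v q] top by simp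
    have "nprod T (e (-1)) (-1) ?u = nprod T (nop T Gm (e (-1))) (int M) v"
      unfolding nop_def nop_modes[OF bp_in(3) fields_in(5) v]
    proof (subst Sum_any_single[where i = M])
      have ev: "nprod T (e (-1)) (int M + int i) v = 0" for i using top_kill(4)[OF top, of "-1" "M + i"] by simp
      fix i assume "i \<noteq> M"
      then consider "i < M" | "i > M" by linarith
      then have "nprod T (e (-1)) (int M - 1 - int i) (nprod T Gm (int i) v) = 0"
      proof cases
        case 1
        then have "int M - 1 - int i = int (M - 1 - i)" by linarith
        then show ?thesis using top_kill(4)[OF Gtop, of "-1" "M - 1 - i"] by simp
      qed (use M(3) in simp)
      then show "nprod T Gm (- 1 - int i) (nprod T (e (-1)) (int M + int i) v) +
          nprod T (e (-1)) (int M - 1 - int i) (nprod T Gm (int i) v) = 0" using ev by simp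
    next
      show "nprod T (e (-1)) (-1) ?u = nprod T Gm (- 1 - int M) (nprod T (e (-1)) (int M + int M) v) +
          nprod T (e (-1)) (int M - 1 - int M) ?u"
        using top_kill(4)[OF top, of "-1" "M + M"] by simp
    qed
    also have "\<dots> = 0" using Ge[of M] M(1) n by simp
    finally have "?u = 0" using e_inverse_top[OF Gtop, of "int M"] by simp
    then show False using M(2) by simp
  qed
  show "nprod T a (int n) v = 0" if "a \<in> {J, Gp, Gm}" "n \<ge> 1" for a n
    using that J Gp Gm by auto
qed

text \<open>The modes of \<open>J\<close>, \<open>Gp\<close>, \<open>Gm\<close> preserve each
  \<open>Om m\<close>, on which \<open>d(0)\<close> is \<open>2 m\<close>, so the annihilation
  conditions hold for every component separately.\<close>

lemma top_components:
  assumes v: "v \<in> top" and kill: "\<And>a n::nat. a \<in> {J, Gp, Gm} \<Longrightarrow> n \<ge> 1 \<Longrightarrow> nprod T a (int n) v = 0"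
  obtains F x where "finite F" "v = (\<Sum>m\<in>F. x m)" "\<And>m. m \<in> F \<Longrightarrow> x m \<in> Om m"
    "\<And>m a n::nat. m \<in> F \<Longrightarrow> a \<in> {J, Gp, Gm} \<Longrightarrow> n \<ge> 1 \<Longrightarrow> nprod T a (int n) (x m) = 0"
proof -
  have "v \<in> vs.span (\<Union>m\<in>UNIV. Om m)" using v by (simp add: top_def)
  from span_UN_decomp[OF Om_subspace this] obtain F x where
    F: "finite F" "\<And>m. m \<in> F \<Longrightarrow> x m \<in> Om m" "v = (\<Sum>m\<in>F. x m)" by blast
  have "nprod T a (int n) (x m) = 0" if m: "m \<in> F" and a: "a \<in> {J, Gp, Gm}" and n: "n \<ge> 1" for m a and n :: nat
  proof -
    have aT: "a \<in> vspace T" using a by auto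
    have lin: "lin_on T (smul T) (nprod T d 0)" by (simp add: lin_on_def nprod_linear)
    have "(\<Sum>m\<in>F. nprod T a (int n) (x m)) = nprod T a (int n) v"
      unfolding F(3) by (rule nprod_sum_right[symmetric]) (use F(2) Om_in aT in blast)+
    then have z: "(\<Sum>m\<in>F. nprod T a (int n) (x m)) = 0" using kill[OF a n] by simp
    have "nprod T a (int n) (x m) \<in> {0}"
    proof (rule eigencomponents[OF lin _ _ _ F(1) _ _ _ m, where c = "\<lambda>m. 2 * of_int m"])
      show "nprod T a (int n) (x i) \<in> vspace T \<and>
          nprod T d 0 (nprod T a (int n) (x i)) = smul T (2 * of_int i) (nprod T a (int n) (x i))" if "i \<in> F" for i
        using Om_d[OF bp_Om[OF a F(2)[OF that]], of 0] Om_in[OF bp_Om[OF a F(2)[OF that]]] by simp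
    qed (use z in \<open>auto simp: inj_on_def\<close>)
    then show ?thesis by simp
  qed
  with F show ?thesis using that by blast
qed

lemma bp_e: "a \<in> {J, Gp, Gm} \<Longrightarrow> nprod T a (int n) (e m) = 0"
  using bp_cross by auto

lemma e_top: "e m \<in> top"
  by (rule Om_top[OF e_Om])

lemma H_e:
  shows "n \<ge> 1 \<Longrightarrow> nprod T H1 (int n) (e m) = 0" "n \<ge> 1 \<Longrightarrow> nprod T H2 (int n) (e m) = 0"
    "nprod T H1 0 (e m) = smul T (of_int m) (e m)"
  using bp_e[of J _ m] top_gamma_beta[OF e_top, of _ m] top_gamma_beta[OF e_top, of 0 m] bp_e[of J 0 m]
    c_e[of 0 m] d_e[of 0 m] c_e[of n m] d_e[of n m]
  by (simp_all add: H1_def H2_def nprod_linear)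

lemma E_e: "nprod T E1 (int n) (e m) = 0" "nprod T \<beta> (int n) (e m) = 0"
proof -
  have "nprod T (e 1) (int n + int j) (e m) = 0" for j using e_e(1)[of 1 "n + j" m] by simp
  then have "nprod T (nop T \<gamma> (e 1)) (int n) (e m) = 0"
    by (intro nop_mode_zero) (simp_all add: cross)
  then show "nprod T E1 (int n) (e m) = 0" by (simp add: E1_def nprod_linear)
qed (simp add: cross)

lemma F1_e: "n \<ge> 1 \<Longrightarrow> nprod T F1 (int n) (e m) = 0"
  using top_F1[OF e_top, of m n] bp_e[of J] bp_e[of Gp] by simp

lemma Y_e: "nprod T Y 0 (e m) = smul T (of_int m) (e m)"
  using bp_e[of J 0 m] c_e[of 0 m] d_e[of 0 m] by (simp add: Y_mode)
lemma X_e: "nprod T X (int j) (e m) = (if j = 0 then smul T (- of_int m) (e m) else 0)"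
  using bp_e[of J j m] c_e[of j m] d_e[of j m] by (simp add: X_mode)

lemma F2_e: "nprod T F2 (int n) (e m) = (if n = 0 then smul T (of_int m) (nprod T \<gamma> (-1) (e m)) else 0)"
proof -
  have "nprod T (nop T Gm (e (-1))) (int n) (e m) = 0"
  proof (rule nop_mode_zero)
    show "nprod T (e (-1)) (int n + int j) (e m) = 0" for j using e_e(1)[of "-1" "n + j" m] by simp
  qed (simp_all add: bp_e)
  moreover have "nprod T (nop T Y \<gamma>) (int n) (e m) = smul T (of_int m) (nprod T \<gamma> (int n - 1) (e m))"
    using top_Y_gamma[OF e_top, of m n] bp_e[of J] by (simp add: Y_e nprod_linear)
  moreover have "nprod T \<gamma> (int n - 1) (e m) = 0" if "n \<ge> 1"
    using cross[of \<gamma> "e m" "n - 1"] that by (simp add: of_nat_diff)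
  ultimately show ?thesis using top_F2_part[OF e_top, of n m] by auto
qed

text \<open>The contribution \<open>m\<close> is minus the eigenvalue of \<open>X(0)\<close>; the
  contribution \<open>-(k + 1)\<close> comes from mode 1 of the derivative of \<beta> contracted
  with \<gamma>.\<close>

lemma F1_gamma_e:
  assumes n: "n \<ge> 1"
  shows "nprod T F1 (int n) (nprod T \<gamma> (-1) (e m)) = (if n = 1 then smul T (of_int m - k - 1) (e (m - 1)) else 0)"
proof -
  let ?x = "nprod T \<gamma> (-1) (e m)" and ?b = "nop T \<beta> (e (-1))"
  have x: "?x \<in> vspace T" by simp
  have Gp: "nprod T Gp (int n) ?x = 0"
    using bp_comm[of Gp \<gamma> "e m" "int n" "-1"] bp_e[of Gp n m] by simp
  have beta: "nprod T \<beta> (int j) ?x = (if j = 0 then e m else 0)" for j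
    using comm_beta_gamma[of "e m" "int j" "-1"] cross[of \<beta> "e m" j] by simp
  have ex: "nprod T (e (-1)) (int j) ?x = 0" for j
    using comm_cross[of "e m" \<gamma> "e (-1)" "-1" "int j"] e_e(1)[of "-1" j m] by simp
  have em: "nprod T (e (-1)) (int j - 1) (e m) = (if j = 0 then e (m - 1) else 0)" for j
  proof (cases j)
    case 0
    then show ?thesis using e_e(2)[of "-1" m] by simp
  next
    case (Suc i)
    then show ?thesis using e_e(1)[of "-1" i m] by simp
  qed
  have b: "nprod T ?b (int j) ?x = (if j = 0 then e (m - 1) else 0)" for j
  proof -
    have "nprod T ?b (int j) ?x = nprod T (e (-1)) (int j - 1) (nprod T \<beta> 0 ?x)"
    proof (rule nop_mode_shift)
      show "nprod T (e (-1)) (int j + int i) ?x = 0" for i using ex[of "j + i"] by simp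
    qed (simp_all add: beta)
    then show ?thesis using beta[of 0] em[of j] by simp
  qed
  have Xx: "nprod T X (int j) ?x = (if j = 0 then smul T (- of_int m) ?x else 0)" for j
  proof -
    have "nprod T X (int j) ?x = nprod T \<gamma> (-1) (nprod T X (int j) (e m))"
      using bp_comm[of J \<gamma> "e m" "int j" "-1"] comm_cross[of "e m" \<gamma> c "-1" "int j"]
        comm_cross[of "e m" \<gamma> d "-1" "int j"] by (simp add: X_mode nprod_linear)
    then show ?thesis by (simp add: X_e nprod_linear)
  qed
  have "nprod T (nop T X ?b) (int n) ?x = nprod T ?b (int n - 1) (nprod T X 0 ?x)"
  proof (rule nop_mode_shift)
    show "nprod T ?b (int n + int j) ?x = 0" for j using b[of "n + j"] n by simp
  qed (simp_all add: Xx)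
  also have "\<dots> = (if n = 1 then smul T (- of_int m) (e (m - 1)) else 0)"
    using Xx[of 0] b[of "n - 1"] n by (simp add: nprod_linear of_nat_diff)
  finally have Xb: "nprod T (nop T X ?b) (int n) ?x = (if n = 1 then smul T (- of_int m) (e (m - 1)) else 0)" .
  have tb: "nprod T (transl T \<beta>) (int j) ?x = (if j = 1 then - e m else 0)" for j
  proof (cases j)
    case 0
    then show ?thesis by (simp add: transl_modes)
  next
    case (Suc i)
    then show ?thesis using beta[of i] by (auto simp: transl_modes)
  qed
  have "nprod T (nop T (transl T \<beta>) (e (-1))) (int n) ?x = - nprod T (e (-1)) (int n - 2) (e m)"
    unfolding nop_def nop_modes[OF transl_in[OF fields_in(1)] fields_in(5) x]
  proof (subst Sum_any_single[where i = 1])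
    have e0: "nprod T (e (-1)) (int n + int j) ?x = 0" for j using ex[of "n + j"] by simp
    show "nprod T (transl T \<beta>) (- 1 - int j) (nprod T (e (-1)) (int n + int j) ?x) +
         nprod T (e (-1)) (int n - 1 - int j) (nprod T (transl T \<beta>) (int j) ?x) = 0" if "j \<noteq> 1" for j
      using e0 tb[of j] that by simp
    show "nprod T (transl T \<beta>) (- 1 - int 1) (nprod T (e (-1)) (int n + int 1) ?x) +
         nprod T (e (-1)) (int n - 1 - int 1) (nprod T (transl T \<beta>) (int 1) ?x) = - nprod T (e (-1)) (int n - 2) (e m)"
      using e0[of 1] tb[of 1] by (simp add: nprod_linear)
  qed
  also have "\<dots> = (if n = 1 then - e (m - 1) else 0)"
    using em[of "n - 1"] n by (auto simp: of_nat_diff)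
  finally have tbe: "nprod T (nop T (transl T \<beta>) (e (-1))) (int n) ?x = (if n = 1 then - e (m - 1) else 0)" .
  show ?thesis
    unfolding F1_mode[OF x] Gp Xb tbe
    by (simp add: vs.scale_left_diff_distrib vs.scale_left_distrib vs.scale_minus_left)
qed

lemma FF_in [simp]: "F1 \<in> vspace T" "F2 \<in> vspace T"
  by (simp_all add: F1_def F2_def)

text \<open>\<open>F3\<close> is the commutator of \<open>F2(0)\<close> with \<open>F1\<close>. As
  \<open>F1(n)\<close> kills \<open>e m\<close> for \<open>n \<ge> 1\<close>, only
  \<open>- F1(n) F2(0) (e m)\<close> remains, with \<open>F2(0)\<close> supplying the factor
  \<open>m\<close> and the letter \<gamma>(-1).\<close>

lemma F3_e:
  assumes n: "n \<ge> 1"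
  shows "nprod T (nprod T F2 0 F1) (int n) (e m) =
    (if n = 1 then smul T (of_int m * (k + 1 - of_int m)) (e (m - 1)) else 0)"
proof -
  have "nprod T F2 0 (nprod T F1 (int n) (e m)) =
      nprod T (nprod T F2 0 F1) (int n) (e m) + nprod T F1 (int n) (nprod T F2 0 (e m))"
    by (rule nprod_zero_mode) simp_all
  then have "nprod T (nprod T F2 0 F1) (int n) (e m) = - nprod T F1 (int n) (smul T (of_int m) (nprod T \<gamma> (-1) (e m)))"
    using F1_e[OF n, of m] F2_e[of 0 m] by (simp add: eq_neg_iff_add_eq_0)
  also have "\<dots> = (if n = 1 then smul T (of_int m * (k + 1 - of_int m)) (e (m - 1)) else 0)"
    using F1_gamma_e[OF n, of m]
    by (auto simp: nprod_linear right_diff_distrib distrib_left vs.scale_left_diff_distrib vs.scale_left_distrib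
        vs.scale_minus_left algebra_simps)
  finally show ?thesis .
qed

end

section \<open>Nonvanishing, local nilpotency, and recovering \<open>L\<close>\<close>

lemma presented_free_nonzero:
  assumes P: "presented_by V X g {}" and V: "vector_space (smul V)" and x: "x \<in> X"
  shows "g x \<noteq> 0"
proof
  interpret free: vector_space free_smul by (rule vector_space_free_smul)
  interpret V: vector_space "smul V" by (rule V)
  assume "g x = 0"
  then have "lin_ext V g (Poly_Mapping.single x 1) = 0"
    by (simp add: lin_ext_eq lext_single[OF V])
  moreover have "Poly_Mapping.keys (Poly_Mapping.single x (1::complex)) \<subseteq> X" using x by simp
  ultimately have "Poly_Mapping.single x (1::complex) \<in> free.span {}"
    using P unfolding presented_by_def by blast
  then have "Poly_Mapping.single x (1::complex) = 0" by simp
  then show False by (metis lookup_single_eq lookup_zero zero_neq_one)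
qed

lemma beta_gamma_vac: "beta_gamma_va S \<beta> \<gamma> \<Longrightarrow> vac S \<noteq> 0"
proof -
  assume S: "beta_gamma_va S \<beta> \<gamma>"
  then interpret vertex_algebra S by (simp add: beta_gamma_va_def)
  have "pbw_monomial S [\<beta>, \<gamma>] [] (vac S) \<noteq> 0"
    by (rule presented_free_nonzero[OF _ ambient, of "pbw_words (length [\<beta>, \<gamma>])"])
      (use S in \<open>simp_all add: beta_gamma_va_def freely_strongly_generated_def pbw_words_def\<close>)
  then show ?thesis by (simp add: pbw_monomial_def modes_on_def)
qed

lemma half_lattice_e_nonzero: "half_lattice_va P c d e \<Longrightarrow> e m \<noteq> 0"
proof -
  assume P: "half_lattice_va P c d e"
  then interpret vertex_algebra P by (simp add: half_lattice_va_def)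
  have p: "presented_by P (pbw_words 2 \<times> UNIV) (\<lambda>(ws, m). pbw_monomial P [c, d] ws (e m)) {}"
    using P by (simp add: half_lattice_va_def)
  have "(\<lambda>(ws, m). pbw_monomial P [c, d] ws (e m)) ([], m) \<noteq> 0"
    by (rule presented_free_nonzero[OF p ambient]) (simp add: pbw_words_def)
  then show ?thesis by (simp add: pbw_monomial_def modes_on_def)
qed

text \<open>After \<open>x\<close> is subtracted in degree \<open>m\<close>, its weight
  decomposition becomes a vanishing sum of eigenvectors with distinct eigenvalues, so the component
  of degree \<open>m\<close> is \<open>x\<close> itself.\<close>

lemma (in reorderable) eigen_in_wspace:
  assumes D: "graded_by D" and x: "x \<in> vspace V" "D x = smul V (of_int m) x"
  shows "x \<in> wspace G m"
proof -
  have lin: "lin_on V (smul V) D" using D by (simp add: graded_by_def)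
  have "x \<in> vs.span (\<Union>N\<in>UNIV. wspace G N)" using x(1) vspace_decomp by auto
  from wspace_decomp[OF this] obtain F f where
    F: "finite F" "\<And>N. N \<in> F \<Longrightarrow> f N \<in> wspace G N" "x = (\<Sum>N\<in>F. f N)" by blast
  define f0 where "f0 N = (if N \<in> F then f N else 0)" for N
  have f0: "f0 N \<in> wspace G N" for N using F(2) by (auto simp: f0_def vs.subspace_0)
  define f' where "f' N = f0 N - (if N = m then x else 0)" for N
  have "(\<Sum>N\<in>insert m F. f0 N) = x"
    unfolding F(3) by (rule sum.mono_neutral_cong_right) (use F(1) in \<open>auto simp: f0_def\<close>)
  moreover have "(\<Sum>N\<in>insert m F. if N = m then x else 0) = x" using F(1) by simp
  ultimately have s: "(\<Sum>N\<in>insert m F. f' N) = 0" unfolding f'_def sum_subtractf by simp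
  have "f' m \<in> {0}"
  proof (rule eigencomponents[OF lin, where F = "insert m F" and c = of_int])
    show "D y \<in> {0}" if "y \<in> {0}" for y using that lin_on_zero[OF lin ambient] by simp
    show "f' N \<in> vspace V \<and> D (f' N) = smul V (of_int N) (f' N)" for N
    proof -
      have "f0 N \<in> vspace V" "D (f0 N) = smul V (of_int N) (f0 N)"
        using f0[of N] D wspace_in[OF G_in] by (auto simp: graded_by_def)
      then show ?thesis using x lin_onD(5)[OF lin ambient] lin_on_zero[OF lin ambient]
        by (simp add: f'_def vs.scale_right_diff_distrib)
    qed
  qed (use s F(1) in \<open>auto simp: inj_on_def\<close>)
  then have "x = f0 m" by (simp add: f'_def)
  then show ?thesis using f0 by simp
qed

lemma locally_nilpotent_kernel:
  assumes Z: "v \<in> Z" "v \<noteq> 0" "\<And>x. x \<in> Z \<Longrightarrow> \<delta> x \<in> Z" and nil: "(\<delta> ^^ r) v = (0::'a::zero)"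
  shows "\<exists>x\<in>Z. x \<noteq> 0 \<and> \<delta> x = 0"
  using assms
proof (induction r arbitrary: v)
  case (Suc r)
  show ?case
  proof (cases "\<delta> v = 0")
    case False
    then show ?thesis using Suc.IH[of "\<delta> v"] Suc.prems by (auto simp: funpow_swap1)
  qed (use Suc.prems in blast)
qed simp

lemma matrix_diff_distrib:
  fixes A B C :: "complex^'n^'n"
  shows "A ** (B - C) = A ** B - A ** C" "(A - B) ** C = A ** C - B ** C"
  by (simp_all add: matrix_matrix_mult_def vec_eq_iff sum_subtractf algebra_simps)

lemma matrix_mul_zero:
  fixes A :: "complex^'n^'n"
  shows "A ** 0 = 0" "0 ** A = 0"
  by (simp_all add: matrix_matrix_mult_def vec_eq_iff)

text \<open>The reason is that \<open>a\<^sup>2 = 0\<close> implies \<open>(ad a)\<^sup>3 = 0\<close>.\<close>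

lemma affine_locally_nilpotent:
  assumes V: "universal_affine_sl3 k V \<iota>" and a: "a \<in> sl3" "a ** a = 0" and v: "v \<in> vspace V"
  shows "\<exists>r. ((nprod V (\<iota> a) 0) ^^ r) v = 0"
proof -
  interpret vertex_algebra V using V by (simp add: universal_affine_sl3_def)
  let ?\<delta> = "nprod V (\<iota> a) 0"
  have i [simp]: "\<iota> x \<in> vspace V" if "x \<in> sl3" for x using affine_relations(1)[OF V that that] .
  note a' [simp] = i[OF a(1)]
  have br: "?\<delta> (\<iota> x) = \<iota> (lie_br a x)" if "x \<in> sl3" for x
    using affine_relations(4)[OF V a(1) that, of 0] by simp
  have iter_in [simp]: "(?\<delta> ^^ r) v \<in> vspace V" if "v \<in> vspace V" for r v
    using that by (induction r) auto
  have iter_add: "(?\<delta> ^^ r) (u + v) = (?\<delta> ^^ r) u + (?\<delta> ^^ r) v" if "u \<in> vspace V" "v \<in> vspace V" for r u v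
    using that by (induction r) (auto simp: nprod_linear)
  have iter_smul: "(?\<delta> ^^ r) (smul V s v) = smul V s ((?\<delta> ^^ r) v)" if "v \<in> vspace V" for r v s
    using that by (induction r) (auto simp: nprod_linear)
  have iter_zero: "(?\<delta> ^^ r) 0 = 0" for r by (induction r) auto
  define nil where "nil = {v \<in> vspace V. \<exists>r. (?\<delta> ^^ r) v = 0}"
  have more: "(?\<delta> ^^ (s + r)) v = 0" if "(?\<delta> ^^ r) v = 0" for r s v using that iter_zero by (simp add: funpow_add)
  have nil_add: "u + v \<in> nil" if "u \<in> nil" "v \<in> nil" for u v
  proof -
    obtain r s where "(?\<delta> ^^ r) u = 0" "(?\<delta> ^^ s) v = 0" using \<open>u \<in> nil\<close> \<open>v \<in> nil\<close> by (auto simp: nil_def)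
    then have "(?\<delta> ^^ (s + r)) u = 0" "(?\<delta> ^^ (r + s)) v = 0" using more by blast+
    then show ?thesis using that iter_add[of u v "s + r"] by (auto simp: nil_def add.commute)
  qed
  have nil_smul: "smul V s v \<in> nil" if "v \<in> nil" for s v
    using that iter_smul by (auto simp: nil_def)
  have nil_back: "v \<in> nil" if dv: "?\<delta> v \<in> nil" and v: "v \<in> vspace V" for v
  proof -
    obtain r where "(?\<delta> ^^ r) (?\<delta> v) = 0" using dv by (auto simp: nil_def)
    then have "(?\<delta> ^^ Suc r) v = 0" by (simp add: funpow_swap1)
    then show ?thesis using v unfolding nil_def by blast
  qed
  \<comment> \<open>The zero mode is a derivation. Given the claim for its value on
    \<open>b\<close>, induction on the order of nilpotency of \<open>v\<close> shows that its value
    on \<open>b(n) v\<close> is nilpotent, and then so is \<open>b(n) v\<close>.\<close>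
  have step: "nprod V b n v \<in> nil"
    if b: "b \<in> vspace V" "\<And>v. v \<in> nil \<Longrightarrow> nprod V (?\<delta> b) n v \<in> nil" and v: "v \<in> nil" for b n v
  proof -
    obtain r where "(?\<delta> ^^ r) v = 0" "v \<in> vspace V" using v by (auto simp: nil_def)
    then show ?thesis
    proof (induction r arbitrary: v)
      case 0
      have "0 \<in> nil" unfolding nil_def using iter_zero zero_in by blast
      then show ?case using 0 b by simp
    next
      case (Suc r)
      have "(?\<delta> ^^ r) (?\<delta> v) = 0" using Suc.prems by (simp add: funpow_swap1)
      then have 1: "nprod V b n (?\<delta> v) \<in> nil" using Suc by simp
      have "v \<in> nil" using Suc.prems unfolding nil_def by blast
      then have "nprod V (?\<delta> b) n v + nprod V b n (?\<delta> v) \<in> nil" using 1 b(2) nil_add by blast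
      then have "?\<delta> (nprod V b n v) \<in> nil" using Suc.prems b(1) by (simp add: nprod_zero_mode)
      then show ?case by (rule nil_back) (use Suc.prems b(1) in simp)
    qed
  qed
  have zero: "0 \<in> nil" unfolding nil_def using iter_zero zero_in by blast
  have letter: "nprod V (\<iota> x) n v \<in> nil" if x: "x \<in> sl3" and v: "v \<in> nil" for x n v
  proof -
    let ?x1 = "lie_br a x" let ?x2 = "lie_br a ?x1"
    have sl: "?x1 \<in> sl3" "?x2 \<in> sl3" "lie_br a ?x2 \<in> sl3" using lie_br_sl3 a(1) x by auto
    have aa: "y ** a ** a = 0" for y by (simp add: matrix_mul_assoc[symmetric] a(2) matrix_mul_zero)
    let ?y = "a ** x ** a"
    have ay: "a ** ?y = 0" "?y ** a = 0" by (simp_all add: matrix_mul_assoc a(2) matrix_mul_zero aa)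
    have p: "a ** ?x1 = 0 - ?y" "?x1 ** a = ?y"
      unfolding lie_br_def matrix_diff_distrib by (simp_all add: matrix_mul_assoc a(2) matrix_mul_zero aa)
    \<comment> \<open>The double commutator is \<open>-2 a x a\<close>, so one more commutator
      contains \<open>a ** a\<close> on both sides. Hence three applications of \<open>step\<close>,
      innermost commutator first, handle a letter.\<close>
    have "?x2 = 0 - ?y - ?y" using p unfolding lie_br_def[of a ?x1] by simp
    then have "lie_br a ?x2 = 0"
      unfolding lie_br_def[of a ?x2] by (simp only: matrix_diff_distrib ay matrix_mul_zero) simp
    moreover have "(0 :: complex^3^3) \<in> sl3" by (simp add: sl3_def trace_def)
    then have "\<iota> 0 = 0" using affine_relations(2)[OF V, of 0 0] by simp
    ultimately have x3: "\<iota> (lie_br a ?x2) = 0" by simp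
    have 2: "nprod V (\<iota> ?x2) n v \<in> nil" if "v \<in> nil" for v
      by (rule step[OF i[OF sl(2)] _ that]) (use x3 zero in \<open>auto simp: br[OF sl(2)] nil_def\<close>)
    have 1: "nprod V (\<iota> ?x1) n v \<in> nil" if "v \<in> nil" for v
      by (rule step[OF i[OF sl(1)] _ that]) (use 2 in \<open>simp add: br[OF sl(1)]\<close>)
    show ?thesis
      by (rule step[OF i[OF x] _ v]) (use 1 in \<open>simp add: br[OF x]\<close>)
  qed
  have "vspace V \<subseteq> nil"
  proof (rule order_trans[OF presented_span[of V affine_words _ "affine_relators k", OF _ ambient] vs.span_minimal])
    show "presented_by V affine_words (\<lambda>ws. modes_on V (map (\<lambda>(x, n). (\<iota> x, n)) ws) (vac V)) (affine_relators k)"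
      using V by (simp add: universal_affine_sl3_def)
    show "(\<lambda>ws. modes_on V (map (\<lambda>(x, n). (\<iota> x, n)) ws) (vac V)) ` affine_words \<subseteq> nil"
    proof clarify
      fix ws assume "ws \<in> affine_words"
      then show "modes_on V (map (\<lambda>(x, n). (\<iota> x, n)) ws) (vac V) \<in> nil"
      proof (induction ws)
        case Nil
        have "?\<delta> (vac V) = 0" by (simp add: vac_right_nonneg)
        then have "(?\<delta> ^^ 1) (vac V) = 0" by simp
        then have "vac V \<in> nil" unfolding nil_def using vac_in by blast
        then show ?case by (simp add: modes_on_def)
      next
        case (Cons l ws)
        then show ?case using letter by (auto simp: modes_on_def affine_words_def)
      qed
    qed
    show "vs.subspace nil" unfolding vs.subspace_def using zero nil_add nil_smul by blast
  qed
  then show ?thesis using v by (auto simp: nil_def)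
qed

text \<open>Take the commutator of \<open>Gp(1)\<close> and \<open>Gm(n - 1)\<close>.\<close>

lemma bp_lowered_L:
  assumes W: "vertex_algebra W" and J: "J \<in> vspace W" "Gp \<in> vspace W" "Gm \<in> vspace W" "L \<in> vspace W" "w \<in> vspace W"
    and ope: "nprod W J 0 J = 0"
      "nprod W Gp 0 Gm = smul W 3 (nop W J J) + smul W r (transl W J) - smul W s L" "s \<noteq> 0"
      "nprod W Gp 1 Gm = smul W q J"
    and kill: "\<And>n::nat. n \<ge> 1 \<Longrightarrow> nprod W J (int n) w = 0" "\<And>n::nat. n \<ge> 1 \<Longrightarrow> nprod W Gp (int n) w = 0"
      "\<And>n::nat. n \<ge> 1 \<Longrightarrow> nprod W Gm (int n) w = 0" and n: "n \<ge> 2"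
  shows "nprod W L (int n) w = 0"
proof -
  interpret vertex_algebra W by (rule W)
  \<comment> \<open>The commutator taken with \<open>Gm(m)\<close> contains \<open>L(m + 1)\<close>,
    and \<open>Gm(m) w = 0\<close> needs \<open>m \<ge> 1\<close>. At \<open>n = 2\<close> this uses
    \<open>Gm(1)\<close>, a weight-preserving mode.\<close>
  define m where "m = n - 1"
  have m: "m \<ge> 1" "n = Suc m" using n by (auto simp: m_def)
  have "nprod W (nprod W Gp 0 Gm) (int n) w + nprod W (nprod W Gp 1 Gm) (int m) w = 0"
    using nprod_one_mode[OF J(2,3,5), of "int m"] kill(2)[of 1] kill(3)[OF m(1)] J m(2) by (simp add: add.commute)
  moreover have "nprod W (nprod W Gp 1 Gm) (int m) w = 0"
    using kill(1)[OF m(1)] J by (simp add: ope nprod_linear)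
  \<comment> \<open>On \<open>w\<close> this mode of the square is \<open>J(n - 1) J(0)\<close>; the
    zero mode commutes with \<open>J(n - 1)\<close>, which kills \<open>w\<close>.\<close>
  moreover have "nprod W (nop W J J) (int n) w = 0"
  proof -
    have "nprod W (nop W J J) (int n) w = nprod W J (int m) (nprod W J 0 w)"
      using nop_mode_shift[OF J(1,1,5), of "int n"] kill(1) n m(2) 
      by (metis (no_types, lifting) add_diff_cancel_left' le_add1 le_trans of_nat_Suc of_nat_add one_le_numeral)
    also have "\<dots> = nprod W J 0 (nprod W J (int m) w) - nprod W (nprod W J 0 J) (int m) w"
      using nprod_zero_mode[OF J(1,1,5), of "int m"] by simp
    finally show ?thesis using ope(1) kill(1)[OF m(1)] J by simp
  qed
  moreover have "nprod W (transl W J) (int n) w = 0"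
    using kill(1)[OF m(1)] m(2) J by (simp add: transl_modes)
  ultimately have "smul W s (nprod W L (int n) w) = 0"
    using J by (simp add: ope nprod_linear)
  then show ?thesis using ope(3) by (simp add: vs.scale_eq_0_iff)
qed

section \<open>The realization\<close>

locale realization =
  fixes k :: complex
    and V :: "'v::ab_group_add vert_alg" and \<iota> :: "complex^3^3 \<Rightarrow> 'v"
    and Lk :: "'l::ab_group_add vert_alg" and \<pi>L :: "'v \<Rightarrow> 'l"
    and U :: "'u::ab_group_add vert_alg" and J Gp Gm L :: 'u
    and W :: "'w::ab_group_add vert_alg" and \<pi>W :: "'u \<Rightarrow> 'w"
    and S :: "'s::ab_group_add vert_alg" and \<beta> \<gamma> :: 's
    and P :: "'p::ab_group_add vert_alg" and c d :: 'p and e :: "int \<Rightarrow> 'p"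
    and M :: "'m::ab_group_add vert_alg" and tM :: "'w \<Rightarrow> 's \<Rightarrow> 'm"
    and T :: "'t::ab_group_add vert_alg" and tT :: "'m \<Rightarrow> 'p \<Rightarrow> 't"
    and \<Phi> :: "'v \<Rightarrow> 't"
  assumes V: "universal_affine_sl3 k V \<iota>"
    and Lk: "simple_graded_quotient V (affine_grading V \<iota>) Lk \<pi>L"
    and U: "bershadsky_polyakov k U J Gp Gm L"
    and W: "simple_graded_quotient U (bp_grading U J Gp Gm L) W \<pi>W"
    and S: "beta_gamma_va S \<beta> \<gamma>"
    and P: "half_lattice_va P c d e"
    and M: "va_tensor W S M tM"
    and T: "va_tensor M P T tT"
    and \<Phi>_hom: "va_hom V T \<Phi>"
    and \<Phi>_values: "realization_values k \<iota> T
          (tT (tM (\<pi>W J) (vac S)) (vac P))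
          (tT (tM (\<pi>W Gp) (vac S)) (vac P))
          (tT (tM (\<pi>W Gm) (vac S)) (vac P))
          (tT (tM (vac W) \<beta>) (vac P))
          (tT (tM (vac W) \<gamma>) (vac P))
          (tT (vac M) c)
          (tT (vac M) d)
          (\<lambda>m. tT (vac M) (e m))
          \<Phi>"
begin

sublocale LQ: simple_quotient V "{(\<iota> x, 1) |x. x \<in> sl3}" Lk \<pi>L
  using affine_reorderable[OF V] Lk
  by (simp add: simple_quotient_def simple_quotient_axioms_def affine_grading_def)

sublocale WQ: simple_quotient U "{(J, 1), (Gp, 1), (Gm, 2), (L, 2)}" W \<pi>W
  using bershadsky_polyakov_graded(1)[OF U] W
  by (simp add: simple_quotient_def simple_quotient_axioms_def bp_grading_def)

sublocale TM: tensor_product W S M tM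
  using M S WQ.epi.Q.vertex_algebra_axioms
  by (simp add: tensor_product_def tensor_product_axioms_def beta_gamma_va_def)

sublocale TT: tensor_product M P T tT
  using T P TM.T.vertex_algebra_axioms
  by (simp add: tensor_product_def tensor_product_axioms_def half_lattice_va_def)

lemma bp_in_U: "J \<in> vspace U" "Gp \<in> vspace U" "Gm \<in> vspace U" "L \<in> vspace U"
  using WQ.G_in by auto
lemma bp_in_W [simp]: "\<pi>W J \<in> vspace W" "\<pi>W Gp \<in> vspace W" "\<pi>W Gm \<in> vspace W" "\<pi>W L \<in> vspace W"
  using bp_in_U by simp_all
lemma beta_gamma_in_S [simp]: "\<beta> \<in> vspace S" "\<gamma> \<in> vspace S"
  using S by (auto simp: beta_gamma_va_def freely_strongly_generated_def)
lemma cde_in_P [simp]: "c \<in> vspace P" "d \<in> vspace P" "e m \<in> vspace P"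
  using P by (auto simp: half_lattice_va_def)

section \<open>The three factors inside the tensor product\<close>

definition inW :: "'w \<Rightarrow> 't" where "inW w = tT (tM w (vac S)) (vac P)"
definition inS :: "'s \<Rightarrow> 't" where "inS s = tT (tM (vac W) s) (vac P)"
definition inP :: "'p \<Rightarrow> 't" where "inP p = tT (vac M) p"
definition Om :: "int \<Rightarrow> 't set" where "Om m = (\<lambda>w. tT (tM w (vac S)) (e m)) ` vspace W"

lemma in_T [simp]: "w \<in> vspace W \<Longrightarrow> inW w \<in> vspace T" "s \<in> vspace S \<Longrightarrow> inS s \<in> vspace T"
  "p \<in> vspace P \<Longrightarrow> inP p \<in> vspace T"
  by (simp_all add: inW_def inS_def inP_def)

lemma inW_mode: "\<lbrakk>a \<in> vspace W; w \<in> vspace W; s \<in> vspace S; p \<in> vspace P\<rbrakk> \<Longrightarrow>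
    nprod T (inW a) n (tT (tM w s) p) = tT (tM (nprod W a n w) s) p"
  by (simp add: inW_def TT.nprod_left TM.nprod_left)
lemma inS_mode: "\<lbrakk>a \<in> vspace S; w \<in> vspace W; s \<in> vspace S; p \<in> vspace P\<rbrakk> \<Longrightarrow>
    nprod T (inS a) n (tT (tM w s) p) = tT (tM w (nprod S a n s)) p"
  by (simp add: inS_def TT.nprod_left TM.nprod_right)
lemma inP_mode: "\<lbrakk>a \<in> vspace P; x \<in> vspace M; p \<in> vspace P\<rbrakk> \<Longrightarrow>
    nprod T (inP a) n (tT x p) = tT x (nprod P a n p)"
  by (simp add: inP_def TT.nprod_right)

lemma vac_T_eq: "vac T = tT (tM (vac W) (vac S)) (vac P)"
  by (simp add: TT.vac_T TM.vac_T)

lemma inP_eq: "inP p = tT (tM (vac W) (vac S)) p"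
  by (simp add: inP_def TM.vac_T)

lemma e_0_P: "e 0 = vac P"
  using P by (simp add: half_lattice_va_def)

lemma P_ope:
  shows "nprod P c (int n) d = (if n = 1 then smul P 2 (vac P) else 0)"
    "nprod P c (int n) c = 0" "nprod P d (int n) d = 0" "nprod P c (int n) (e m) = 0"
    "nprod P d (int n) (e m) = (if n = 0 then smul P (2 * of_int m) (e m) else 0)"
    "transl P (e m) = smul P (of_int m) (nprod P c (-1) (e m))"
    "nprod P (e m) (int n) (e l) = 0" "nprod P (e m) (-1) (e l) = e (m + l)"
  using P by (auto simp: half_lattice_va_def ope_def nop_def nth_Cons split: nat.split)

lemma S_ope:
  shows "nprod S \<beta> (int n) \<gamma> = (if n = 0 then vac S else 0)"
    "nprod S \<beta> (int n) \<beta> = 0" "nprod S \<gamma> (int n) \<gamma> = 0"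
  using S by (simp_all add: beta_gamma_va_def ope_def)

lemma OmI: "w \<in> vspace W \<Longrightarrow> tT (tM w (vac S)) (e m) \<in> Om m"
  by (simp add: Om_def)

lemma inS_inS: "a \<in> vspace S \<Longrightarrow> b \<in> vspace S \<Longrightarrow> nprod T (inS a) n (inS b) = inS (nprod S a n b)"
  using inS_mode[of a "vac W" b "vac P" n] by (simp flip: inS_def)

lemma inP_inP: "a \<in> vspace P \<Longrightarrow> b \<in> vspace P \<Longrightarrow> nprod T (inP a) n (inP b) = inP (nprod P a n b)"
  using inP_mode[of a "vac M" b n] by (simp flip: inP_def)

lemma inSP_linear: "inS 0 = 0" "inP 0 = 0" "p \<in> vspace P \<Longrightarrow> inP (smul P r p) = smul T r (inP p)"
    "inS (vac S) = vac T" "inP (vac P) = vac T"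
  by (simp_all add: inS_def inP_def TT.t_smul_right vac_T_eq TM.vac_T)

lemma cross_zero:
  shows "a \<in> vspace S \<Longrightarrow> b \<in> vspace P \<Longrightarrow> nprod T (inS a) (int n) (inP b) = 0"
    "w \<in> vspace W \<Longrightarrow> b \<in> vspace P \<Longrightarrow> nprod T (inW w) (int n) (inP b) = 0"
    "w \<in> vspace W \<Longrightarrow> a \<in> vspace S \<Longrightarrow> nprod T (inW w) (int n) (inS a) = 0"
    apply (simp add: inP_eq inS_mode TM.B.vac_right_nonneg)
   apply (simp add: inP_eq inW_mode WQ.epi.Q.vac_right_nonneg)
  apply (simp add: inS_def inW_mode WQ.epi.Q.vac_right_nonneg)
  done

text \<open>The factor \<open>W\<close> is left untouched: starting from
  \<open>w \<otimes> vac \<otimes> e^(mc)\<close>, the \<beta>\<gamma> factor is built up by its PBW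
  generators, then the half-lattice factor, and pure tensors span.\<close>

lemma T_generated: "vspace T \<subseteq> TT.T.vs.span {modes_on T ws x | ws x m.
    (\<forall>(a, q)\<in>set ws. a \<in> {inS \<beta>, inS \<gamma>, inP c, inP d} \<and> q < 0) \<and> x \<in> Om m}" (is "_ \<subseteq> ?K")
proof -
  let ?l = "\<lambda>ws. \<forall>(a, q)\<in>set ws. a \<in> {inS \<beta>, inS \<gamma>, inP c, inP d} \<and> q < (0::int)"
  have K: "TT.T.vs.subspace ?K" by simp
  have inT: "modes_on T ws x \<in> vspace T" if "?l ws" "x \<in> Om m" for ws x m
    by (rule TT.T.modes_on_in) (use that in \<open>fastforce simp: Om_def\<close>)+
  have letter: "nprod T a q y \<in> ?K" if a: "a \<in> {inS \<beta>, inS \<gamma>, inP c, inP d}" "q < 0" and y: "y \<in> ?K" for a q y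
  proof -
    have "y \<in> {y \<in> vspace T. nprod T a q y \<in> ?K}"
    proof (rule subsetD[OF TT.T.vs.span_minimal y])
      show "TT.T.vs.subspace {y \<in> vspace T. nprod T a q y \<in> ?K}"
        by (rule TT.T.subspace_preimage_right[OF K]) (use a in auto)
      show "{modes_on T ws x | ws x m. ?l ws \<and> x \<in> Om m} \<subseteq> {y \<in> vspace T. nprod T a q y \<in> ?K}"
      proof clarify
        fix ws x m assume ws: "?l ws" "x \<in> Om m"
        have "modes_on T ((a, q) # ws) x \<in> ?K"
          by (rule TT.T.vs.span_base, intro CollectI exI[of _ "(a, q) # ws"] exI[of _ x] exI[of _ m])
            (use ws a in simp)
        then show "modes_on T ws x \<in> vspace T \<and> nprod T a q (modes_on T ws x) \<in> ?K"
          using inT[OF ws] by (simp add: modes_on_def)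
      qed
    qed
    then show ?thesis by simp
  qed
  have base: "tT (tM w (vac S)) (e m) \<in> ?K" if "w \<in> vspace W" for w m
    by (rule TT.T.vs.span_base, intro CollectI exI[of _ "[]"] exI[of _ "tT (tM w (vac S)) (e m)"] exI[of _ m])
      (use OmI[OF that] in \<open>simp add: modes_on_def\<close>)
  have s: "tT (tM w s) (e m) \<in> ?K" if w: "w \<in> vspace W" and s: "s \<in> vspace S" for w s m
  proof -
    have free: "freely_strongly_generated S [\<beta>, \<gamma>]" using S by (simp add: beta_gamma_va_def)
    have "vspace S \<subseteq> {s \<in> vspace S. tT (tM w s) (e m) \<in> ?K}"
    proof (rule freely_generated_subset[OF free TM.B.ambient])
      show "TM.B.vs.subspace {s \<in> vspace S. tT (tM w s) (e m) \<in> ?K}"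
        unfolding TM.B.vs.subspace_def using w
        by (auto simp: TM.t_add_right TT.t_add_left TM.t_smul_right TT.t_smul_left
            intro: TT.T.vs.span_add TT.T.vs.span_scale TT.T.vs.span_zero)
      fix g n y assume g: "g \<in> set [\<beta>, \<gamma>]" and y: "y \<in> {s \<in> vspace S. tT (tM w s) (e m) \<in> ?K}"
      have "nprod T (inS g) (- int n - 1) (tT (tM w y) (e m)) \<in> ?K"
        by (rule letter) (use g y in auto)
      then have "tT (tM w (nprod S g (- int n - 1) y)) (e m) \<in> ?K"
        using inS_mode[of g w y "e m"] g y w by auto
      then show "nprod S g (- int n - 1) y \<in> {s \<in> vspace S. tT (tM w s) (e m) \<in> ?K}" using g y by auto
    qed (use base[OF w] in simp)
    then show ?thesis using s by blast
  qed
  have sp: "tT (tM w s) p \<in> ?K" if w: "w \<in> vspace W" and s': "s \<in> vspace S" and p': "p \<in> vspace P" for w s p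
  proof -
    have "vspace P \<subseteq> {p \<in> vspace P. tT (tM w s) p \<in> ?K}"
    proof (rule half_lattice_subset[OF P])
      show "TT.B.vs.subspace {p \<in> vspace P. tT (tM w s) p \<in> ?K}"
        unfolding TT.B.vs.subspace_def using w s'
        by (auto simp: TT.t_add_right TT.t_smul_right intro: TT.T.vs.span_add TT.T.vs.span_scale TT.T.vs.span_zero)
      show "e m \<in> {p \<in> vspace P. tT (tM w s) p \<in> ?K}" for m using s[OF w s'] by simp
      fix g n y assume g: "g \<in> {c, d}" and y: "y \<in> {p \<in> vspace P. tT (tM w s) p \<in> ?K}"
      have "nprod T (inP g) (- int n - 1) (tT (tM w s) y) \<in> ?K"
        by (rule letter) (use g y in auto)
      then have "tT (tM w s) (nprod P g (- int n - 1) y) \<in> ?K"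
        using inP_mode[of g "tM w s" y] g y w s' by auto
      then show "nprod P g (- int n - 1) y \<in> {p \<in> vspace P. tT (tM w s) p \<in> ?K}" using g y by auto
    qed
    then show ?thesis using p' by blast
  qed
  have mp: "tT x p \<in> ?K" if "x \<in> vspace M" "p \<in> vspace P" for x p
    using that(1)
  proof (induction rule: TM.tensor_induct)
    case (add x y)
    then show ?case using that(2) by (simp add: TT.t_add_left TT.T.vs.span_add)
  qed (use sp that(2) in \<open>auto simp: TT.T.vs.span_zero\<close>)
  show ?thesis
  proof
    fix x assume "x \<in> vspace T"
    then show "x \<in> ?K"
    proof (induction rule: TT.tensor_induct)
      case (pure x p)
      then show ?case by (rule mp)
    qed (rule TT.T.vs.span_zero, rule TT.T.vs.span_add)
  qed
qed

lemma Om_subspace: "TT.T.vs.subspace (Om m)"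
  unfolding TT.T.vs.subspace_def
proof (intro conjI ballI allI)
  show "0 \<in> Om m" using OmI[OF WQ.epi.Q.zero_in, of m] by simp
  fix x y assume "x \<in> Om m" "y \<in> Om m"
  then obtain w w' where w: "w \<in> vspace W" "x = tT (tM w (vac S)) (e m)" "w' \<in> vspace W" "y = tT (tM w' (vac S)) (e m)"
    by (auto simp: Om_def)
  show "x + y \<in> Om m" using OmI[of "w + w'" m] w by (simp add: TM.t_add_left TT.t_add_left)
next
  fix r x assume "x \<in> Om m"
  then obtain w where w: "w \<in> vspace W" "x = tT (tM w (vac S)) (e m)" by (auto simp: Om_def)
  show "smul T r x \<in> Om m" using OmI[of "smul W r w" m] w by (simp add: TM.t_smul_left TT.t_smul_left)
qed

sublocale F: bp_fields T "inS \<beta>" "inS \<gamma>" "inP c" "inP d" "\<lambda>m. inP (e m)" Om "inW (\<pi>W J)" "inW (\<pi>W Gp)" "inW (\<pi>W Gm)" k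
proof (unfold_locales, goal_cases)
  case 6 show ?case by (simp add: inS_inS S_ope inSP_linear)
next
  case 7 show ?case by (simp add: inS_inS S_ope inSP_linear)
next
  case 8 show ?case by (simp add: inS_inS S_ope inSP_linear)
next
  case 9 show ?case by (simp add: inP_inP P_ope inSP_linear)
next
  case 10 show ?case by (simp add: inP_inP P_ope inSP_linear)
next
  case 11 show ?case by (simp add: inP_inP P_ope inSP_linear)
next
  case 12 show ?case by (simp add: inP_inP P_ope inSP_linear)
next
  case 13 show ?case by (simp add: inP_inP P_ope inSP_linear)
next
  case (14 m)
  have "transl T (inP (e m)) = inP (transl P (e m))"
    unfolding transl_def inSP_linear(5)[symmetric] by (simp add: inP_inP)
  then show ?case by (simp add: P_ope inP_inP inSP_linear)
next
  case 15 show ?case by (simp add: inP_inP P_ope inSP_linear)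
next
  case 16 show ?case by (simp add: inP_inP P_ope)
next
  case 17 show ?case by (simp add: e_0_P inSP_linear)
next
  case 18 then show ?case using cross_zero(1) by auto
next
  case 19 show ?case by (rule Om_subspace)
next
  case 20 then show ?case by (auto simp: Om_def)
next
  case 21 then show ?case by (auto simp: Om_def inS_mode TM.B.vac_right_nonneg)
next
  case 22 then show ?case by (auto simp: Om_def inS_mode TM.B.vac_right_nonneg)
next
  case 23 then show ?case by (auto simp: Om_def inP_mode P_ope)
next
  case (24 x m n)
  then obtain w where w: "w \<in> vspace W" "x = tT (tM w (vac S)) (e m)" by (auto simp: Om_def)
  then have "nprod T (inP d) (int n) x = tT (tM w (vac S)) (nprod P d (int n) (e m))" by (simp add: inP_mode)
  then show ?case using w by (simp only: P_ope(5)) (simp add: TT.t_smul_right)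
next
  case 25 then show ?case by (auto simp: Om_def inP_mode P_ope)
next
  case 26 then show ?case by (auto simp: Om_def inP_mode P_ope add.commute)
next
  case 27 then show ?case by (auto simp: Om_def inP_mode P_ope)
next
  case 28 show ?case by (rule T_generated)
next
  case 32 then show ?case using cross_zero(2,3) by auto
next
  case 33 then show ?case by (auto simp: Om_def inW_mode)
next
  case 34 show ?case using OmI[OF WQ.epi.Q.vac_in] by (simp add: inP_eq)
qed (simp_all)

end

lemma sl3_induct [consumes 1, case_names e1 e2 e3 h1 h2 f1 f2 f3 add smul]:
  assumes x: "x \<in> sl3"
    and gen: "Q (emat 1 2)" "Q (emat 2 3)" "Q (emat 1 3)" "Q (emat 1 1 - emat 2 2)" "Q (emat 2 2 - emat 3 3)"
      "Q (emat 2 1)" "Q (emat 3 2)" "Q (emat 3 1)"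
    and add: "\<And>x y. x \<in> sl3 \<Longrightarrow> y \<in> sl3 \<Longrightarrow> Q x \<Longrightarrow> Q y \<Longrightarrow> Q (x + y)"
    and smul: "\<And>r x. x \<in> sl3 \<Longrightarrow> Q x \<Longrightarrow> Q (msmul r x)"
  shows "Q x"
proof -
  have sl3: "emat 1 2 \<in> sl3" "emat 2 3 \<in> sl3" "emat 1 3 \<in> sl3" "emat 1 1 - emat 2 2 \<in> sl3"
    "emat 2 2 - emat 3 3 \<in> sl3" "emat 2 1 \<in> sl3" "emat 3 2 \<in> sl3" "emat 3 1 \<in> sl3"
    by (simp_all add: sl3_def trace_def emat_def sum_3)
  have closed: "x + y \<in> sl3 \<and> Q (x + y)" if "x \<in> sl3 \<and> Q x" "y \<in> sl3 \<and> Q y" for x y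
    using that add by (simp add: sl3_def trace_add)
  have m: "msmul r x \<in> sl3 \<and> Q (msmul r x)" if "x \<in> sl3" "Q x" for r x
    using that smul by (simp add: sl3_def msmul_def trace_def flip: sum_distrib_left)
  \<comment> \<open>The trace condition makes the diagonal part of \<open>x\<close> equal to
    \<open>x11\<close> times the first coroot minus \<open>x33\<close> times the second.\<close>
  have tr: "x $ 2 $ 2 = - x $ 1 $ 1 - x $ 3 $ 3"
    using x by (simp add: sl3_def trace_def sum_3 eq_neg_iff_add_eq_0 algebra_simps)
  have "x = msmul (x $ 1 $ 2) (emat 1 2) + msmul (x $ 2 $ 3) (emat 2 3) + msmul (x $ 1 $ 3) (emat 1 3)
    + msmul (x $ 1 $ 1) (emat 1 1 - emat 2 2) + msmul (- x $ 3 $ 3) (emat 2 2 - emat 3 3)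
    + msmul (x $ 2 $ 1) (emat 2 1) + msmul (x $ 3 $ 2) (emat 3 2) + msmul (x $ 3 $ 1) (emat 3 1)"
    by (simp add: vec_eq_iff forall_3 msmul_def emat_def tr)
  moreover have "\<dots> \<in> sl3 \<and> Q \<dots>"
    by (intro closed m sl3 gen)
  ultimately show ?thesis by simp
qed

lemma emat_in_sl3: "i \<noteq> j \<Longrightarrow> emat i j \<in> sl3" "emat i i - emat j j \<in> sl3"
  by (auto simp: sl3_def trace_def emat_def sum_subtractf intro!: sum.neutral)

lemma emat_mult: "emat i j ** emat l m = (if j = l then emat i m else 0)"
  by (auto simp: emat_def matrix_matrix_mult_def vec_eq_iff if_distrib[of "\<lambda>x. x * _"] if_distrib[of "\<lambda>x. _ * x"]
      cong: if_cong)

lemma (in va_epi) hom_gensE: "(b, p) \<in> hom_gens G \<Longrightarrow> \<exists>a. (a, p) \<in> G \<and> b = \<pi> a"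
  by (auto simp: hom_gens_def)

section \<open>The image of the homomorphism and its grading\<close>

context realization
begin

abbreviation "GV \<equiv> {(\<iota> x, 1::nat) |x. x \<in> sl3}"
abbreviation "A \<equiv> va_image V T \<Phi>"

sublocale EA: va_epi V A \<Phi>
  by (rule va_epi_va_image[OF LQ.vertex_algebra_axioms TT.T.vertex_algebra_axioms \<Phi>_hom])

sublocale AG: reorderable A "EA.hom_gens GV"
  by (rule EA.reorderable_hom[OF LQ.reorderable_axioms])

lemma A_simps [simp]: "smul A = smul T" "vac A = vac T" "nprod A = nprod T" "vspace A = \<Phi> ` vspace V"
  by (simp_all add: va_image_def)

definition cur :: "complex^3^3 \<Rightarrow> 't" where "cur x = \<Phi> (\<iota> x)"

lemma iota_in: "x \<in> sl3 \<Longrightarrow> \<iota> x \<in> vspace V"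
  using affine_relations(1)[OF V] by blast

lemma GA_eq: "EA.hom_gens GV = {(cur x, 1) |x. x \<in> sl3}"
  by (auto simp: EA.hom_gens_def cur_def image_iff)

lemma A_subset_T: "\<Phi> ` vspace V \<subseteq> vspace T"
  using \<Phi>_hom by (auto simp: va_hom_def)

lemma cur_in_A: "x \<in> sl3 \<Longrightarrow> cur x \<in> \<Phi> ` vspace V"
  unfolding cur_def using iota_in by blast

lemma cur_in [simp]: "x \<in> sl3 \<Longrightarrow> cur x \<in> vspace T"
  using cur_in_A A_subset_T by blast

lemma cur_linear:
  assumes "x \<in> sl3" "y \<in> sl3"
  shows "cur (x + y) = cur x + cur y" "cur (msmul r x) = smul T r (cur x)"
  using affine_relations[OF V assms] EA.hom_add[OF iota_in iota_in, OF assms] EA.hom_smul[OF iota_in[OF assms(1)], of r]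
  by (simp_all add: cur_def)

lemma cur_bracket:
  assumes "x \<in> sl3" "y \<in> sl3"
  shows "nprod T (cur x) 0 (cur y) = cur (lie_br x y)"
  using affine_relations(4)[OF V assms, of 0] EA.hom_nprod[OF iota_in iota_in, OF assms, of 0] by (simp add: cur_def)

lemma cur_values:
  "cur (emat 1 2) = F.E1" "cur (emat 2 3) = inS \<beta>" "cur (emat 1 3) = inP (e 1)"
  "cur (emat 1 1 - emat 2 2) = F.H1" "cur (emat 2 2 - emat 3 3) = F.H2"
  "cur (emat 2 1) = F.F1" "cur (emat 3 2) = F.F2"
  using \<Phi>_values unfolding realization_values_def cur_def F.E1_def F.H1_def F.H2_def F.F1_def F.F2_def F.X_def F.Y_def
    inW_def[symmetric] inS_def[symmetric] inP_def[symmetric]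
  by blast+

lemma cur_f3: "cur (emat 3 1) = nprod T F.F2 0 F.F1"
proof -
  have "lie_br (emat 3 2) (emat 2 1) = emat 3 1" by (simp add: lie_br_def emat_mult)
  then show ?thesis using cur_bracket[of "emat 3 2" "emat 2 1"] emat_in_sl3(1) by (simp add: cur_values)
qed

lemma vac_T_nonzero: "vac T \<noteq> 0"
proof
  assume "vac T = 0"
  then have "tM (vac W) (vac S) = 0 \<or> vac P = 0"
    by (intro TT.pure_nonzero) (auto simp: vac_T_eq)
  then have "vac W = 0 \<or> vac S = 0 \<or> vac P = 0" using TM.pure_nonzero[of "vac W" "vac S"] by auto
  then show False
    using WQ.vac_Q beta_gamma_vac[OF S] half_lattice_e_nonzero[OF P, of 0] e_0_P by auto
qed

text \<open>Its product with \<open>e^(-mc)\<close> is the vacuum.\<close>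

lemma inP_e_nonzero: "inP (e m) \<noteq> 0"
proof
  assume "inP (e m) = 0"
  then have "inP (nprod P (e (- m)) (-1) (e m)) = 0"
    using inP_inP[of "e (- m)" "e m" "-1"] by simp
  then show False using vac_T_nonzero by (simp add: P_ope e_0_P inSP_linear)
qed

lemma W_grading:
  obtains D where "WQ.epi.Q.grading_op D" "WQ.Q.graded_by D"
    "\<And>a p. (a, p) \<in> {(J, 1), (Gp, 1), (Gm, 2), (L, 2)} \<Longrightarrow> D (\<pi>W a) = smul W (of_int (int p)) (\<pi>W a)"
proof -
  obtain DU where DU: "WQ.graded_by DU" using bershadsky_polyakov_graded(2)[OF U] by blast
  have g: "WQ.grading_op DU" by (rule WQ.graded_by_grading_op[OF DU])
  have gen: "DU a = smul U (of_int (int p)) a" if "(a, p) \<in> {(J, 1), (Gp, 1), (Gm, 2), (L, 2)}" for a p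
    using DU WQ.generator_in_wspace[OF that] unfolding WQ.graded_by_def by blast
  obtain D where D: "WQ.epi.Q.grading_op D" "\<And>v. v \<in> vspace U \<Longrightarrow> D (\<pi>W v) = \<pi>W (DU v)"
  proof (rule WQ.quotient_grading_op[OF g gen])
    fix D assume "WQ.epi.Q.grading_op D" "\<And>v. v \<in> vspace U \<Longrightarrow> D (\<pi>W v) = \<pi>W (DU v)"
    then show thesis by (rule that)
  qed
  have Dgen: "D (\<pi>W a) = smul W (of_int (int p)) (\<pi>W a)" if "(a, p) \<in> {(J, 1), (Gp, 1), (Gm, 2), (L, 2)}" for a p
  proof -
    have "a \<in> vspace U" using WQ.G_fst_in[OF that] .
    then show ?thesis using D(2) gen[OF that] WQ.epi.hom_smul by simp
  qed
  have "WQ.Q.graded_by D"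
    unfolding WQ.Q.graded_by_def
  proof (intro conjI allI ballI)
    show "lin_on W (smul W) D" using D(1) by (simp add: WQ.epi.Q.grading_op_def)
    fix N v assume v: "v \<in> WQ.epi.Q.wspace (WQ.epi.hom_gens {(J, 1), (Gp, 1), (Gm, 2), (L, 2)}) N"
    show "D v = smul W (of_int N) v"
    proof (rule WQ.epi.Q.grading_op_wspace[OF D(1) WQ.Q.G_in _ v])
      fix b p assume "(b, p) \<in> WQ.epi.hom_gens {(J, 1), (Gp, 1), (Gm, 2), (L, 2)}"
      from WQ.epi.hom_gensE[OF this] obtain a where
        "(a, p) \<in> {(J, 1), (Gp, 1), (Gm, 2), (L, 2)} \<and> b = \<pi>W a" ..
      then show "D b = smul W (of_int (int p)) b" using Dgen[of a p] by simp
    qed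
  qed
  from that[OF D(1) this Dgen] show ?thesis .
qed

text \<open>The sum of the three grading operators. In the image of \<open>f2\<close> the weight 2
  of \<open>G-\<close> is compensated by the weight -1 of \<open>e^(-c)\<close>; in the image of
  \<open>f1\<close> the same factor compensates the extra letter or the derivative.\<close>

lemma T_grading:
  obtains D where "TT.T.grading_op D" "\<And>x. x \<in> sl3 \<Longrightarrow> D (cur x) = cur x"
    "\<And>m. D (inP (e m)) = smul T (of_int m) (inP (e m))"
proof -
  obtain DW where DW: "WQ.epi.Q.grading_op DW" "WQ.Q.graded_by DW"
    "\<And>a p. (a, p) \<in> {(J, 1), (Gp, 1), (Gm, 2), (L, 2)} \<Longrightarrow> DW (\<pi>W a) = smul W (of_int (int p)) (\<pi>W a)"
  proof (rule W_grading)
    fix DW assume "WQ.epi.Q.grading_op DW" "WQ.Q.graded_by DW"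
    "\<And>a p. (a, p) \<in> {(J, 1), (Gp, 1), (Gm, 2), (L, 2)} \<Longrightarrow> DW (\<pi>W a) = smul W (of_int (int p)) (\<pi>W a)"
    then show thesis by (rule that)
  qed
  obtain DS where DS: "TM.B.grading_op DS" "DS \<beta> = \<beta>" "DS \<gamma> = 0"
  proof (rule beta_gamma_grading_op[OF S])
    fix DS assume "TM.B.grading_op DS" "DS \<beta> = \<beta>" "DS \<gamma> = 0"
    then show thesis by (rule that)
  qed
  obtain DP where DP: "TT.B.grading_op DP" "DP c = c" "DP d = d" "\<And>m. DP (e m) = smul P (of_int m) (e m)"
  proof (rule half_lattice_grading_op[OF P])
    fix DP assume "TT.B.grading_op DP" "DP c = c" "DP d = d" "\<And>m. DP (e m) = smul P (of_int m) (e m)"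
    then show thesis by (rule that)
  qed
  obtain DM where DM: "TM.T.grading_op DM" "\<And>a b. a \<in> vspace W \<Longrightarrow> b \<in> vspace S \<Longrightarrow> DM (tM a b) = tM (DW a) b + tM a (DS b)"
  proof (rule TM.grading_op_tensor[OF DW(1) DS(1)])
    fix DM assume "TM.T.grading_op DM" "\<And>a b. a \<in> vspace W \<Longrightarrow> b \<in> vspace S \<Longrightarrow> DM (tM a b) = tM (DW a) b + tM a (DS b)"
    then show thesis by (rule that)
  qed
  obtain D where D: "TT.T.grading_op D" "\<And>a b. a \<in> vspace M \<Longrightarrow> b \<in> vspace P \<Longrightarrow> D (tT a b) = tT (DM a) b + tT a (DP b)"
  proof (rule TT.grading_op_tensor[OF DM(1) DP(1)])
    fix D assume "TT.T.grading_op D" "\<And>a b. a \<in> vspace M \<Longrightarrow> b \<in> vspace P \<Longrightarrow> D (tT a b) = tT (DM a) b + tT a (DP b)"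
    then show thesis by (rule that)
  qed
  have v0: "DW (vac W) = 0" "DS (vac S) = 0" "DM (vac M) = 0" "DP (vac P) = 0"
    using WQ.epi.Q.grading_op_vac[OF DW(1)] TM.B.grading_op_vac[OF DS(1)] TM.T.grading_op_vac[OF DM(1)]
      TT.B.grading_op_vac[OF DP(1)] by auto
  have DW_in: "DW w \<in> vspace W" if "w \<in> vspace W" for w using DW(1) that by (simp add: WQ.epi.Q.grading_op_def)
  have DS_in: "DS w \<in> vspace S" if "w \<in> vspace S" for w using DS(1) that by (simp add: TM.B.grading_op_def)
  have DinW: "D (inW w) = inW (DW w)" if "w \<in> vspace W" for w
    using that DW_in by (simp add: inW_def D(2) DM(2) v0)
  have DinS: "D (inS s) = inS (DS s)" if "s \<in> vspace S" for s
    using that DS_in by (simp add: inS_def D(2) DM(2) v0)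
  have DP_in: "DP p \<in> vspace P" if "p \<in> vspace P" for p using DP(1) that by (simp add: TT.B.grading_op_def)
  have DinP: "D (inP p) = inP (DP p)" if "p \<in> vspace P" for p
    using that DP_in by (simp add: inP_def D(2) v0)
  have lin: "lin_on T (smul T) D" using D(1) by (simp add: TT.T.grading_op_def)
  define wt where "wt n x \<longleftrightarrow> x \<in> vspace T \<and> D x = smul T (of_int n) x" for n :: int and x
  have wt_add: "wt n (x + y)" "wt n (x - y)" if "wt n x" "wt n y" for n x y
    using that TT.T.lin_onD(1,5)[OF lin TT.T.ambient]
    by (simp_all add: wt_def TT.T.vs.scale_right_distrib TT.T.vs.scale_right_diff_distrib)
  have wt_smul: "wt n (smul T r x)" "wt n (- x)" if "wt n x" for n r x
    using that TT.T.lin_onD(2)[OF lin TT.T.ambient _ TT.T.zero_in] TT.T.lin_onD(4)[OF lin TT.T.ambient _ TT.T.zero_in]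
    by (simp_all add: wt_def mult.commute)
  have wt_nprod: "wt (p + q - n - 1) (nprod T x n y)" if "wt p x" "wt q y" for p q n x y
    using that TT.T.grading_op_nprod[OF D(1)] by (simp add: wt_def)
  have wt_nop: "wt n (nop T x y)" if "wt p x" "wt q y" "n = p + q" for p q n x y
    using wt_nprod[OF that(1,2), of "-1"] that(3) by (simp add: nop_def)
  have wt_vac: "wt 0 (vac T)" using TT.T.grading_op_vac[OF D(1)] by (simp add: wt_def)
  have wt_transl: "wt n (transl T x)" if "wt p x" "n = p + 1" for p n x
    using wt_nprod[OF that(1) wt_vac, of "-2"] that(2) by (simp add: transl_def add.commute)
  have inW_smul: "inW (smul W r w) = smul T r (inW w)" if "w \<in> vspace W" for r w
    using that by (simp add: inW_def TM.t_smul_left TT.t_smul_left)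
  have g: "wt 1 (inW (\<pi>W J))" "wt 1 (inW (\<pi>W Gp))" "wt 2 (inW (\<pi>W Gm))"
    using DW(3)[of J 1] DW(3)[of Gp 1] DW(3)[of Gm 2] by (simp_all add: wt_def DinW inW_smul)
  have s: "wt 1 (inS \<beta>)" "wt 0 (inS \<gamma>)" by (simp_all add: wt_def DinS DS inSP_linear)
  have p: "wt 1 (inP c)" "wt 1 (inP d)" "wt m (inP (e m))" for m by (simp_all add: wt_def DinP DP inSP_linear)
  have XY: "wt 1 F.X" "wt 1 F.Y" unfolding F.X_def F.Y_def by (intro wt_add wt_smul g p)+
  have gb: "wt 1 (nop T (inS \<gamma>) (inS \<beta>))" by (rule wt_nop[OF s(2,1)]) simp
  have F1: "wt 1 F.F1"
    unfolding F.F1_def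
    by (intro wt_add wt_smul g wt_nop[OF XY(1) wt_nop[OF s(1) p(3)]] wt_nop[OF wt_transl[OF s(1)] p(3)]) auto
  have F2: "wt 1 F.F2"
    unfolding F.F2_def
    by (intro wt_add wt_smul wt_nop[OF g(3) p(3)] wt_nop[OF XY(2) s(2)] wt_transl[OF s(2)] wt_nop[OF s(2) gb]) auto
  have "wt 1 (cur x)" if "x \<in> sl3" for x
    using that
  proof (induction rule: sl3_induct)
    case e1
    show ?case unfolding cur_values F.E1_def by (intro wt_smul wt_nop[OF s(2) p(3)]) simp
  next
    case h1
    show ?case unfolding cur_values F.H1_def by (intro wt_add wt_smul g p gb)
  next
    case h2
    show ?case unfolding cur_values F.H2_def by (intro wt_add wt_smul g p gb)
  next
    case f3
    show ?case unfolding cur_f3 using wt_nprod[OF F2 F1, of 0] by simp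
  qed (use s p F1 F2 wt_add wt_smul in \<open>simp_all add: cur_values cur_linear\<close>)
  then have "D (cur x) = cur x" if "x \<in> sl3" for x using that by (simp add: wt_def)
  moreover have "D (inP (e m)) = smul T (of_int m) (inP (e m))" for m using p(3)[of m] by (simp add: wt_def)
  ultimately show ?thesis by (rule that[OF D(1)])
qed

text \<open>Words in the currents are eigenvectors of the operator on \<open>T\<close> with their
  word weight as eigenvalue, because each current has eigenvalue 1; so it restricts to a grading of
  the image, at every level.\<close>

lemma A_graded:
  "\<exists>D. AG.graded_by D \<and> (\<forall>m. D (inP (e m)) = smul T (of_int m) (inP (e m)))"
proof -
  obtain D where D: "TT.T.grading_op D" "\<And>x. x \<in> sl3 \<Longrightarrow> D (cur x) = cur x"
    "\<And>m. D (inP (e m)) = smul T (of_int m) (inP (e m))"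
  proof (rule T_grading)
    fix D assume "TT.T.grading_op D" "\<And>x. x \<in> sl3 \<Longrightarrow> D (cur x) = cur x"
    "\<And>m. D (inP (e m)) = smul T (of_int m) (inP (e m))"
    then show thesis by (rule that)
  qed
  have lin: "lin_on T (smul T) D" using D(1) by (simp add: TT.T.grading_op_def)
  have linA: "lin_on A (smul A) D" using lin A_subset_T by (auto simp: lin_on_def subset_iff)
  have G: "fst ` EA.hom_gens GV \<subseteq> vspace T" unfolding GA_eq using cur_in by auto
  have DG: "D a = smul T (of_int (int p)) a" if "(a, p) \<in> EA.hom_gens GV" for a p
    using that D(2) unfolding GA_eq by auto
  have act: "EA.Q.act ws v = TT.T.act ws v" for ws v
    by (simp add: EA.Q.act_def TT.T.act_def modes_on_def)
  have "D v = smul T (of_int N) v" if "v \<in> EA.Q.wspace (EA.hom_gens GV) N" for v N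
  proof -
    have "v \<in> vspace T \<and> D v = smul T (of_int N) v"
      using that unfolding EA.Q.wspace_def
    proof (induction rule: EA.Q.vs.span_induct_alt)
      case base
      show ?case using TT.T.lin_on_zero[OF lin TT.T.ambient] by simp
    next
      case (step r x y)
      then obtain ws where ws: "EA.Q.letters (EA.hom_gens GV) ws" "EA.Q.wdeg ws = N" "x = TT.T.act ws (vac T)"
        by (auto simp: act)
      have x: "x \<in> vspace T" "D x = smul T (of_int N) x"
        using TT.T.act_in[OF ws(1) G TT.T.vac_in] TT.T.grading_op_act[OF D(1) G DG ws(1)] ws(2,3)
        by simp_all
      then show ?case using step
        by (simp add: TT.T.lin_onD(1)[OF lin TT.T.ambient] TT.T.lin_onD(2)[OF lin TT.T.ambient _ TT.T.zero_in]
            TT.T.vs.scale_right_distrib mult.commute)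
    qed
    then show ?thesis by simp
  qed
  then have "AG.graded_by D" using linA unfolding AG.graded_by_def A_simps by blast
  then show ?thesis using D(3) by blast
qed

lemma vac_not_positive_A: "vac T \<notin> AG.positive_part"
proof -
  obtain D where D: "AG.graded_by D" using A_graded by blast
  show ?thesis using AG.vac_not_positive[OF D] vac_T_nonzero by simp
qed

end

section \<open>Ideals of the image, simplicity and the embedding\<close>

context realization
begin

text \<open>Nothing is assumed about \<open>L\<close>; its lowering modes are recovered by
  \<open>bp_lowered_L\<close>, after which \<open>w\<close> is lowered for all four generators of
  the simple quotient.\<close>

lemma lowered_W:
  assumes w: "w \<in> vspace W" and kill: "\<And>n::nat. n \<ge> 1 \<Longrightarrow> nprod W (\<pi>W J) (int n) w = 0"
    "\<And>n::nat. n \<ge> 1 \<Longrightarrow> nprod W (\<pi>W Gp) (int n) w = 0" "\<And>n::nat. n \<ge> 1 \<Longrightarrow> nprod W (\<pi>W Gm) (int n) w = 0"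
  shows "w \<in> WQ.epi.Q.vs.span {vac W}"
proof -
  \<comment> \<open>A nonzero coefficient for the last generator that covers the critical level,
    where \<open>L\<close> stands for the central field.\<close>
  define s where "s = (if k = -3 then 1 else k + 3)"
  have s: "s \<noteq> 0" by (auto simp: s_def eq_neg_iff_add_eq_0)
  have sL: "(if k = -3 then L else smul U (k + 3) L) = smul U s L" by (simp add: s_def)
  have ope: "nprod U J 0 J = 0"
    "nprod U Gp 0 Gm = smul U 3 (nop U J J) + smul U (3 * (k + 1) / 2) (transl U J) - smul U s L"
    "nprod U Gp 1 Gm = smul U (3 * (k + 1)) J"
    using U WQ.opeD[of J J _ 0] WQ.opeD[of Gp Gm _ 0] WQ.opeD[of Gp Gm _ 1]
    unfolding bershadsky_polyakov_def sL by (fastforce simp: nth_Cons)+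
  have "nprod W (\<pi>W J) 0 (\<pi>W J) = \<pi>W (nprod U J 0 J)"
    "nprod W (\<pi>W Gp) 0 (\<pi>W Gm) = \<pi>W (nprod U Gp 0 Gm)" "nprod W (\<pi>W Gp) 1 (\<pi>W Gm) = \<pi>W (nprod U Gp 1 Gm)"
    by (simp_all add: WQ.epi.hom_nprod bp_in_U)
  then have opeW: "nprod W (\<pi>W J) 0 (\<pi>W J) = 0"
    "nprod W (\<pi>W Gp) 0 (\<pi>W Gm) = smul W 3 (nop W (\<pi>W J) (\<pi>W J)) + smul W (3 * (k + 1) / 2) (transl W (\<pi>W J)) - smul W s (\<pi>W L)"
    "nprod W (\<pi>W Gp) 1 (\<pi>W Gm) = smul W (3 * (k + 1)) (\<pi>W J)"
    unfolding ope nop_def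
    by (simp_all add: WQ.epi.hom_add WQ.epi.hom_diff WQ.epi.hom_smul WQ.epi.hom_nprod WQ.epi.hom_transl bp_in_U)
  have L0: "nprod W (\<pi>W L) (int n) w = 0" if "n \<ge> 2" for n
    by (rule bp_lowered_L[OF WQ.epi.Q.vertex_algebra_axioms bp_in_W w opeW(1,2) s opeW(3) kill that])
  have "WQ.Q.lowered w"
    unfolding WQ.Q.lowered_def
  proof (intro ballI, clarify)
    fix x p j assume x: "(x, p) \<in> WQ.epi.hom_gens {(J, 1), (Gp, 1), (Gm, 2), (L, 2)}" and j: "int p \<le> j"
    have n: "j = int (nat j)" using j by simp
    from WQ.epi.hom_gensE[OF x] consider "x = \<pi>W J \<and> p = 1" | "x = \<pi>W Gp \<and> p = 1" | "x = \<pi>W Gm \<and> p = 2" | "x = \<pi>W L \<and> p = 2"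
      by auto
    then show "nprod W x j w = 0"
    proof cases
      case 1 then show ?thesis using kill(1)[of "nat j"] j n by simp
    next
      case 2 then show ?thesis using kill(2)[of "nat j"] j n by simp
    next
      case 3 then show ?thesis using kill(3)[of "nat j"] j n by simp
    next
      case 4 then show ?thesis using L0[of "nat j"] j n by simp
    qed
  qed
  moreover obtain DW where "WQ.Q.graded_by DW"
  proof (rule W_grading)
    fix D assume "WQ.Q.graded_by D"
    then show thesis by (rule that)
  qed
  ultimately show ?thesis using WQ.lowered_in_vac w by blast
qed

text \<open>\<open>singular_vectors\<close> and \<open>top_components\<close> split \<open>v\<close>
  into vectors \<open>w \<otimes> vac \<otimes> e^(mc)\<close> killed by the positive modes of
  \<open>J\<close>, \<open>Gp\<close>, \<open>Gm\<close>. By \<open>pure_nonzero\<close> these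
  conditions pass to \<open>w\<close>, which is then a multiple of the vacuum.\<close>

lemma singular_in_A:
  assumes v: "v \<in> vspace T" "v \<noteq> 0"
    and low: "\<And>x n. x \<in> sl3 \<Longrightarrow> n \<ge> (1::nat) \<Longrightarrow> nprod T (cur x) (int n) v = 0"
    and e: "nprod T (cur (emat 1 2)) 0 v = 0" "nprod T (cur (emat 2 3)) 0 v = 0" "nprod T (cur (emat 1 3)) 0 v = 0"
  obtains F a where "finite F" "v = (\<Sum>m\<in>F. smul T (a m) (inP (e m)))"
proof -
  have e_all: "nprod T (cur x) (int n) v = 0" if "x \<in> {emat 1 2, emat 2 3, emat 1 3}" for x n
  proof (cases "n = 0")
    case False
    then show ?thesis using low[of x n] that emat_in_sl3(1) by auto
  qed (use that e in auto)
  have c0: "nprod T (inP (e 1)) (int n) v = 0" "nprod T (inS \<beta>) (int n) v = 0" "nprod T F.E1 (int n) v = 0" for n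
    using e_all[of "emat 1 3" n] e_all[of "emat 2 3" n] e_all[of "emat 1 2" n] by (simp_all add: cur_values)
  have c1: "nprod T F.H1 (int n) v = 0" "nprod T F.H2 (int n) v = 0" "nprod T F.F1 (int n) v = 0"
    "nprod T F.F2 (int n) v = 0" if "n \<ge> 1" for n
    using low[OF emat_in_sl3(2)[of 1 2] that] low[OF emat_in_sl3(2)[of 2 3] that]
      low[OF emat_in_sl3(1)[of 2 1] that] low[OF emat_in_sl3(1)[of 3 2] that] by (simp_all add: cur_values)
  have top: "v \<in> F.top" by (rule F.singular_vectors(1)[OF v(1) c0 c1])
  have kill: "nprod T a (int n) v = 0" if "a \<in> {inW (\<pi>W J), inW (\<pi>W Gp), inW (\<pi>W Gm)}" "n \<ge> 1" for a n
    by (rule F.singular_vectors(2)[OF v(1) c0 c1 that])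
  obtain F x where F: "finite F" "v = (\<Sum>m\<in>F. x m)" "\<And>m. m \<in> F \<Longrightarrow> x m \<in> Om m"
    "\<And>m a n. m \<in> F \<Longrightarrow> a \<in> {inW (\<pi>W J), inW (\<pi>W Gp), inW (\<pi>W Gm)} \<Longrightarrow> n \<ge> (1::nat) \<Longrightarrow> nprod T a (int n) (x m) = 0"
  proof (rule F.top_components[OF top kill])
    fix F x assume "finite F" "v = (\<Sum>m\<in>F. x m)" "\<And>m. m \<in> F \<Longrightarrow> x m \<in> Om m"
      "\<And>m a n. m \<in> F \<Longrightarrow> a \<in> {inW (\<pi>W J), inW (\<pi>W Gp), inW (\<pi>W Gm)} \<Longrightarrow> n \<ge> (1::nat) \<Longrightarrow> nprod T a (int n) (x m) = 0"
    then show thesis by (rule that)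
  qed
  have "\<exists>a. x m = smul T a (inP (e m))" if m: "m \<in> F" for m
  proof -
    obtain w where w: "w \<in> vspace W" "x m = tT (tM w (vac S)) (e m)" using F(3)[OF m] by (auto simp: Om_def)
    have zero: "nprod W b (int n) w = 0" if b: "b \<in> {\<pi>W J, \<pi>W Gp, \<pi>W Gm}" and n: "n \<ge> 1" for b n
    proof -
      have bW: "b \<in> vspace W" using b by auto
      have "nprod T (inW b) (int n) (x m) = 0" using F(4)[OF m _ n, of "inW b"] b by auto
      then have "tT (tM (nprod W b (int n) w) (vac S)) (e m) = 0" using w bW by (simp add: inW_mode)
      then have "tM (nprod W b (int n) w) (vac S) = 0 \<or> e m = 0"
        by (intro TT.pure_nonzero) (use w bW in auto)
      then have "tM (nprod W b (int n) w) (vac S) = 0" using half_lattice_e_nonzero[OF P] by blast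
      then have "nprod W b (int n) w = 0 \<or> vac S = 0"
        by (intro TM.pure_nonzero) (use w bW in auto)
      then show ?thesis using beta_gamma_vac[OF S] by blast
    qed
    have "w \<in> WQ.epi.Q.vs.span {vac W}" by (rule lowered_W[OF w(1)]) (use zero in auto)
    then obtain a where "w = smul W a (vac W)" unfolding WQ.epi.Q.vs.span_singleton by auto
    then have "x m = smul T a (inP (e m))" using w by (simp add: inP_eq TM.t_smul_left TT.t_smul_left)
    then show ?thesis by blast
  qed
  then obtain a where "\<And>m. m \<in> F \<Longrightarrow> x m = smul T (a m) (inP (e m))" by metis
  then have "v = (\<Sum>m\<in>F. smul T (a m) (inP (e m)))" unfolding F(2) by (intro sum.cong) auto
  then show ?thesis using that F(1) by blast
qed

lemma ideal_A:
  assumes I: "va_ideal A I"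
  shows "TT.T.vs.subspace I" "I \<subseteq> \<Phi> ` vspace V"
    "\<And>a x n. a \<in> \<Phi> ` vspace V \<Longrightarrow> x \<in> I \<Longrightarrow> nprod T a n x \<in> I"
  using I unfolding va_ideal_def by auto

lemma cur_locally_nilpotent:
  assumes a: "a \<in> sl3" "a ** a = 0" and v: "v \<in> \<Phi> ` vspace V"
  shows "\<exists>r. ((nprod T (cur a) 0) ^^ r) v = 0"
proof -
  obtain u where u: "u \<in> vspace V" "v = \<Phi> u" using v by blast
  have "(nprod V (\<iota> a) 0 ^^ r) u \<in> vspace V \<and> (nprod T (cur a) 0 ^^ r) v = \<Phi> ((nprod V (\<iota> a) 0 ^^ r) u)" for r
  proof (induction r)
    case (Suc r)
    then show ?case using EA.hom_nprod[OF iota_in[OF a(1)], of "(nprod V (\<iota> a) 0 ^^ r) u" 0] iota_in[OF a(1)]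
      by (simp add: cur_def)
  qed (use u in simp)
  then show ?thesis using affine_locally_nilpotent[OF V a u(1)] EA.hom_zero by metis
qed

text \<open>The lowest layer \<open>Z\<close> of the ideal is stable under the zero modes of all
  currents and killed by their positive modes. A vector of \<open>Z\<close> killed by the zero modes
  of \<open>e1\<close>, \<open>e2\<close>, \<open>e3\<close> is singular, and its lattice components
  are separated inside the ideal.\<close>

lemma lattice_vector_in_ideal:
  assumes I: "va_ideal A I" "I \<noteq> {0}"
  shows "\<exists>m. inP (e m) \<in> I"
proof -
  note I' = ideal_A[OF I(1)]
  have IT: "I \<subseteq> vspace T" using I'(2) A_subset_T by blast
  have ne: "I \<noteq> {}" using TT.T.vs.subspace_0[OF I'(1)] by blast
  obtain B v0 where B: "v0 \<in> I \<inter> AG.lower_part B" "v0 \<noteq> 0" "\<And>v. v \<in> I \<inter> AG.lower_part B \<Longrightarrow> AG.lowered v"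
  proof (rule AG.lowered_exists[of I])
    show "I \<subseteq> vspace A" using I'(2) by simp
    show "nprod A x j v \<in> I" if "(x, p) \<in> EA.hom_gens GV" "v \<in> I" for x p j v
      using I'(3) that cur_in_A unfolding GA_eq by auto
    fix B v assume "v \<in> I \<inter> AG.lower_part B" "v \<noteq> 0" "\<And>v. v \<in> I \<inter> AG.lower_part B \<Longrightarrow> AG.lowered v"
    then show thesis by (rule that)
  qed (use I ne in auto)
  define Z where "Z = I \<inter> AG.lower_part B"
  have ZA: "v \<in> \<Phi> ` vspace V" "v \<in> vspace T" if "v \<in> Z" for v using that I'(2) IT by (auto simp: Z_def)
  have gen: "(cur x, 1) \<in> EA.hom_gens GV" if "x \<in> sl3" for x using that unfolding GA_eq by blast
  have Z0: "nprod T (cur x) 0 v \<in> Z" if x: "x \<in> sl3" and v: "v \<in> Z" for x v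
  proof -
    have "nprod A (cur x) 0 v \<in> AG.lower_part (int 1 + B - 0 - 1)"
      by (rule AG.nprod_lower_part[OF AG.generator_in_wspace[OF gen[OF x]]]) (use v in \<open>simp add: Z_def\<close>)
    then show ?thesis using I'(3)[OF cur_in_A[OF x], of v 0] v by (simp add: Z_def)
  qed
  have low: "nprod T (cur x) (int n) v = 0" if x: "x \<in> sl3" and v: "v \<in> Z" and n: "n \<ge> 1" for x v and n :: nat
  proof -
    have "AG.lowered v" using B(3) v by (simp add: Z_def)
    then have "\<forall>j\<ge>int 1. nprod A (cur x) j v = 0" using gen[OF x] unfolding AG.lowered_def by blast
    then show ?thesis using n by simp
  qed
  let ?d1 = "nprod T (cur (emat 1 2)) 0" and ?d2 = "nprod T (cur (emat 2 3)) 0" and ?d3 = "nprod T (cur (emat 1 3)) 0"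
  have sl: "emat 1 2 \<in> sl3" "emat 2 3 \<in> sl3" "emat 1 3 \<in> sl3" using emat_in_sl3(1) by auto
  have sq: "emat 1 2 ** emat 1 2 = 0" "emat 2 3 ** emat 2 3 = 0" "emat 1 3 ** emat 1 3 = 0"
    by (simp_all add: emat_mult)
  have comm: "nprod T (cur x) 0 (nprod T (cur y) 0 v) = nprod T (cur (lie_br x y)) 0 v + nprod T (cur y) 0 (nprod T (cur x) 0 v)"
    if "x \<in> sl3" "y \<in> sl3" "v \<in> Z" for x y v
    using that TT.T.nprod_zero_mode[of "cur x" "cur y" v 0] ZA by (simp add: cur_bracket)
  have cur0: "cur 0 = 0"
  proof -
    have "(0 :: complex^3^3) \<in> sl3" by (simp add: sl3_def trace_def)
    then show ?thesis using cur_linear(1)[of 0 0] by simp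
  qed
  have br: "lie_br (emat 1 3) (emat 1 2) = 0" "lie_br (emat 1 3) (emat 2 3) = 0" "lie_br (emat 1 2) (emat 2 3) = emat 1 3"
    by (simp_all add: lie_br_def emat_mult)
  \<comment> \<open>Successive kernels of locally nilpotent operators. \<open>e3\<close> commutes
    with \<open>e1\<close> and \<open>e2\<close>, so \<open>Z1\<close> is stable under
    \<open>e1\<close>; \<open>Z2\<close> is stable under \<open>e2\<close> because the commutator of
    \<open>e1\<close> and \<open>e2\<close> is \<open>e3\<close>, which is zero there.\<close>
  define Z1 where "Z1 = {v \<in> Z. ?d3 v = 0}"
  define Z2 where "Z2 = {v \<in> Z1. ?d1 v = 0}"
  have c1: "?d1 v \<in> Z1" if "v \<in> Z1" for v
    using that Z0[OF sl(1), of v] comm[OF sl(3,1), of v] by (simp add: Z1_def br cur0 sl ZA)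
  have c2: "?d2 v \<in> Z2" if "v \<in> Z2" for v
    using that Z0[OF sl(2), of v] comm[OF sl(3,2), of v] comm[OF sl(1,2), of v]
    by (simp add: Z1_def Z2_def br cur0 sl ZA)
  obtain r3 where r3: "(?d3 ^^ r3) v0 = 0" using cur_locally_nilpotent[OF sl(3) sq(3) ZA(1)] B(1) by (auto simp: Z_def)
  have "\<exists>v\<in>Z. v \<noteq> 0 \<and> ?d3 v = 0"
    by (rule locally_nilpotent_kernel[OF _ B(2) Z0[OF sl(3)] r3]) (use B(1) in \<open>simp_all add: Z_def\<close>)
  then obtain v1 where v1: "v1 \<in> Z1" "v1 \<noteq> 0" by (auto simp: Z1_def)
  obtain r1 where r1: "(?d1 ^^ r1) v1 = 0" using cur_locally_nilpotent[OF sl(1) sq(1) ZA(1)] v1(1) by (auto simp: Z1_def)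
  have "\<exists>v\<in>Z1. v \<noteq> 0 \<and> ?d1 v = 0" by (rule locally_nilpotent_kernel[OF v1 c1 r1])
  then obtain v2 where v2: "v2 \<in> Z2" "v2 \<noteq> 0" by (auto simp: Z2_def)
  obtain r2 where r2: "(?d2 ^^ r2) v2 = 0" using cur_locally_nilpotent[OF sl(2) sq(2) ZA(1)] v2(1) by (auto simp: Z1_def Z2_def)
  have "\<exists>v\<in>Z2. v \<noteq> 0 \<and> ?d2 v = 0" by (rule locally_nilpotent_kernel[OF v2 c2 r2])
  then obtain v where v: "v \<in> Z" "v \<noteq> 0" "?d1 v = 0" "?d2 v = 0" "?d3 v = 0" by (auto simp: Z1_def Z2_def)
  obtain F a where F: "finite F" "v = (\<Sum>m\<in>F. smul T (a m) (inP (e m)))"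
    by (rule singular_in_A[OF ZA(2)[OF v(1)] v(2) low[OF _ v(1)] v(3-5)])
  have "\<exists>m\<in>F. a m \<noteq> 0"
  proof (rule ccontr)
    assume "\<not> (\<exists>m\<in>F. a m \<noteq> 0)"
    then have "v = 0" unfolding F(2) by (intro sum.neutral) auto
    then show False using v(2) by blast
  qed
  then obtain m where m: "m \<in> F" "a m \<noteq> 0" by blast
  \<comment> \<open>The zero mode of \<open>h1\<close> has eigenvalue \<open>m\<close> on
    \<open>e^(mc)\<close>. Unlike \<open>d(0)\<close>, it is the mode of an element of the image and
    so preserves the ideal.\<close>
  have lin: "lin_on T (smul T) (nprod T F.H1 0)"
    using cur_in[OF emat_in_sl3(2)[of 1 2]] by (simp add: lin_on_def TT.T.nprod_linear cur_values)
  have "smul T (a m) (inP (e m)) \<in> I"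
  proof (rule TT.T.eigencomponents[OF lin I'(1) IT _ F(1) _ _ _ m(1), where c = of_int])
    show "nprod T F.H1 0 x \<in> I" if "x \<in> I" for x
      using I'(3)[OF cur_in_A[OF emat_in_sl3(2)[of 1 2]] that] by (simp add: cur_values)
    show "smul T (a i) (inP (e i)) \<in> vspace T \<and>
        nprod T F.H1 0 (smul T (a i) (inP (e i))) = smul T (of_int i) (smul T (a i) (inP (e i)))" for i
      using F.H_e(3)[of i] cur_in[OF emat_in_sl3(2)[of 1 2]] by (simp add: TT.T.nprod_linear cur_values mult.commute)
    show "(\<Sum>m\<in>F. smul T (a m) (inP (e m))) \<in> I" using v(1) F(2) by (simp add: Z_def)
  qed (simp add: inj_on_def)
  then have "smul T (1 / a m) (smul T (a m) (inP (e m))) \<in> I" by (rule TT.T.vs.subspace_scale[OF I'(1)])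
  then have "inP (e m) \<in> I" using m(2) by simp
  then show ?thesis by blast
qed

text \<open>The grading operator has eigenvalue \<open>m\<close> on this vector, which would
  otherwise lie in a weight space of the image of negative weight, hence be zero.\<close>

lemma lattice_vector_nonneg:
  assumes "inP (e m) \<in> \<Phi> ` vspace V" shows "m \<ge> 0"
proof (rule ccontr)
  assume "\<not> m \<ge> 0"
  obtain D where D: "AG.graded_by D" "\<And>m. D (inP (e m)) = smul T (of_int m) (inP (e m))"
    using A_graded by blast
  have "inP (e m) \<in> EA.Q.wspace (EA.hom_gens GV) m"
    by (rule AG.eigen_in_wspace[OF D(1)]) (use assms D(2) in simp_all)
  then have "inP (e m) = 0" using AG.wspace_neg[of m] \<open>\<not> m \<ge> 0\<close> by simp
  then show False using inP_e_nonzero by blast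
qed

lemma cur_f3_e: "nprod T (cur (emat 3 1)) 1 (inP (e m)) = smul T (of_int m * (k + 1 - of_int m)) (inP (e (m - 1)))"
  using F.F3_e[of 1 m] by (simp add: cur_f3)

lemma vac_in_ideal:
  assumes k: "k \<notin> \<nat>" and I: "va_ideal A I" "I \<noteq> {0}"
  shows "vac T \<in> I"
proof -
  note I' = ideal_A[OF I(1)]
  obtain m where m: "inP (e m) \<in> I" using lattice_vector_in_ideal[OF I] by blast
  have down: "inP (e (int n)) \<in> I \<Longrightarrow> inP (e 0) \<in> I" for n
  proof (induction n)
    case (Suc n)
    let ?m = "int (Suc n)"
    \<comment> \<open>With \<open>m = n + 1\<close> this is \<open>(n + 1) (k - n)\<close>, nonzero
      since \<open>k\<close> is not the natural number \<open>n\<close>.\<close>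
    define r where "r = of_int ?m * (k + 1 - of_int ?m)"
    have "smul T r (inP (e (int n))) \<in> I"
      using I'(3)[OF cur_in_A[OF emat_in_sl3(1)[of 3 1]] Suc.prems, of 1] cur_f3_e[of ?m] by (simp add: r_def)
    from TT.T.vs.subspace_scale[OF I'(1) this, of "1 / r"]
    have "smul T (1 / r) (smul T r (inP (e (int n)))) \<in> I" .
    moreover have "r \<noteq> 0"
    proof -
      have "k \<noteq> of_nat n" using k by auto
      moreover have "k + 1 - of_int ?m = k - of_nat n" by simp
      moreover have "(of_int ?m :: complex) \<noteq> 0" by (simp only: of_int_eq_0_iff)
      ultimately show ?thesis by (simp add: r_def)
    qed
    ultimately have "inP (e (int n)) \<in> I" by simp
    then show ?case by (rule Suc.IH)
  qed simp
  have "m \<ge> 0" using lattice_vector_nonneg m I'(2) by blast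
  then have "inP (e 0) \<in> I" using down[of "nat m"] m by simp
  then show ?thesis by (simp add: e_0_P inSP_linear)
qed

lemma A_simple:
  assumes k: "k \<notin> \<nat>" shows "simple_vertex_algebra A"
  unfolding simple_vertex_algebra_def
proof (intro conjI allI impI)
  show "vertex_algebra A" by (rule EA.Q.vertex_algebra_axioms)
  show "vspace A \<noteq> {0}" using EA.Q.vac_in vac_T_nonzero by auto
  fix I assume I: "va_ideal A I"
  show "I = {0} \<or> I = vspace A"
    using vac_in_ideal[OF k I] EA.Q.va_ideal_vac[OF I] by auto
qed

lemma A_not_simple:
  assumes k: "k \<in> \<nat>" shows "\<not> simple_vertex_algebra A"
proof
  assume simple: "simple_vertex_algebra A"
  obtain n where n: "k = of_nat n" using k by (auto elim: Nats_cases)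
  \<comment> \<open>The value \<open>m = k + 1\<close> is the zero of the factor
    \<open>k + 1 - m\<close> in \<open>cur_f3_e\<close>: here the descent by \<open>f3(1)\<close>
    stops.\<close>
  let ?m = "int (Suc n)"
  let ?u = "inP (e ?m)"
  \<comment> \<open>For \<open>j \<ge> 0\<close> this is \<open>e3(-1)\<close> applied
    \<open>j\<close> times to the vacuum, so it belongs to the image.\<close>
  have e_wspace: "inP (e (int j)) \<in> EA.Q.wspace (EA.hom_gens GV) (int j)" for j
  proof (induction j)
    case 0
    show ?case using EA.Q.vac_in_wspace by (simp add: e_0_P inSP_linear)
  next
    case (Suc j)
    have "(cur (emat 1 3), 1) \<in> EA.hom_gens GV" unfolding GA_eq using emat_in_sl3(1)[of 1 3] by auto
    from EA.Q.wspace_nprod[OF AG.G_in AG.generator_in_wspace[OF this] Suc, of "-1"]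
    show ?case by (simp add: cur_values inP_inP P_ope)
  qed
  have low: "\<forall>j\<ge>1. nprod T (cur x) (int j) ?u = 0" if "x \<in> sl3" for x
    using that
  proof (induction rule: sl3_induct)
    case f3
    show ?case
      using F.F3_e[of _ ?m] n by (auto simp: cur_f3 simp del: of_nat_Suc) (simp add: algebra_simps)
  next
    case (add x y)
    then show ?case by (simp add: cur_linear TT.T.nprod_linear)
  next
    case (smul r x)
    then show ?case using cur_linear(2)[of x x r] by (simp add: TT.T.nprod_linear)
  qed (simp_all add: cur_values F.E_e F.H_e F.F1_e F.F2_e F.e_e)
  have "AG.lowered ?u"
    unfolding AG.lowered_def
  proof (intro ballI, clarify)
    fix a p and j :: int assume "(a, p) \<in> EA.hom_gens GV" and j: "int p \<le> j"
    then obtain x where x: "x \<in> sl3" "a = cur x" "p = 1" unfolding GA_eq by blast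
    have "nat j \<ge> 1" using j x by simp
    then have "nprod T (cur x) (int (nat j)) ?u = 0" using low[OF x(1)] by blast
    then show "nprod A a j ?u = 0" using x j by simp
  qed
  then have u: "?u \<in> AG.maximal_ideal" by (intro AG.lowered_in_maximal_ideal[OF e_wspace]) auto
  have "AG.maximal_ideal = {0} \<or> AG.maximal_ideal = vspace A"
    using simple AG.va_ideal_maximal unfolding simple_vertex_algebra_def by blast
  moreover have "AG.maximal_ideal \<noteq> {0}" using u inP_e_nonzero by blast
  ultimately have "vac T \<in> AG.maximal_ideal" using EA.Q.vac_in by simp
  then have "nprod A (vac T) (-1) (vac T) \<in> AG.positive_part"
    using EA.Q.vac_in unfolding AG.maximal_ideal_def by auto
  then show False using vac_not_positive_A by (simp add: TT.T.vac_left)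
qed

lemma hom_positive: "x \<in> LQ.positive_part \<Longrightarrow> \<Phi> x \<in> AG.positive_part"
proof -
  assume x: "x \<in> LQ.positive_part"
  have "\<Phi> x \<in> \<Phi> ` LQ.vs.span (\<Union>N\<in>{1..}. LQ.wspace GV N)"
    using x unfolding LQ.positive_part_def by blast
  also have "\<dots> = EA.Q.vs.span (\<Phi> ` (\<Union>N\<in>{1..}. LQ.wspace GV N))"
    by (rule EA.hom_span) (use LQ.wspace_in[OF LQ.G_in] in blast)
  also have "\<Phi> ` (\<Union>N\<in>{1..}. LQ.wspace GV N) = (\<Union>N\<in>{1..}. EA.Q.wspace (EA.hom_gens GV) N)"
    using EA.hom_wspace[OF LQ.G_in] by (simp add: image_UN)
  finally show ?thesis unfolding AG.positive_part_def .
qed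

text \<open>If the images of the homogeneous components of a vector sum to zero, each is zero by
  independence of the weight spaces of the image. So the kernel is graded, and it is proper because
  the vacuum survives.\<close>

lemma ker_\<Phi>_subset: "va_kernel V \<Phi> \<subseteq> LQ.ker"
proof (rule LQ.ker_largest[OF EA.kernel_ideal])
  obtain D where D: "AG.graded_by D" using A_graded by blast
  have "vac V \<notin> va_kernel V \<Phi>" using vac_T_nonzero EA.hom_vac by (simp add: va_kernel_def)
  then show "va_kernel V \<Phi> \<noteq> vspace V" using LQ.vac_in by blast
  have sub: "LQ.vs.subspace (va_kernel V \<Phi>)" using EA.kernel_ideal by (simp add: va_ideal_def)
  show "va_kernel V \<Phi> = LQ.vs.span (\<Union>N. va_kernel V \<Phi> \<inter> LQ.wspace GV (int N))"
  proof
    show "LQ.vs.span (\<Union>N. va_kernel V \<Phi> \<inter> LQ.wspace GV (int N)) \<subseteq> va_kernel V \<Phi>"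
      by (rule LQ.vs.span_minimal[OF _ sub]) blast
    show "va_kernel V \<Phi> \<subseteq> LQ.vs.span (\<Union>N. va_kernel V \<Phi> \<inter> LQ.wspace GV (int N))"
    proof
      fix v assume v: "v \<in> va_kernel V \<Phi>"
      then have "v \<in> LQ.vs.span (\<Union>N\<in>UNIV. LQ.wspace GV N)" using LQ.vspace_decomp by (auto simp: va_kernel_def)
      from LQ.wspace_decomp[OF this] obtain F f where
        F: "finite F" "\<And>N. N \<in> F \<Longrightarrow> f N \<in> LQ.wspace GV N" "v = (\<Sum>N\<in>F. f N)" by blast
      have fV: "f N \<in> vspace V" if "N \<in> F" for N using F(2)[OF that] LQ.wspace_in[OF LQ.G_in] by blast
      have s: "(\<Sum>N\<in>F. \<Phi> (f N)) = 0" using v F(3) EA.hom_sum[of F f] fV by (simp add: va_kernel_def)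
      have w: "\<Phi> (f N) \<in> EA.Q.wspace (EA.hom_gens GV) N" if "N \<in> F" for N
        using F(2)[OF that] EA.hom_wspace[OF LQ.G_in] by blast
      have "f N \<in> LQ.vs.span (\<Union>N. va_kernel V \<Phi> \<inter> LQ.wspace GV (int N))" if N: "N \<in> F" for N
      proof (cases "N < 0")
        case True
        then show ?thesis using F(2)[OF N] LQ.wspace_neg by (simp add: LQ.vs.span_zero)
      next
        case False
        have "f N \<in> va_kernel V \<Phi>" using AG.graded_by_independent[OF D F(1) w s N] fV[OF N] by (simp add: va_kernel_def)
        then show ?thesis using F(2)[OF N] False by (intro LQ.vs.span_base UN_I[of "nat N"]) auto
      qed
      then show "v \<in> LQ.vs.span (\<Union>N. va_kernel V \<Phi> \<inter> LQ.wspace GV (int N))"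
        unfolding F(3) by (rule LQ.vs.span_sum)
    qed
  qed
qed

text \<open>Conversely, the image of the maximal graded ideal is an ideal inside the positive part;
  were it nonzero, \<open>vac_in_ideal\<close> would put the vacuum there.\<close>

lemma ker_eq:
  assumes k: "k \<notin> \<nat>" shows "va_kernel V \<Phi> = LQ.ker"
proof
  show "va_kernel V \<Phi> \<subseteq> LQ.ker" by (rule ker_\<Phi>_subset)
  have "\<Phi> ` LQ.ker = {0}"
  proof (rule ccontr)
    assume "\<Phi> ` LQ.ker \<noteq> {0}"
    then have "vac T \<in> \<Phi> ` LQ.ker" by (rule vac_in_ideal[OF k EA.ideal_image[OF LQ.epi.kernel_ideal]])
    then show False using hom_positive LQ.ker_positive vac_not_positive_A by auto
  qed
  then show "LQ.ker \<subseteq> va_kernel V \<Phi>" by (auto simp: va_kernel_def)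
qed

text \<open>Equality of the kernels makes the value of \<Phi> on a preimage depend only on the point
  of \<open>Lk\<close>, and makes the resulting map injective.\<close>

lemma embedding:
  assumes k: "k \<notin> \<nat>" shows "\<exists>\<Psi>. va_hom Lk T \<Psi> \<and> inj_on \<Psi> (vspace Lk)"
proof -
  define \<Psi> where "\<Psi> y = \<Phi> (SOME v. v \<in> vspace V \<and> \<pi>L v = y)" for y
  have \<Psi>: "\<Psi> (\<pi>L v) = \<Phi> v" if v: "v \<in> vspace V" for v
  proof -
    define u where "u = (SOME u. u \<in> vspace V \<and> \<pi>L u = \<pi>L v)"
    have u: "u \<in> vspace V \<and> \<pi>L u = \<pi>L v" unfolding u_def by (rule someI[of _ v]) (use v in simp)
    have "u - v \<in> LQ.ker" using u v by (simp add: va_kernel_def LQ.epi.hom_diff)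
    then have "\<Phi> (u - v) = 0" unfolding ker_eq[OF k, symmetric] by (simp add: va_kernel_def)
    then show ?thesis using u v by (simp add: EA.hom_diff \<Psi>_def u_def)
  qed
  have pre: "\<exists>v\<in>vspace V. y = \<pi>L v" if "y \<in> vspace Lk" for y
    using LQ.epi.onto that by blast
  have "va_hom Lk T \<Psi>"
    unfolding va_hom_def
  proof (intro conjI ballI allI)
    fix y z r n assume "y \<in> vspace Lk" "z \<in> vspace Lk"
    then obtain a b where ab: "a \<in> vspace V" "y = \<pi>L a" "b \<in> vspace V" "z = \<pi>L b" using pre by blast
    show "\<Psi> y \<in> vspace T" using ab \<Psi> A_subset_T by auto
    show "\<Psi> (y + z) = \<Psi> y + \<Psi> z"
      using ab \<Psi>[of "a + b"] by (simp add: LQ.epi.hom_add EA.hom_add \<Psi>)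
    show "\<Psi> (smul Lk r y) = smul T r (\<Psi> y)"
      using ab \<Psi>[of "smul V r a"] by (simp add: LQ.epi.hom_smul EA.hom_smul \<Psi>)
    show "\<Psi> (nprod Lk y n z) = nprod T (\<Psi> y) n (\<Psi> z)"
      using ab \<Psi>[of "nprod V a n b"] by (simp add: LQ.epi.hom_nprod EA.hom_nprod \<Psi>)
  next
    show "\<Psi> (vac Lk) = vac T" using \<Psi>[OF LQ.vac_in] LQ.epi.hom_vac EA.hom_vac by simp
  qed
  moreover have "inj_on \<Psi> (vspace Lk)"
  proof (rule inj_onI)
    fix y z assume yz: "y \<in> vspace Lk" "z \<in> vspace Lk" "\<Psi> y = \<Psi> z"
    then obtain a b where ab: "a \<in> vspace V" "y = \<pi>L a" "b \<in> vspace V" "z = \<pi>L b" using pre by blast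
    then have "a - b \<in> va_kernel V \<Phi>" using yz(3) by (simp add: \<Psi> va_kernel_def EA.hom_diff)
    then have "a - b \<in> LQ.ker" by (simp add: ker_eq[OF k])
    then show "y = z" using ab by (simp add: va_kernel_def LQ.epi.hom_diff)
  qed
  ultimately show ?thesis by blast
qed

end

theorem theorem5p2:
  fixes k :: complex
    and V :: "'v::ab_group_add vert_alg" and \<iota> :: "complex^3^3 \<Rightarrow> 'v"
    and Lk :: "'l::ab_group_add vert_alg" and \<pi>\<^sub>L :: "'v \<Rightarrow> 'l"
    and U :: "'u::ab_group_add vert_alg" and J Gp Gm L :: 'u
    and W :: "'w::ab_group_add vert_alg" and \<pi>\<^sub>W :: "'u \<Rightarrow> 'w"
    and S :: "'s::ab_group_add vert_alg" and \<beta> \<gamma> :: 's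
    and P :: "'p::ab_group_add vert_alg" and c d :: 'p and e :: "int \<Rightarrow> 'p"
    and M :: "'m::ab_group_add vert_alg" and tM :: "'w \<Rightarrow> 's \<Rightarrow> 'm"
    and T :: "'t::ab_group_add vert_alg" and tT :: "'m \<Rightarrow> 'p \<Rightarrow> 't"
    and \<Phi> :: "'v \<Rightarrow> 't"
  assumes V: "universal_affine_sl3 k V \<iota>"
    and Lk: "simple_graded_quotient V (affine_grading V \<iota>) Lk \<pi>\<^sub>L"
    and U: "bershadsky_polyakov k U J Gp Gm L"
    and W: "simple_graded_quotient U (bp_grading U J Gp Gm L) W \<pi>\<^sub>W"
    and S: "beta_gamma_va S \<beta> \<gamma>"
    and P: "half_lattice_va P c d e"
    and M: "va_tensor W S M tM"
    and T: "va_tensor M P T tT"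
    and \<Phi>_hom: "va_hom V T \<Phi>"
    and \<Phi>_values: "realization_values k \<iota> T
          (tT (tM (\<pi>\<^sub>W J) (vac S)) (vac P))
          (tT (tM (\<pi>\<^sub>W Gp) (vac S)) (vac P))
          (tT (tM (\<pi>\<^sub>W Gm) (vac S)) (vac P))
          (tT (tM (vac W) \<beta>) (vac P))
          (tT (tM (vac W) \<gamma>) (vac P))
          (tT (vac M) c)
          (tT (vac M) d)
          (\<lambda>m. tT (vac M) (e m))
          \<Phi>"
  shows "(simple_vertex_algebra (va_image V T \<Phi>) \<longleftrightarrow> k \<notin> \<nat>) \<and>
         (k \<notin> \<nat> \<longrightarrow> (\<exists>\<Psi>. va_hom Lk T \<Psi> \<and> inj_on \<Psi> (vspace Lk)))"
proof -
  interpret realization k V \<iota> Lk \<pi>\<^sub>L U J Gp Gm L W \<pi>\<^sub>W S \<beta> \<gamma> P c d e M tM T tT \<Phi>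
    by (rule realization.intro) (fact assms)+
  show ?thesis using A_simple A_not_simple embedding by blast
qed

end
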